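(* Let $K$ be a local field whose residue field $k$ has order $p^t$ ($p$ prime), and let $L/K$ be a tamely ramified cyclic extension of degree $q^n$, where $q$ is a prime distinct from $p$. Let $e=e_{L/K}$ be the ramification index of $L/K$. Fix a uniformiser $\pi_K$ of $K$ and a uniformiser $\pi_L$ of $L$. Then the local reciprocity map $\theta_{L/K}$ satisfies $$\frac{\theta_{L/K}\left(u\pi_K^i\right)(\beta)}{\beta}\equiv \frac{\beta^{(p^{ti}-1)}}{\left((-1)^{e-1}\pi_K\right)^{(p^{ti}-1)\mathfrak{v}_K(\beta)}\,u^{(p^t-1)\mathfrak{v}_K(\beta)}}\pmod{\pi_L}$$ for all $i\in\mathbb{N}$, all $u\in\mathcal{O}_K^*$ and all $\beta\in L^*$.
   Context: A local field is a field complete with respect to a discrete valuation, with finite residue field. $\mathfrak{v}_K$ denotes the valuation of $K$ normalised so that $\mathfrak{v}_K(K^* )=\mathbb{Z}$, extended uniquely to $L$ (values in $\frac1e\mathbb{Z}$). The local reciprocity map $\theta_{L/K}:K^*\to\mathrm{Gal}(L/K)$ is the canonical surjective homomorphism with kernel $N_{L/K}(L^* )$, characterised by $\mathrm{inv}_K(\chi,b)=\chi(\theta_{L/K}(b))$ for all characters $\chi$ of $\mathrm{Gal}(L/K)$ (cyclic algebra class $(\chi,b)$, Hasse invariant $\mathrm{inv}_K$); for unramified extensions it sends uniformisers to the Frobenius $x\mapsto x^{|k|}$. Both sides of the congruence are units of $\mathcal{O}_L$ and the congruence means their difference lies in $\pi_L\mathcal{O}_L$. *)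

theory Defs
  imports "HOL-Algebra.Algebra" "HOL-Algebra.Algebraic_Closure_Type"
begin

text \<open>
  All fields are subfields of one algebraically closed field, the type \<open>'a\<close>. This loses no
  generality, as every field embeds in an algebraically closed one, and it makes room for the
  unramified extensions of the base field which enter the definition of the Hasse invariant.
\<close>

abbreviation ambient :: "'a::alg_closed_field ring"  (\<open>\<Omega>\<close>)
  where "\<Omega> \<equiv> ring_of_type_algebra"

abbreviation ring_on :: "'a::alg_closed_field set \<Rightarrow> 'a ring"
  where "ring_on F \<equiv> \<Omega>\<lparr>carrier := F\<rparr>"


section \<open>Valuations and local fields\<close>

text \<open>
  Valuations are additive, with values in the rationals, so that the extension of the normalised
  valuation of a field to a ramified extension need not be rescaled. The value at \<open>0\<close> (which
  ought to be infinite) is irrelevant and never used, and neither are values outside \<open>F\<close>.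
\<close>

definition valuation_on :: "'a::alg_closed_field set \<Rightarrow> ('a \<Rightarrow> rat) \<Rightarrow> bool"
  where "valuation_on F v \<longleftrightarrow>
    (\<forall>x\<in>F - {0}. \<forall>y\<in>F - {0}. v (x * y) = v x + v y) \<and>
    (\<forall>x\<in>F - {0}. \<forall>y\<in>F - {0}. x + y \<noteq> 0 \<longrightarrow> min (v x) (v y) \<le> v (x + y))"

definition value_group :: "'a::alg_closed_field set \<Rightarrow> ('a \<Rightarrow> rat) \<Rightarrow> rat set"
  where "value_group F v = v ` (F - {0})"

definition valuation_ring :: "'a::alg_closed_field set \<Rightarrow> ('a \<Rightarrow> rat) \<Rightarrow> 'a set"
  where "valuation_ring F v = {x \<in> F. x = 0 \<or> 0 \<le> v x}"

definition maximal_ideal_of :: "'a::alg_closed_field set \<Rightarrow> ('a \<Rightarrow> rat) \<Rightarrow> 'a set"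
  where "maximal_ideal_of F v = {x \<in> F. x = 0 \<or> 0 < v x}"

definition residue_field :: "'a::alg_closed_field set \<Rightarrow> ('a \<Rightarrow> rat) \<Rightarrow> 'a set ring"
  where "residue_field F v = ring_on (valuation_ring F v) Quot maximal_ideal_of F v"

definition uniformiser :: "'a::alg_closed_field set \<Rightarrow> ('a \<Rightarrow> rat) \<Rightarrow> 'a \<Rightarrow> bool"
  where "uniformiser F v \<pi> \<longleftrightarrow> \<pi> \<in> F - {0} \<and> 0 < v \<pi> \<and> (\<forall>x\<in>F - {0}. 0 < v x \<longrightarrow> v \<pi> \<le> v x)"

definition complete_valued :: "'a::alg_closed_field set \<Rightarrow> ('a \<Rightarrow> rat) \<Rightarrow> bool"
  where "complete_valued F v \<longleftrightarrow>
    (\<forall>s::nat \<Rightarrow> 'a.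
      (\<forall>i. s i \<in> F) \<and>
      (\<forall>N. \<exists>n0. \<forall>i\<ge>n0. \<forall>j\<ge>n0. s i = s j \<or> N < v (s i - s j)) \<longrightarrow>
      (\<exists>l\<in>F. \<forall>N. \<exists>n0. \<forall>i\<ge>n0. s i = l \<or> N < v (s i - l)))"

text \<open>The valuation of a local field is the normalised one.\<close>

definition local_field :: "'a::alg_closed_field set \<Rightarrow> ('a \<Rightarrow> rat) \<Rightarrow> bool"
  where "local_field K v \<longleftrightarrow>
    subfield K \<Omega> \<and> valuation_on K v \<and> value_group K v = \<int> \<and>
    complete_valued K v \<and> finite (carrier (residue_field K v))"


section \<open>Extensions\<close>

definition extension_of_degree :: "nat \<Rightarrow> 'a::alg_closed_field set \<Rightarrow> 'a set \<Rightarrow> bool"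
  where "extension_of_degree d K L \<longleftrightarrow>
    subfield K \<Omega> \<and> subfield L \<Omega> \<and> K \<subseteq> L \<and> ring.dimension \<Omega> d K L"

text \<open>Automorphisms are extended by \<open>undefined\<close> outside \<open>L\<close>, which makes equality of functions
  coincide with equality of automorphisms.\<close>

definition galois_group :: "'a::alg_closed_field set \<Rightarrow> 'a set \<Rightarrow> ('a \<Rightarrow> 'a) monoid"
  where "galois_group L K =
    \<lparr>carrier = {\<sigma> \<in> ring_iso (ring_on L) (ring_on L) \<inter> extensional L. \<forall>x\<in>K. \<sigma> x = x},
     monoid.mult = compose L, one = (\<lambda>x\<in>L. x)\<rparr>"

definition fixed_field :: "'a::alg_closed_field set \<Rightarrow> ('a \<Rightarrow> 'a) set \<Rightarrow> 'a set"
  where "fixed_field L H = {x \<in> L. \<forall>\<sigma>\<in>H. \<sigma> x = x}"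

definition cyclic_extension :: "nat \<Rightarrow> 'a::alg_closed_field set \<Rightarrow> 'a set \<Rightarrow> bool"
  where "cyclic_extension d K L \<longleftrightarrow>
    extension_of_degree d K L \<and>
    fixed_field L (carrier (galois_group L K)) = K \<and>
    cyclic_group (galois_group L K)"

text \<open>The norm of a Galois extension.\<close>

definition galois_norm :: "'a::alg_closed_field set \<Rightarrow> 'a set \<Rightarrow> 'a \<Rightarrow> 'a"
  where "galois_norm L K x = (\<Prod>\<sigma>\<in>carrier (galois_group L K). \<sigma> x)"

text \<open>In the following, \<open>v\<close> is a valuation on \<open>L\<close>, and \<open>K\<close> carries its restriction.
  The ramification index is the index of \<open>v(K\<^sup>*)\<close> in \<open>v(L\<^sup>*)\<close>.\<close>

definition ramification_index ::
    "'a::alg_closed_field set \<Rightarrow> 'a set \<Rightarrow> ('a \<Rightarrow> rat) \<Rightarrow> nat"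
  where "ramification_index K L v =
    card ((\<lambda>a. (\<lambda>b. a + b) ` value_group K v) ` value_group L v)"

text \<open>For a finite residue field of characteristic \<open>p\<close>; the residue extension is
  then automatically separable.\<close>

definition tamely_ramified ::
    "nat \<Rightarrow> 'a::alg_closed_field set \<Rightarrow> 'a set \<Rightarrow> ('a \<Rightarrow> rat) \<Rightarrow> bool"
  where "tamely_ramified p K L v \<longleftrightarrow> \<not> p dvd ramification_index K L v"

text \<open>An unramified extension of degree \<open>m\<close> of a local field (the residue fields being finite,
  separability of the residue extension is automatic).\<close>

definition unramified_extension ::
    "nat \<Rightarrow> 'a::alg_closed_field set \<Rightarrow> 'a set \<Rightarrow> ('a \<Rightarrow> rat) \<Rightarrow> bool"
  where "unramified_extension m K W w \<longleftrightarrow>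
    extension_of_degree m K W \<and> valuation_on W w \<and> ramification_index K W w = 1"

definition frobenius ::
    "'a::alg_closed_field set \<Rightarrow> 'a set \<Rightarrow> ('a \<Rightarrow> rat) \<Rightarrow> ('a \<Rightarrow> 'a) \<Rightarrow> bool"
  where "frobenius K W w \<phi> \<longleftrightarrow>
    \<phi> \<in> carrier (galois_group W K) \<and>
    (\<forall>x\<in>valuation_ring W w.
      \<phi> x - x ^ card (carrier (residue_field K w)) \<in> maximal_ideal_of W w)"


section \<open>Cyclic algebras and Brauer equivalence\<close>

text \<open>
  Algebras over a field are represented by the \<open>module\<close> record, that is, a (not necessarily
  commutative) ring with a scalar multiplication.

  The cyclic algebra \<open>(E/K, \<sigma>, b)\<close> of degree \<open>m = [E:K]\<close> is the direct sum of the
  \<open>E y\<^sup>i\<close> for \<open>i < m\<close>, with \<open>y x = \<sigma>(x) y\<close> for \<open>x \<in> E\<close>, and \<open>y\<^sup>m = b\<close>; the function \<open>f\<close>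
  represents the sum of the \<open>f(i) y\<^sup>i\<close>.
\<close>

definition cyclic_algebra ::
    "'a::alg_closed_field set \<Rightarrow> ('a \<Rightarrow> 'a) \<Rightarrow> nat \<Rightarrow> 'a \<Rightarrow> ('a, nat \<Rightarrow> 'a) module"
  where "cyclic_algebra E \<sigma> m b =
    \<lparr>carrier = {f. (\<forall>i<m. f i \<in> E) \<and> (\<forall>i\<ge>m. f i = 0)},
     monoid.mult = (\<lambda>f g k. if k < m then
         (\<Sum>i<m. \<Sum>j<m. if (i + j) mod m = k
            then f i * (\<sigma> ^^ i) (g j) * (if i + j < m then 1 else b) else 0)
       else 0),
     one = (\<lambda>i. if i = 0 then 1 else 0),
     ring.zero = (\<lambda>i. 0),
     add = (\<lambda>f g i. f i + g i),
     module.smult = (\<lambda>c f i. c * f i)\<rparr>"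

definition matrix_algebra :: "nat \<Rightarrow> ('a, 'b) module \<Rightarrow> ('a, nat \<Rightarrow> nat \<Rightarrow> 'b) module"
  where "matrix_algebra r A =
    \<lparr>carrier = {M. \<forall>i j. (i < r \<and> j < r \<longrightarrow> M i j \<in> carrier A) \<and>
                         (\<not> (i < r \<and> j < r) \<longrightarrow> M i j = \<zero>\<^bsub>A\<^esub>)},
     monoid.mult = (\<lambda>M N i j. if i < r \<and> j < r
               then finsum A (\<lambda>k. M i k \<otimes>\<^bsub>A\<^esub> N k j) {..<r} else \<zero>\<^bsub>A\<^esub>),
     one = (\<lambda>i j. if i < r \<and> i = j then \<one>\<^bsub>A\<^esub> else \<zero>\<^bsub>A\<^esub>),
     ring.zero = (\<lambda>i j. \<zero>\<^bsub>A\<^esub>),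
     add = (\<lambda>M N i j. M i j \<oplus>\<^bsub>A\<^esub> N i j),
     module.smult = (\<lambda>c M i j. if i < r \<and> j < r then c \<odot>\<^bsub>A\<^esub> M i j else \<zero>\<^bsub>A\<^esub>)\<rparr>"

definition algebra_isomorphic :: "'a set \<Rightarrow> ('a, 'b) module \<Rightarrow> ('a, 'c) module \<Rightarrow> bool"
  where "algebra_isomorphic K A B \<longleftrightarrow>
    (\<exists>h\<in>ring_iso A B. \<forall>c\<in>K. \<forall>x\<in>carrier A. h (c \<odot>\<^bsub>A\<^esub> x) = c \<odot>\<^bsub>B\<^esub> h x)"

text \<open>To be used for central simple \<open>K\<close>-algebras: equality of classes in the Brauer group.\<close>

definition brauer_equivalent :: "'a set \<Rightarrow> ('a, 'b) module \<Rightarrow> ('a, 'c) module \<Rightarrow> bool"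
  where "brauer_equivalent K A B \<longleftrightarrow>
    (\<exists>r\<ge>1. \<exists>s\<ge>1. algebra_isomorphic K (matrix_algebra r A) (matrix_algebra s B))"


section \<open>The Hasse invariant and the local reciprocity map\<close>

definition rat_add_group :: "rat monoid"
  where "rat_add_group = \<lparr>carrier = UNIV, monoid.mult = (+), one = 0\<rparr>"

text \<open>The group \<open>\<rat>/\<int>\<close>.\<close>

definition QZ :: "rat set monoid"
  where "QZ = rat_add_group Mod \<int>"

definition QZ_class :: "rat \<Rightarrow> rat set"
  where "QZ_class r = \<int> #>\<^bsub>rat_add_group\<^esub> r"

text \<open>
  \<open>inv\<^sub>K [A] = s\<close>: the Brauer class of \<open>A\<close> is that of \<open>(W/K, \<phi>, \<pi>\<^sup>r)\<close>, where \<open>W\<close> is the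
  unramified extension of \<open>K\<close> of degree \<open>m\<close> with Frobenius \<open>\<phi>\<close>, and \<open>s = r/m\<close> in \<open>\<rat>/\<int>\<close>.
\<close>

definition has_hasse_invariant ::
    "'a::alg_closed_field set \<Rightarrow> ('a \<Rightarrow> rat) \<Rightarrow> ('a, 'b) module \<Rightarrow> rat set \<Rightarrow> bool"
  where "has_hasse_invariant K v A s \<longleftrightarrow>
    (\<exists>m r W w \<phi> \<pi>.
       unramified_extension m K W w \<and> (\<forall>x\<in>K - {0}. w x = v x) \<and>
       frobenius K W w \<phi> \<and> uniformiser K v \<pi> \<and>
       brauer_equivalent K A (cyclic_algebra W \<phi> m (\<pi> powi r)) \<and>
       s = QZ_class (of_int r / of_nat m))"

text \<open>
  \<open>(\<chi>, b)\<close> for a character \<open>\<chi>\<close> of \<open>Gal(L/K)\<close> of order \<open>m\<close>: the cyclic algebra \<open>(E/K, \<sigma>, b)\<close>,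
  where \<open>E\<close> is the fixed field of the kernel of \<open>\<chi>\<close> and \<open>\<sigma>\<close> is the generator of \<open>Gal(E/K)\<close>
  on which the character induced by \<open>\<chi>\<close> takes the value \<open>1/m\<close>. The choice of a lift of
  this generator to \<open>L\<close> is immaterial, since only its restriction to \<open>E\<close> is used.
\<close>

definition character_algebra ::
    "'a::alg_closed_field set \<Rightarrow> 'a set \<Rightarrow> (('a \<Rightarrow> 'a) \<Rightarrow> rat set) \<Rightarrow> 'a \<Rightarrow> ('a, nat \<Rightarrow> 'a) module"
  where "character_algebra K L \<chi> b =
    (let G = galois_group L K;
         m = card (\<chi> ` carrier G);
         E = fixed_field L (kernel G QZ \<chi>);
         \<sigma> = (SOME \<sigma>. \<sigma> \<in> carrier G \<and> \<chi> \<sigma> = QZ_class (1 / of_nat m))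
     in cyclic_algebra E (restrict \<sigma> E) m b)"

text \<open>The surjective homomorphism \<open>\<theta> : K\<^sup>* \<rightarrow> Gal(L/K)\<close> with kernel \<open>N(L\<^sup>*)\<close> which is
  characterised by \<open>inv\<^sub>K (\<chi>, b) = \<chi> (\<theta> b)\<close> for all \<open>\<chi>\<close> and \<open>b\<close>.\<close>

definition local_reciprocity_map ::
    "'a::alg_closed_field set \<Rightarrow> 'a set \<Rightarrow> ('a \<Rightarrow> rat) \<Rightarrow> ('a \<Rightarrow> 'a \<Rightarrow> 'a) \<Rightarrow> bool"
  where "local_reciprocity_map K L v \<theta> \<longleftrightarrow>
    \<theta> \<in> epi (mult_of (ring_on K)) (galois_group L K) \<and>
    kernel (mult_of (ring_on K)) (galois_group L K) \<theta> = galois_norm L K ` (L - {0}) \<and>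
    (\<forall>\<chi>\<in>hom (galois_group L K) QZ. \<forall>b\<in>K - {0}.
       has_hasse_invariant K v (character_algebra K L \<chi> b) (\<chi> (\<theta> b)))"


section \<open>Congruences\<close>

definition cong_mod ::
    "'a::alg_closed_field set \<Rightarrow> ('a \<Rightarrow> rat) \<Rightarrow> 'a \<Rightarrow> 'a \<Rightarrow> 'a \<Rightarrow> bool"
  where "cong_mod L v \<pi> x y \<longleftrightarrow> x - y \<in> (\<lambda>z. \<pi> * z) ` valuation_ring L v"

end

theory Submission
  imports Defs "HOL-Library.Function_Algebras"
begin

text \<open>
  For a faithful character, \<open>(\<chi>, b)\<close> is the class of \<open>(L/K, \<sigma>, b)\<close>, where \<open>\<sigma>\<close> generates the Galois
  group. Let it be Brauer equivalent to \<open>(W/K, \<phi>, c)\<close> with \<open>W\<close> unramified. Extending scalars to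
  \<open>M = L W\<close>, the row vectors over the second algebra become a module over the first one, and by
  Schur's lemma the eigenspaces of \<open>L\<close> in it, cut out by a primitive idempotent, are lines, which are
  permuted by the generator \<open>y\<close> of the cyclic algebra. Automorphisms of \<open>M\<close> over \<open>K\<close> act
  semilinearly and move a line just like a power of \<open>y\<close>, up to a scalar. For a generator \<open>\<iota>\<close> of the
  inertia group and a lift \<open>\<Phi>\<close> of the Frobenius, the scalars \<open>\<alpha>\<close>, \<open>\<beta>\<close> satisfy two norm equations
  and \<open>\<iota>(\<beta>) \<alpha> = \<Phi>(\<alpha>) \<beta>\<close>.

  The valuations of \<open>\<alpha>\<close> and \<open>\<beta>\<close> determine the Hasse invariant in terms of \<open>b\<close>, so that
  \<open>\<theta>(b) = \<iota>\<^sup>a \<Phi>\<^sup>l\<close> with \<open>a\<close> the valuation of \<open>\<beta>\<close> and \<open>l\<close> that of \<open>b\<close>. As \<open>L/K\<close> is tame, \<open>L\<close> has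
  a uniformiser \<open>lam\<close> with \<open>lam\<^sup>e = \<pi>\<^sub>K \<tau>\<close>, where \<open>\<tau>\<close> is a root of unity, and the residues of both
  sides of the third equation express \<open>\<theta>(b)(lam)/lam\<close> through the unit part of \<open>b\<close>. The sign
  \<open>(-1)\<^bsup>e-1\<^esup>\<close> is the product of the \<open>e\<close>-th roots of unity, which enters with the norm of \<open>\<alpha>\<close>.
\<close>

section \<open>Subfields, endomorphisms and polynomials\<close>

text \<open>The comparison avoids tensor products and cohomology: on a line of eigenvectors every
  semilinear operator becomes a scalar, and the relations between \<iota> and \<Phi> (finite orders,
  commutation) become the equations between these scalars. In effect the two cyclic algebras have
  cohomologous cocycles over \<open>M\<close>. The obstacle is that degree and valuation of
  \<open>M\<close>, and the lifts of inertia and Frobenius to it, have to be produced. Therefore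
  completeness is axiomatised adically, in a form stable under adjoining a root of unity, and the
  invariance of the valuation under automorphisms is deduced from the divisibility of one-units. The
  exponent \<open>(Q - 1) / e\<close>, with \<open>Q\<close> the order of the residue field of
  \<open>K\<close>, arises as follows. If \<open>s\<close> is the unit part of \<alpha>, the third
  equation makes \<open>\<zeta>^a * \<omega>^l\<close> congruent to \<open>s^(Q - 1)\<close>, where
  \<zeta> and \<omega> are the factors by which \<iota> and \<Phi> multiply \<open>lam\<close>. The
  norm equation determines only the residue of \<open>s^e\<close>; this suffices because
  \<open>e\<close> divides \<open>Q - 1\<close>, which in turn holds because \<iota> and \<Phi>
  commute.\<close>

locale subfld =
  fixes F :: "'a::field set"
  assumes zero_closed [simp]: "0 \<in> F" and one_closed [simp]: "1 \<in> F"
    and add_closed: "x \<in> F \<Longrightarrow> y \<in> F \<Longrightarrow> x + y \<in> F"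
    and uminus_closed: "x \<in> F \<Longrightarrow> - x \<in> F"
    and mult_closed: "x \<in> F \<Longrightarrow> y \<in> F \<Longrightarrow> x * y \<in> F"
    and inverse_closed: "x \<in> F \<Longrightarrow> inverse x \<in> F"
begin

lemma diff_closed: "x \<in> F \<Longrightarrow> y \<in> F \<Longrightarrow> x - y \<in> F"
  using add_closed[of x "-y"] uminus_closed[of y] by simp

lemma divide_closed: "x \<in> F \<Longrightarrow> y \<in> F \<Longrightarrow> x / y \<in> F"
  using mult_closed[of x "inverse y"] inverse_closed[of y] by (simp add: field_simps)

lemma power_closed: "x \<in> F \<Longrightarrow> x ^ n \<in> F"
  by (induction n) (auto intro: mult_closed)

lemma power_int_closed: "x \<in> F \<Longrightarrow> x powi k \<in> F"
  by (auto simp: power_int_def intro: power_closed inverse_closed)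

lemma sum_closed: "(\<And>i. i \<in> I \<Longrightarrow> f i \<in> F) \<Longrightarrow> sum f I \<in> F"
  by (induction I rule: infinite_finite_induct) (auto intro: add_closed)

lemma prod_closed: "(\<And>i. i \<in> I \<Longrightarrow> f i \<in> F) \<Longrightarrow> prod f I \<in> F"
  by (induction I rule: infinite_finite_induct) (auto intro: mult_closed)

lemma of_nat_closed: "of_nat n \<in> F"
  by (induction n) (auto intro: add_closed)

lemmas closed_intros = add_closed uminus_closed mult_closed inverse_closed diff_closed
  divide_closed power_closed power_int_closed sum_closed prod_closed of_nat_closed

end

lemma subfield_ambient_iff: "subfield F (\<Omega> :: 'a::alg_closed_field ring) \<Longrightarrow> subfld F"
proof -
  assume F: "subfield F (\<Omega> :: 'a ring)"
  interpret R: field "\<Omega> :: 'a ring" by (rule field_from_type_algebra)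
  have sr: "subring F \<Omega>" using F subfieldE(1) by blast
  note simps = ring_of_type_algebra_def
  have neg: "\<ominus>\<^bsub>\<Omega>\<^esub> x = - x" for x :: 'a
    by (rule R.minus_equality) (auto simp: simps)
  have inv: "inv\<^bsub>\<Omega>\<^esub> x = inverse x" if "x \<noteq> 0" for x :: 'a
    using that by (intro R.comm_inv_char) (auto simp: simps)
  show "subfld F"
  proof
    show "0 \<in> F" "1 \<in> F" using subringE(2,3)[OF sr] by (auto simp: simps)
    show "x + y \<in> F" "x * y \<in> F" if "x \<in> F" "y \<in> F" for x y
      using subringE(6,7)[OF sr] that by (auto simp: simps)
    show "- x \<in> F" if "x \<in> F" for x using subringE(5)[OF sr that] by (simp add: neg)
    show "inverse x \<in> F" if "x \<in> F" for x
    proof (cases "x = 0")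
      case False
      then show ?thesis using R.subfield_m_inv(1)[OF F, of x] that inv[OF False]
        by (auto simp: simps)
    qed (use that in simp)
  qed
qed

lemma funpow_multiple: "(f ^^ m) x = x \<Longrightarrow> (f ^^ (m * k)) x = x"
  by (induction k) (auto simp: funpow_add)

text \<open>All conditions are relative to the carrier \<open>F\<close>, so that one function can
  act on several nested fields: the generator of the Galois group is later an endomorphism of
  \<open>L\<close> and of its inertia field alike.\<close>

locale fld_endo = subfld F for F :: "'a::field set" +
  fixes f :: "'a \<Rightarrow> 'a"
  assumes endo_closed: "x \<in> F \<Longrightarrow> f x \<in> F"
    and endo_add: "x \<in> F \<Longrightarrow> y \<in> F \<Longrightarrow> f (x + y) = f x + f y"
    and endo_mult: "x \<in> F \<Longrightarrow> y \<in> F \<Longrightarrow> f (x * y) = f x * f y"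
    and endo_one: "f 1 = 1"
begin

lemma endo_zero: "f 0 = 0"
  using endo_add[OF zero_closed zero_closed] by (metis add.right_neutral add_left_cancel)

lemma endo_uminus: "x \<in> F \<Longrightarrow> f (- x) = - f x"
  using endo_add[of x "-x"] uminus_closed[of x] by (simp add: endo_zero eq_neg_iff_add_eq_0 add.commute)

lemma endo_diff: "x \<in> F \<Longrightarrow> y \<in> F \<Longrightarrow> f (x - y) = f x - f y"
  using endo_add[of x "-y"] by (simp add: endo_uminus uminus_closed)

lemma endo_inverse: "x \<in> F \<Longrightarrow> f (inverse x) = inverse (f x)"
proof (cases "x = 0")
  case False
  assume "x \<in> F"
  then have "f (inverse x) * f x = 1"
    using endo_mult[of "inverse x" x] inverse_closed[of x] False by (simp add: endo_one)
  then show ?thesis by (metis inverse_unique mult.commute)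
qed (simp add: endo_zero)

lemma endo_eq_0_iff: "x \<in> F \<Longrightarrow> f x = 0 \<longleftrightarrow> x = 0"
  using endo_mult[of x "inverse x"] inverse_closed[of x] endo_zero endo_one
  by (metis mult_eq_0_iff right_inverse zero_neq_one)

lemma endo_inj: "inj_on f F"
proof (rule inj_onI)
  fix x y assume *: "x \<in> F" "y \<in> F" "f x = f y"
  then have "f (x - y) = 0" by (simp add: endo_diff)
  then show "x = y" using * by (simp add: endo_eq_0_iff diff_closed)
qed

lemma endo_divide: "x \<in> F \<Longrightarrow> y \<in> F \<Longrightarrow> f (x / y) = f x / f y"
  by (simp add: divide_inverse endo_mult endo_inverse inverse_closed)

lemma endo_power: "x \<in> F \<Longrightarrow> f (x ^ n) = f x ^ n"
  by (induction n) (auto simp: endo_one endo_mult power_closed)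

lemma endo_power_int: "x \<in> F \<Longrightarrow> f (x powi n) = f x powi n"
  by (auto simp: power_int_def endo_inverse endo_power inverse_closed)

lemma endo_sum: "(\<And>i. i \<in> I \<Longrightarrow> g i \<in> F) \<Longrightarrow> f (sum g I) = (\<Sum>i\<in>I. f (g i))"
  by (induction I rule: infinite_finite_induct) (auto simp: endo_zero endo_add sum_closed)

lemma endo_prod: "(\<And>i. i \<in> I \<Longrightarrow> g i \<in> F) \<Longrightarrow> f (prod g I) = (\<Prod>i\<in>I. f (g i))"
  by (induction I rule: infinite_finite_induct) (auto simp: endo_one endo_mult prod_closed)

lemma funpow_closed: "x \<in> F \<Longrightarrow> (f ^^ n) x \<in> F"
  by (induction n) (auto simp: endo_closed)

lemma fld_endo_funpow: "fld_endo F (f ^^ n)"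
proof (induction n)
  case 0
  show ?case by unfold_locales auto
next
  case (Suc n)
  interpret s: fld_endo F "f ^^ n" by fact
  show ?case by unfold_locales
      (auto simp: s.endo_add s.endo_mult s.endo_one endo_add endo_mult endo_one endo_closed s.endo_closed)
qed

text \<open>Applying \<open>f\<close> shifts the factors cyclically, the last one wrapping around by
  the second assumption. This is the invariance of a norm.\<close>

lemma prod_funpow_shift:
  assumes "x \<in> F" and "(f ^^ n) x = x"
  shows "f (\<Prod>i<n. (f ^^ i) x) = (\<Prod>i<n. (f ^^ i) x)"
proof -
  have "f (\<Prod>i<n. (f ^^ i) x) = (\<Prod>i<n. (f ^^ Suc i) x)"
    by (subst endo_prod) (auto simp: assms funpow_closed)
  also have "\<dots> = (\<Prod>i<n. (f ^^ i) x)"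
  proof (cases n)
    case (Suc m)
    have "(\<Prod>i<n. (f ^^ Suc i) x) = (\<Prod>i<m. (f ^^ Suc i) x) * x"
      using assms(2) unfolding Suc prod.lessThan_Suc by simp
    also have "\<dots> = (\<Prod>i<n. (f ^^ i) x)"
      unfolding Suc prod.lessThan_Suc_shift by simp
    finally show ?thesis .
  qed simp
  finally show ?thesis .
qed

end

section \<open>Polynomials with coefficients in a subset of the ambient field\<close>

definition polys_over :: "'a::zero set \<Rightarrow> 'a poly set"
  where "polys_over F = {p. \<forall>i. Polynomial.coeff p i \<in> F}"

context subfld
begin

lemma polys_0 [simp]: "0 \<in> polys_over F"
  by (simp add: polys_over_def)

lemma polys_1 [simp]: "1 \<in> polys_over F"
  by (auto simp: polys_over_def)

lemma polys_add: "p \<in> polys_over F \<Longrightarrow> q \<in> polys_over F \<Longrightarrow> p + q \<in> polys_over F"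
  by (auto simp: polys_over_def add_closed)

lemma polys_diff: "p \<in> polys_over F \<Longrightarrow> q \<in> polys_over F \<Longrightarrow> p - q \<in> polys_over F"
  by (auto simp: polys_over_def diff_closed)

lemma polys_smult: "c \<in> F \<Longrightarrow> p \<in> polys_over F \<Longrightarrow> Polynomial.smult c p \<in> polys_over F"
  by (auto simp: polys_over_def mult_closed)

lemma polys_mult: "p \<in> polys_over F \<Longrightarrow> q \<in> polys_over F \<Longrightarrow> p * q \<in> polys_over F"
  by (auto simp: polys_over_def coeff_mult intro!: sum_closed mult_closed)

lemma polys_prod: "(\<And>i. i \<in> I \<Longrightarrow> p i \<in> polys_over F) \<Longrightarrow> prod p I \<in> polys_over F"
  by (induction I rule: infinite_finite_induct) (auto intro: polys_mult)

lemma polys_monom: "c \<in> F \<Longrightarrow> Polynomial.monom c n \<in> polys_over F"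
  by (auto simp: polys_over_def)

lemma polys_pCons: "c \<in> F \<Longrightarrow> p \<in> polys_over F \<Longrightarrow> pCons c p \<in> polys_over F"
  by (auto simp: polys_over_def coeff_pCons split: nat.splits)

lemma poly_closed: "p \<in> polys_over F \<Longrightarrow> x \<in> F \<Longrightarrow> poly p x \<in> F"
  by (auto simp: polys_over_def poly_altdef intro!: sum_closed mult_closed power_closed)

text \<open>Newton's scheme: a new node is met by adding a multiple of the product of the linear
  factors of the old nodes. The guard on \<open>S\<close> is there because the zero polynomial has
  degree 0.\<close>

lemma interpolation:
  assumes "finite S" "S \<subseteq> F" "\<And>x. x \<in> S \<Longrightarrow> g x \<in> F"
  shows "\<exists>p\<in>polys_over F. (S \<noteq> {} \<longrightarrow> Polynomial.degree p < card S) \<and> (\<forall>x\<in>S. poly p x = g x)"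
  using assms
proof (induction S)
  case empty
  show ?case using polys_0 by (intro bexI[of _ 0]) simp_all
next
  case (insert a S)
  then obtain p where p: "p \<in> polys_over F" "S \<noteq> {} \<Longrightarrow> Polynomial.degree p < card S"
    "\<And>x. x \<in> S \<Longrightarrow> poly p x = g x" by auto
  define q where "q = (\<Prod>x\<in>S. [:- x, 1:])"
  have q: "q \<in> polys_over F"
    unfolding q_def using insert.prems by (intro polys_prod polys_pCons) (auto intro: uminus_closed)
  have dq: "Polynomial.degree q = card S"
    unfolding q_def by (subst degree_prod_eq_sum_degree) auto
  have qa: "poly q a \<noteq> 0" unfolding q_def poly_prod using insert by auto
  have qx: "poly q x = 0" if "x \<in> S" for x unfolding q_def poly_prod using insert that by auto
  define c where "c = (g a - poly p a) / poly q a"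
  have c: "c \<in> F" unfolding c_def using insert.prems p q by (auto intro!: closed_intros poly_closed)
  define P where "P = (if S = {} then [:g a:] else p + Polynomial.smult c q)"
  show ?case
  proof (cases "S = {}")
    case True
    then show ?thesis using insert.prems
      by (intro bexI[of _ "[:g a:]"]) (auto intro: polys_pCons)
  next
    case False
    have "Polynomial.degree (p + Polynomial.smult c q) \<le> card S"
      using p(2)[OF False] dq by (intro degree_add_le) auto
    then show ?thesis using insert p q c qa qx
      by (intro bexI[of _ "p + Polynomial.smult c q"])
        (auto intro!: polys_add polys_smult simp: c_def)
  qed
qed

lemma polys_division:
  assumes "g \<in> polys_over F" "g \<noteq> 0" "p \<in> polys_over F"
  shows "\<exists>q\<in>polys_over F. \<exists>r\<in>polys_over F. p = g * q + r \<and> (r = 0 \<or> Polynomial.degree r < Polynomial.degree g)"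
  using assms(3)
proof (induction "Polynomial.degree p" arbitrary: p rule: less_induct)
  case less
  show ?case
  proof (cases "p = 0 \<or> Polynomial.degree p < Polynomial.degree g")
    case True
    then show ?thesis using less.prems by (intro bexI[of _ 0] bexI[of _ p]) auto
  next
    case False
    define m where "m = Polynomial.monom (Polynomial.lead_coeff p / Polynomial.lead_coeff g) (Polynomial.degree p - Polynomial.degree g)"
    have m: "m \<in> polys_over F" unfolding m_def using less.prems assms
      by (intro polys_monom divide_closed) (auto simp: polys_over_def)
    define p' where "p' = p - g * m"
    have p': "p' \<in> polys_over F" unfolding p'_def by (intro polys_diff polys_mult less.prems assms m)
    have cm: "Polynomial.lead_coeff p / Polynomial.lead_coeff g \<noteq> 0" using False assms(2) by auto
    have dm0: "Polynomial.degree m = Polynomial.degree p - Polynomial.degree g"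
      unfolding m_def by (rule Polynomial.degree_monom_eq[OF cm])
    have "m \<noteq> 0" unfolding m_def using cm by (simp add: monom_eq_0_iff)
    then have dm: "Polynomial.degree (g * m) = Polynomial.degree p"
      using False assms(2) dm0 by (subst degree_mult_eq) auto
    have lm: "Polynomial.lead_coeff (g * m) = Polynomial.lead_coeff p"
    proof -
      have "Polynomial.lead_coeff m = Polynomial.lead_coeff p / Polynomial.lead_coeff g"
        unfolding dm0 unfolding m_def by simp
      then show ?thesis using assms(2) unfolding lead_coeff_mult by simp
    qed
    have "p' = 0 \<or> Polynomial.degree p' < Polynomial.degree p"
    proof (cases "Polynomial.degree p = 0")
      case True
      then have "Polynomial.degree p' = 0" unfolding p'_def using dm
        by (metis Polynomial.degree_diff_le le_zero_eq)
      moreover have "Polynomial.coeff p' 0 = 0" unfolding p'_def using lm dm True by simp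
      ultimately show ?thesis by (metis degree_0_id[symmetric] leading_coeff_0_iff)
    next
      case F: False
      have "Polynomial.degree p' \<le> Polynomial.degree p" unfolding p'_def
        by (intro Polynomial.degree_diff_le) (auto simp: dm)
      moreover have "Polynomial.coeff p' (Polynomial.degree p) = 0"
        unfolding p'_def using lm dm by simp
      ultimately show ?thesis
        by (metis le_neq_implies_less leading_coeff_0_iff)
    qed
    then obtain q r where qr: "q \<in> polys_over F" "r \<in> polys_over F" "p' = g * q + r"
      "r = 0 \<or> Polynomial.degree r < Polynomial.degree g"
    proof
      assume "p' = 0" then show thesis using that[of 0 0] by auto
    next
      assume "Polynomial.degree p' < Polynomial.degree p"
      from less.hyps[OF this p'] show thesis using that by blast
    qed
    have "p = g * (q + m) + r" using qr(3) unfolding p'_def by (simp add: algebra_simps)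
    then show ?thesis using qr m by (intro bexI[of _ "q + m"] bexI[of _ r]) (auto intro: polys_add)
  qed
qed

end

context fld_endo
begin

lemma map_polys: "p \<in> polys_over F \<Longrightarrow> map_poly f p \<in> polys_over F"
  by (auto simp: polys_over_def coeff_map_poly endo_zero endo_closed)

lemma map_poly_add: "p \<in> polys_over F \<Longrightarrow> q \<in> polys_over F \<Longrightarrow> map_poly f (p + q) = map_poly f p + map_poly f q"
  by (intro poly_eqI) (auto simp: polys_over_def coeff_map_poly endo_zero endo_add)

lemma map_poly_mult: "p \<in> polys_over F \<Longrightarrow> q \<in> polys_over F \<Longrightarrow> map_poly f (p * q) = map_poly f p * map_poly f q"
  by (intro poly_eqI)
    (auto simp: polys_over_def coeff_map_poly endo_zero coeff_mult endo_sum endo_mult mult_closed)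

lemma poly_map_poly: "p \<in> polys_over F \<Longrightarrow> x \<in> F \<Longrightarrow> poly (map_poly f p) (f x) = f (poly p x)"
proof -
  assume p: "p \<in> polys_over F" and x: "x \<in> F"
  have "f (poly p x) = (\<Sum>i\<le>Polynomial.degree p. f (Polynomial.coeff p i) * f x ^ i)"
    using p x by (auto simp: poly_altdef polys_over_def endo_sum endo_mult endo_power closed_intros)
  also have "\<dots> = (\<Sum>i\<le>Polynomial.degree p. Polynomial.coeff (map_poly f p) i * f x ^ i)"
    by (simp add: coeff_map_poly endo_zero)
  also have "\<dots> = poly (map_poly f p) (f x)"
    unfolding poly_altdef[of "map_poly f p"] using map_poly_degree_leq[of f p]
    by (intro sum.mono_neutral_right) (auto simp: not_le Polynomial.coeff_eq_0)
  finally show ?thesis by simp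
qed

lemma degree_map_polys: "p \<in> polys_over F \<Longrightarrow> Polynomial.degree (map_poly f p) = Polynomial.degree p"
proof (rule antisym)
  assume p: "p \<in> polys_over F"
  show "Polynomial.degree (map_poly f p) \<le> Polynomial.degree p" by (rule map_poly_degree_leq)
  show "Polynomial.degree p \<le> Polynomial.degree (map_poly f p)"
  proof (cases "p = 0")
    case False
    then have "Polynomial.coeff (map_poly f p) (Polynomial.degree p) \<noteq> 0"
      using p by (auto simp: coeff_map_poly endo_zero polys_over_def endo_eq_0_iff)
    then show ?thesis by (rule le_degree)
  qed simp
qed

end

section \<open>Cyclic algebras and their row vectors\<close>

lemma sum_rotate3:
  "(\<Sum>a\<in>A. \<Sum>i\<in>B. \<Sum>j\<in>C. f a i j) = (\<Sum>i\<in>B. \<Sum>j\<in>C. \<Sum>a\<in>A. f a i j)"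
  for f :: "_ \<Rightarrow> _ \<Rightarrow> _ \<Rightarrow> 'b::comm_monoid_add"
proof -
  have "(\<Sum>a\<in>A. \<Sum>i\<in>B. \<Sum>j\<in>C. f a i j) = (\<Sum>i\<in>B. \<Sum>a\<in>A. \<Sum>j\<in>C. f a i j)" by (rule sum.swap)
  also have "\<dots> = (\<Sum>i\<in>B. \<Sum>j\<in>C. \<Sum>a\<in>A. f a i j)" by (rule sum.cong[OF refl], rule sum.swap)
  finally show ?thesis .
qed

lemma sum_rotate4:
  "(\<Sum>a\<in>A. \<Sum>k\<in>D. \<Sum>i\<in>B. \<Sum>j\<in>C. f a k i j) = (\<Sum>k\<in>D. \<Sum>i\<in>B. \<Sum>j\<in>C. \<Sum>a\<in>A. f a k i j)"
  for f :: "_ \<Rightarrow> _ \<Rightarrow> _ \<Rightarrow> _ \<Rightarrow> 'b::comm_monoid_add"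
proof -
  have "(\<Sum>a\<in>A. \<Sum>k\<in>D. \<Sum>i\<in>B. \<Sum>j\<in>C. f a k i j) = (\<Sum>k\<in>D. \<Sum>a\<in>A. \<Sum>i\<in>B. \<Sum>j\<in>C. f a k i j)"
    by (rule sum.swap)
  also have "\<dots> = (\<Sum>k\<in>D. \<Sum>i\<in>B. \<Sum>j\<in>C. \<Sum>a\<in>A. f a k i j)"
    by (rule sum.cong[OF refl], rule sum_rotate3)
  finally show ?thesis .
qed

lemma div_carry: "0 < d \<Longrightarrow> (n + k) div d = n div d + (n mod d + k) div d" for d :: nat
proof -
  assume d: "0 < d"
  have e: "n + k = (n mod d + k) + d * (n div d)" by simp
  show ?thesis using d by (subst e, subst div_mult_self2) auto
qed

text \<open>The element \<gamma> replaces Galois theory: since its \<open>d\<close> conjugates are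
  distinct, interpolation makes it a primitive element, and its powers up to \<open>d - 1\<close>
  form a basis of \<open>E\<close> over \<open>K\<close>.\<close>

locale cyc = K: subfld K + fld_endo E \<sigma>
  for K E :: "'a::alg_closed_field set" and \<sigma> :: "'a \<Rightarrow> 'a" +
  fixes d :: nat and b \<gamma> :: 'a
  assumes K_subset: "K \<subseteq> E" and fix_K: "x \<in> K \<Longrightarrow> \<sigma> x = x"
    and fixed_in_K: "x \<in> E \<Longrightarrow> \<sigma> x = x \<Longrightarrow> x \<in> K"
    and d_pos: "0 < d" and order_d: "x \<in> E \<Longrightarrow> (\<sigma> ^^ d) x = x"
    and b_in: "b \<in> K" and b_nz: "b \<noteq> 0"
    and \<gamma>_in: "\<gamma> \<in> E" and \<gamma>_distinct: "inj_on (\<lambda>i. (\<sigma> ^^ i) \<gamma>) {..<d}"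
begin

lemma funpow_fix_K: "x \<in> K \<Longrightarrow> (\<sigma> ^^ n) x = x"
  by (induction n) (auto simp: fix_K)

lemma funpow_mod: "x \<in> E \<Longrightarrow> (\<sigma> ^^ (n mod d)) x = (\<sigma> ^^ n) x"
proof -
  assume x: "x \<in> E"
  have *: "(\<sigma> ^^ (d * k)) x = x" for k
    by (induction k) (auto simp: funpow_add x order_d)
  have "(\<sigma> ^^ n) x = (\<sigma> ^^ (n mod d + d * (n div d))) x" by simp
  also have "\<dots> = (\<sigma> ^^ (n mod d)) x" unfolding funpow_add by (simp add: *)
  finally show ?thesis by simp
qed

text \<open>By interpolation; the uniqueness of the interpolating polynomial makes it \<open>\<sigma>\<close>-invariant.\<close>

lemma generated:
  assumes "l \<in> E"
  shows "\<exists>p\<in>polys_over K. Polynomial.degree p < d \<and> (\<forall>j. (\<sigma> ^^ j) l = poly p ((\<sigma> ^^ j) \<gamma>))"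
proof -
  define S where "S = (\<lambda>i. (\<sigma> ^^ i) \<gamma>) ` {..<d}"
  have S: "finite S" "S \<subseteq> E" "card S = d" "S \<noteq> {}"
    unfolding S_def using d_pos by (auto intro: funpow_closed \<gamma>_in card_image[OF \<gamma>_distinct, simplified])
  define g where "g x = (\<sigma> ^^ (inv_into {..<d} (\<lambda>i. (\<sigma> ^^ i) \<gamma>) x)) l" for x
  have g: "g ((\<sigma> ^^ i) \<gamma>) = (\<sigma> ^^ i) l" if "i < d" for i
    unfolding g_def using that by (subst inv_into_f_f[OF \<gamma>_distinct]) auto
  have "\<exists>p\<in>polys_over E. (S \<noteq> {} \<longrightarrow> Polynomial.degree p < card S) \<and> (\<forall>x\<in>S. poly p x = g x)"
    using S by (intro interpolation) (auto simp: g_def assms funpow_closed)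
  then obtain p where p: "p \<in> polys_over E" "Polynomial.degree p < d" and pS: "\<And>x. x \<in> S \<Longrightarrow> poly p x = g x"
    using S by auto
  have pval: "poly p ((\<sigma> ^^ i) \<gamma>) = (\<sigma> ^^ i) l" for i
  proof -
    have "(\<sigma> ^^ (i mod d)) \<gamma> \<in> S" unfolding S_def using d_pos by auto
    then show ?thesis using pS[of "(\<sigma> ^^ (i mod d)) \<gamma>"] g[of "i mod d"] d_pos
      by (simp add: funpow_mod \<gamma>_in assms)
  qed
  have "map_poly \<sigma> p = p"
  proof (rule poly_eqI_degree[where A = S])
    fix x assume "x \<in> S"
    then obtain i where i: "i < d" "x = (\<sigma> ^^ i) \<gamma>" unfolding S_def by auto
    have "x = (\<sigma> ^^ (i + d)) \<gamma>" using i by (simp add: funpow_add order_d \<gamma>_in)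
    then have x: "x = \<sigma> ((\<sigma> ^^ (i + d - 1)) \<gamma>)" using d_pos by (cases d) auto
    have "poly (map_poly \<sigma> p) x = \<sigma> (poly p ((\<sigma> ^^ (i + d - 1)) \<gamma>))"
      unfolding x by (rule poly_map_poly[OF p(1)]) (simp add: funpow_closed \<gamma>_in)
    also have "\<dots> = (\<sigma> ^^ (i + d)) l" unfolding pval using d_pos by (cases d) auto
    also have "\<dots> = poly p x" using i(2) pval[of i] by (simp add: funpow_add order_d assms)
    finally show "poly (map_poly \<sigma> p) x = poly p x" .
  qed (use p S in \<open>auto simp: degree_map_polys\<close>)
  then have "p \<in> polys_over K"
    using p(1) by (auto simp: polys_over_def poly_eq_iff coeff_map_poly endo_zero intro!: fixed_in_K)
  then show ?thesis using p pval by auto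
qed

text \<open>Interpolating \<open>\<gamma>^d\<close> yields a polynomial \<open>q\<close> over
  \<open>K\<close> of degree below \<open>d\<close> with the same values at all conjugates. Then
  \<open>X^d - q\<close> is monic with the \<open>d\<close> conjugates as roots, hence equal to the
  product.\<close>

lemma min_poly:
  "(\<Prod>j<d. [:- (\<sigma> ^^ j) \<gamma>, 1:]) \<in> polys_over K"
proof -
  obtain q where q: "q \<in> polys_over K" "Polynomial.degree q < d"
    "\<And>j. (\<sigma> ^^ j) (\<gamma> ^ d) = poly q ((\<sigma> ^^ j) \<gamma>)"
    using generated[of "\<gamma> ^ d"] power_closed[OF \<gamma>_in] by blast
  define p where "p = Polynomial.monom 1 d - q"
  define P where "P = (\<Prod>j<d. [:- (\<sigma> ^^ j) \<gamma>, 1:])"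
  have dP: "Polynomial.degree P = d" unfolding P_def by (subst degree_prod_eq_sum_degree) auto
  have lP: "Polynomial.coeff P d = 1"
    unfolding dP[symmetric] unfolding P_def lead_coeff_prod by simp
  have "Polynomial.degree (p - P) < d"
  proof -
    have "Polynomial.degree (p - P) \<le> d" unfolding p_def using dP q(2)
      by (intro Polynomial.degree_diff_le) (auto simp: Polynomial.degree_monom_eq)
    moreover have "Polynomial.coeff (p - P) d = 0"
      unfolding p_def using lP q(2) by (simp add: Polynomial.coeff_eq_0)
    ultimately show ?thesis using d_pos
      by (metis Polynomial.degree_0 le_neq_implies_less leading_coeff_0_iff)
  qed
  moreover have "poly (p - P) x = 0" if x: "x \<in> (\<lambda>i. (\<sigma> ^^ i) \<gamma>) ` {..<d}" for x
  proof -
    obtain j where j: "j < d" "x = (\<sigma> ^^ j) \<gamma>" using x by auto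
    interpret sj: fld_endo E "\<sigma> ^^ j" by (rule fld_endo_funpow)
    have "poly p x = 0" unfolding p_def j using q(3)[of j]
      by (simp add: poly_monom sj.endo_power \<gamma>_in)
    moreover have "poly P x = 0" unfolding P_def poly_prod using j by auto
    ultimately show ?thesis by simp
  qed
  ultimately have "p - P = 0"
    using card_image[OF \<gamma>_distinct] d_pos
    by (intro poly_eqI_degree[of "(\<lambda>i. (\<sigma> ^^ i) \<gamma>) ` {..<d}"]) auto
  then have "p = P" by simp
  moreover have "p \<in> polys_over K" unfolding p_def
    using q by (intro K.polys_diff K.polys_monom) auto
  ultimately show ?thesis by (simp add: P_def)
qed

abbreviation A where "A \<equiv> cyclic_algebra E \<sigma> d b"

text \<open>The product of the algebra, with the carry \<open>b\<^bsup>\<lfloor>(i + j)/d\<rfloor>\<^esup>\<close> made explicit. It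
  makes sense for all left factors, so that it defines a right action of the algebra on
  row vectors with arbitrary entries.\<close>

definition act :: "(nat \<Rightarrow> 'a) \<Rightarrow> (nat \<Rightarrow> 'a) \<Rightarrow> nat \<Rightarrow> 'a"
  where "act x g = (\<lambda>k. if k < d then \<Sum>i<d. \<Sum>j<d. if (i + j) mod d = k
    then x i * (\<sigma> ^^ i) (g j) * b ^ ((i + j) div d) else 0 else 0)"

lemma mult_A: "monoid.mult A = act"
proof (intro ext)
  fix f g k
  have "b ^ ((i + j) div d) = (if i + j < d then 1 else b)" if "i < d" "j < d" for i j
  proof (cases "i + j < d")
    case False
    then have "(i + j) div d = 1" using that by (intro div_nat_eqI) auto
    then show ?thesis using False by simp
  qed simp
  note * = this
  show "monoid.mult A f g k = act f g k"
    unfolding cyclic_algebra_def act_def by (auto intro!: sum.cong simp: *)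
qed

lemma carrier_A: "f \<in> carrier A \<longleftrightarrow> (\<forall>i<d. f i \<in> E) \<and> (\<forall>i\<ge>d. f i = 0)"
  by (simp add: cyclic_algebra_def)

lemma A_entry: "f \<in> carrier A \<Longrightarrow> f i \<in> E"
  by (cases "i < d") (auto simp: carrier_A not_less)

lemma A_simps: "ring.zero A = 0" "add A = (+)" "monoid.one A = (\<lambda>i. if i = 0 then 1 else 0)"
  "module.smult A c f = (\<lambda>i. c * f i)"
  by (auto simp: cyclic_algebra_def fun_eq_iff plus_fun_def)

lemma abelian_monoid_A: "abelian_monoid A"
proof
  fix x y z assume "x \<in> carrier (add_monoid A)" "y \<in> carrier (add_monoid A)"
  then show "x \<otimes>\<^bsub>add_monoid A\<^esub> y \<in> carrier (add_monoid A)"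
    by (auto simp: A_simps carrier_A intro: add_closed)
qed (auto simp: A_simps carrier_A algebra_simps)

lemma finsum_A: "finite I \<Longrightarrow> f \<in> I \<rightarrow> carrier A \<Longrightarrow> finsum A f I = sum f I"
proof (induction I rule: finite_induct)
  case empty
  interpret abelian_monoid A by (rule abelian_monoid_A)
  show ?case by (simp add: A_simps)
next
  case (insert a I)
  interpret abelian_monoid A by (rule abelian_monoid_A)
  show ?case using insert by (subst finsum_insert) (auto simp: A_simps)
qed

lemma act_closed: "x \<in> carrier A \<Longrightarrow> g \<in> carrier A \<Longrightarrow> act x g \<in> carrier A"
  unfolding carrier_A act_def
  using K_subset b_in
  by (auto intro!: sum_closed mult_closed funpow_closed power_closed)

lemma act_add_left: "act (x + y) g = act x g + act y g"
  by (auto simp: act_def fun_eq_iff sum.distrib[symmetric] algebra_simps intro!: sum.cong)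

lemma act_scale_left: "act (\<lambda>i. c * x i) g = (\<lambda>k. c * act x g k)"
  by (auto simp: act_def fun_eq_iff sum_distrib_left mult.assoc intro!: sum.cong)

lemma act_add_right:
  assumes "g \<in> carrier A" "h \<in> carrier A"
  shows "act x (g + h) = act x g + act x h"
proof -
  have "(\<sigma> ^^ i) (g j + h j) = (\<sigma> ^^ i) (g j) + (\<sigma> ^^ i) (h j)" for i j
    using fld_endo.endo_add[OF fld_endo_funpow] assms A_entry by blast
  then show ?thesis
    by (auto simp: act_def fun_eq_iff sum.distrib[symmetric] algebra_simps intro!: sum.cong)
qed

lemma act_zero_left: "act 0 g = 0" and act_zero_right: "act x 0 = 0"
  using fld_endo.endo_zero[OF fld_endo_funpow]
  by (auto simp: act_def fun_eq_iff intro!: sum.neutral)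

lemma act_sum_left: "act (\<Sum>i\<in>I. f i) g = (\<Sum>i\<in>I. act (f i) g)"
proof (induction I rule: infinite_finite_induct)
  case (insert a I)
  then show ?case by (simp only: sum.insert act_add_left not_False_eq_True)
qed (simp_all only: act_zero_left sum.infinite sum.empty not_False_eq_True)

lemma carrier_A_sum: "(\<And>i. i \<in> I \<Longrightarrow> f i \<in> carrier A) \<Longrightarrow> sum f I \<in> carrier A"
  by (induction I rule: infinite_finite_induct) (auto simp: carrier_A add_closed)

lemma act_sum_right: "(\<And>i. i \<in> I \<Longrightarrow> f i \<in> carrier A) \<Longrightarrow> act x (sum f I) = (\<Sum>i\<in>I. act x (f i))"
proof (induction I rule: infinite_finite_induct)
  case (insert a I)
  then have "act x (f a + sum f I) = act x (f a) + act x (sum f I)"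
    by (intro act_add_right carrier_A_sum) auto
  then show ?case using insert by (simp only: sum.insert not_False_eq_True insert_iff simp_thms)
qed (simp_all only: act_zero_right sum.infinite sum.empty not_False_eq_True)

lemma act_smult_right:
  assumes "c \<in> K" "g \<in> carrier A"
  shows "act x (\<lambda>i. c * g i) = (\<lambda>k. c * act x g k)"
proof -
  have "(\<sigma> ^^ i) (c * g j) = c * (\<sigma> ^^ i) (g j)" for i j
    using fld_endo.endo_mult[OF fld_endo_funpow, of c "g j" i] assms A_entry K_subset funpow_fix_K
    by auto
  then show ?thesis
    by (auto simp: act_def fun_eq_iff sum_distrib_left algebra_simps intro!: sum.cong)
qed

definition one_at :: "nat \<Rightarrow> 'a \<Rightarrow> nat \<Rightarrow> 'a"
  where "one_at j l = (\<lambda>i. if i = j then l else 0)"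

lemma one_at_carrier: "j < d \<Longrightarrow> l \<in> E \<Longrightarrow> one_at j l \<in> carrier A"
  by (auto simp: one_at_def carrier_A)

text \<open>Both sides are the sum of the same terms \<open>T i j k\<close>, because the carries of
  two successive additions modulo \<open>d\<close> add up to the total carry
  (\<open>div_carry\<close>). The automorphism is never applied to entries of \<open>x\<close>,
  which may therefore lie outside \<open>E\<close>.\<close>

lemma act_assoc:
  assumes "g \<in> carrier A" "h \<in> carrier A"
  shows "act (act x g) h = act x (act g h)"
proof
  fix r
  have gE: "g j \<in> E" and hE: "h j \<in> E" for j using assms A_entry by auto
  have bE: "b ^ n \<in> E" for n using b_in K_subset power_closed by auto
  show "act (act x g) h r = act x (act g h) r"
  proof (cases "r < d")
    case True
    have cut: "(if P then (\<Sum>i<d. \<Sum>j<d. f i j) else 0) = (\<Sum>i<d. \<Sum>j<d. if P then f i j else 0)"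
      for P and f :: "nat \<Rightarrow> nat \<Rightarrow> 'a" by auto
    define T where "T i j k = (if (i + j + k) mod d = r
        then x i * (\<sigma> ^^ i) (g j) * (\<sigma> ^^ (i + j)) (h k) * b ^ ((i + j + k) div d) else 0)" for i j k
    have "act (act x g) h r = (\<Sum>a<d. \<Sum>k<d. \<Sum>i<d. \<Sum>j<d. if (i + j) mod d = a then
        (if (a + k) mod d = r then x i * (\<sigma> ^^ i) (g j) * b ^ ((i + j) div d) * (\<sigma> ^^ a) (h k) * b ^ ((a + k) div d) else 0) else 0)"
      using True unfolding act_def
      by (auto simp: sum_distrib_right intro!: sum.cong sum.neutral)
    also have "\<dots> = (\<Sum>k<d. \<Sum>i<d. \<Sum>j<d. \<Sum>a<d. if (i + j) mod d = a then
        (if (a + k) mod d = r then x i * (\<sigma> ^^ i) (g j) * b ^ ((i + j) div d) * (\<sigma> ^^ a) (h k) * b ^ ((a + k) div d) else 0) else 0)"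
      by (rule sum_rotate4)
    also have "\<dots> = (\<Sum>k<d. \<Sum>i<d. \<Sum>j<d. T i j k)"
    proof (intro sum.cong refl)
      fix k i j assume "k \<in> {..<d}" "i \<in> {..<d}" "j \<in> {..<d}"
      have "(i + j + k) div d = (i + j) div d + ((i + j) mod d + k) div d"
        using d_pos by (rule div_carry)
      moreover have "((i + j) mod d + k) mod d = (i + j + k) mod d" by (simp add: mod_add_left_eq)
      ultimately show "(\<Sum>a<d. if (i + j) mod d = a then (if (a + k) mod d = r then x i * (\<sigma> ^^ i) (g j) * b ^ ((i + j) div d) * (\<sigma> ^^ a) (h k) * b ^ ((a + k) div d) else 0) else 0) = T i j k"
        using d_pos by (subst sum.delta') (auto simp: T_def funpow_mod hE power_add)
    qed
    finally have L: "act (act x g) h r = (\<Sum>k<d. \<Sum>i<d. \<Sum>j<d. T i j k)" .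
    have e: "(\<sigma> ^^ i) (act g h c) = (\<Sum>j<d. \<Sum>k<d. if (j + k) mod d = c then
        (\<sigma> ^^ i) (g j) * (\<sigma> ^^ (i + j)) (h k) * b ^ ((j + k) div d) else 0)" if "c < d" for i c
    proof -
      interpret si: fld_endo E "\<sigma> ^^ i" by (rule fld_endo_funpow)
      have "(\<sigma> ^^ i) (act g h c) = (\<Sum>j<d. \<Sum>k<d. (\<sigma> ^^ i) (if (j + k) mod d = c then
        g j * (\<sigma> ^^ j) (h k) * b ^ ((j + k) div d) else 0))"
      proof -
        have cl: "(if (j + k) mod d = c then g j * (\<sigma> ^^ j) (h k) * b ^ ((j + k) div d) else 0) \<in> E" for j k
          by (auto simp: gE hE bE funpow_closed intro!: mult_closed)
        show ?thesis using that unfolding act_def by (simp only: if_True si.endo_sum sum_closed cl)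
      qed
      also have "\<dots> = (\<Sum>j<d. \<Sum>k<d. if (j + k) mod d = c then
        (\<sigma> ^^ i) (g j) * (\<sigma> ^^ (i + j)) (h k) * b ^ ((j + k) div d) else 0)"
        using funpow_fix_K[OF K.power_closed[OF b_in], of i]
        by (intro sum.cong refl) (auto simp: si.endo_mult si.endo_zero gE hE bE funpow_closed mult_closed funpow_add)
      finally show ?thesis .
    qed
    have "act x (act g h) r = (\<Sum>i<d. \<Sum>c<d. \<Sum>j<d. \<Sum>k<d. if (j + k) mod d = c then
        (if (i + c) mod d = r then x i * ((\<sigma> ^^ i) (g j) * (\<sigma> ^^ (i + j)) (h k) * b ^ ((j + k) div d)) * b ^ ((i + c) div d) else 0) else 0)"
      using True unfolding act_def[of x]
      by (auto simp: e sum_distrib_right sum_distrib_left intro!: sum.cong sum.neutral)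
    also have "\<dots> = (\<Sum>i<d. \<Sum>j<d. \<Sum>k<d. \<Sum>c<d. if (j + k) mod d = c then
        (if (i + c) mod d = r then x i * ((\<sigma> ^^ i) (g j) * (\<sigma> ^^ (i + j)) (h k) * b ^ ((j + k) div d)) * b ^ ((i + c) div d) else 0) else 0)"
      by (rule sum.cong[OF refl], rule sum_rotate3)
    also have "\<dots> = (\<Sum>i<d. \<Sum>j<d. \<Sum>k<d. T i j k)"
    proof (intro sum.cong refl)
      fix k i j assume "k \<in> {..<d}" "i \<in> {..<d}" "j \<in> {..<d}"
      have "(i + j + k) div d = (j + k) div d + (i + (j + k) mod d) div d"
        using div_carry[OF d_pos, of "j + k" i] by (simp add: ac_simps)
      moreover have "(i + (j + k) mod d) mod d = (i + j + k) mod d"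
        by (simp add: mod_add_right_eq add.assoc)
      ultimately show "(\<Sum>c<d. if (j + k) mod d = c then
        (if (i + c) mod d = r then x i * ((\<sigma> ^^ i) (g j) * (\<sigma> ^^ (i + j)) (h k) * b ^ ((j + k) div d)) * b ^ ((i + c) div d) else 0) else 0) = T i j k"
        using d_pos by (subst sum.delta') (auto simp: T_def power_add)
    qed
    also have "\<dots> = (\<Sum>k<d. \<Sum>i<d. \<Sum>j<d. T i j k)"
      by (rule sum_rotate3[symmetric])
    finally show ?thesis using L by simp
  qed (simp add: act_def)
qed

end

section \<open>Row vectors over a cyclic algebra as a module over its matrix ring\<close>

definition vscale :: "'a::times \<Rightarrow> (nat \<Rightarrow> nat \<Rightarrow> 'a) \<Rightarrow> nat \<Rightarrow> nat \<Rightarrow> 'a"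
  where "vscale c x = (\<lambda>\<kappa> j. c * x \<kappa> j)"

lemma vscale_simps:
  "vscale c (vscale c' x) = vscale (c * c') x" "vscale 1 x = x"
  "vscale c (x + y) = vscale c x + vscale c y" "vscale (c + c') x = vscale c x + vscale c' x"
  "vscale c 0 = 0" "vscale 0 x = 0"
  for x y :: "nat \<Rightarrow> nat \<Rightarrow> 'a::comm_ring_1"
  by (auto simp: vscale_def fun_eq_iff algebra_simps)

lemma vscale_sum: "vscale c (sum f I) = (\<Sum>i\<in>I. vscale c (f i))"
  for c :: "'a::comm_ring_1"
proof (induction I rule: infinite_finite_induct)
  case (insert a I)
  then show ?case by (simp only: sum.insert vscale_simps not_False_eq_True)
qed (simp_all only: vscale_simps sum.infinite sum.empty not_False_eq_True)

lemma vscale_eq_0_iff: "vscale c x = 0 \<longleftrightarrow> c = 0 \<or> x = 0" for c :: "'a::idom"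
  by (auto simp: vscale_def fun_eq_iff)

lemma vscale_cancel_right: "x \<noteq> 0 \<Longrightarrow> vscale c x = vscale c' x \<longleftrightarrow> c = c'" for c :: "'a::idom"
  by (auto simp: vscale_def fun_eq_iff)

locale csa = cyc +
  fixes r :: nat
  assumes r_pos: "0 < r"
begin

abbreviation RM where "RM \<equiv> matrix_algebra r A"

lemma zero_carrier_A [simp]: "0 \<in> carrier A"
  by (simp add: carrier_A)

lemma carrier_RM: "N \<in> carrier RM \<longleftrightarrow>
    (\<forall>i j. (i < r \<and> j < r \<longrightarrow> N i j \<in> carrier A) \<and> (\<not> (i < r \<and> j < r) \<longrightarrow> N i j = 0))"
  by (simp add: matrix_algebra_def A_simps)

lemma RM_entry: "N \<in> carrier RM \<Longrightarrow> N i j \<in> carrier A"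
  using zero_carrier_A by (cases "i < r \<and> j < r") (simp_all only: carrier_RM simp_thms)

lemma mult_RM:
  assumes "N \<in> carrier RM" "N' \<in> carrier RM"
  shows "N \<otimes>\<^bsub>RM\<^esub> N' = (\<lambda>i j. if i < r \<and> j < r then \<Sum>k<r. act (N i k) (N' k j) else 0)"
proof -
  have "finsum A (\<lambda>k. act (N i k) (N' k j)) {..<r} = (\<Sum>k<r. act (N i k) (N' k j))" for i j
    using assms by (intro finsum_A) (auto intro: act_closed RM_entry)
  then show ?thesis by (simp add: matrix_algebra_def A_simps mult_A fun_eq_iff)
qed

lemma add_RM: "N \<oplus>\<^bsub>RM\<^esub> N' = N + N'"
  by (simp add: matrix_algebra_def A_simps fun_eq_iff)

lemma smult_RM: "N \<in> carrier RM \<Longrightarrow> c \<odot>\<^bsub>RM\<^esub> N = (\<lambda>i. vscale c (N i))"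
  unfolding carrier_RM by (auto simp: matrix_algebra_def A_simps fun_eq_iff vscale_def)

lemma RM_add_closed: "N \<in> carrier RM \<Longrightarrow> N' \<in> carrier RM \<Longrightarrow> N + N' \<in> carrier RM"
  unfolding carrier_RM by (auto simp: carrier_A intro: add_closed)

lemma RM_mult_closed: "N \<in> carrier RM \<Longrightarrow> N' \<in> carrier RM \<Longrightarrow> N \<otimes>\<^bsub>RM\<^esub> N' \<in> carrier RM"
  by (simp only: mult_RM, subst carrier_RM) (auto intro!: carrier_A_sum act_closed intro: RM_entry[of N] RM_entry[of N'])

text \<open>The row vectors after extension of scalars from \<open>E\<close>, acting on the left, to
  the whole ambient field; the \<open>bas \<kappa> j 1\<close> form a basis. The lattice of honest
  row vectors over the algebra is \<open>VE\<close>.\<close>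

definition V :: "(nat \<Rightarrow> nat \<Rightarrow> 'a) set"
  where "V = {x. \<forall>\<kappa> j. \<not> (\<kappa> < r \<and> j < d) \<longrightarrow> x \<kappa> j = 0}"

definition VE :: "(nat \<Rightarrow> nat \<Rightarrow> 'a) set"
  where "VE = {x \<in> V. \<forall>\<kappa> j. x \<kappa> j \<in> E}"

definition vact :: "(nat \<Rightarrow> nat \<Rightarrow> 'a) \<Rightarrow> (nat \<Rightarrow> nat \<Rightarrow> nat \<Rightarrow> 'a) \<Rightarrow> nat \<Rightarrow> nat \<Rightarrow> 'a"
  where "vact x N = (\<lambda>\<kappa>'. if \<kappa>' < r then \<Sum>\<kappa><r. act (x \<kappa>) (N \<kappa> \<kappa>') else 0)"

lemma VE_row: "u \<in> VE \<Longrightarrow> u \<kappa> \<in> carrier A"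
  by (cases "\<kappa> < r") (auto simp: VE_def V_def carrier_A)

lemma VE_iff: "u \<in> VE \<longleftrightarrow> (\<forall>\<kappa>. (\<kappa> < r \<longrightarrow> u \<kappa> \<in> carrier A) \<and> (\<kappa> \<ge> r \<longrightarrow> u \<kappa> = 0))"
proof
  assume u: "u \<in> VE"
  then show "\<forall>\<kappa>. (\<kappa> < r \<longrightarrow> u \<kappa> \<in> carrier A) \<and> (\<kappa> \<ge> r \<longrightarrow> u \<kappa> = 0)"
    using VE_row[OF u] by (auto simp: VE_def V_def fun_eq_iff)
next
  assume *: "\<forall>\<kappa>. (\<kappa> < r \<longrightarrow> u \<kappa> \<in> carrier A) \<and> (\<kappa> \<ge> r \<longrightarrow> u \<kappa> = 0)"
  have "u \<kappa> j = 0" if "\<not> (\<kappa> < r \<and> j < d)" for \<kappa> j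
    using * that by (cases "\<kappa> < r") (auto simp: carrier_A)
  moreover have "u \<kappa> j \<in> E" for \<kappa> j
    using *[rule_format, of \<kappa>] by (cases "\<kappa> < r") (auto intro: A_entry)
  ultimately show "u \<in> VE" by (auto simp: VE_def V_def)
qed

lemma V_add: "x \<in> V \<Longrightarrow> y \<in> V \<Longrightarrow> x + y \<in> V"
  and V_scale: "x \<in> V \<Longrightarrow> vscale c x \<in> V"
  and V_zero: "0 \<in> V"
  by (auto simp: V_def vscale_def)

lemma V_sum: "(\<And>i. i \<in> I \<Longrightarrow> f i \<in> V) \<Longrightarrow> sum f I \<in> V"
  by (induction I rule: infinite_finite_induct) (auto intro: V_add V_zero simp del: plus_fun_apply zero_fun_apply)

lemma vact_V: "vact x N \<in> V"
  unfolding vact_def V_def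
proof (clarify)
  fix \<kappa> j assume *: "\<not> (\<kappa> < r \<and> j < d)" 
  have "(\<Sum>\<kappa>'<r. act (x \<kappa>') (N \<kappa>' \<kappa>)) j = 0" if "\<not> j < d"
  proof -
    have "(\<Sum>\<kappa>'\<in>I. act (x \<kappa>') (N \<kappa>' \<kappa>)) j = 0" for I
      using that by (induction I rule: infinite_finite_induct) (auto simp: act_def)
    then show ?thesis .
  qed
  then show "(if \<kappa> < r then \<Sum>\<kappa>'<r. act (x \<kappa>') (N \<kappa>' \<kappa>) else 0) j = 0" using * by auto
qed

lemma vact_VE: "u \<in> VE \<Longrightarrow> N \<in> carrier RM \<Longrightarrow> vact u N \<in> VE"
  by (subst VE_iff) (auto simp: vact_def intro!: carrier_A_sum act_closed intro: RM_entry[of N] VE_row[of u])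

lemma vact_add_left: "vact (x + y) N = vact x N + vact y N"
  by (rule ext) (simp add: vact_def act_add_left sum.distrib)

lemma vact_scale_left: "vact (vscale c x) N = vscale c (vact x N)"
proof -
  have s: "(\<Sum>\<kappa>\<in>I. (\<lambda>k. c * act (x \<kappa>) (N \<kappa> \<kappa>') k)) = (\<lambda>k. c * (\<Sum>\<kappa>\<in>I. act (x \<kappa>) (N \<kappa> \<kappa>')) k)" for I \<kappa>'
    by (induction I rule: infinite_finite_induct) (auto simp: fun_eq_iff algebra_simps)
  show ?thesis by (intro ext) (simp add: vact_def vscale_def act_scale_left s)
qed

lemma vact_add_right:
  assumes "N \<in> carrier RM" "N' \<in> carrier RM" shows "vact x (N + N') = vact x N + vact x N'"
proof -
  have "act (x \<kappa>) ((N + N') \<kappa> \<kappa>') = act (x \<kappa>) (N \<kappa> \<kappa>') + act (x \<kappa>) (N' \<kappa> \<kappa>')" for \<kappa> \<kappa>'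
    using act_add_right[OF RM_entry[OF assms(1)] RM_entry[OF assms(2)]]
    by (simp add: plus_fun_def)
  then show ?thesis by (intro ext) (simp add: vact_def sum.distrib)
qed

lemma vact_smult_right:
  assumes "c \<in> K" "N \<in> carrier RM"
  shows "vact x (c \<odot>\<^bsub>RM\<^esub> N) = vscale c (vact x N)"
proof -
  have *: "act (x \<kappa>) ((c \<odot>\<^bsub>RM\<^esub> N) \<kappa> \<kappa>') = (\<lambda>k. c * act (x \<kappa>) (N \<kappa> \<kappa>') k)" for \<kappa> \<kappa>'
    using act_smult_right[OF assms(1) RM_entry[OF assms(2)]]
    by (simp add: smult_RM[OF assms(2)] vscale_def)
  have s: "(\<Sum>\<kappa>\<in>I. (\<lambda>k. c * act (x \<kappa>) (N \<kappa> \<kappa>') k)) = (\<lambda>k. c * (\<Sum>\<kappa>\<in>I. act (x \<kappa>) (N \<kappa> \<kappa>')) k)" for I \<kappa>'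
    by (induction I rule: infinite_finite_induct) (auto simp: fun_eq_iff algebra_simps)
  show ?thesis by (intro ext) (simp add: vact_def * vscale_def[of c "\<lambda>\<kappa>'. _ \<kappa>'"] s)
qed

lemma vact_assoc:
  assumes "N \<in> carrier RM" "N' \<in> carrier RM"
  shows "vact (vact x N) N' = vact x (N \<otimes>\<^bsub>RM\<^esub> N')"
proof
  fix \<kappa>'
  show "vact (vact x N) N' \<kappa>' = vact x (N \<otimes>\<^bsub>RM\<^esub> N') \<kappa>'"
  proof (cases "\<kappa>' < r")
    case True
    have "vact (vact x N) N' \<kappa>' = (\<Sum>\<mu><r. act (\<Sum>\<kappa><r. act (x \<kappa>) (N \<kappa> \<mu>)) (N' \<mu> \<kappa>'))"
      using True by (simp add: vact_def)
    also have "\<dots> = (\<Sum>\<mu><r. \<Sum>\<kappa><r. act (x \<kappa>) (act (N \<kappa> \<mu>) (N' \<mu> \<kappa>')))"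
      by (simp only: act_sum_left act_assoc[OF RM_entry[OF assms(1)] RM_entry[OF assms(2)]])
    also have "\<dots> = (\<Sum>\<kappa><r. \<Sum>\<mu><r. act (x \<kappa>) (act (N \<kappa> \<mu>) (N' \<mu> \<kappa>')))"
      by (rule sum.swap)
    also have "\<dots> = (\<Sum>\<kappa><r. act (x \<kappa>) (\<Sum>\<mu><r. act (N \<kappa> \<mu>) (N' \<mu> \<kappa>')))"
      by (intro sum.cong refl act_sum_right[symmetric] act_closed RM_entry assms)
    also have "\<dots> = vact x (N \<otimes>\<^bsub>RM\<^esub> N') \<kappa>'"
      using True by (simp add: vact_def mult_RM[OF assms])
    finally show ?thesis .
  qed (simp add: vact_def)
qed

text \<open>Identifies \<open>VE\<close> with the right ideal of matrices supported in the first
  row. In this way a row vector can act on modules over the matrix ring.\<close>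

definition Row :: "(nat \<Rightarrow> nat \<Rightarrow> 'a) \<Rightarrow> nat \<Rightarrow> nat \<Rightarrow> nat \<Rightarrow> 'a"
  where "Row u = (\<lambda>i. if i = 0 then u else 0)"

lemma Row_carrier: "u \<in> VE \<Longrightarrow> Row u \<in> carrier RM"
  using r_pos by (auto simp: Row_def carrier_RM VE_iff)

lemma Row_mult: "u \<in> VE \<Longrightarrow> N \<in> carrier RM \<Longrightarrow> Row u \<otimes>\<^bsub>RM\<^esub> N = Row (vact u N)"
  using r_pos by (simp only: mult_RM Row_carrier)
    (auto simp: Row_def vact_def fun_eq_iff act_zero_left intro!: sum.neutral)

lemma Row_add: "Row (u + u') = Row u + Row u'"
  by (auto simp: Row_def fun_eq_iff)

definition bas :: "nat \<Rightarrow> nat \<Rightarrow> 'a \<Rightarrow> nat \<Rightarrow> nat \<Rightarrow> 'a"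
  where "bas \<kappa> j l = (\<lambda>\<kappa>'. if \<kappa>' = \<kappa> then one_at j l else 0)"

lemma bas_VE: "\<kappa> < r \<Longrightarrow> j < d \<Longrightarrow> l \<in> E \<Longrightarrow> bas \<kappa> j l \<in> VE"
  by (auto simp: bas_def VE_iff one_at_carrier)

lemma vscale_bas: "vscale c (bas \<kappa> j l) = bas \<kappa> j (c * l)"
  by (auto simp: bas_def vscale_def one_at_def fun_eq_iff)

lemma sum_bas: "x \<in> V \<Longrightarrow> x = (\<Sum>\<kappa><r. \<Sum>j<d. bas \<kappa> j (x \<kappa> j))"
proof -
  assume x: "x \<in> V"
  have s: "(\<Sum>i\<in>I. f i) a b = (\<Sum>i\<in>I. f i a b)" for f :: "nat \<Rightarrow> nat \<Rightarrow> nat \<Rightarrow> 'a" and I a b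
    by (induction I rule: infinite_finite_induct) auto
  have "(\<Sum>\<kappa><r. \<Sum>j<d. bas \<kappa> j (x \<kappa> j)) a c = x a c" for a c
  proof -
    have "(\<Sum>\<kappa><r. \<Sum>j<d. bas \<kappa> j (x \<kappa> j)) a c = (\<Sum>\<kappa><r. \<Sum>j<d. if j = c then (if \<kappa> = a then x \<kappa> j else 0) else 0)"
      unfolding s by (intro sum.cong refl) (auto simp: bas_def one_at_def)
    also have "\<dots> = x a c" using x by (cases "c < d") (auto simp: V_def)
    finally show ?thesis .
  qed
  then show ?thesis by (auto simp: fun_eq_iff)
qed

lemma linear_ext:
  assumes "\<And>x y. F (x + y) = F x + F y" "\<And>c x. F (vscale c x) = vscale c (F x)"
    and "\<And>x y. G (x + y) = G x + G y" "\<And>c x. G (vscale c x) = vscale c (G x)"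
    and "\<And>\<kappa> j. \<kappa> < r \<Longrightarrow> j < d \<Longrightarrow> F (bas \<kappa> j 1) = G (bas \<kappa> j 1)"
    and u: "u \<in> V"
  shows "F u = (G u :: nat \<Rightarrow> nat \<Rightarrow> 'a)"
proof -
  have lin: "H (sum f I) = (\<Sum>i\<in>I. H (f i))"
    if "\<And>x y. H (x + y) = H x + H y" "\<And>c x. H (vscale c x) = vscale c (H x)"
    for H :: "(nat \<Rightarrow> nat \<Rightarrow> 'a) \<Rightarrow> nat \<Rightarrow> nat \<Rightarrow> 'a" and f and I :: "nat set"
  proof -
    have z: "H 0 = 0" using that(2)[of 0 0] by (simp only: vscale_simps)
    show ?thesis
      by (induction I rule: infinite_finite_induct)
        (simp_all only: z that(1) sum.infinite sum.empty sum.insert not_False_eq_True)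
  qed
  have e: "bas \<kappa> j c = vscale c (bas \<kappa> j 1)" for \<kappa> j c by (simp add: vscale_bas)
  have "F u = (\<Sum>\<kappa><r. \<Sum>j<d. F (bas \<kappa> j (u \<kappa> j)))"
    by (subst sum_bas[OF u]) (simp only: lin[of F, OF assms(1,2)])
  also have "\<dots> = (\<Sum>\<kappa><r. \<Sum>j<d. G (bas \<kappa> j (u \<kappa> j)))"
  proof (intro sum.cong refl)
    fix \<kappa> j assume "\<kappa> \<in> {..<r}" "j \<in> {..<d}"
    then show "F (bas \<kappa> j (u \<kappa> j)) = G (bas \<kappa> j (u \<kappa> j))"
      using assms(5)[of \<kappa> j] unfolding e[of \<kappa> j "u \<kappa> j"] assms(2,4) by simp
  qed
  also have "\<dots> = G (\<Sum>\<kappa><r. \<Sum>j<d. bas \<kappa> j (u \<kappa> j))"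
    by (simp only: lin[of G, OF assms(3,4)])
  also have "\<dots> = G u" by (simp only: sum_bas[OF u, symmetric])
  finally show ?thesis .
qed

lemma act_one_at:
  assumes "j < d"
  shows "act x (one_at j l) = (\<lambda>k. if k < d then \<Sum>i<d. if (i + j) mod d = k
    then x i * (\<sigma> ^^ i) l * b ^ ((i + j) div d) else 0 else 0)"
proof
  fix k
  have "(\<sigma> ^^ i) 0 = 0" for i using fld_endo.endo_zero[OF fld_endo_funpow] .
  then have "act x (one_at j l) k = (if k < d then \<Sum>i<d. \<Sum>j'<d. if j' = j then (if (i + j) mod d = k
    then x i * (\<sigma> ^^ i) l * b ^ ((i + j) div d) else 0) else 0 else 0)"
    by (simp only: act_def, intro if_cong[OF refl _ refl], intro sum.cong refl) (auto simp: one_at_def)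
  then show "act x (one_at j l) k = (if k < d then \<Sum>i<d. if (i + j) mod d = k
    then x i * (\<sigma> ^^ i) l * b ^ ((i + j) div d) else 0 else 0)" using assms by simp
qed

lemma act_one_at_one_at:
  assumes "i < d" "j < d"
  shows "act (one_at i l) (one_at j l') = one_at ((i + j) mod d) (l * (\<sigma> ^^ i) l' * b ^ ((i + j) div d))"
proof
  fix k
  have "act (one_at i l) (one_at j l') k = (if k < d then \<Sum>i'<d. if i' = i then (if (i + j) mod d = k
    then l * (\<sigma> ^^ i) l' * b ^ ((i + j) div d) else 0) else 0 else 0)"
    by (simp only: act_one_at[OF assms(2)], intro if_cong[OF refl _ refl], intro sum.cong refl) (auto simp: one_at_def)
  then show "act (one_at i l) (one_at j l') k = one_at ((i + j) mod d) (l * (\<sigma> ^^ i) l' * b ^ ((i + j) div d)) k"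
    using assms by (auto simp: one_at_def)
qed

lemma act_one_at_0: "x \<in> carrier A \<or> (\<forall>i\<ge>d. x i = 0) \<Longrightarrow> act x (one_at 0 l) = (\<lambda>k. x k * (\<sigma> ^^ k) l)"
proof
  fix k assume x: "x \<in> carrier A \<or> (\<forall>i\<ge>d. x i = 0)"
  have "act x (one_at 0 l) k = (if k < d then \<Sum>i<d. if i = k then x i * (\<sigma> ^^ i) l else 0 else 0)"
    unfolding act_one_at[OF d_pos] by (auto intro!: sum.cong)
  then show "act x (one_at 0 l) k = x k * (\<sigma> ^^ k) l" using x by (auto simp: carrier_A)
qed

lemma vact_Row: "vact x (Row u) = (\<lambda>\<kappa>. if \<kappa> < r then act (x 0) (u \<kappa>) else 0)"
proof
  fix \<kappa>
  have "(\<Sum>\<kappa>'<r. act (x \<kappa>') (Row u \<kappa>' \<kappa>)) = (\<Sum>\<kappa>'<r. if \<kappa>' = 0 then act (x 0) (u \<kappa>) else 0)"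
    by (intro sum.cong refl) (auto simp: Row_def act_zero_right)
  then show "vact x (Row u) \<kappa> = (if \<kappa> < r then act (x 0) (u \<kappa>) else 0)"
    using r_pos by (auto simp: vact_def)
qed

text \<open>The element \<open>l y^i\<close> in the upper left corner, for an arbitrary exponent
  \<open>i\<close>. Thus \<open>mon 0 1\<close> is a primitive idempotent of the matrix ring over
  the ambient field, and its corner is a copy of the cyclic algebra.\<close>

definition mon :: "nat \<Rightarrow> 'a \<Rightarrow> nat \<Rightarrow> nat \<Rightarrow> nat \<Rightarrow> 'a"
  where "mon i l = Row (bas 0 (i mod d) (l * b ^ (i div d)))"

lemma b_power_E: "b ^ n \<in> E"
  using b_in K_subset power_closed by auto

lemma mon_VE: "l \<in> E \<Longrightarrow> bas 0 (i mod d) (l * b ^ (i div d)) \<in> VE"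
  using r_pos d_pos b_power_E by (intro bas_VE mult_closed) auto

lemma mon_carrier: "l \<in> E \<Longrightarrow> mon i l \<in> carrier RM"
  unfolding mon_def by (intro Row_carrier mon_VE)

lemma mon_mult:
  assumes l: "l \<in> E" and l': "l' \<in> E"
  shows "mon i l \<otimes>\<^bsub>RM\<^esub> mon j l' = mon (i + j) (l * (\<sigma> ^^ i) l')"
proof -
  let ?i = "i mod d" and ?j = "j mod d"
  interpret s: fld_endo E "\<sigma> ^^ (i mod d)" by (rule fld_endo_funpow)
  have fx: "(\<sigma> ^^ (i mod d)) (l' * b ^ (j div d)) = (\<sigma> ^^ i) l' * b ^ (j div d)"
    using s.endo_mult[OF l' b_power_E] funpow_fix_K[OF K.power_closed[OF b_in]] l' by (simp add: funpow_mod)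
  have "mon i l \<otimes>\<^bsub>RM\<^esub> mon j l' = Row (vact (bas 0 ?i (l * b ^ (i div d))) (Row (bas 0 ?j (l' * b ^ (j div d)))))"
    unfolding mon_def using l l' by (intro Row_mult mon_VE Row_carrier)
  also have "vact (bas 0 ?i (l * b ^ (i div d))) (Row (bas 0 ?j (l' * b ^ (j div d)))) =
     bas 0 ((?i + ?j) mod d) ((l * b ^ (i div d)) * (\<sigma> ^^ ?i) (l' * b ^ (j div d)) * b ^ ((?i + ?j) div d))"
    unfolding vact_Row using r_pos d_pos act_one_at_one_at[of ?i ?j]
    by (intro ext) (simp add: bas_def act_zero_right)
  also have "(?i + ?j) mod d = (i + j) mod d" by (simp add: mod_add_eq)
  also have "(l * b ^ (i div d)) * (\<sigma> ^^ ?i) (l' * b ^ (j div d)) * b ^ ((?i + ?j) div d)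
     = l * (\<sigma> ^^ i) l' * b ^ ((i + j) div d)"
    unfolding fx div_add1_eq[of i j d] power_add by (simp add: algebra_simps)
  finally show ?thesis by (simp add: mon_def)
qed

lemma mon_add: "mon i (l + l') = mon i l + mon i l'"
  by (auto simp: mon_def Row_def bas_def one_at_def fun_eq_iff algebra_simps)

lemma mon_smult: "l \<in> E \<Longrightarrow> c \<odot>\<^bsub>RM\<^esub> mon i l = mon i (c * l)"
  by (auto simp: smult_RM mon_carrier) (auto simp: mon_def Row_def bas_def one_at_def fun_eq_iff vscale_def)

lemma mon_order: "mon (i + d) l = mon i (l * b)"
  using d_pos by (simp add: mon_def algebra_simps)

lemma mon_nz: "l \<noteq> 0 \<Longrightarrow> mon i l \<noteq> 0"
  using b_nz by (auto simp: mon_def Row_def bas_def one_at_def fun_eq_iff)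

lemma mon_zero: "mon i 0 = 0"
  by (auto simp: mon_def Row_def bas_def one_at_def fun_eq_iff)

lemma act_one_at_0_left:
  assumes g: "g \<in> carrier A"
  shows "act (one_at 0 l) g = (\<lambda>k. l * g k)"
proof
  fix k
  have "act (one_at 0 l) g k = (if k < d then \<Sum>i<d. if i = 0 then \<Sum>j<d. if j = k then l * g j else 0 else 0 else 0)"
    by (simp only: act_def, intro if_cong[OF refl _ refl], intro sum.cong refl)
      (auto simp: one_at_def intro!: sum.cong sum.neutral)
  also have "\<dots> = l * g k" using g d_pos by (auto simp: carrier_A)
  finally show "act (one_at 0 l) g k = l * g k" .
qed

lemma mon_row_mult:
  assumes "l \<in> E" "v \<in> VE"
  shows "mon 0 l \<otimes>\<^bsub>RM\<^esub> Row v = Row (vscale l v)"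
proof -
  have m: "mon 0 l = Row (bas 0 0 l)" by (simp add: mon_def)
  have "vact (bas 0 0 l) (Row v) = vscale l v"
  proof (intro ext)
    fix \<kappa> k
    show "vact (bas 0 0 l) (Row v) \<kappa> k = vscale l v \<kappa> k"
      using assms(2) act_one_at_0_left[OF VE_row[OF assms(2)]]
      by (cases "\<kappa> < r") (auto simp: vact_Row bas_def vscale_def VE_def V_def)
  qed
  then show ?thesis unfolding m using assms r_pos d_pos
    by (simp add: Row_mult Row_carrier bas_VE)
qed

lemma vact_mon_0: "x \<in> V \<Longrightarrow> vact x (mon 0 l) = (\<lambda>\<kappa> k. if \<kappa> = 0 then x 0 k * (\<sigma> ^^ k) l else 0)"
proof (intro ext)
  fix \<kappa> k assume "x \<in> V"
  then have "act (x 0) (one_at 0 l) = (\<lambda>k. x 0 k * (\<sigma> ^^ k) l)"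
    by (intro act_one_at_0) (auto simp: V_def)
  then show "vact x (mon 0 l) \<kappa> k = (if \<kappa> = 0 then x 0 k * (\<sigma> ^^ k) l else 0)"
    unfolding mon_def vact_Row using r_pos by (auto simp: bas_def act_zero_right)
qed

text \<open>The case \<open>l = 1\<close> kills all components but the first. There the coefficient
  of \<open>y^k\<close> is multiplied by \<open>(\<sigma> ^^ k) l\<close> on the one hand and by
  \<open>l\<close> on the other, and \<gamma> separates the two for
  \<open>0 < k < d\<close>.\<close>

lemma schur:
  assumes x: "x \<in> V" and eig: "\<And>l. l \<in> E \<Longrightarrow> vact x (mon 0 l) = vscale l x"
  shows "x = vscale (x 0 0) (bas 0 0 1)"
proof (intro ext)
  fix \<kappa> k
  have e: "(if \<kappa> = 0 then x 0 k * (\<sigma> ^^ k) l else 0) = l * x \<kappa> k" if "l \<in> E" for l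
    using fun_cong[OF fun_cong[OF eig[OF that]], of \<kappa> k] unfolding vact_mon_0[OF x]
    by (simp add: vscale_def)
  show "x \<kappa> k = vscale (x 0 0) (bas 0 0 1) \<kappa> k"
  proof (cases "\<kappa> = 0")
    case False
    then show ?thesis using e[of 1] by (simp add: vscale_def bas_def)
  next
    case True
    show ?thesis
    proof (cases "k = 0 \<or> k \<ge> d")
      case True
      then show ?thesis using x d_pos \<open>\<kappa> = 0\<close> by (auto simp: vscale_def bas_def one_at_def V_def)
    next
      case k: False
      then have "(\<sigma> ^^ k) \<gamma> \<noteq> (\<sigma> ^^ 0) \<gamma>"
        using inj_onD[OF \<gamma>_distinct, of k 0] d_pos by auto
      moreover have "x 0 k * ((\<sigma> ^^ k) \<gamma> - \<gamma>) = 0" using e[OF \<gamma>_in] True by (simp add: algebra_simps)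
      ultimately show ?thesis using k True by (auto simp: vscale_def bas_def one_at_def)
    qed
  qed
qed

text \<open>The module stays simple after the extension of scalars: a nonzero entry is moved to the
  first position, and all other powers of \<open>y\<close> are projected away.\<close>

lemma simple:
  assumes U_add: "\<And>x y. x \<in> U \<Longrightarrow> y \<in> U \<Longrightarrow> x + y \<in> U"
    and U_scale: "\<And>c x. x \<in> U \<Longrightarrow> vscale c x \<in> U"
    and U_act: "\<And>x N. x \<in> U \<Longrightarrow> N \<in> carrier RM \<Longrightarrow> vact x N \<in> U"
    and u: "u \<in> U" "u \<in> V" "u \<noteq> 0"
  shows "bas 0 0 1 \<in> U"
proof -
  obtain \<kappa>0 j0 where uj: "u \<kappa>0 j0 \<noteq> 0" using u(3) by (auto simp: fun_eq_iff)
  with u(2) have lt: "\<kappa>0 < r" "j0 < d" by (auto simp: V_def)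
  \<comment> \<open>Multiplication by \<open>y^j\<close> turns \<open>y^j0\<close> into a scalar;
    the reduction modulo \<open>d\<close> takes care of \<open>j0 = 0\<close>.\<close>
  define j where "j = (d - j0) mod d"
  have j: "j < d" unfolding j_def using d_pos by simp
  define N where "N = (\<lambda>\<kappa> \<kappa>'. if \<kappa> = \<kappa>0 \<and> \<kappa>' = (0::nat) then one_at j 1 else 0)"
  have N: "N \<in> carrier RM" unfolding carrier_RM N_def
    using one_at_carrier[OF j, of 1] lt r_pos by auto
  define u1 where "u1 = vact u N"
  have u1: "u1 \<in> U" "u1 \<in> V" unfolding u1_def by (auto intro: U_act u N vact_V)
  have u1_row: "u1 0 = act (u \<kappa>0) (one_at j 1)"
  proof -
    have "u1 0 = (\<Sum>\<kappa><r. act (u \<kappa>) (N \<kappa> 0))"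
      using r_pos by (simp add: u1_def vact_def)
    also have "\<dots> = (\<Sum>\<kappa><r. if \<kappa> = \<kappa>0 then act (u \<kappa>0) (one_at j 1) else 0)"
      by (intro sum.cong refl) (auto simp: N_def act_zero_right)
    finally show ?thesis using lt by simp
  qed
  have u1_0: "u1 0 0 \<noteq> 0"
  proof -
    have jj: "(i + j) mod d = 0 \<longleftrightarrow> i = j0" if "i < d" for i
    proof (cases "j0 = 0")
      case True then show ?thesis using that by (simp add: j_def)
    next
      case False
      then have [simp]: "j = d - j0" unfolding j_def using lt by simp
      show ?thesis
      proof
        assume "(i + j) mod d = 0"
        then obtain k where k: "i + j = d * k" by auto
        have "k = 1"
        proof (rule ccontr)
          assume "k \<noteq> 1"
          then consider "k = 0" | "k \<ge> 2" by linarith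
          then show False
          proof cases
            case 2
            then have "d * 2 \<le> d * k" by simp
            then show False using k that \<open>j < d\<close> by linarith
          qed (use k False lt in simp)
        qed
        then show "i = j0" using k lt by simp
      qed (use lt in simp)
    qed
    have "u1 0 0 = (\<Sum>i<d. if i = j0 then u \<kappa>0 i * (\<sigma> ^^ i) 1 * b ^ ((i + j) div d) else 0)"
      unfolding u1_row act_one_at[OF j] using d_pos by (auto intro!: sum.cong simp: jj)
    also have "\<dots> = u \<kappa>0 j0 * b ^ ((j0 + j) div d)"
      using lt fld_endo.endo_one[OF fld_endo_funpow] by simp
    finally show ?thesis using uj b_nz by simp
  qed
  have u1_other: "u1 \<kappa> = 0" if "\<kappa> \<noteq> 0" for \<kappa>
    using that unfolding u1_def vact_def
    by (auto intro!: sum.neutral simp: N_def act_zero_right)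
  \<comment> \<open>A Lagrange projector built factor by factor: \<gamma> acts on the coefficient of
    \<open>y^k\<close> as \<open>(\<sigma> ^^ k) \<gamma>\<close>, so subtracting
    \<open>(\<sigma> ^^ n) \<gamma>\<close> kills exactly the coefficient of \<open>y^n\<close>. At
    the end only the coefficient of \<open>y^0\<close> survives.\<close>
  have "\<exists>x\<in>U. x \<in> V \<and> (\<forall>\<kappa> k. x \<kappa> k = (\<Prod>i\<in>{1..<n}. (\<sigma> ^^ k) \<gamma> - (\<sigma> ^^ i) \<gamma>) * u1 \<kappa> k)" if "n \<le> d" for n
    using that
  proof (induction n)
    case 0
    then show ?case using u1 by (intro bexI[of _ u1]) auto
  next
    case (Suc n)
    then obtain x where x: "x \<in> U" "x \<in> V" and xv: "\<And>\<kappa> k. x \<kappa> k = (\<Prod>i\<in>{1..<n}. (\<sigma> ^^ k) \<gamma> - (\<sigma> ^^ i) \<gamma>) * u1 \<kappa> k"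
      by auto
    show ?case
    proof (cases "n = 0")
      case True
      then show ?thesis using u1 by (intro bexI[of _ u1]) auto
    next
      case False
      define y where "y = vact x (mon 0 \<gamma>) + vscale (- (\<sigma> ^^ n) \<gamma>) x"
      have "y \<in> U" "y \<in> V" unfolding y_def
        by (auto intro!: U_add U_act U_scale V_add V_scale vact_V x mon_carrier \<gamma>_in simp del: plus_fun_apply)
      moreover have "y \<kappa> k = (\<Prod>i\<in>{1..<Suc n}. (\<sigma> ^^ k) \<gamma> - (\<sigma> ^^ i) \<gamma>) * u1 \<kappa> k" for \<kappa> k
        using False xv[of \<kappa> k] u1_other[of \<kappa>]
        by (cases "\<kappa> = 0") (auto simp: y_def vact_mon_0[OF x(2)] vscale_def algebra_simps)
      ultimately show ?thesis by blast
    qed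
  qed
  then obtain x where x: "x \<in> U" "x \<in> V" and xv: "\<And>\<kappa> k. x \<kappa> k = (\<Prod>i\<in>{1..<d}. (\<sigma> ^^ k) \<gamma> - (\<sigma> ^^ i) \<gamma>) * u1 \<kappa> k"
    by blast
  define c where "c = x 0 0"
  have "(\<sigma> ^^ 0) \<gamma> \<noteq> (\<sigma> ^^ i) \<gamma>" if "i \<in> {1..<d}" for i
    using inj_onD[OF \<gamma>_distinct, of 0 i] that d_pos by auto
  then have "(\<Prod>i\<in>{1..<d}. (\<sigma> ^^ 0) \<gamma> - (\<sigma> ^^ i) \<gamma>) \<noteq> 0"
    by (subst prod_zero_iff) auto
  then have c: "c \<noteq> 0" unfolding c_def xv using u1_0 by simp
  have "x = vscale c (bas 0 0 1)"
  proof (intro ext)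
    fix \<kappa> k
    show "x \<kappa> k = vscale c (bas 0 0 1) \<kappa> k"
    proof (cases "\<kappa> = 0 \<and> k \<noteq> 0 \<and> k < d")
      case True
      then have "(\<Prod>i\<in>{1..<d}. (\<sigma> ^^ k) \<gamma> - (\<sigma> ^^ i) \<gamma>) = 0" by auto
      then have "x \<kappa> k = 0" unfolding xv by simp
      then show ?thesis using True by (auto simp: vscale_def bas_def one_at_def)
    next
      case False
      then consider "\<kappa> \<noteq> 0" | "\<kappa> = 0" "k = 0" | "k \<ge> d" by linarith
      then show ?thesis
      proof cases
        case 1
        then show ?thesis unfolding xv using u1_other[of \<kappa>] by (simp add: vscale_def bas_def)
      next
        case 3
        then have "x \<kappa> k = 0" using x(2) by (auto simp: V_def)
        then show ?thesis using d_pos 3 by (auto simp: vscale_def bas_def one_at_def)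
      qed (simp add: c_def vscale_def bas_def one_at_def)
    qed
  qed
  then have "bas 0 0 1 = vscale (inverse c) x" using c by (simp add: vscale_simps)
  then show ?thesis using U_scale x by simp
qed

end

section \<open>Intertwiners of Brauer equivalent cyclic algebras\<close>

text \<open>Through \<open>h\<close> the rows over the second algebra become a module over the
  first. The axioms are kept weak enough to be checked directly for the inverse of an isomorphism,
  which gives the module structure in the other direction.\<close>

locale csa_hom = A: csa K E \<sigma> d b \<gamma> r + B: csa K W \<phi> m c \<omega> s
  for K E :: "'a::alg_closed_field set" and \<sigma> d b \<gamma> r W \<phi> m c \<omega> s +
  fixes h :: "(nat \<Rightarrow> nat \<Rightarrow> nat \<Rightarrow> 'a) \<Rightarrow> nat \<Rightarrow> nat \<Rightarrow> nat \<Rightarrow> 'a"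
  assumes h_closed: "N \<in> carrier A.RM \<Longrightarrow> h N \<in> carrier B.RM"
    and h_mult: "N \<in> carrier A.RM \<Longrightarrow> N' \<in> carrier A.RM \<Longrightarrow> h (N \<otimes>\<^bsub>A.RM\<^esub> N') = h N \<otimes>\<^bsub>B.RM\<^esub> h N'"
    and h_add: "N \<in> carrier A.RM \<Longrightarrow> N' \<in> carrier A.RM \<Longrightarrow> h (N + N') = h N + h N'"
    and h_smult: "a \<in> K \<Longrightarrow> N \<in> carrier A.RM \<Longrightarrow> h (a \<odot>\<^bsub>A.RM\<^esub> N) = a \<odot>\<^bsub>B.RM\<^esub> h N"
    and h_inj: "N \<in> carrier A.RM \<Longrightarrow> h N = 0 \<Longrightarrow> N = 0"
begin

abbreviation hact where "hact x N \<equiv> B.vact x (h N)"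

lemma hact_mult: "N \<in> carrier A.RM \<Longrightarrow> N' \<in> carrier A.RM \<Longrightarrow> hact (hact x N) N' = hact x (N \<otimes>\<^bsub>A.RM\<^esub> N')"
  by (simp add: h_mult B.vact_assoc h_closed)

lemma hact_add: "N \<in> carrier A.RM \<Longrightarrow> N' \<in> carrier A.RM \<Longrightarrow> hact x (N + N') = hact x N + hact x N'"
  by (simp only: h_add B.vact_add_right h_closed)

lemma hact_smult: "a \<in> K \<Longrightarrow> N \<in> carrier A.RM \<Longrightarrow> hact x (a \<odot>\<^bsub>A.RM\<^esub> N) = vscale a (hact x N)"
  by (simp only: h_smult B.vact_smult_right h_closed)

lemma hact_zero: "hact x 0 = 0"
proof -
  have "0 \<in> carrier A.RM" by (simp add: A.carrier_RM)
  from hact_add[OF this this, of x] show ?thesis by (simp only: add_0_left add_cancel_right_right)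
qed

lemma hact_left_add: "hact (x + y) N = hact x N + hact y N"
  by (rule B.vact_add_left)

lemma hact_left_scale: "hact (vscale a x) N = vscale a (hact x N)"
  by (rule B.vact_scale_left)

text \<open>For \<open>l = 1\<close> the condition says that the idempotent \<open>mon 0 1\<close>
  fixes \<open>x\<close>; this cuts the eigenspaces down from whole isotypic parts to lines.\<close>

definition eigs :: "nat \<Rightarrow> (nat \<Rightarrow> nat \<Rightarrow> 'a) set"
  where "eigs i = {x \<in> B.V. \<forall>l\<in>E. hact x (A.mon 0 l) = vscale ((\<sigma> ^^ i) l) x}"

definition Y :: "(nat \<Rightarrow> nat \<Rightarrow> 'a) \<Rightarrow> nat \<Rightarrow> nat \<Rightarrow> 'a"
  where "Y x = hact x (A.mon 1 1)"

lemma mon_shift: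
  assumes "l \<in> E" shows "A.mon i 1 \<otimes>\<^bsub>A.RM\<^esub> A.mon 0 l = A.mon 0 ((\<sigma> ^^ i) l) \<otimes>\<^bsub>A.RM\<^esub> A.mon i 1"
  using assms by (simp add: A.mon_mult A.funpow_closed)

lemma Y_eigs: "x \<in> eigs i \<Longrightarrow> Y x \<in> eigs (Suc i)"
proof -
  assume x: "x \<in> eigs i"
  have "hact (Y x) (A.mon 0 l) = vscale ((\<sigma> ^^ Suc i) l) (Y x)" if l: "l \<in> E" for l
  proof -
    have "hact (Y x) (A.mon 0 l) = hact x (A.mon 1 1 \<otimes>\<^bsub>A.RM\<^esub> A.mon 0 l)"
      unfolding Y_def using l by (intro hact_mult A.mon_carrier) auto
    also have "\<dots> = hact (hact x (A.mon 0 (\<sigma> l))) (A.mon 1 1)"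
      using l mon_shift[OF l, of 1] by (subst hact_mult) (auto intro: A.mon_carrier A.endo_closed)
    also have "hact x (A.mon 0 (\<sigma> l)) = vscale ((\<sigma> ^^ i) (\<sigma> l)) x"
      using x A.endo_closed[OF l] by (auto simp: eigs_def)
    finally show ?thesis by (simp add: hact_left_scale Y_def funpow_swap1)
  qed
  then show ?thesis by (auto simp: eigs_def Y_def B.vact_V)
qed

lemma Y_power: "x \<in> eigs i \<Longrightarrow> (Y ^^ k) x = hact x (A.mon k 1)"
proof (induction k)
  case 0
  then have "hact x (A.mon 0 1) = vscale ((\<sigma> ^^ i) 1) x" by (auto simp: eigs_def)
  then show ?case using fld_endo.endo_one[OF A.fld_endo_funpow] by (simp add: vscale_simps)
next
  case (Suc k)
  then have "(Y ^^ Suc k) x = hact (hact x (A.mon k 1)) (A.mon 1 1)"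
    by (simp only: funpow.simps comp_apply Y_def[of "hact x (A.mon k 1)"])
  also have "\<dots> = hact x (A.mon (Suc k) 1)"
    using fld_endo.endo_one[OF A.fld_endo_funpow, of k]
    by (subst hact_mult) (auto intro: A.mon_carrier simp: A.mon_mult)
  finally show ?case .
qed

lemma Y_power_eigs: "x \<in> eigs i \<Longrightarrow> (Y ^^ k) x \<in> eigs (i + k)"
  by (induction k) (auto simp: Y_eigs)

lemma eigs_mod: "eigs (i + d) = eigs i"
  by (auto simp: eigs_def funpow_add A.order_d)

lemma Y_order: "x \<in> eigs i \<Longrightarrow> (Y ^^ d) x = vscale b x"
proof -
  assume x: "x \<in> eigs i"
  have "A.mon d 1 = A.mon 0 b" using A.mon_order[of 0 1] by simp
  then have "(Y ^^ d) x = hact x (A.mon 0 b)" using Y_power[OF x, of d] by simp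
  also have "\<dots> = vscale ((\<sigma> ^^ i) b) x" using x A.b_in A.K_subset by (auto simp: eigs_def)
  finally show ?thesis by (simp add: A.funpow_fix_K A.b_in)
qed

lemma Y_scale: "Y (vscale a x) = vscale a (Y x)"
  by (simp add: Y_def hact_left_scale)

lemma Y_power_scale: "(Y ^^ k) (vscale a x) = vscale a ((Y ^^ k) x)"
  by (induction k) (auto simp: Y_scale)

lemma Y_order_mult: "x \<in> eigs i \<Longrightarrow> (Y ^^ (d * k)) x = vscale (b ^ k) x"
proof (induction k)
  case (Suc k)
  have "(Y ^^ (d * Suc k)) x = (Y ^^ d) ((Y ^^ (d * k)) x)" by (simp add: funpow_add)
  also have "\<dots> = vscale (b ^ k) ((Y ^^ d) x)" unfolding Suc.IH[OF Suc.prems] by (rule Y_power_scale)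
  also have "\<dots> = vscale (b ^ Suc k) x" unfolding Y_order[OF Suc.prems] by (simp add: vscale_simps ac_simps)
  finally show ?case .
qed (simp add: vscale_simps)

lemma Y_power_nz:
  assumes "x \<in> eigs i" "x \<noteq> 0" shows "(Y ^^ k) x \<noteq> 0"
proof
  assume z: "(Y ^^ k) x = 0"
  have Y0: "(Y ^^ n) 0 = 0" for n using Y_power_scale[of n 0 0] by (simp only: vscale_simps)
  have "d * k = (d * k - k) + k" using A.d_pos by (simp add: Suc_leI)
  then have "(Y ^^ (d * k)) x = (Y ^^ (d * k - k)) ((Y ^^ k) x)"
    by (metis comp_apply funpow_add)
  then have "vscale (b ^ k) x = 0" unfolding z Y0 Y_order_mult[OF assms(1)] .
  then show False using A.b_nz assms(2) by (simp add: vscale_eq_0_iff)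
qed

text \<open>The linear extension of \<open>u \<mapsto> hact x (A.Row u)\<close> from the basis
  vectors to all of \<open>A.V\<close>. For \<open>x\<close> in \<open>eigs 0\<close> it is the
  intertwiner of the two row modules that sends \<open>A.bas 0 0 1\<close> to
  \<open>x\<close>.\<close>

definition P :: "(nat \<Rightarrow> nat \<Rightarrow> 'a) \<Rightarrow> (nat \<Rightarrow> nat \<Rightarrow> 'a) \<Rightarrow> nat \<Rightarrow> nat \<Rightarrow> 'a"
  where "P x u = (\<Sum>\<kappa><r. \<Sum>j<d. vscale (u \<kappa> j) (hact x (A.Row (A.bas \<kappa> j 1))))"

lemma P_add: "P x (u + v) = P x u + P x v"
  by (simp only: P_def plus_fun_apply vscale_simps sum.distrib)

lemma P_scale: "P x (vscale a u) = vscale a (P x u)"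
  by (simp only: P_def vscale_sum vscale_simps) (simp add: vscale_def mult.assoc)

lemma P_V: "P x u \<in> B.V"
  unfolding P_def by (intro B.V_sum B.V_scale B.vact_V)

lemma VE_sum: "(\<And>i. i \<in> I \<Longrightarrow> f i \<in> A.VE) \<Longrightarrow> sum f I \<in> A.VE"
proof (induction I rule: infinite_finite_induct)
  case (insert i I)
  then have "f i \<in> A.VE" "sum f I \<in> A.VE" by auto
  then have "f i + sum f I \<in> A.VE" by (auto simp: A.VE_def A.V_def A.add_closed)
  then show ?case by (simp only: sum.insert insert not_False_eq_True)
qed (auto simp: A.VE_def A.V_def)

text \<open>Left multiplication of a row by \<open>l\<close> is multiplication by
  \<open>mon 0 l\<close>, which acts on \<open>x\<close> as the scalar \<open>l\<close>. Hence
  \<open>u \<mapsto> hact x (A.Row u)\<close> is already linear over \<open>E\<close> and agrees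
  with its linear extension.\<close>

lemma P_Row:
  assumes x: "x \<in> eigs 0" and u: "u \<in> A.VE"
  shows "hact x (A.Row u) = P x u"
proof -
  have "A.Row 0 = 0" by (auto simp: A.Row_def fun_eq_iff)
  then have z: "hact x (A.Row 0) = 0" by (simp only: hact_zero)
  have add: "hact x (A.Row (v + w)) = hact x (A.Row v) + hact x (A.Row w)" if "v \<in> A.VE" "w \<in> A.VE" for v w
    using that by (simp only: A.Row_add hact_add A.Row_carrier)
  have sum: "hact x (A.Row (sum f I)) = (\<Sum>i\<in>I. hact x (A.Row (f i)))" if "\<And>i. i \<in> I \<Longrightarrow> f i \<in> A.VE"
    for f and I :: "nat set"
    using that
  proof (induction I rule: infinite_finite_induct)
    case (insert i I)
    then have "f i \<in> A.VE" "sum f I \<in> A.VE" by (auto intro: VE_sum)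
    then show ?case using insert by (simp only: sum.insert add insert_iff simp_thms not_False_eq_True)
  qed (simp_all only: z sum.infinite sum.empty not_False_eq_True)
  have uE: "u \<kappa> j \<in> E" for \<kappa> j using u by (auto simp: A.VE_def)
  have "hact x (A.Row u) = hact x (A.Row (\<Sum>\<kappa><r. \<Sum>j<d. A.bas \<kappa> j (u \<kappa> j)))"
    using A.sum_bas[of u] u by (simp add: A.VE_def)
  also have "\<dots> = (\<Sum>\<kappa><r. hact x (A.Row (\<Sum>j<d. A.bas \<kappa> j (u \<kappa> j))))"
    by (intro sum VE_sum A.bas_VE) (auto simp: uE)
  also have "\<dots> = (\<Sum>\<kappa><r. \<Sum>j<d. hact x (A.Row (A.bas \<kappa> j (u \<kappa> j))))"
    by (intro sum.cong[OF refl] sum VE_sum A.bas_VE) (auto simp: uE)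
  also have "\<dots> = P x u"
    unfolding P_def
  proof (intro sum.cong refl)
    fix \<kappa> j assume *: "\<kappa> \<in> {..<r}" "j \<in> {..<d}"
    have b: "A.bas \<kappa> j 1 \<in> A.VE" using * by (intro A.bas_VE) auto
    have "A.bas \<kappa> j (u \<kappa> j) = vscale (u \<kappa> j) (A.bas \<kappa> j 1)" by (simp add: A.vscale_bas)
    then have "hact x (A.Row (A.bas \<kappa> j (u \<kappa> j))) = hact (hact x (A.mon 0 (u \<kappa> j))) (A.Row (A.bas \<kappa> j 1))"
      using A.mon_row_mult[OF uE b] by (simp add: hact_mult A.mon_carrier uE A.Row_carrier b)
    also have "hact x (A.mon 0 (u \<kappa> j)) = vscale (u \<kappa> j) x" using x uE by (auto simp: eigs_def)
    finally show "hact x (A.Row (A.bas \<kappa> j (u \<kappa> j))) = vscale (u \<kappa> j) (hact x (A.Row (A.bas \<kappa> j 1)))"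
      by (simp add: hact_left_scale)
  qed
  finally show ?thesis .
qed

lemma P_intertwines:
  assumes x: "x \<in> eigs 0" and u: "u \<in> A.V" and N: "N \<in> carrier A.RM"
  shows "P x (A.vact u N) = hact (P x u) N"
proof (rule A.linear_ext[where F = "\<lambda>u. P x (A.vact u N)" and G = "\<lambda>u. hact (P x u) N", OF _ _ _ _ _ u])
  fix \<kappa> j assume "\<kappa> < r" "j < d"
  then have b: "A.bas \<kappa> j 1 \<in> A.VE" by (intro A.bas_VE) auto
  have "P x (A.vact (A.bas \<kappa> j 1) N) = hact x (A.Row (A.vact (A.bas \<kappa> j 1) N))"
    using P_Row[OF x A.vact_VE[OF b N]] by simp
  also have "\<dots> = hact (hact x (A.Row (A.bas \<kappa> j 1))) N"
    using b N by (simp add: hact_mult A.Row_mult A.Row_carrier)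
  finally show "P x (A.vact (A.bas \<kappa> j 1) N) = hact (P x (A.bas \<kappa> j 1)) N"
    by (simp add: P_Row[OF x b])
qed (simp_all only: A.vact_add_left A.vact_scale_left hact_left_add hact_left_scale P_add P_scale)

lemma P_bas: "x \<in> eigs 0 \<Longrightarrow> P x (A.bas 0 0 1) = x"
proof -
  assume x: "x \<in> eigs 0"
  have "P x (A.bas 0 0 1) = hact x (A.Row (A.bas 0 0 1))"
    using A.r_pos A.d_pos by (intro P_Row[OF x, symmetric] A.bas_VE) auto
  also have "\<dots> = hact x (A.mon 0 1)" by (simp add: A.mon_def)
  also have "\<dots> = x" using x by (auto simp: eigs_def vscale_simps)
  finally show ?thesis .
qed

lemma hact_values:
  assumes M: "subfld M" "W \<subseteq> M" and x: "\<And>\<kappa> j. x \<kappa> j \<in> M" and N: "N \<in> carrier A.RM"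
  shows "hact x N \<kappa> j \<in> M"
proof -
  interpret M: subfld M by fact
  have s: "(\<Sum>\<kappa>\<in>I. f \<kappa>) j \<in> M" if "\<And>\<kappa>. f \<kappa> j \<in> M" for f :: "nat \<Rightarrow> nat \<Rightarrow> 'a" and I
    using that by (induction I rule: infinite_finite_induct) (auto intro: M.add_closed)
  have e: "(\<phi> ^^ i) (h N \<kappa> \<kappa>' k) \<in> M" for i \<kappa> \<kappa>' k
    using B.A_entry[OF B.RM_entry[OF h_closed[OF N]]] B.funpow_closed M by blast
  have bM: "c ^ n \<in> M" for n using B.b_power_E M by auto
  have "B.act (x \<kappa>) (h N \<kappa> \<kappa>') j \<in> M" for \<kappa> \<kappa>'
    unfolding B.act_def using x e bM by (auto intro!: M.sum_closed M.mult_closed)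
  then show ?thesis unfolding B.vact_def using s by (cases "\<kappa> < s") auto
qed

text \<open>A vector fixed by the idempotent \<open>e = mon 0 1\<close>: the subalgebra \<open>eRe\<close> contains a copy of
  \<open>E = K[\<gamma>]\<close>, so that \<open>\<gamma>\<close> acts with eigenvalues among its conjugates.\<close>

lemma hact_poly:
  assumes e: "hact x (A.mon 0 1) = x" and p: "p \<in> polys_over K" "Polynomial.degree p \<le> n"
  shows "hact x (A.mon 0 (poly p \<gamma>)) =
    (\<Sum>k\<le>n. vscale (Polynomial.coeff p k) (((\<lambda>y. hact y (A.mon 0 \<gamma>)) ^^ k) x))"
proof -
  let ?a = "\<lambda>y. hact y (A.mon 0 \<gamma>)"
  have pw: "(?a ^^ k) x = hact x (A.mon 0 (\<gamma> ^ k))" for k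
  proof (induction k)
    case (Suc k)
    then show ?case
      by (simp add: hact_mult A.mon_carrier A.power_closed A.\<gamma>_in A.mon_mult mult.commute)
  qed (simp add: e)
  have cK: "Polynomial.coeff p k \<in> K" for k using p by (auto simp: polys_over_def)
  have cE: "Polynomial.coeff p k \<in> E" for k using cK A.K_subset by auto
  have sum: "hact x (A.mon 0 (\<Sum>k\<in>I. f k)) = (\<Sum>k\<in>I. hact x (A.mon 0 (f k)))" if "\<And>k. f k \<in> E"
    for f and I :: "nat set"
  proof (induction I rule: infinite_finite_induct)
    case (insert i I)
    then show ?case
      using that by (simp only: sum.insert A.mon_add hact_add A.mon_carrier A.sum_closed not_False_eq_True)
  qed (simp_all only: A.mon_zero hact_zero sum.infinite sum.empty not_False_eq_True)
  have "poly p \<gamma> = (\<Sum>k\<le>n. Polynomial.coeff p k * \<gamma> ^ k)"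
    unfolding poly_altdef using p by (intro sum.mono_neutral_left) (auto simp: Polynomial.coeff_eq_0)
  then have "hact x (A.mon 0 (poly p \<gamma>)) = (\<Sum>k\<le>n. hact x (A.mon 0 (Polynomial.coeff p k * \<gamma> ^ k)))"
    using sum[of "\<lambda>k. Polynomial.coeff p k * \<gamma> ^ k"] cE by (simp only: A.mult_closed A.power_closed A.\<gamma>_in simp_thms)
  also have "\<dots> = (\<Sum>k\<le>n. vscale (Polynomial.coeff p k) ((?a ^^ k) x))"
  proof (intro sum.cong refl)
    fix k
    have "A.mon 0 (Polynomial.coeff p k * \<gamma> ^ k) = Polynomial.coeff p k \<odot>\<^bsub>A.RM\<^esub> A.mon 0 (\<gamma> ^ k)"
      by (simp add: A.mon_smult A.power_closed A.\<gamma>_in)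
    then show "hact x (A.mon 0 (Polynomial.coeff p k * \<gamma> ^ k)) = vscale (Polynomial.coeff p k) ((?a ^^ k) x)"
      by (simp add: hact_smult cK A.mon_carrier A.power_closed A.\<gamma>_in pw)
  qed
  finally show ?thesis .
qed

text \<open>The action of \<gamma> on the image of the idempotent is annihilated by the minimal
  polynomial, which splits into the conjugates of \<gamma>; so one of them is an eigenvalue. All
  constructions are rational over \<open>M\<close>, so the entries remain there.\<close>

lemma eigenvector_exists:
  assumes M: "subfld M" "W \<subseteq> M" "E \<subseteq> M"
  shows "\<exists>x\<in>eigs 0. x \<noteq> 0 \<and> (\<forall>\<kappa> j. x \<kappa> j \<in> M)"
proof -
  interpret M: subfld M by fact
  let ?e = "A.mon 0 1" and ?a = "\<lambda>y. hact y (A.mon 0 \<gamma>)"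
  have eC: "?e \<in> carrier A.RM" by (simp add: A.mon_carrier)
  have "h ?e \<noteq> 0" using h_inj[OF eC] A.mon_nz[of 1 0] by auto
  then obtain i where i: "h ?e i \<noteq> 0" by (auto simp: fun_eq_iff)
  have i_less: "i < s" using h_closed[OF eC] i by (auto simp: B.carrier_RM fun_eq_iff)
  \<comment> \<open>This is the nonzero row number \<open>i\<close> of the matrix
    \<open>h (A.mon 0 1)\<close>.\<close>
  define x1 where "x1 = hact (B.bas i 0 1) ?e"
  have x1M: "x1 \<kappa> j \<in> M" for \<kappa> j unfolding x1_def
    by (intro hact_values M eC) (auto simp: B.bas_def B.one_at_def)
  have x1V: "x1 \<in> B.V" unfolding x1_def by (rule B.vact_V)
  have x1nz: "x1 \<noteq> 0"
  proof -
    have "x1 \<kappa> = h ?e i \<kappa>" if \<kappa>: "\<kappa> < s" for \<kappa>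
    proof -
      have "x1 \<kappa> = (\<Sum>\<kappa>'<s. B.act (B.bas i 0 1 \<kappa>') (h ?e \<kappa>' \<kappa>))"
        using \<kappa> by (simp add: x1_def B.vact_def)
      also have "\<dots> = (\<Sum>\<kappa>'<s. if \<kappa>' = i then h ?e i \<kappa> else 0)"
        using B.act_one_at_0_left[OF B.RM_entry[OF h_closed[OF eC]], of 1]
        by (intro sum.cong refl) (auto simp: B.bas_def B.act_zero_left)
      finally show ?thesis using i_less by simp
    qed
    moreover obtain \<kappa> where "h ?e i \<kappa> \<noteq> 0" using i by (auto simp: fun_eq_iff)
    moreover have "\<kappa> < s" using calculation(2) h_closed[OF eC] by (auto simp: B.carrier_RM)
    ultimately show ?thesis by auto
  qed
  have x1e: "hact x1 ?e = x1" unfolding x1_def by (simp add: hact_mult eC A.mon_mult)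
  define q where "q n = (\<Prod>j<n. [:- (\<sigma> ^^ j) \<gamma>, 1:])" for n
  define z where "z n = (\<Sum>k\<le>d. vscale (Polynomial.coeff (q n) k) ((?a ^^ k) x1))" for n
  have dq: "Polynomial.degree (q n) = n" for n unfolding q_def by (subst degree_prod_eq_sum_degree) auto
  have a_lin: "?a (x + y) = ?a x + ?a y" "?a (vscale t x) = vscale t (?a x)" for x y t
    by (simp_all only: hact_left_add hact_left_scale)
  have a_sum: "?a (sum f I) = (\<Sum>i\<in>I. ?a (f i))" for f and I :: "nat set"
  proof -
    have z: "?a 0 = 0" using a_lin(2)[of 0 0] by (simp only: vscale_simps)
    show ?thesis by (induction I rule: infinite_finite_induct)
        (simp_all only: z a_lin sum.infinite sum.empty sum.insert not_False_eq_True)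
  qed
  have zS: "z (Suc n) = ?a (z n) + vscale (- (\<sigma> ^^ n) \<gamma>) (z n)" if n: "n < d" for n
  proof -
    have "q (Suc n) = pCons 0 (q n) + Polynomial.smult (- (\<sigma> ^^ n) \<gamma>) (q n)"
      unfolding q_def by (simp add: mult.commute[of _ "[:_, _:]"])
    then have "z (Suc n) = (\<Sum>k\<le>d. vscale (Polynomial.coeff (pCons 0 (q n)) k) ((?a ^^ k) x1))
        + (\<Sum>k\<le>d. vscale (- (\<sigma> ^^ n) \<gamma>) (vscale (Polynomial.coeff (q n) k) ((?a ^^ k) x1)))"
      by (simp only: z_def Polynomial.coeff_add Polynomial.coeff_smult vscale_simps sum.distrib)
    also have "(\<Sum>k\<le>d. vscale (Polynomial.coeff (pCons 0 (q n)) k) ((?a ^^ k) x1))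
       = (\<Sum>k<d. vscale (Polynomial.coeff (q n) k) ((?a ^^ Suc k) x1))"
      unfolding lessThan_Suc_atMost[symmetric] sum.lessThan_Suc_shift
      by (simp only: coeff_pCons_0 coeff_pCons_Suc vscale_simps add_0_left)
    also have "\<dots> = (\<Sum>k\<le>d. vscale (Polynomial.coeff (q n) k) ((?a ^^ Suc k) x1))"
      using n dq[of n]
      by (simp only: lessThan_Suc_atMost[symmetric] sum.lessThan_Suc Polynomial.coeff_eq_0 vscale_simps add_0_right)
    also have "\<dots> = ?a (z n)" unfolding z_def a_sum by (simp only: a_lin funpow.simps comp_apply)
    finally show ?thesis by (simp only: z_def vscale_sum)
  qed
  have z0: "z 0 = x1"
  proof -
    have "z 0 = (\<Sum>k\<le>d. if k = 0 then x1 else 0)"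
      unfolding z_def q_def by (intro sum.cong refl) (auto simp: vscale_simps)
    then show ?thesis by simp
  qed
  have zd: "z d = 0"
  proof -
    have "q d \<in> polys_over K" unfolding q_def by (rule A.min_poly)
    then have "z d = hact x1 (A.mon 0 (poly (q d) \<gamma>))"
      unfolding z_def using hact_poly[OF x1e, of "q d" d] dq[of d] by simp
    also have "poly (q d) \<gamma> = 0" unfolding q_def poly_prod using A.d_pos
      by (auto intro!: prod_zero bexI[of _ 0])
    finally show ?thesis by (simp only: A.mon_zero hact_zero)
  qed
  \<comment> \<open>The factors of the minimal polynomial are applied one at a time; the last vector
    before zero is killed by the next factor, hence an eigenvector.\<close>
  define n where "n = (LEAST n. z n = 0)"
  have zn: "z n = 0" unfolding n_def by (rule LeastI[of _ d]) (rule zd)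
  have "n \<noteq> 0" using zn z0 x1nz by auto
  then obtain k where k: "n = Suc k" by (cases n) auto
  have zk: "z k \<noteq> 0" using k not_less_Least[of k "\<lambda>n. z n = 0"] unfolding n_def by auto
  have "n \<le> d" unfolding n_def by (rule Least_le) (rule zd)
  then have kd: "k < d" using k by simp
  define x where "x = z k"
  have ax: "?a x = vscale ((\<sigma> ^^ k) \<gamma>) x"
  proof -
    have "?a x + vscale (- (\<sigma> ^^ k) \<gamma>) x = 0" using zS[OF kd] zn k by (simp only: x_def)
    from fun_cong[OF fun_cong[OF this]]
    have "?a x \<kappa> j + - (\<sigma> ^^ k) \<gamma> * x \<kappa> j = 0" for \<kappa> j
      by (simp only: plus_fun_apply vscale_def zero_fun_apply)
    then show ?thesis by (auto simp: vscale_def fun_eq_iff)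
  qed
  have ap: "hact ((?a ^^ j) x1) ?e = (?a ^^ j) x1" for j
  proof (cases j)
    case (Suc i)
    then show ?thesis by (simp add: hact_mult eC A.mon_carrier A.\<gamma>_in A.mon_mult)
  qed (simp add: x1e)
  have xe: "hact x ?e = x"
  proof -
    have "hact (sum f I) ?e = (\<Sum>i\<in>I. hact (f i) ?e)" for f and I :: "nat set"
    proof -
      have z: "hact 0 ?e = 0" using hact_left_scale[of 0 0] by (simp only: vscale_simps)
      show ?thesis by (induction I rule: infinite_finite_induct)
        (simp_all only: z hact_left_add sum.infinite sum.empty sum.insert not_False_eq_True)
    qed
    then show ?thesis by (simp only: x_def z_def hact_left_scale ap)
  qed
  have xV: "x \<in> B.V"
  proof -
    have "(?a ^^ j) x1 \<in> B.V" for j by (cases j) (auto simp: x1V B.vact_V)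
    then show ?thesis unfolding x_def z_def by (intro B.V_sum B.V_scale)
  qed
  have aM: "(?a ^^ j) x1 \<kappa> i \<in> M" for j \<kappa> i
    by (induction j arbitrary: \<kappa> i) (auto intro!: x1M hact_values M A.mon_carrier A.\<gamma>_in)
  have xM: "x \<kappa> j \<in> M" for \<kappa> j
  proof -
    have s: "(\<Sum>i\<in>I. f i) a b = (\<Sum>i\<in>I. f i a b)" for f :: "nat \<Rightarrow> nat \<Rightarrow> nat \<Rightarrow> 'a" and I a b
      by (induction I rule: infinite_finite_induct) auto
    have "q k \<in> polys_over E" unfolding q_def
      by (intro A.polys_prod A.polys_pCons) (auto intro: A.uminus_closed A.funpow_closed A.\<gamma>_in)
    then have "Polynomial.coeff (q k) i \<in> M" for i using M by (auto simp: polys_over_def)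
    then show ?thesis unfolding x_def z_def s vscale_def by (intro M.sum_closed M.mult_closed aM)
  qed
  have ak: "(?a ^^ j) x = vscale ((\<sigma> ^^ k) \<gamma> ^ j) x" for j
    by (induction j) (simp_all add: vscale_simps ax hact_left_scale mult.commute)
  have "hact x (A.mon 0 l) = vscale ((\<sigma> ^^ k) l) x" if l: "l \<in> E" for l
  proof -
    obtain p where p: "p \<in> polys_over K" "Polynomial.degree p < d" "\<And>j. (\<sigma> ^^ j) l = poly p ((\<sigma> ^^ j) \<gamma>)"
      using A.generated[OF l] by blast
    have "hact x (A.mon 0 l) = (\<Sum>i\<le>d. vscale (Polynomial.coeff p i) ((?a ^^ i) x))"
      using hact_poly[OF xe p(1), of d] p(2) p(3)[of 0] by simp
    also have "\<dots> = vscale (\<Sum>i\<le>d. Polynomial.coeff p i * (\<sigma> ^^ k) \<gamma> ^ i) x"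
    proof -
      have s: "(\<Sum>i\<in>I. f i) a b = (\<Sum>i\<in>I. f i a b)" for f :: "nat \<Rightarrow> nat \<Rightarrow> nat \<Rightarrow> 'a" and I a b
        by (induction I rule: infinite_finite_induct) auto
      show ?thesis by (intro ext) (simp only: s ak vscale_simps vscale_def sum_distrib_right mult.assoc)
    qed
    also have "(\<Sum>i\<le>d. Polynomial.coeff p i * (\<sigma> ^^ k) \<gamma> ^ i) = poly p ((\<sigma> ^^ k) \<gamma>)"
      unfolding poly_altdef using p(2) by (intro sum.mono_neutral_right) (auto simp: Polynomial.coeff_eq_0)
    finally show ?thesis by (simp add: p(3))
  qed
  then have xk: "x \<in> eigs k" using xV by (auto simp: eigs_def)
  \<comment> \<open>The eigenvalue found is some conjugate of \<gamma>; the generator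
    \<open>y\<close> rotates it back to index 0, which is the same as index
    \<open>d\<close>.\<close>
  define y where "y = (Y ^^ (d - k)) x"
  have "y \<in> eigs (k + (d - k))" unfolding y_def by (rule Y_power_eigs[OF xk])
  then have "y \<in> eigs 0" using kd eigs_mod[of 0] by simp
  moreover have "y \<noteq> 0" unfolding y_def by (rule Y_power_nz[OF xk]) (use zk in \<open>simp add: x_def\<close>)
  moreover have "y \<kappa> j \<in> M" for \<kappa> j
    unfolding y_def Y_power[OF xk] by (intro hact_values M xM A.mon_carrier) simp
  ultimately show ?thesis by blast
qed

end

locale csa_iso = csa_hom +
  assumes h_surj: "h ` carrier A.RM = carrier B.RM"
    and h_inj_on: "inj_on h (carrier A.RM)"
begin

definition h' where "h' = inv_into (carrier A.RM) h"

lemma h'_h: "N \<in> carrier A.RM \<Longrightarrow> h' (h N) = N"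
  unfolding h'_def using h_inj_on by (rule inv_into_f_f)

lemma h_h': "N \<in> carrier B.RM \<Longrightarrow> h (h' N) = N"
  unfolding h'_def using h_surj by (simp add: f_inv_into_f)

lemma h'_closed: "N \<in> carrier B.RM \<Longrightarrow> h' N \<in> carrier A.RM"
  unfolding h'_def using h_surj by (simp add: inv_into_into)

sublocale inverse: csa_hom K W \<phi> m c \<omega> s E \<sigma> d b \<gamma> r h'
proof
  fix N N' assume N: "N \<in> carrier B.RM" "N' \<in> carrier B.RM"
  show "h' (N \<otimes>\<^bsub>B.RM\<^esub> N') = h' N \<otimes>\<^bsub>A.RM\<^esub> h' N'"
    using h'_h[OF A.RM_mult_closed[OF h'_closed[OF N(1)] h'_closed[OF N(2)]]]
    by (simp add: h_mult h'_closed N h_h')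
  show "h' (N + N') = h' N + h' N'"
    using h'_h[OF A.RM_add_closed[OF h'_closed[OF N(1)] h'_closed[OF N(2)]]]
    by (simp only: h_add h'_closed N h_h')
next
  fix N a assume N: "N \<in> carrier B.RM" and a: "a \<in> K"
  have "a \<odot>\<^bsub>A.RM\<^esub> h' N \<in> carrier A.RM"
    using h'_closed[OF N] a A.K_subset unfolding A.smult_RM[OF h'_closed[OF N]]
    by (auto simp: A.carrier_RM A.carrier_A vscale_def fun_eq_iff intro!: A.mult_closed)
  from h'_h[OF this] show "h' (a \<odot>\<^bsub>B.RM\<^esub> N) = a \<odot>\<^bsub>A.RM\<^esub> h' N"
    by (simp add: h_smult h'_closed N a h_h')
next
  fix N assume "N \<in> carrier B.RM" "h' N = 0"
  then have "N = h 0" using h_h' by metis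
  moreover have "h 0 = 0"
  proof -
    have z: "0 \<in> carrier A.RM" by (simp add: A.carrier_RM)
    from h_add[OF z z] show ?thesis by (simp only: add_0_left add_cancel_right_right)
  qed
  ultimately show "N = 0" by simp
qed (rule h'_closed)

text \<open>Both simple modules are isomorphic, so Schur's lemma makes the eigenspaces one-dimensional.\<close>

lemma eigs_dim:
  assumes x: "x \<in> eigs 0" "x \<noteq> 0" and y: "y \<in> eigs 0"
  shows "\<exists>a. y = vscale a x"
proof -
  obtain w where w: "w \<in> inverse.eigs 0" "w \<noteq> 0"
    using inverse.eigenvector_exists[of UNIV] by (auto simp: subfld_def)
  let ?P = "inverse.P w"
  \<comment> \<open>The intertwiner \<open>?P\<close> goes back to the rows over the first algebra,
    where eigenvectors are known explicitly by \<open>A.schur\<close>.\<close>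
  have cc: "\<exists>a. ?P u = vscale a (A.bas 0 0 1)" if u: "u \<in> eigs 0" for u
  proof -
    have "A.vact (?P u) (A.mon 0 l) = vscale l (?P u)" if l: "l \<in> E" for l
    proof -
      have mc: "A.mon 0 l \<in> carrier A.RM" by (rule A.mon_carrier[OF l])
      have "A.vact (?P u) (A.mon 0 l) = A.vact (?P u) (h' (h (A.mon 0 l)))" by (simp add: h'_h mc)
      also have "\<dots> = ?P (hact u (A.mon 0 l))"
        using u by (intro inverse.P_intertwines[OF w(1), symmetric] h_closed mc) (simp add: eigs_def)
      also have "hact u (A.mon 0 l) = vscale l u" using u l by (simp add: eigs_def)
      finally show ?thesis by (simp add: inverse.P_scale)
    qed
    then show ?thesis using A.schur[OF inverse.P_V] by blast
  qed
  \<comment> \<open>The kernel is a submodule. By simplicity a nonzero one would contain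
    \<open>B.bas 0 0 1\<close>, whose image is \<open>w\<close>.\<close>
  have inj: "u = 0" if u: "u \<in> B.V" "?P u = 0" for u
  proof (rule ccontr)
    assume "u \<noteq> 0"
    have P0: "?P 0 = 0" using inverse.P_scale[of w 0 0] by (simp only: vscale_simps)
    have "B.bas 0 0 1 \<in> {u \<in> B.V. ?P u = 0}"
    proof (rule B.simple)
      fix x N assume "x \<in> {u \<in> B.V. ?P u = 0}" and N: "N \<in> carrier B.RM"
      then have "?P (B.vact x N) = A.vact 0 (h' N)"
        using inverse.P_intertwines[OF w(1) _ N, of x] by simp
      also have "\<dots> = 0" using A.vact_scale_left[of 0 0] by (simp only: vscale_simps)
      finally show "B.vact x N \<in> {u \<in> B.V. ?P u = 0}" by (simp add: B.vact_V)
    next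
      fix x y assume "x \<in> {u \<in> B.V. ?P u = 0}" "y \<in> {u \<in> B.V. ?P u = 0}"
      then have "x + y \<in> B.V" "?P (x + y) = 0 + 0" by (simp_all only: inverse.P_add B.V_add mem_Collect_eq)
      then show "x + y \<in> {u \<in> B.V. ?P u = 0}" by (simp only: mem_Collect_eq add_0_left simp_thms)
    next
      fix a x assume "x \<in> {u \<in> B.V. ?P u = 0}"
      then have "vscale a x \<in> B.V" "?P (vscale a x) = vscale a 0" by (simp_all only: inverse.P_scale B.V_scale mem_Collect_eq)
      then show "vscale a x \<in> {u \<in> B.V. ?P u = 0}" by (simp only: mem_Collect_eq vscale_simps simp_thms)
    qed (use u \<open>u \<noteq> 0\<close> in auto)
    then have "w = 0" using inverse.P_bas[OF w(1)] by simp
    then show False using w(2) by simp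
  qed
  obtain cx where cx: "?P x = vscale cx (A.bas 0 0 1)" using cc[OF x(1)] by blast
  obtain cy where cy: "?P y = vscale cy (A.bas 0 0 1)" using cc[OF y] by blast
  have V: "x \<in> B.V" "y \<in> B.V" using x y by (auto simp: eigs_def)
  have "cx \<noteq> 0"
  proof
    assume "cx = 0"
    then have "?P x = 0" unfolding cx by (simp only: vscale_simps)
    then show False using inj V x by auto
  qed
  let ?u = "y + vscale (- (cy / cx)) x"
  have "?P ?u = vscale (cy + (- (cy / cx)) * cx) (A.bas 0 0 1)"
    by (simp only: inverse.P_add inverse.P_scale cx cy vscale_simps)
  also have "\<dots> = 0" using \<open>cx \<noteq> 0\<close> by (simp add: vscale_simps)
  finally have "?u = 0" using inj[of ?u] V by (simp only: B.V_add B.V_scale simp_thms)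
  from fun_cong[OF fun_cong[OF this]]
  have "y \<kappa> j + - (cy / cx) * x \<kappa> j = 0" for \<kappa> j
    by (simp only: plus_fun_apply vscale_def zero_fun_apply)
  then have "y = vscale (cy / cx) x" by (auto simp: vscale_def fun_eq_iff)
  then show ?thesis by blast
qed

end

section \<open>Semilinear operators on row vectors\<close>

context csa
begin

definition mo :: "nat \<Rightarrow> nat \<Rightarrow> 'a"
  where "mo n = one_at (n mod d) (b ^ (n div d))"

lemma mo_carrier: "mo n \<in> carrier A"
  unfolding mo_def using d_pos by (intro one_at_carrier b_power_E) auto

lemma mo_mult: "act (mo i) (mo j) = mo (i + j)"
proof -
  have "act (mo i) (mo j) = one_at ((i mod d + j mod d) mod d)
      (b ^ (i div d) * (\<sigma> ^^ (i mod d)) (b ^ (j div d)) * b ^ ((i mod d + j mod d) div d))"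
    unfolding mo_def using d_pos by (intro act_one_at_one_at) auto
  also have "(i mod d + j mod d) mod d = (i + j) mod d" by (simp add: mod_add_eq)
  also have "b ^ (i div d) * (\<sigma> ^^ (i mod d)) (b ^ (j div d)) * b ^ ((i mod d + j mod d) div d) = b ^ ((i + j) div d)"
    unfolding funpow_fix_K[OF K.power_closed[OF b_in]] div_add1_eq[of i j d] power_add by (simp add: algebra_simps)
  finally show ?thesis by (simp add: mo_def)
qed

lemma act_mo_shift:
  assumes "g \<in> carrier A"
  shows "act (mo n) g = act (\<lambda>i. (\<sigma> ^^ n) (g i)) (mo n)"
proof
  fix k
  let ?n = "n mod d"
  have gn: "(\<sigma> ^^ ?n) (g j) = (\<sigma> ^^ n) (g j)" for j using A_entry[OF assms] by (rule funpow_mod)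
  have "act (mo n) g k = (if k < d then \<Sum>i<d. if i = ?n then \<Sum>j<d. if (?n + j) mod d = k then
     b ^ (n div d) * (\<sigma> ^^ n) (g j) * b ^ ((?n + j) div d) else 0 else 0 else 0)"
    unfolding gn[symmetric] mo_def by (simp only: act_def, intro if_cong[OF refl _ refl], intro sum.cong refl)
        (auto simp: one_at_def intro!: sum.neutral sum.cong)
  also have "\<dots> = (if k < d then \<Sum>j<d. if (j + ?n) mod d = k then
     (\<sigma> ^^ n) (g j) * (\<sigma> ^^ j) (b ^ (n div d)) * b ^ ((j + ?n) div d) else 0 else 0)"
    using d_pos by (auto intro!: sum.cong simp: add.commute mult.commute funpow_fix_K[OF K.power_closed[OF b_in]])
  also have "\<dots> = act (\<lambda>i. (\<sigma> ^^ n) (g i)) (mo n) k"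
    unfolding mo_def using d_pos by (subst act_one_at) auto
  finally show "act (mo n) g k = act (\<lambda>i. (\<sigma> ^^ n) (g i)) (mo n) k" .
qed

text \<open>The \<open>\<tau>\<close>-semilinear map \<open>x y\<^sup>i \<mapsto> \<tau>(x) y\<^bsup>i+n\<^esup>\<close>; it commutes with the right action of
  the matrix algebra if \<open>\<tau>\<close> restricts to \<open>\<sigma>\<^sup>n\<close>.\<close>

definition T :: "('a \<Rightarrow> 'a) \<Rightarrow> nat \<Rightarrow> (nat \<Rightarrow> nat \<Rightarrow> 'a) \<Rightarrow> nat \<Rightarrow> nat \<Rightarrow> 'a"
  where "T \<tau> n x = (\<lambda>\<kappa>. act (\<lambda>i. \<tau> (x \<kappa> i)) (mo n))"

text \<open>The automorphisms used below behave as such only on \<open>M\<close>, so semilinear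
  operators are applied to vectors with entries there.\<close>

definition VM :: "'a set \<Rightarrow> (nat \<Rightarrow> nat \<Rightarrow> 'a) set"
  where "VM M = {x \<in> V. \<forall>\<kappa> j. x \<kappa> j \<in> M}"

lemma act_values:
  assumes "subfld M" "E \<subseteq> M" "\<And>i. x i \<in> M" "g \<in> carrier A"
  shows "act x g k \<in> M"
proof -
  interpret M: subfld M by fact
  have "(\<sigma> ^^ i) (g j) \<in> M" "b ^ n \<in> M" for i j n
    using funpow_closed[OF A_entry[OF assms(4)]] b_power_E assms(2) by auto
  then show ?thesis unfolding act_def using assms(3) by (auto intro!: M.sum_closed M.mult_closed)
qed

lemma endo_act:
  assumes \<tau>: "fld_endo M \<tau>" "E \<subseteq> M" "\<And>w. w \<in> E \<Longrightarrow> \<tau> w = (\<sigma> ^^ n) w"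
    and x: "\<And>i. x i \<in> M" and g: "g \<in> carrier A"
  shows "\<tau> (act x g k) = act (\<lambda>i. \<tau> (x i)) (\<lambda>i. (\<sigma> ^^ n) (g i)) k"
proof -
  interpret \<tau>: fld_endo M \<tau> by fact
  have gE: "(\<sigma> ^^ i) (g j) \<in> E" for i j using funpow_closed[OF A_entry[OF g]] .
  have cl: "(if (i + j) mod d = k then x i * (\<sigma> ^^ i) (g j) * b ^ ((i + j) div d) else 0) \<in> M" for i j
    using x gE b_power_E \<tau>(2) by (auto intro!: \<tau>.mult_closed)
  have e: "\<tau> (if (i + j) mod d = k then x i * (\<sigma> ^^ i) (g j) * b ^ ((i + j) div d) else 0) =
    (if (i + j) mod d = k then \<tau> (x i) * (\<sigma> ^^ i) ((\<sigma> ^^ n) (g j)) * b ^ ((i + j) div d) else 0)" for i j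
  proof -
    have M1: "(\<sigma> ^^ i) (g j) \<in> M" "b ^ ((i + j) div d) \<in> M" using gE b_power_E \<tau>(2) by auto
    have "\<tau> ((\<sigma> ^^ i) (g j)) = (\<sigma> ^^ i) ((\<sigma> ^^ n) (g j))"
      unfolding \<tau>(3)[OF gE] by (metis add.commute comp_apply funpow_add)
    moreover have "\<tau> (b ^ ((i + j) div d)) = b ^ ((i + j) div d)"
      unfolding \<tau>(3)[OF b_power_E] by (rule funpow_fix_K[OF K.power_closed[OF b_in]])
    ultimately show ?thesis using x M1 by (simp add: \<tau>.endo_mult \<tau>.endo_zero \<tau>.mult_closed)
  qed
  show ?thesis
    by (cases "k < d") (simp_all only: act_def if_True if_False \<tau>.endo_sum \<tau>.sum_closed cl e \<tau>.endo_zero)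
qed

text \<open>Two twists cancel: \<tau> changes \<open>x g\<close> into
  \<open>\<tau>(x) \<sigma>^n(g)\<close>, and \<open>\<sigma>^n(g) y^n = y^n g\<close> restores the
  original right factor.\<close>

lemma T_vact:
  assumes \<tau>: "fld_endo M \<tau>" "E \<subseteq> M" "\<And>w. w \<in> E \<Longrightarrow> \<tau> w = (\<sigma> ^^ n) w"
    and x: "x \<in> VM M" and N: "N \<in> carrier RM"
  shows "T \<tau> n (vact x N) = vact (T \<tau> n x) N"
proof
  fix \<kappa>'
  interpret \<tau>: fld_endo M \<tau> by fact
  have M: "subfld M" by unfold_locales
  have xM: "x \<kappa> i \<in> M" for \<kappa> i using x by (auto simp: VM_def)
  note NA = RM_entry[OF N]
  have one: "act (\<lambda>k. \<tau> (act (x \<kappa>) (N \<kappa> \<kappa>') k)) (mo n) = act (act (\<lambda>i. \<tau> (x \<kappa> i)) (mo n)) (N \<kappa> \<kappa>')" for \<kappa>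
  proof -
    let ?g = "\<lambda>i. (\<sigma> ^^ n) (N \<kappa> \<kappa>' i)"
    have g: "?g \<in> carrier A" using NA[of \<kappa> \<kappa>'] fld_endo.endo_zero[OF fld_endo_funpow]
      by (auto simp: carrier_A funpow_closed)
    have "(\<lambda>k. \<tau> (act (x \<kappa>) (N \<kappa> \<kappa>') k)) = act (\<lambda>i. \<tau> (x \<kappa> i)) ?g"
      using endo_act[OF \<tau> xM NA] by auto
    then have "act (\<lambda>k. \<tau> (act (x \<kappa>) (N \<kappa> \<kappa>') k)) (mo n) = act (act (\<lambda>i. \<tau> (x \<kappa> i)) ?g) (mo n)" by simp
    also have "\<dots> = act (\<lambda>i. \<tau> (x \<kappa> i)) (act (mo n) (N \<kappa> \<kappa>'))"
      unfolding act_assoc[OF g mo_carrier] act_mo_shift[OF NA] ..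
    also have "\<dots> = act (act (\<lambda>i. \<tau> (x \<kappa> i)) (mo n)) (N \<kappa> \<kappa>')"
      by (rule act_assoc[OF mo_carrier NA, symmetric])
    finally show ?thesis .
  qed
  show "T \<tau> n (vact x N) \<kappa>' = vact (T \<tau> n x) N \<kappa>'"
  proof (cases "\<kappa>' < r")
    case True
    have s: "(\<Sum>\<kappa>\<in>I. f \<kappa>) j = (\<Sum>\<kappa>\<in>I. f \<kappa> j)" for f :: "nat \<Rightarrow> nat \<Rightarrow> 'a" and I j
      by (induction I rule: infinite_finite_induct) auto
    have av: "act (x \<kappa>) (N \<kappa> \<kappa>') k \<in> M" for \<kappa> k by (rule act_values[OF M \<tau>(2) xM NA])
    have "(\<lambda>k. \<tau> (vact x N \<kappa>' k)) = (\<Sum>\<kappa><r. (\<lambda>k. \<tau> (act (x \<kappa>) (N \<kappa> \<kappa>') k)))"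
      using True by (intro ext) (simp add: vact_def s \<tau>.endo_sum av)
    then have "T \<tau> n (vact x N) \<kappa>' = (\<Sum>\<kappa><r. act (\<lambda>k. \<tau> (act (x \<kappa>) (N \<kappa> \<kappa>') k)) (mo n))"
      by (simp only: T_def act_sum_left)
    then show ?thesis using True by (simp only: one vact_def T_def if_True)
  next
    case False
    have "(\<lambda>k. \<tau> (vact x N \<kappa>' k)) = 0" using False by (auto simp: vact_def \<tau>.endo_zero)
    then show ?thesis using False by (simp only: T_def vact_def act_zero_left if_False)
  qed
qed

lemma T_VM:
  assumes \<tau>: "fld_endo M \<tau>" "E \<subseteq> M" and x: "x \<in> VM M"
  shows "T \<tau> n x \<in> VM M"
proof -
  interpret \<tau>: fld_endo M \<tau> by fact
  have M: "subfld M" by unfold_locales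
  have xM: "x \<kappa> i \<in> M" for \<kappa> i using x by (auto simp: VM_def)
  have "T \<tau> n x \<kappa> j \<in> M" for \<kappa> j
    unfolding T_def by (intro act_values M \<tau>(2) mo_carrier \<tau>.endo_closed xM)
  moreover have "T \<tau> n x \<kappa> j = 0" if "\<not> (\<kappa> < r \<and> j < d)" for \<kappa> j
  proof (cases "\<kappa> < r")
    case False
    then have "(\<lambda>i. \<tau> (x \<kappa> i)) = 0" using x by (auto simp: VM_def V_def \<tau>.endo_zero)
    then show ?thesis by (simp only: T_def act_zero_left zero_fun_apply)
  qed (use that in \<open>simp add: T_def act_def\<close>)
  ultimately show ?thesis by (auto simp: VM_def V_def)
qed

lemma T_scale:
  assumes \<tau>: "fld_endo M \<tau>" and x: "x \<in> VM M" and a: "a \<in> M"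
  shows "T \<tau> n (vscale a x) = vscale (\<tau> a) (T \<tau> n x)"
proof -
  interpret \<tau>: fld_endo M \<tau> by fact
  have "\<tau> (a * x \<kappa> i) = \<tau> a * \<tau> (x \<kappa> i)" for \<kappa> i
    using x a by (auto simp: VM_def \<tau>.endo_mult)
  then show ?thesis by (simp add: T_def vscale_def act_scale_left)
qed

lemma T_comp:
  assumes \<tau>: "fld_endo M \<tau>" "E \<subseteq> M" "\<And>w. w \<in> E \<Longrightarrow> \<tau> w = (\<sigma> ^^ n) w"
    and \<tau>': "fld_endo M \<tau>'" and x: "x \<in> VM M"
  shows "T \<tau> n (T \<tau>' n' x) = T (\<tau> \<circ> \<tau>') (n' + n) x"
proof
  fix \<kappa>
  interpret \<tau>': fld_endo M \<tau>' by fact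
  have xM: "\<tau>' (x \<kappa> i) \<in> M" for i using x by (auto simp: VM_def intro!: \<tau>'.endo_closed)
  have "(\<sigma> ^^ n) (mo n' i) = mo n' i" for i
    using funpow_fix_K[OF K.power_closed[OF b_in], of n] funpow_fix_K[OF K.zero_closed, of n]
    by (auto simp: mo_def one_at_def)
  then have "\<tau> (act (\<lambda>i. \<tau>' (x \<kappa> i)) (mo n') k) = act (\<lambda>i. \<tau> (\<tau>' (x \<kappa> i))) (mo n') k" for k
    using endo_act[OF \<tau> xM mo_carrier] by simp
  then show "T \<tau> n (T \<tau>' n' x) \<kappa> = T (\<tau> \<circ> \<tau>') (n' + n) x \<kappa>"
    by (simp add: T_def act_assoc[OF mo_carrier mo_carrier] mo_mult)
qed

text \<open>Here \<open>y^(d * k)\<close> is the central scalar \<open>b^k\<close>, so that after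
  complete turns only the entrywise action of \<tau> remains.\<close>

lemma T_pure:
  assumes "x \<in> V" "fld_endo M \<tau>"
  shows "T \<tau> (d * k) x = vscale (b ^ k) (\<lambda>\<kappa> i. \<tau> (x \<kappa> i))"
proof (intro ext)
  fix \<kappa> i
  interpret \<tau>: fld_endo M \<tau> by fact
  have "mo (d * k) = one_at 0 (b ^ k)" using d_pos by (simp add: mo_def)
  moreover have "\<forall>i\<ge>d. \<tau> (x \<kappa> i) = 0" using assms(1) by (auto simp: V_def \<tau>.endo_zero)
  ultimately show "T \<tau> (d * k) x \<kappa> i = vscale (b ^ k) (\<lambda>\<kappa> i. \<tau> (x \<kappa> i)) \<kappa> i"
    using act_one_at_0[of "\<lambda>i. \<tau> (x \<kappa> i)" "b ^ k"] funpow_fix_K[OF K.power_closed[OF b_in]]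
    by (simp add: T_def vscale_def mult.commute)
qed

lemma T_cong: "x \<in> VM M \<Longrightarrow> (\<And>a. a \<in> M \<Longrightarrow> \<tau> a = \<tau>' a) \<Longrightarrow> T \<tau> n x = T \<tau>' n x"
  by (simp add: T_def VM_def)

lemma T_power:
  assumes \<tau>: "fld_endo M \<tau>" "E \<subseteq> M" "\<And>w. w \<in> E \<Longrightarrow> \<tau> w = (\<sigma> ^^ n) w"
    and x: "x \<in> VM M"
  shows "(T \<tau> n ^^ k) x = T (\<tau> ^^ k) (n * k) x"
proof (induction k)
  case 0
  interpret \<tau>: fld_endo M \<tau> by fact
  have "T (\<tau> ^^ 0) (d * 0) x = vscale (b ^ 0) (\<lambda>\<kappa> i. (\<tau> ^^ 0) (x \<kappa> i))"
    using x by (intro T_pure[OF _ \<tau>.fld_endo_funpow]) (auto simp: VM_def)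
  then show ?case by (simp add: vscale_simps id_def)
next
  case (Suc k)
  interpret \<tau>: fld_endo M \<tau> by fact
  show ?case using T_comp[OF \<tau> \<tau>.fld_endo_funpow x, of k "n * k"] Suc
    by (simp add: algebra_simps comp_def)
qed

end

section \<open>Scalars attached to automorphisms\<close>

context csa_iso
begin

text \<open>Multiplying by \<open>Y^((d - 1) * i)\<close> brings \<open>y\<close> to
  \<open>eigs 0\<close>; together with \<open>Y^i\<close> this makes the scalar \<open>b^i\<close>,
  which is divided out.\<close>

lemma eigs_dim_shift:
  assumes x: "x \<in> eigs 0" "x \<noteq> 0" and y: "y \<in> eigs i"
  shows "\<exists>a. y = vscale a ((Y ^^ i) x)"
proof -
  have "eigs (d * n) = eigs 0" for n
    by (induction n) (use eigs_mod[of "d * _"] in \<open>auto simp: add.commute\<close>)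
  moreover have di: "i + (d - 1) * i = d * i" using A.d_pos by (cases d) auto
  ultimately have "(Y ^^ ((d - 1) * i)) y \<in> eigs 0" using Y_power_eigs[OF y, of "(d - 1) * i"] by simp
  then obtain a where a: "(Y ^^ ((d - 1) * i)) y = vscale a x" using eigs_dim[OF x] by blast
  have "vscale (b ^ i) y = (Y ^^ (d * i)) y" by (rule Y_order_mult[OF y, symmetric])
  also have "\<dots> = (Y ^^ i) ((Y ^^ ((d - 1) * i)) y)" unfolding di[symmetric] by (simp add: funpow_add)
  also have "\<dots> = vscale a ((Y ^^ i) x)" unfolding a by (rule Y_power_scale)
  finally have "vscale (inverse (b ^ i)) (vscale (b ^ i) y) = vscale (inverse (b ^ i)) (vscale a ((Y ^^ i) x))" by simp
  then show ?thesis using A.b_nz by (auto simp: vscale_simps)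
qed

text \<open>The operator commutes with the matrices over the second algebra, hence with
  \<open>hact\<close>, and its semilinearity turns the eigenvalue \<open>l\<close> into
  \<open>\<tau> l\<close>. The scalar is a quotient of two entries from \<open>M\<close>.\<close>

lemma semilinear_scalar:
  assumes M: "W \<subseteq> M" "E \<subseteq> M" and \<tau>: "fld_endo M \<tau>" "\<And>w. w \<in> W \<Longrightarrow> \<tau> w = (\<phi> ^^ n) w"
      "\<And>l. l \<in> E \<Longrightarrow> \<tau> l = (\<sigma> ^^ i) l"
    and x: "x \<in> eigs 0" "x \<noteq> 0" "x \<in> B.VM M"
  shows "\<exists>a\<in>M. B.T \<tau> n x = vscale a ((Y ^^ i) x)"
proof -
  interpret \<tau>: fld_endo M \<tau> by fact
  have Msub: "subfld M" by unfold_locales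
  have TM: "B.T \<tau> n x \<in> B.VM M" using B.T_VM[OF \<tau>(1) M(1) x(3)] .
  have "hact (B.T \<tau> n x) (A.mon 0 l) = vscale ((\<sigma> ^^ i) l) (B.T \<tau> n x)" if l: "l \<in> E" for l
  proof -
    have "hact (B.T \<tau> n x) (A.mon 0 l) = B.T \<tau> n (hact x (A.mon 0 l))"
      by (rule B.T_vact[OF \<tau>(1) M(1) \<tau>(2) x(3) h_closed[OF A.mon_carrier[OF l]], symmetric])
    also have "hact x (A.mon 0 l) = vscale l x" using x l by (auto simp: eigs_def)
    also have "B.T \<tau> n (vscale l x) = vscale (\<tau> l) (B.T \<tau> n x)"
      using l M by (intro B.T_scale[OF \<tau>(1) x(3)]) auto
    finally show ?thesis by (simp add: \<tau>(3) l)
  qed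
  then have "B.T \<tau> n x \<in> eigs i" using TM by (auto simp: eigs_def B.VM_def)
  then obtain a where a: "B.T \<tau> n x = vscale a ((Y ^^ i) x)" using eigs_dim_shift[OF x(1,2)] by blast
  have "(Y ^^ i) x \<noteq> 0" by (rule Y_power_nz[OF x(1,2)])
  then obtain \<kappa> j where nz: "(Y ^^ i) x \<kappa> j \<noteq> 0" by (auto simp: fun_eq_iff)
  have "(Y ^^ i) x \<kappa> j \<in> M" unfolding Y_power[OF x(1)]
    using x(3) by (intro hact_values Msub M A.mon_carrier) (auto simp: B.VM_def)
  moreover have "B.T \<tau> n x \<kappa> j \<in> M" using TM by (auto simp: B.VM_def)
  moreover have "a = B.T \<tau> n x \<kappa> j / (Y ^^ i) x \<kappa> j" using nz by (simp add: a vscale_def)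
  ultimately have "a \<in> M" by (simp add: \<tau>.divide_closed)
  then show ?thesis using a by blast
qed

lemma Y_VM: "subfld M \<Longrightarrow> W \<subseteq> M \<Longrightarrow> x \<in> B.VM M \<Longrightarrow> (Y ^^ k) x \<in> B.VM M"
proof (induction k)
  case (Suc k)
  have "hact ((Y ^^ k) x) (A.mon 1 1) \<kappa> j \<in> M" for \<kappa> j
    using Suc by (intro hact_values A.mon_carrier) (auto simp: B.VM_def)
  then have "hact ((Y ^^ k) x) (A.mon 1 1) \<in> B.VM M" by (simp only: B.VM_def B.vact_V mem_Collect_eq simp_thms)
  then show ?case by (simp only: funpow.simps comp_apply Y_def[of "(Y ^^ k) x"])
qed simp

lemma T_Y:
  assumes M: "W \<subseteq> M" and \<tau>: "fld_endo M \<tau>" "\<And>w. w \<in> W \<Longrightarrow> \<tau> w = (\<phi> ^^ n) w"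
    and x: "x \<in> B.VM M"
  shows "B.T \<tau> n ((Y ^^ k) x) = (Y ^^ k) (B.T \<tau> n x)"
proof (induction k)
  case (Suc k)
  interpret \<tau>: fld_endo M \<tau> by fact
  have Msub: "subfld M" by unfold_locales
  have "B.T \<tau> n (Y ((Y ^^ k) x)) = Y (B.T \<tau> n ((Y ^^ k) x))"
    unfolding Y_def[of "(Y ^^ k) x"] Y_def[of "B.T _ _ _"]
    by (rule B.T_vact[OF \<tau>(1) M \<tau>(2) Y_VM[OF Msub M x] h_closed[OF A.mon_carrier[OF A.one_closed]]])
  then show ?case by (simp add: Suc)
qed simp

text \<open>As the operator is \<tau>-semilinear and commutes with \<open>Y\<close>, each iteration
  conjugates the scalar collected so far; a norm results.\<close>

lemma T_iterate:
  assumes M: "W \<subseteq> M" and \<tau>: "fld_endo M \<tau>" "\<And>w. w \<in> W \<Longrightarrow> \<tau> w = (\<phi> ^^ n) w"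
    and x: "x \<in> B.VM M" and a: "a \<in> M" "B.T \<tau> n x = vscale a ((Y ^^ i) x)"
  shows "(B.T \<tau> n ^^ k) x = vscale (\<Prod>j<k. (\<tau> ^^ j) a) ((Y ^^ (k * i)) x)"
proof (induction k)
  case 0
  show ?case by (simp add: vscale_simps)
next
  case (Suc k)
  interpret \<tau>: fld_endo M \<tau> by fact
  have Msub: "subfld M" by unfold_locales
  have p: "(\<Prod>j<k. (\<tau> ^^ j) a) \<in> M" by (intro \<tau>.prod_closed \<tau>.funpow_closed a)
  have "(B.T \<tau> n ^^ Suc k) x = B.T \<tau> n (vscale (\<Prod>j<k. (\<tau> ^^ j) a) ((Y ^^ (k * i)) x))"
    by (simp add: Suc)
  also have "\<dots> = vscale (\<tau> (\<Prod>j<k. (\<tau> ^^ j) a)) ((Y ^^ (k * i)) (vscale a ((Y ^^ i) x)))"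
    using T_Y[OF M \<tau> x, of "k * i"] B.T_scale[OF \<tau>(1) Y_VM[OF Msub M x] p, of n "k * i"] a(2) by simp
  also have "\<dots> = vscale (a * (\<Prod>j<k. (\<tau> ^^ Suc j) a)) ((Y ^^ (Suc k * i)) x)"
  proof -
    have "Suc k * i = k * i + i" by simp
    then have "(Y ^^ (k * i)) ((Y ^^ i) x) = (Y ^^ (Suc k * i)) x" by (simp only: funpow_add comp_apply)
    then show ?thesis
      by (simp only: Y_power_scale vscale_simps \<tau>.endo_prod \<tau>.funpow_closed a) (simp add: mult.commute)
  qed
  also have "a * (\<Prod>j<k. (\<tau> ^^ Suc j) a) = (\<Prod>j<Suc k. (\<tau> ^^ j) a)"
    unfolding prod.lessThan_Suc_shift by simp
  finally show ?case .
qed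

text \<open>The scalars by which the commuting semilinear maps \<open>\<iota>\<close> and \<open>\<Phi>\<close> act on the one-dimensional
  space of intertwiners compare the two cocycles.\<close>

theorem comparison:
  assumes M: "W \<subseteq> M" "E \<subseteq> M"
    and \<iota>: "fld_endo M \<iota>" "\<And>w. w \<in> W \<Longrightarrow> \<iota> w = w" "\<And>l. l \<in> E \<Longrightarrow> \<iota> l = (\<sigma> ^^ i1) l"
    and \<Phi>: "fld_endo M \<Phi>" "\<And>w. w \<in> W \<Longrightarrow> \<Phi> w = \<phi> w" "\<And>l. l \<in> E \<Longrightarrow> \<Phi> l = (\<sigma> ^^ i0) l"
    and comm: "\<And>x. x \<in> M \<Longrightarrow> \<iota> (\<Phi> x) = \<Phi> (\<iota> x)"
    and e: "\<And>x. x \<in> M \<Longrightarrow> (\<iota> ^^ e) x = x" "e * i1 = d"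
    and N: "\<And>x. x \<in> M \<Longrightarrow> (\<Phi> ^^ N) x = x" "N = m * kB" "N * i0 = d * kA" "0 < N"
  shows "\<exists>\<alpha>\<in>M - {0}. \<exists>\<beta>\<in>M - {0}. (\<Prod>k<e. (\<iota> ^^ k) \<alpha>) * b = 1 \<and>
    (\<Prod>k<N. (\<Phi> ^^ k) \<beta>) * b ^ kA = c ^ kB \<and> \<iota> \<beta> * \<alpha> = \<Phi> \<alpha> * \<beta>"
proof -
  interpret \<iota>: fld_endo M \<iota> by fact
  interpret \<Phi>: fld_endo M \<Phi> by fact
  have Msub: "subfld M" by unfold_locales
  obtain x where x: "x \<in> eigs 0" "x \<noteq> 0" "x \<in> B.VM M"
    using eigenvector_exists[OF Msub M] by (auto simp: eigs_def B.VM_def)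
  have \<iota>W: "\<iota> w = (\<phi> ^^ 0) w" if "w \<in> W" for w using \<iota>(2)[OF that] by simp
  have \<Phi>W: "\<Phi> w = (\<phi> ^^ 1) w" if "w \<in> W" for w using \<Phi>(2)[OF that] by simp
  obtain \<alpha> where \<alpha>: "\<alpha> \<in> M" "B.T \<iota> 0 x = vscale \<alpha> ((Y ^^ i1) x)"
    using semilinear_scalar[OF M \<iota>(1) \<iota>W \<iota>(3) x] by blast
  obtain \<beta> where \<beta>: "\<beta> \<in> M" "B.T \<Phi> 1 x = vscale \<beta> ((Y ^^ i0) x)"
    using semilinear_scalar[OF M \<Phi>(1) \<Phi>W \<Phi>(3) x] by blast
  have xV: "x \<in> B.V" using x by (auto simp: B.VM_def)
  have xM: "x \<kappa> j \<in> M" for \<kappa> j using x by (auto simp: B.VM_def)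
  \<comment> \<open>The \<open>e\<close>-th iterate is the identity, as \<iota> has order dividing
    \<open>e\<close> and fixes \<open>W\<close>; on the other side \<open>e * i1 = d\<close> turns
    of \<open>Y\<close> give \<open>b\<close>.\<close>
  have eq1: "(\<Prod>k<e. (\<iota> ^^ k) \<alpha>) * b = 1"
  proof -
    have "(B.T \<iota> 0 ^^ e) x = B.T (\<iota> ^^ e) (m * 0) x"
      using B.T_power[OF \<iota>(1) M(1) \<iota>W x(3)] by simp
    also have "\<dots> = vscale 1 x"
      using B.T_pure[OF xV \<iota>.fld_endo_funpow, of e 0] by (simp add: e xM)
    finally have "vscale 1 x = vscale (\<Prod>k<e. (\<iota> ^^ k) \<alpha>) ((Y ^^ (e * i1)) x)"
      using T_iterate[OF M(1) \<iota>(1) \<iota>W x(3) \<alpha>] by simp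
    also have "\<dots> = vscale ((\<Prod>k<e. (\<iota> ^^ k) \<alpha>) * b) x"
      using Y_order[OF x(1)] by (simp add: e vscale_simps)
    finally show ?thesis using vscale_cancel_right[OF x(2)] by metis
  qed
  \<comment> \<open>After \<open>N\<close> steps the powers of the generator on both sides are
    scalars: \<open>c^kB\<close> from the second algebra and \<open>b^kA\<close> from the
    first.\<close>
  have eq2: "(\<Prod>k<N. (\<Phi> ^^ k) \<beta>) * b ^ kA = c ^ kB"
  proof -
    have "(B.T \<Phi> 1 ^^ N) x = B.T (\<Phi> ^^ N) (m * kB) x"
      using B.T_power[OF \<Phi>(1) M(1) \<Phi>W x(3), of N] N(2) by simp
    also have "\<dots> = vscale (c ^ kB) x"
      using B.T_pure[OF xV \<Phi>.fld_endo_funpow, of N kB] by (simp add: N(1) xM)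
    finally have "vscale (c ^ kB) x = vscale (\<Prod>k<N. (\<Phi> ^^ k) \<beta>) ((Y ^^ (N * i0)) x)"
      using T_iterate[OF M(1) \<Phi>(1) \<Phi>W x(3) \<beta>] by simp
    also have "\<dots> = vscale ((\<Prod>k<N. (\<Phi> ^^ k) \<beta>) * b ^ kA) x"
      using Y_order_mult[OF x(1)] by (simp add: N(3) vscale_simps)
    finally show ?thesis using vscale_cancel_right[OF x(2)] by metis
  qed
  have eq3: "\<iota> \<beta> * \<alpha> = \<Phi> \<alpha> * \<beta>"
  proof -
    have A1: "B.T \<iota> 0 (B.T \<Phi> 1 x) = vscale (\<iota> \<beta> * \<alpha>) ((Y ^^ (i0 + i1)) x)"
    proof -
      have "B.T \<iota> 0 (B.T \<Phi> 1 x) = vscale (\<iota> \<beta>) (B.T \<iota> 0 ((Y ^^ i0) x))"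
        unfolding \<beta>(2) by (rule B.T_scale[OF \<iota>(1) Y_VM[OF Msub M(1) x(3)] \<beta>(1)])
      then show ?thesis
        by (simp add: T_Y[OF M(1) \<iota>(1) \<iota>W x(3)] \<alpha> Y_power_scale vscale_simps funpow_add)
    qed
    have A2: "B.T \<Phi> 1 (B.T \<iota> 0 x) = vscale (\<Phi> \<alpha> * \<beta>) ((Y ^^ (i0 + i1)) x)"
    proof -
      have "B.T \<Phi> 1 (B.T \<iota> 0 x) = vscale (\<Phi> \<alpha>) (B.T \<Phi> 1 ((Y ^^ i1) x))"
        unfolding \<alpha>(2) by (rule B.T_scale[OF \<Phi>(1) Y_VM[OF Msub M(1) x(3)] \<alpha>(1)])
      also have "B.T \<Phi> 1 ((Y ^^ i1) x) = vscale \<beta> ((Y ^^ (i1 + i0)) x)"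
        using T_Y[OF M(1) \<Phi>(1) \<Phi>W x(3), of i1] by (simp only: \<beta>(2) Y_power_scale funpow_add comp_apply)
      finally show ?thesis by (simp add: vscale_simps add.commute)
    qed
    have "B.T \<iota> 0 (B.T \<Phi> 1 x) = B.T (\<iota> \<circ> \<Phi>) 1 x"
      using B.T_comp[OF \<iota>(1) M(1) \<iota>W \<Phi>(1) x(3), of 1] by simp
    also have "\<dots> = B.T (\<Phi> \<circ> \<iota>) 1 x" by (rule B.T_cong[OF x(3)]) (simp add: comm)
    also have "\<dots> = B.T \<Phi> 1 (B.T \<iota> 0 x)"
      using B.T_comp[OF \<Phi>(1) M(1) \<Phi>W \<iota>(1) x(3), of 0] by simp
    finally show ?thesis unfolding A1 A2 using vscale_cancel_right[OF Y_power_nz[OF x(1,2)]] by metis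
  qed
  have "0 < e" using e(2) A.d_pos by (cases e) auto
  have "\<alpha> \<noteq> 0"
  proof
    assume "\<alpha> = 0"
    then have "(\<Prod>k<e. (\<iota> ^^ k) \<alpha>) = 0"
      using \<open>0 < e\<close> by (intro prod_zero bexI[of _ 0]) auto
    with eq1 show False by (metis mult_zero_left zero_neq_one)
  qed
  moreover have "\<beta> \<noteq> 0"
  proof
    assume "\<beta> = 0"
    then have "(\<Prod>k<N. (\<Phi> ^^ k) \<beta>) = 0"
      using N(4) by (intro prod_zero bexI[of _ 0]) auto
    with eq2 show False using B.b_nz by (metis mult_zero_left power_not_zero)
  qed
  ultimately show ?thesis using eq1 eq2 eq3 \<alpha>(1) \<beta>(1) by blast
qed

end

section \<open>Residue fields\<close>

lemma ambient_simps: "x \<otimes>\<^bsub>\<Omega>\<^esub> y = x * y" "x \<oplus>\<^bsub>\<Omega>\<^esub> y = x + y" "\<one>\<^bsub>\<Omega>\<^esub> = 1" "\<zero>\<^bsub>\<Omega>\<^esub> = 0"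
  "carrier \<Omega> = UNIV"
  by (simp_all add: ring_of_type_algebra_def)

text \<open>A local ring with maximal ideal \<open>I\<close>, given by subsets of the ambient field.
  It serves as the bridge to the quotient ring, from which finiteness facts about residue fields are
  drawn.\<close>

locale local_dom =
  fixes \<O> I :: "'a::alg_closed_field set"
  assumes O_one: "1 \<in> \<O>" and O_add: "x \<in> \<O> \<Longrightarrow> y \<in> \<O> \<Longrightarrow> x + y \<in> \<O>"
    and O_uminus: "x \<in> \<O> \<Longrightarrow> - x \<in> \<O>" and O_mult: "x \<in> \<O> \<Longrightarrow> y \<in> \<O> \<Longrightarrow> x * y \<in> \<O>"
    and I_sub: "I \<subseteq> \<O>" and I_zero: "0 \<in> I" and I_add: "x \<in> I \<Longrightarrow> y \<in> I \<Longrightarrow> x + y \<in> I"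
    and I_mult: "x \<in> I \<Longrightarrow> y \<in> \<O> \<Longrightarrow> x * y \<in> I"
    and one_notin: "1 \<notin> I" and unit: "x \<in> \<O> \<Longrightarrow> x \<notin> I \<Longrightarrow> inverse x \<in> \<O>"
begin

abbreviation R where "R \<equiv> ring_on \<O>"
abbreviation RF where "RF \<equiv> R Quot I"

lemma R_carrier: "carrier R = \<O>"
  by simp

lemmas R_simps = ambient_simps R_carrier

lemma I_uminus: "x \<in> I \<Longrightarrow> - x \<in> I"
  using I_mult[of x "-1"] O_uminus[OF O_one] by simp

lemma cring_R: "cring R"
proof -
  interpret A: field "\<Omega> :: 'a ring" by (rule field_from_type_algebra)
  have neg: "\<ominus>\<^bsub>\<Omega>\<^esub> x = - x" for x :: 'a
    by (rule A.minus_equality) (auto simp: ring_of_type_algebra_def)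
  have "subring \<O> \<Omega>"
    by (rule A.subringI) (auto simp: neg O_one O_add O_uminus O_mult, auto simp: ring_of_type_algebra_def O_one O_add O_mult)
  then have "subcring \<O> \<Omega>" by (rule A.subcringI')
  then show ?thesis using A.subcring_iff[of \<O>] by (simp add: ring_of_type_algebra_def)
qed

lemma ideal_I: "ideal I R"
proof -
  interpret cring R by (rule cring_R)
  have neg: "\<ominus>\<^bsub>R\<^esub> x = - x" if "x \<in> \<O>" for x
    using that by (intro minus_equality) (auto simp: R_simps O_uminus)
  show ?thesis
  proof (rule idealI)
    show "subgroup I (add_monoid R)"
    proof (rule add.subgroupI)
      show "I \<subseteq> carrier R" using I_sub by (simp add: R_simps)
      show "I \<noteq> {}" using I_zero by auto
      show "\<ominus>\<^bsub>R\<^esub> a \<in> I" if "a \<in> I" for a using that I_sub neg[of a] I_uminus by auto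
      show "a \<oplus>\<^bsub>R\<^esub> b \<in> I" if "a \<in> I" "b \<in> I" for a b using that by (simp add: R_simps I_add)
    qed
    show "x \<otimes>\<^bsub>R\<^esub> a \<in> I" "a \<otimes>\<^bsub>R\<^esub> x \<in> I" if "a \<in> I" "x \<in> carrier R" for a x
      using that I_mult[of a x] by (simp_all add: R_simps mult.commute)
  qed (rule ring_axioms)
qed

definition cl :: "'a \<Rightarrow> 'a set" where "cl x = I +>\<^bsub>R\<^esub> x"

lemma cl_eq: "x \<in> \<O> \<Longrightarrow> y \<in> \<O> \<Longrightarrow> cl x = cl y \<longleftrightarrow> x - y \<in> I"
proof -
  assume x: "x \<in> \<O>" and y: "y \<in> \<O>"
  have c: "cl z = (\<lambda>i. i + z) ` I" for z
    by (auto simp: cl_def a_r_coset_def r_coset_def ambient_simps)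
  show ?thesis
  proof
    assume "cl x = cl y"
    moreover have "x \<in> cl x" unfolding c using I_zero by force
    ultimately show "x - y \<in> I" unfolding c by auto
  next
    assume i: "x - y \<in> I"
    show "cl x = cl y"
    proof (intro equalityI subsetI)
      fix z assume "z \<in> cl x"
      then obtain a where a: "a \<in> I" "z = a + x" unfolding c by auto
      then have "z = (a + (x - y)) + y" by simp
      then show "z \<in> cl y" unfolding c using I_add[OF a(1) i] by blast
    next
      fix z assume "z \<in> cl y"
      then obtain a where a: "a \<in> I" "z = a + y" unfolding c by auto
      then have "z = (a + - (x - y)) + x" by simp
      then show "z \<in> cl x" unfolding c using I_add[OF a(1) I_uminus[OF i]] by blast
    qed
  qed
qed

lemma carrier_k: "carrier RF = cl ` \<O>"
  by (auto simp: FactRing_def A_RCOSETS_def RCOSETS_def cl_def a_r_coset_def R_simps)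

lemma cl_hom: "cl \<in> ring_hom R RF"
proof -
  interpret ideal I R by (rule ideal_I)
  have "cl = (+>\<^bsub>R\<^esub>) I" by (auto simp: cl_def fun_eq_iff)
  then show ?thesis using rcos_ring_hom by simp
qed

lemma zero_k: "\<zero>\<^bsub>RF\<^esub> = cl 0"
proof -
  interpret ideal I R by (rule ideal_I)
  have "cl 0 = I" by (auto simp: cl_def a_r_coset_def r_coset_def ambient_simps)
  then show ?thesis by (simp add: FactRing_def)
qed

lemma one_k: "\<one>\<^bsub>RF\<^esub> = cl 1"
  using ring_hom_one[OF cl_hom] by (simp add: R_simps)

lemma mult_k: "x \<in> \<O> \<Longrightarrow> y \<in> \<O> \<Longrightarrow> cl x \<otimes>\<^bsub>RF\<^esub> cl y = cl (x * y)"
  and add_k: "x \<in> \<O> \<Longrightarrow> y \<in> \<O> \<Longrightarrow> cl x \<oplus>\<^bsub>RF\<^esub> cl y = cl (x + y)"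
  using ring_hom_mult[OF cl_hom, of x y] ring_hom_add[OF cl_hom, of x y] by (simp_all add: R_simps)

lemma O_zero: "0 \<in> \<O>" using I_zero I_sub by auto

lemma O_power: "x \<in> \<O> \<Longrightarrow> x ^ n \<in> \<O>"
  by (induction n) (auto intro: O_one O_mult)

lemma O_of_nat: "of_nat n \<in> \<O>"
  by (induction n) (auto intro: O_zero O_one O_add)

lemma pow_k: "x \<in> \<O> \<Longrightarrow> cl x [^]\<^bsub>RF\<^esub> n = cl (x ^ n)" for n :: nat
proof (induction n)
  case 0
  then show ?case by (simp add: nat_pow_def one_k)
next
  case (Suc n)
  then show ?case by (simp add: nat_pow_def mult_k O_power mult.commute)
qed

lemma field_k: "field RF"
proof -
  interpret ideal I R by (rule ideal_I)
  interpret k: cring RF by (rule quotient_is_cring[OF cring_R])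
  show ?thesis
  proof (rule k.cring_fieldI)
    have "cl x \<in> Units RF" if x: "x \<in> \<O>" "cl x \<noteq> cl 0" for x
    proof -
      have xI: "x \<notin> I" using cl_eq[OF x(1) O_zero] x(2) by simp
      then have "x \<noteq> 0" using I_zero by auto
      have ix: "inverse x \<in> \<O>" using unit[OF x(1) xI] .
      have "cl (inverse x) \<otimes>\<^bsub>RF\<^esub> cl x = \<one>\<^bsub>RF\<^esub>"
        unfolding mult_k[OF ix x(1)] one_k using \<open>x \<noteq> 0\<close> by simp
      then show ?thesis using ix x(1) using mult_k[OF x(1) ix] mult_k[OF ix x(1)] unfolding Units_def carrier_k by (auto simp: mult.commute)
    qed
    moreover have "cl 0 \<notin> Units RF"
    proof
      assume "cl 0 \<in> Units RF"
      then obtain y where y: "y \<in> \<O>" "cl y \<otimes>\<^bsub>RF\<^esub> cl 0 = \<one>\<^bsub>RF\<^esub>"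
        unfolding Units_def carrier_k by blast
      then have "cl 0 = cl 1" unfolding mult_k[OF y(1) O_zero] one_k by simp
      then show False using cl_eq[OF O_one O_zero] one_notin by simp
    qed
    ultimately show "Units RF = carrier RF - {\<zero>\<^bsub>RF\<^esub>}"
      unfolding zero_k using k.Units_closed by (auto simp: carrier_k)
  qed
qed

lemma residue_power:
  assumes "finite (carrier RF)" and x: "x \<in> \<O>"
  shows "x ^ card (carrier RF) - x \<in> I"
proof (cases "cl x = cl 0")
  case True
  then have "x \<in> I" using cl_eq[OF x O_zero] by simp
  moreover have "card (carrier RF) \<noteq> 0" using assms(1) x by (auto simp: carrier_k)
  then obtain n where n: "card (carrier RF) = Suc n" using not0_implies_Suc by blast
  ultimately show ?thesis
    using I_add[OF I_mult[of x "x ^ n"] I_uminus, of x] O_power[OF x] by simp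
next
  case False
  interpret k: field RF by (rule field_k)
  interpret G: group "Multiplicative_Group.mult_of RF" by (rule k.field_mult_group)
  have cx: "cl x \<in> carrier (Multiplicative_Group.mult_of RF)" using x False by (auto simp: carrier_k zero_k)
  have "cl x [^]\<^bsub>Multiplicative_Group.mult_of RF\<^esub> Coset.order (Multiplicative_Group.mult_of RF) = \<one>\<^bsub>Multiplicative_Group.mult_of RF\<^esub>"
    by (rule G.pow_order_eq_1[OF cx])
  then have "cl (x ^ (card (carrier RF) - 1)) = cl 1"
    using k.order_mult_of[OF assms(1)] by (simp add: Multiplicative_Group.nat_pow_mult_of pow_k x one_k Coset.order_def)
  then have "x ^ (card (carrier RF) - 1) - 1 \<in> I" using cl_eq O_power[OF x] O_one by auto
  then have "(x ^ (card (carrier RF) - 1) - 1) * x \<in> I" using x by (rule I_mult)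
  moreover have "card (carrier RF) \<noteq> 0" using assms(1) x by (auto simp: carrier_k)
  ultimately show ?thesis by (cases "card (carrier RF)") (auto simp: algebra_simps)
qed

lemma residue_char:
  assumes "finite (carrier RF)"
  shows "of_nat (card (carrier RF)) \<in> I"
proof -
  interpret k: field RF by (rule field_k)
  have "add_pow RF n \<one>\<^bsub>RF\<^esub> = cl (of_nat n)" for n :: nat
    by (induction n) (auto simp: zero_k one_k add_k O_one O_of_nat add.commute)
  moreover have "add_pow RF (card (carrier RF)) \<one>\<^bsub>RF\<^esub> = \<zero>\<^bsub>RF\<^esub>"
    using k.add.pow_order_eq_1[OF k.one_closed] by (simp add: Coset.order_def add_pow_def)
  ultimately have "cl (of_nat (card (carrier RF))) = cl 0" by (simp add: zero_k)
  then show ?thesis using cl_eq[OF O_of_nat O_zero] by simp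
qed

lemma residue_generator:
  assumes "finite (carrier RF)"
  shows "\<exists>g\<in>\<O>. g \<notin> I \<and> (\<forall>x\<in>\<O>. x \<in> I \<or> (\<exists>i::nat. x - g ^ i \<in> I))"
proof -
  interpret k: field RF by (rule field_k)
  obtain a where a: "a \<in> carrier (Multiplicative_Group.mult_of RF)" "carrier (Multiplicative_Group.mult_of RF) = {a [^]\<^bsub>RF\<^esub> i | i::nat. i \<in> UNIV}"
    using k.finite_field_mult_group_has_gen[OF assms] by blast
  obtain g where g: "g \<in> \<O>" "a = cl g" using a(1) by (auto simp: carrier_k)
  have "g \<notin> I" using a(1) cl_eq[OF g(1) O_zero] by (auto simp: zero_k g)
  moreover have "x \<in> I \<or> (\<exists>i::nat. x - g ^ i \<in> I)" if x: "x \<in> \<O>" for x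
  proof (cases "cl x = cl 0")
    case True
    then show ?thesis using cl_eq[OF x O_zero] by simp
  next
    case False
    then have "cl x \<in> carrier (Multiplicative_Group.mult_of RF)" using x by (auto simp: carrier_k zero_k)
    then obtain i :: nat where "cl x = cl (g ^ i)" unfolding a(2) g(2) by (auto simp: pow_k g(1))
    then show ?thesis using cl_eq[OF x O_power[OF g(1)]] by blast
  qed
  ultimately show ?thesis using g(1) by blast
qed

end

section \<open>Complete discrete valuation rings\<close>

text \<open>Enough structure for congruences modulo powers of \<pi> and for the additivity of the
  Frobenius map. It is also instantiated with \<pi> equal to the number \<open>p\<close>
  itself.\<close>

locale pi_ring =
  fixes \<O> :: "'a::alg_closed_field set" and \<pi> :: 'a and p :: nat
  assumes O_zero: "0 \<in> \<O>" and O_one: "1 \<in> \<O>"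
    and O_add: "x \<in> \<O> \<Longrightarrow> y \<in> \<O> \<Longrightarrow> x + y \<in> \<O>"
    and O_uminus: "x \<in> \<O> \<Longrightarrow> - x \<in> \<O>" and O_mult: "x \<in> \<O> \<Longrightarrow> y \<in> \<O> \<Longrightarrow> x * y \<in> \<O>"
    and pi_in: "\<pi> \<in> \<O>" and p: "Factorial_Ring.prime p" and p_in: "\<exists>z\<in>\<O>. of_nat p = \<pi> * z"
begin

definition cg :: "nat \<Rightarrow> 'a \<Rightarrow> 'a \<Rightarrow> bool"
  where "cg k x y \<longleftrightarrow> (\<exists>z\<in>\<O>. x - y = \<pi> ^ k * z)"

lemma O_diff: "x \<in> \<O> \<Longrightarrow> y \<in> \<O> \<Longrightarrow> x - y \<in> \<O>"
  using O_add[of x "-y"] O_uminus[of y] by simp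

lemma O_power: "x \<in> \<O> \<Longrightarrow> x ^ n \<in> \<O>"
  by (induction n) (auto intro: O_one O_mult)

lemma O_sum: "(\<And>i. i \<in> I \<Longrightarrow> f i \<in> \<O>) \<Longrightarrow> sum f I \<in> \<O>"
  by (induction I rule: infinite_finite_induct) (auto intro: O_add O_zero)

lemma O_prod: "(\<And>i. i \<in> I \<Longrightarrow> f i \<in> \<O>) \<Longrightarrow> prod f I \<in> \<O>"
  by (induction I rule: infinite_finite_induct) (auto intro: O_mult O_one)

lemma O_of_nat: "of_nat n \<in> \<O>"
  by (induction n) (auto intro: O_zero O_one O_add)

lemmas O_intros = O_zero O_one O_add O_uminus O_mult O_diff O_power O_sum O_prod O_of_nat pi_in

lemma cg_refl [simp]: "cg k x x"
  by (auto simp: cg_def intro: bexI[of _ 0] O_zero)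

lemma cg_sym: "cg k x y \<Longrightarrow> cg k y x"
proof -
  assume "cg k x y"
  then obtain z where z: "z \<in> \<O>" "x - y = \<pi> ^ k * z" by (auto simp: cg_def)
  then have "y - x = \<pi> ^ k * (- z)" by (simp add: algebra_simps)
  then show ?thesis using O_uminus[OF z(1)] unfolding cg_def by blast
qed

lemma cg_add: "cg k x y \<Longrightarrow> cg k x' y' \<Longrightarrow> cg k (x + x') (y + y')"
proof -
  assume "cg k x y" "cg k x' y'"
  then obtain z z' where z: "z \<in> \<O>" "x - y = \<pi> ^ k * z" "z' \<in> \<O>" "x' - y' = \<pi> ^ k * z'" by (auto simp: cg_def)
  then have "(x + x') - (y + y') = \<pi> ^ k * (z + z')" by (simp add: algebra_simps)
  then show ?thesis using O_add[OF z(1,3)] by (auto simp: cg_def)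
qed

lemma cg_trans [trans]: "cg k x y \<Longrightarrow> cg k y z \<Longrightarrow> cg k x z"
  using cg_add[of k x y y z] by (auto simp: cg_def)

lemma cg_uminus: "cg k x y \<Longrightarrow> cg k (- x) (- y)"
proof -
  assume "cg k x y"
  then obtain z where z: "z \<in> \<O>" "x - y = \<pi> ^ k * z" by (auto simp: cg_def)
  then have "(- x) - (- y) = \<pi> ^ k * (- z)" by (simp add: algebra_simps)
  then show ?thesis using O_uminus[OF z(1)] unfolding cg_def by blast
qed

lemma cg_diff: "cg k x y \<Longrightarrow> cg k x' y' \<Longrightarrow> cg k (x - x') (y - y')"
  using cg_add[of k x y "-x'" "-y'"] cg_uminus[of k x' y'] by simp

lemma cg_scale: "a \<in> \<O> \<Longrightarrow> cg k x y \<Longrightarrow> cg k (a * x) (a * y)"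
proof -
  assume a: "a \<in> \<O>" and "cg k x y"
  then obtain z where z: "z \<in> \<O>" "x - y = \<pi> ^ k * z" by (auto simp: cg_def)
  have "a * x - a * y = a * (x - y)" by (simp add: algebra_simps)
  also have "\<dots> = \<pi> ^ k * (a * z)" unfolding z(2) by simp
  finally show ?thesis using O_mult[OF a z(1)] by (auto simp: cg_def)
qed

lemma cg_mult: "cg k x y \<Longrightarrow> cg k x' y' \<Longrightarrow> x \<in> \<O> \<Longrightarrow> y' \<in> \<O> \<Longrightarrow> cg k (x * x') (y * y')"
  using cg_trans[of k "x * x'" "x * y'" "y * y'"] cg_scale[of x k x' y'] cg_scale[of y' k x y]
  by (simp add: mult.commute)

lemma cg_power: "cg k x y \<Longrightarrow> x \<in> \<O> \<Longrightarrow> y \<in> \<O> \<Longrightarrow> cg k (x ^ n) (y ^ n)"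
  by (induction n) (auto intro!: cg_mult O_power)

lemma cg_sum: "(\<And>i. i \<in> I \<Longrightarrow> cg k (f i) (g i)) \<Longrightarrow> cg k (sum f I) (sum g I)"
  by (induction I rule: infinite_finite_induct) (auto intro: cg_add)

lemma cg_prod: "(\<And>i. i \<in> I \<Longrightarrow> cg k (f i) (g i) \<and> f i \<in> \<O> \<and> g i \<in> \<O>) \<Longrightarrow> cg k (prod f I) (prod g I)"
  by (induction I rule: infinite_finite_induct) (auto intro!: cg_mult O_prod)

lemma cg_mono: "cg k x y \<Longrightarrow> j \<le> k \<Longrightarrow> cg j x y"
proof -
  assume "cg k x y" and jk: "j \<le> k"
  then obtain z where z: "z \<in> \<O>" "x - y = \<pi> ^ k * z" by (auto simp: cg_def)
  then have "x - y = \<pi> ^ j * (\<pi> ^ (k - j) * z)" using jk by (simp add: mult.assoc[symmetric] power_add[symmetric])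
  then show ?thesis using O_mult[OF O_power[OF pi_in] z(1)] by (auto simp: cg_def)
qed

lemma cg_shift: "cg k x y \<Longrightarrow> cg (j + k) (\<pi> ^ j * x) (\<pi> ^ j * y)"
  by (auto simp: cg_def power_add algebra_simps)

lemma cg_pi_mult: "z \<in> \<O> \<Longrightarrow> cg 1 (\<pi> * z) 0"
  by (auto simp: cg_def)

lemma cg_0: "x \<in> \<O> \<Longrightarrow> y \<in> \<O> \<Longrightarrow> cg 0 x y"
  using O_diff by (auto simp: cg_def)

lemma p_gt_1: "p > 1"
  using p by (rule prime_gt_1_nat)

lemma cg_p: "cg 1 (of_nat p) 0"
  using p_in by (auto simp: cg_def)

text \<open>In \<open>x^p - y^p = (x - y) * S\<close> the second factor is congruent to
  \<open>p * y^(p - 1)\<close>, so it contributes one more power of \<pi>.\<close>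

lemma cg_power_p:
  assumes "cg k x y" "k \<ge> 1" "x \<in> \<O>" "y \<in> \<O>"
  shows "cg (Suc k) (x ^ p) (y ^ p)"
proof -
  obtain z where z: "z \<in> \<O>" "x - y = \<pi> ^ k * z" using assms(1) by (auto simp: cg_def)
  define S where "S = (\<Sum>i<p. y ^ (p - Suc i) * x ^ i)"
  have e: "x ^ p - y ^ p = (x - y) * S" unfolding S_def by (rule power_diff_sumr2)
  have c1: "cg 1 x y" using assms(1,2) by (rule cg_mono)
  have "cg 1 S (\<Sum>i<p. y ^ (p - Suc i) * y ^ i)"
    unfolding S_def by (intro cg_sum cg_scale cg_power c1 O_intros assms)
  also have "(\<Sum>i<p. y ^ (p - Suc i) * y ^ i) = (\<Sum>i<p. y ^ (p - 1))"
    by (intro sum.cong refl) (simp add: power_add[symmetric])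
  also have "\<dots> = of_nat p * y ^ (p - 1)" by simp
  also have "cg 1 (of_nat p * y ^ (p - 1)) (0 * y ^ (p - 1))" by (intro cg_mult cg_p cg_refl O_intros assms)
  finally obtain s where s: "s \<in> \<O>" "S = \<pi> * s" by (auto simp: cg_def)
  have "x ^ p - y ^ p = \<pi> ^ Suc k * (z * s)" unfolding e z(2) s(2) by simp
  then show ?thesis using O_mult[OF z(1) s(1)] by (auto simp: cg_def)
qed

lemma cg_power_p_iter:
  assumes "cg k x y" "k \<ge> 1" "x \<in> \<O>" "y \<in> \<O>"
  shows "cg (k + n) (x ^ (p ^ n)) (y ^ (p ^ n))"
proof (induction n)
  case (Suc n)
  have "cg (Suc (k + n)) ((x ^ (p ^ n)) ^ p) ((y ^ (p ^ n)) ^ p)"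
    using Suc assms by (intro cg_power_p O_intros) auto
  then show ?case by (simp add: power_mult[symmetric] mult.commute)
qed (use assms in simp)

lemma freshman:
  assumes "x \<in> \<O>" "y \<in> \<O>"
  shows "cg 1 ((x + y) ^ (p ^ n)) (x ^ (p ^ n) + y ^ (p ^ n))"
proof (induction n)
  case (Suc n)
  have one: "cg 1 ((a + b) ^ p) (a ^ p + b ^ p)" if ab: "a \<in> \<O>" "b \<in> \<O>" for a b
  proof -
    obtain z0 where z0: "z0 \<in> \<O>" "of_nat p = \<pi> * z0" using p_in by blast
    have c: "cg 1 (of_nat (p choose k) * a ^ k * b ^ (p - k)) 0" if k: "k \<in> {1..<p}" for k
    proof -
      have "p dvd (p choose k)" using p k by (intro dvd_choose_prime) auto
      then obtain m where m: "p choose k = p * m" by (elim dvdE)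
      have "of_nat (p choose k) * a ^ k * b ^ (p - k) = \<pi> * (z0 * of_nat m * a ^ k * b ^ (p - k))"
        unfolding m of_nat_mult z0(2) by (simp add: ac_simps)
      also have "cg 1 \<dots> 0" by (intro cg_pi_mult O_intros z0 ab)
      finally show ?thesis .
    qed
    have "(a + b) ^ p = (\<Sum>k\<le>p. of_nat (p choose k) * a ^ k * b ^ (p - k))" by (rule binomial_ring)
    also have "{..p} = insert 0 (insert p {1..<p})" using p_gt_1 by auto
    also have "(\<Sum>k\<in>\<dots>. of_nat (p choose k) * a ^ k * b ^ (p - k)) =
      b ^ p + (a ^ p + (\<Sum>k\<in>{1..<p}. of_nat (p choose k) * a ^ k * b ^ (p - k)))"
      using p_gt_1 by simp
    also have "cg 1 \<dots> (b ^ p + (a ^ p + (\<Sum>k\<in>{1..<p}. 0)))"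
      by (intro cg_add cg_refl cg_sum c)
    finally show ?thesis by (simp add: add.commute)
  qed
  have "cg 1 (((x + y) ^ (p ^ n)) ^ p) ((x ^ (p ^ n) + y ^ (p ^ n)) ^ p)"
    by (intro cg_power Suc O_intros assms)
  also have "cg 1 ((x ^ (p ^ n) + y ^ (p ^ n)) ^ p) ((x ^ (p ^ n)) ^ p + (y ^ (p ^ n)) ^ p)"
    by (intro one O_intros assms)
  finally show ?case by (simp add: power_mult[symmetric] mult.commute)
qed simp

text \<open>Used in the following form: if \<open>x\<close> is a root of \<open>g\<close>, then its
  \<open>p^n\<close>-th power is a root modulo \<pi> of the polynomial with Frobenius-twisted
  coefficients.\<close>

lemma freshman_poly:
  assumes g: "g \<in> polys_over \<O>" and x: "x \<in> \<O>"
    and h: "h \<in> polys_over \<O>" and gh: "\<And>i. cg 1 (Polynomial.coeff g i ^ (p ^ n)) (Polynomial.coeff h i)"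
  shows "cg 1 (poly g x ^ (p ^ n)) (poly h (x ^ (p ^ n)))"
  using g h gh
proof (induction g arbitrary: h rule: pCons_induct)
  case 0
  have "cg 1 0 (Polynomial.coeff h i)" for i using "0.prems"(3)[of i] p_gt_1 by (simp add: power_0_left)
  then have "cg 1 (\<Sum>i\<le>Polynomial.degree h. 0 * (x ^ (p ^ n)) ^ i) (poly h (x ^ (p ^ n)))"
    unfolding poly_altdef by (intro cg_sum cg_mult O_intros x cg_refl)
  then show ?case using p_gt_1 by (simp add: power_0_left)
next
  case (pCons a g)
  obtain b h' where h: "h = pCons b h'" by (rule pCons_cases)
  have a: "a \<in> \<O>" "g \<in> polys_over \<O>" using pCons.prems(1)
    by (auto simp: polys_over_def coeff_pCons split: nat.splits)
  have b: "b \<in> \<O>" "h' \<in> polys_over \<O>" using pCons.prems(2) h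
    by (auto simp: polys_over_def coeff_pCons split: nat.splits)
  have ab: "cg 1 (a ^ (p ^ n)) b" using pCons.prems(3)[of 0] h by simp
  have IH: "cg 1 (poly g x ^ (p ^ n)) (poly h' (x ^ (p ^ n)))"
    using pCons.prems(3)[of "Suc _"] h by (intro pCons.IH a b) auto
  have gO: "poly g x \<in> \<O>" using a x by (auto simp: poly_altdef polys_over_def intro!: O_intros)
  have hO: "poly h' (x ^ (p ^ n)) \<in> \<O>" using b x by (auto simp: poly_altdef polys_over_def intro!: O_intros)
  have "cg 1 ((a + x * poly g x) ^ (p ^ n)) (a ^ (p ^ n) + (x * poly g x) ^ (p ^ n))"
    by (intro freshman a O_intros x gO)
  also have "cg 1 \<dots> (b + x ^ (p ^ n) * poly h' (x ^ (p ^ n)))"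
    unfolding power_mult_distrib by (intro cg_add ab cg_scale IH O_intros x)
  finally show ?case by (simp add: h)
qed

end

text \<open>A \<open>\<pi>\<close>-adically complete subring \<open>\<O>\<close> with field of fractions \<open>F = \<O>[1/\<pi>]\<close>, such that
  the \<open>P\<close>-th power map induces the identity of \<open>\<O>/\<pi>\<O>\<close>. These axioms are inherited by extensions
  by roots of unity, and imply that \<open>\<O>\<close> is a discrete valuation ring.\<close>

locale adic = subfld F + pi_ring \<O> \<pi> p
  for F :: "'a::alg_closed_field set" and \<O> :: "'a set" and \<pi> :: 'a and p :: nat +
  fixes P :: nat
  assumes O_sub: "\<O> \<subseteq> F"
    and pi_nz: "\<pi> \<noteq> 0" and frac: "x \<in> F \<Longrightarrow> \<exists>k. \<pi> ^ k * x \<in> \<O>"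
    and proper: "x \<in> \<O> \<Longrightarrow> \<pi> * x \<noteq> 1"
    and P: "\<exists>k\<ge>1. P = p ^ k" and frob: "x \<in> \<O> \<Longrightarrow> \<exists>z\<in>\<O>. x ^ P - x = \<pi> * z"
    and complete: "(\<And>k. s k \<in> \<O>) \<Longrightarrow> (\<And>k. \<exists>z\<in>\<O>. s (Suc k) - s k = \<pi> ^ k * z) \<Longrightarrow>
      \<exists>y\<in>\<O>. \<forall>k. \<exists>z\<in>\<O>. y - s k = \<pi> ^ k * z"
begin

lemma cg_frob: "x \<in> \<O> \<Longrightarrow> cg 1 (x ^ P) x"
  using frob by (auto simp: cg_def)

lemma one_not_cg_0: "\<not> cg 1 1 0"
  using proper by (auto simp: cg_def)

text \<open>For a nonzero difference \<open>w\<close> some \<open>\<pi>^k / w\<close> is integral by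
  \<open>frac\<close>. If \<open>\<pi>^(k+1)\<close> divided \<open>w\<close>, then \<pi> would be a
  unit, against \<open>proper\<close>.\<close>

lemma cg_separated:
  assumes x: "x \<in> \<O>" and y: "y \<in> \<O>" and c: "\<And>k. cg k x y"
  shows "x = y"
proof (rule ccontr)
  assume "x \<noteq> y"
  define w where "w = x - y"
  have w: "w \<in> \<O>" "w \<noteq> 0" unfolding w_def using O_diff[OF x y] \<open>x \<noteq> y\<close> by auto
  obtain k where k: "\<pi> ^ k * inverse w \<in> \<O>" using frac[of "inverse w"] w O_sub inverse_closed by blast
  obtain z where z: "z \<in> \<O>" "w = \<pi> ^ Suc k * z" using c[of "Suc k"] by (auto simp: cg_def w_def)
  have "\<pi> ^ k * 1 = \<pi> ^ k * inverse w * w" using w by simp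
  also have "\<dots> = \<pi> ^ k * inverse w * (\<pi> ^ Suc k * z)" using z(2) by simp
  also have "\<dots> = \<pi> ^ k * (\<pi> * (\<pi> ^ k * inverse w * z))" by simp
  finally have "\<pi> * (\<pi> ^ k * inverse w * z) = 1" using pi_nz by simp
  then show False using proper[OF O_mult[OF k z(1)]] by simp
qed

lemma limit:
  assumes "\<And>k. s k \<in> \<O>" "\<And>k. cg k (s (Suc k)) (s k)"
  obtains y where "y \<in> \<O>" "\<And>k. cg k y (s k)"
proof -
  have "\<exists>y\<in>\<O>. \<forall>k. \<exists>z\<in>\<O>. y - s k = \<pi> ^ k * z"
    by (rule complete) (use assms in \<open>auto simp: cg_def\<close>)
  then show thesis using that by (auto simp: cg_def)
qed

text \<open>The inverse is the geometric series, which converges by completeness.\<close>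

lemma one_plus_unit:
  assumes z: "z \<in> \<O>"
  shows "1 + \<pi> * z \<noteq> 0" "inverse (1 + \<pi> * z) \<in> \<O>"
proof -
  define a where "a = - (\<pi> * z)"
  have a: "a \<in> \<O>" unfolding a_def by (intro O_intros z)
  have ak: "cg k (a ^ k) 0" for k
    unfolding a_def by (auto simp: cg_def power_minus[of "\<pi> * z"] power_mult_distrib intro!: bexI[of _ "(-1) ^ k * z ^ k"] O_intros z)
  define s where "s n = (\<Sum>j<n. a ^ j)" for n
  have sO: "s n \<in> \<O>" for n unfolding s_def by (intro O_intros a)
  have "cg k (s (Suc k)) (s k)" for k using cg_add[OF cg_refl[of k "s k"] ak[of k]] by (simp add: s_def)
  from limit[OF sO this] obtain y where y: "y \<in> \<O>" "\<And>k. cg k y (s k)" by blast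
  have "(1 - a) * y = 1"
  proof (rule cg_separated)
    fix k
    have "cg k ((1 - a) * y) ((1 - a) * s k)" using y by (intro cg_scale O_intros a)
    also have "(1 - a) * s k = 1 - a ^ k" unfolding s_def by (rule one_diff_power_eq[symmetric])
    also have "cg k (1 - a ^ k) (1 - 0)" by (intro cg_diff cg_refl ak)
    finally show "cg k ((1 - a) * y) 1" by simp
  qed (intro O_intros a y)+
  then have e: "(1 + \<pi> * z) * y = 1" by (simp add: a_def)
  then show "1 + \<pi> * z \<noteq> 0" by auto
  show "inverse (1 + \<pi> * z) \<in> \<O>" using e y(1) inverse_unique[OF e] by simp
qed

definition \<U> :: "'a set" where "\<U> = {x \<in> \<O>. x \<noteq> 0 \<and> inverse x \<in> \<O>}"

lemma U_O: "x \<in> \<U> \<Longrightarrow> x \<in> \<O>" and U_nz: "x \<in> \<U> \<Longrightarrow> x \<noteq> 0"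
  and U_inverse: "x \<in> \<U> \<Longrightarrow> inverse x \<in> \<U>" and U_one: "1 \<in> \<U>"
  and U_mult: "x \<in> \<U> \<Longrightarrow> y \<in> \<U> \<Longrightarrow> x * y \<in> \<U>"
  by (auto simp: \<U>_def O_one O_mult)

lemma U_power: "x \<in> \<U> \<Longrightarrow> x ^ n \<in> \<U>"
  by (induction n) (auto intro: U_one U_mult)

lemma U_power_int: "x \<in> \<U> \<Longrightarrow> x powi n \<in> \<U>"
  by (auto simp: power_int_def intro: U_power U_inverse)

lemma U_not_cg_0: "x \<in> \<U> \<Longrightarrow> \<not> cg 1 x 0"
proof
  assume x: "x \<in> \<U>" and "cg 1 x 0"
  then have "cg 1 (inverse x * x) (inverse x * 0)" by (intro cg_scale) (auto simp: \<U>_def)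
  then show False using x one_not_cg_0 by (simp add: \<U>_def)
qed

lemma P_gt_1: "P > 1"
proof -
  obtain k where "k \<ge> 1" "P = p ^ k" using P by blast
  then show "P > 1" using p_gt_1 by (metis one_less_power less_eq_Suc_le One_nat_def)
qed

lemma cg_power_P_iter:
  assumes "cg k x y" "k \<ge> 1" "x \<in> \<O>" "y \<in> \<O>"
  shows "cg (k + n) (x ^ (P ^ n)) (y ^ (P ^ n))"
proof -
  obtain j where j: "j \<ge> 1" "P = p ^ j" using P by blast
  have "cg (k + j * n) (x ^ (p ^ (j * n))) (y ^ (p ^ (j * n)))" by (rule cg_power_p_iter[OF assms])
  then have c: "cg (k + j * n) (x ^ (P ^ n)) (y ^ (P ^ n))" by (simp add: j power_mult)
  show ?thesis by (rule cg_mono[OF c]) (use j(1) in simp)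
qed

lemma teichmueller_unique:
  assumes "t \<in> \<O>" "u \<in> \<O>" "t ^ P = t" "u ^ P = u" "cg 1 t u"
  shows "t = u"
proof (rule cg_separated[OF assms(1,2)])
  fix k
  have iter: "t ^ (P ^ k) = t" if "t ^ P = t" for t :: 'a and k
    by (induction k) (use that in \<open>auto simp: power_mult\<close>)
  have "cg (1 + k) (t ^ (P ^ k)) (u ^ (P ^ k))" using assms by (intro cg_power_P_iter) auto
  then show "cg k t u" using iter assms by (auto intro: cg_mono)
qed

text \<open>The powers \<open>x^(P^n)\<close> converge because \<pi>-adic congruences improve under
  \<open>p\<close>-th powers; as \<open>P\<close>-th powers are trivial on residues, the limit has
  the residue of \<open>x\<close>.\<close>

lemma teichmueller:
  assumes x: "x \<in> \<O>"
  obtains t where "t \<in> \<O>" "t ^ P = t" "cg 1 x t"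
proof -
  define s where "s n = x ^ (P ^ n)" for n
  have sO: "s n \<in> \<O>" for n unfolding s_def by (intro O_intros x)
  have c: "cg (1 + k) (s (Suc k)) (s k)" for k
  proof -
    have "cg (1 + k) ((x ^ P) ^ (P ^ k)) (x ^ (P ^ k))" by (intro cg_power_P_iter cg_frob O_intros x) simp
    then show ?thesis by (simp add: s_def power_mult[symmetric])
  qed
  then have "cg k (s (Suc k)) (s k)" for k by (rule cg_mono) simp
  from limit[OF sO this] obtain t where t: "t \<in> \<O>" "\<And>k. cg k t (s k)" by blast
  have "t ^ P = t"
  proof (rule cg_separated)
    fix k
    have "cg k (t ^ P) (s k ^ P)" by (intro cg_power t sO)
    also have "s k ^ P = s (Suc k)" by (simp add: s_def power_mult[symmetric] mult.commute)
    also have "cg k (s (Suc k)) t" by (rule cg_mono[OF cg_sym[OF t(2)]]) simp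
    finally show "cg k (t ^ P) t" .
  qed (intro O_intros t)+
  moreover have "cg 1 x t"
  proof -
    have "cg 1 x (s 1)" using cg_sym[OF cg_frob[OF x]] by (simp add: s_def)
    then show ?thesis using cg_sym[OF t(2)[of 1]] by (rule cg_trans)
  qed
  ultimately show thesis using that t(1) by blast
qed

lemma teichmueller_unit: "t \<in> \<O> \<Longrightarrow> t ^ P = t \<Longrightarrow> t \<noteq> 0 \<Longrightarrow> t \<in> \<U>"
proof -
  assume t: "t \<in> \<O>" "t ^ P = t" "t \<noteq> 0"
  have "P = Suc (Suc (P - 2))" using P_gt_1 by simp
  then have "t * (t * t ^ (P - 2)) = t" using t(2) by (metis power_Suc)
  then have e: "t * t ^ (P - 2) = 1" using t(3) by simp
  have "inverse t = t ^ (P - 2)" using inverse_unique[OF e] .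
  then show ?thesis using t by (auto simp: \<U>_def O_power)
qed

text \<open>Locality of the ring is a consequence of the axioms: a nonzero Teichmueller
  representative satisfies \<open>t^(P-1) = 1\<close>, and \<open>x\<close> differs from it by a
  factor in \<open>1 + \<pi>\<O>\<close>.\<close>

lemma cg_0_or_unit:
  assumes x: "x \<in> \<O>" and "\<not> cg 1 x 0"
  shows "x \<in> \<U>"
proof -
  obtain t where t: "t \<in> \<O>" "t ^ P = t" "cg 1 x t" using teichmueller[OF x] .
  have "t \<noteq> 0" using t(3) assms(2) by auto
  then have tU: "t \<in> \<U>" using t by (intro teichmueller_unit)
  obtain z where z: "z \<in> \<O>" "x - t = \<pi> * z" using t(3) by (auto simp: cg_def)
  have zt: "z * inverse t \<in> \<O>" using z tU by (auto simp: \<U>_def O_mult)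
  have "x = t * (1 + \<pi> * (z * inverse t))" using z(2) \<open>t \<noteq> 0\<close> by (simp add: algebra_simps)
  moreover have "1 + \<pi> * (z * inverse t) \<in> \<U>"
    using one_plus_unit[OF zt] by (auto simp: \<U>_def intro!: O_intros zt)
  ultimately show ?thesis using U_mult[OF tU] by simp
qed

lemma cg_1_unit: "x \<in> \<O> \<Longrightarrow> cg 1 x y \<Longrightarrow> y \<in> \<U> \<Longrightarrow> x \<in> \<U>"
  using cg_0_or_unit[of x] U_not_cg_0[of y] cg_trans[OF cg_sym[of 1 x y], of 0] by blast

lemma cg_1_prime: "x \<in> \<O> \<Longrightarrow> y \<in> \<O> \<Longrightarrow> cg 1 (x * y) 0 \<Longrightarrow> cg 1 x 0 \<or> cg 1 y 0"
  using cg_0_or_unit U_mult U_not_cg_0 by blast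

lemma cg_1_prime_prod:
  "finite I \<Longrightarrow> (\<And>i. i \<in> I \<Longrightarrow> f i \<in> \<O>) \<Longrightarrow> cg 1 (prod f I) 0 \<Longrightarrow> \<exists>i\<in>I. cg 1 (f i) 0"
proof (induction I rule: finite_induct)
  case empty
  then show ?case using one_not_cg_0 by simp
next
  case (insert a I)
  then show ?case using cg_1_prime[of "f a" "prod f I"] O_prod[of I f] by auto
qed

lemma cg_inverse: "x \<in> \<U> \<Longrightarrow> y \<in> \<U> \<Longrightarrow> cg k x y \<Longrightarrow> cg k (inverse x) (inverse y)"
proof -
  assume xy: "x \<in> \<U>" "y \<in> \<U>" and c: "cg k x y"
  then have "cg k (inverse x * inverse y * y) (inverse x * inverse y * x)"
    by (intro cg_scale cg_sym[OF c]) (auto simp: \<U>_def O_mult)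
  moreover have "inverse x * inverse y * y = inverse x" "inverse x * inverse y * x = inverse y"
    using xy by (auto simp: U_nz mult.assoc mult.left_commute)
  ultimately show ?thesis by simp
qed

lemma cg_divide: "cg k x x' \<Longrightarrow> cg k y y' \<Longrightarrow> x \<in> \<O> \<Longrightarrow> y \<in> \<U> \<Longrightarrow> y' \<in> \<U> \<Longrightarrow> cg k (x / y) (x' / y')"
  unfolding divide_inverse by (intro cg_mult cg_inverse) (auto intro: U_O U_inverse)

lemma cg_power_int: "cg k x y \<Longrightarrow> x \<in> \<U> \<Longrightarrow> y \<in> \<U> \<Longrightarrow> cg k (x powi n) (y powi n)"
  by (auto simp: power_int_def intro!: cg_power cg_inverse U_O U_inverse)

lemma cg_cancel: "a \<in> \<U> \<Longrightarrow> cg k (a * x) (a * y) \<Longrightarrow> cg k x y"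
  using cg_scale[of "inverse a" k "a * x" "a * y"] by (auto simp: \<U>_def mult.assoc[symmetric])

text \<open>Formally \<open>1/(P - 1) = -(1 + P + P^2 + ...)\<close>. The infinite product
  \<open>z\<close> of the \<open>x^(P^i)\<close> satisfies \<open>z^P * x = z\<close>, so its
  inverse is the root.\<close>

lemma one_unit_root:
  assumes x: "x \<in> \<O>" "cg 1 x 1"
  shows "\<exists>y\<in>\<O>. cg 1 y 1 \<and> y ^ (P - 1) = x"
proof -
  define s where "s n = (\<Prod>i<n. x ^ (P ^ i))" for n
  have sO: "s n \<in> \<O>" for n unfolding s_def by (intro O_intros x)
  have xc: "cg (1 + k) (x ^ (P ^ k)) 1" for k
    using cg_power_P_iter[OF x(2) _ x(1) O_one, of k] by simp
  have c: "cg k (s (Suc k)) (s k)" for k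
  proof -
    have "cg k (s k * x ^ (P ^ k)) (s k * 1)" by (intro cg_scale sO cg_mono[OF xc]) simp
    then show ?thesis by (simp add: s_def)
  qed
  from limit[OF sO this] obtain z where z: "z \<in> \<O>" "\<And>k. cg k z (s k)" by blast
  have "cg 1 z x" using z(2)[of 1] by (simp add: s_def)
  then have z1: "cg 1 z 1" using x(2) by (rule cg_trans)
  have zU: "z \<in> \<U>" by (rule cg_1_unit[OF z(1) z1 U_one])
  have "z ^ P * x = z"
  proof (rule cg_separated)
    fix k
    have "cg k (z ^ P * x) (s k ^ P * x)" by (intro cg_mult cg_power cg_refl z sO O_intros x)
    also have "s k ^ P * x = s (Suc k)"
      unfolding s_def prod.lessThan_Suc_shift by (simp add: prod_power_distrib power_mult[symmetric] mult.commute)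
    also have "cg k (s (Suc k)) z" by (rule cg_mono[OF cg_sym[OF z(2)]]) simp
    finally show "cg k (z ^ P * x) z" .
  qed (intro O_intros z x)+
  then have "z * (z ^ (P - 1) * x) = z * 1" using P_gt_1 by (cases P) (auto simp: mult.assoc)
  then have "z ^ (P - 1) * x = 1" using U_nz[OF zU] by simp
  then have "inverse z ^ (P - 1) = x" by (simp add: power_inverse inverse_unique)
  moreover have "cg 1 (inverse z) 1" using cg_inverse[OF zU U_one z1] by simp
  ultimately show ?thesis using zU by (intro bexI[of _ "inverse z"]) (auto simp: \<U>_def)
qed

lemma one_unit_root_iter:
  assumes "x \<in> \<O>" "cg 1 x 1"
  shows "\<exists>y\<in>\<O>. cg 1 y 1 \<and> y ^ ((P - 1) ^ k) = x"
proof (induction k)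
  case 0
  show ?case using assms by (intro bexI[of _ x]) auto
next
  case (Suc k)
  then obtain y where y: "y \<in> \<O>" "cg 1 y 1" "y ^ ((P - 1) ^ k) = x" by blast
  obtain w where w: "w \<in> \<O>" "cg 1 w 1" "w ^ (P - 1) = y" using one_unit_root[OF y(1,2)] by blast
  then show ?case using y by (intro bexI[of _ w]) (auto simp: power_mult)
qed

text \<open>The exponent \<open>P\<close> can be enlarged at will; this is used to make
  \<open>P^j - 1\<close> divisible by a given number prime to \<open>p\<close>.\<close>

lemma adic_power:
  assumes "j \<ge> 1" shows "adic F \<O> \<pi> p (P ^ j)"
proof
  show "\<exists>k\<ge>1. P ^ j = p ^ k"
  proof -
    obtain k where k: "k \<ge> 1" "P = p ^ k" using P by blast
    then show ?thesis using assms by (intro exI[of _ "k * j"]) (auto simp: power_mult)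
  qed
  show "\<exists>z\<in>\<O>. x ^ (P ^ j) - x = \<pi> * z" if x: "x \<in> \<O>" for x
  proof -
    have "cg 1 (x ^ (P ^ j)) x"
    proof (induction j)
      case (Suc j)
      have "cg 1 ((x ^ (P ^ j)) ^ P) (x ^ (P ^ j))" by (intro cg_frob O_intros x)
      then show ?case using Suc by (auto simp: power_mult[symmetric] mult.commute intro: cg_trans)
    qed simp
    then show ?thesis by (simp add: cg_def)
  qed
  show "\<exists>y\<in>\<O>. \<forall>k. \<exists>z\<in>\<O>. y - s k = \<pi> ^ k * z"
    if "\<And>k. s k \<in> \<O>" "\<And>k. \<exists>z\<in>\<O>. s (Suc k) - s k = \<pi> ^ k * z" for s
    using that by (rule complete)
qed (use O_sub pi_nz frac proper in auto)

lemma dvd_power_minus_one: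
  assumes e: "\<not> p dvd e" shows "\<exists>j\<ge>1. e dvd P ^ j - 1"
proof -
  have e0: "e \<noteq> 0" using e by (metis dvd_0_right)
  have "coprime P e" using P p e by (auto simp: coprime_power_left_iff prime_imp_coprime)
  have "\<exists>i j. i < j \<and> P ^ i mod e = P ^ j mod e"
  proof -
    have "\<not> inj (\<lambda>i. P ^ i mod e)"
    proof
      assume "inj (\<lambda>i. P ^ i mod e)"
      moreover have "range (\<lambda>i. P ^ i mod e) \<subseteq> {..<e}" using e0 by auto
      ultimately show False using finite_subset[of _ "{..<e}"] finite_imageD[of "\<lambda>i. P ^ i mod e" UNIV] by auto
    qed
    then obtain i j where "i \<noteq> j" "P ^ i mod e = P ^ j mod e" by (auto simp: inj_def)
    then show ?thesis by (metis linorder_neqE_nat)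
  qed
  then obtain i j where ij: "i < j" "P ^ i mod e = P ^ j mod e" by blast
  have "P ^ i \<le> P ^ j" using P_gt_1 ij(1) by (intro power_increasing) auto
  then have "e dvd P ^ j - P ^ i" using mod_eq_dvd_iff_nat[of "P ^ i" "P ^ j" e] ij(2) by simp
  also have "P ^ j - P ^ i = P ^ i * (P ^ (j - i) - 1)"
    using ij by (simp add: algebra_simps power_add[symmetric])
  finally have "e dvd P ^ (j - i) - 1"
    using \<open>coprime P e\<close> by (simp add: coprime_dvd_mult_right_iff coprime_commute)
  then show ?thesis using ij by (intro exI[of _ "j - i"]) simp
qed

lemma one_unit_root_coprime:
  assumes x: "x \<in> \<O>" "cg 1 x 1" and e: "\<not> p dvd e"
  shows "\<exists>y\<in>\<O>. cg 1 y 1 \<and> y ^ e = x"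
proof -
  obtain j where j: "j \<ge> 1" "e dvd P ^ j - 1" using dvd_power_minus_one[OF e] by blast
  interpret Pj: adic F \<O> \<pi> p "P ^ j" by (rule adic_power[OF j(1)])
  obtain y where y: "y \<in> \<O>" "cg 1 y 1" "y ^ (P ^ j - 1) = x" using Pj.one_unit_root[OF x] by blast
  obtain m where m: "P ^ j - 1 = e * m" using j(2) by (elim dvdE)
  have "(y ^ m) ^ e = x" using y(3) m by (simp add: power_mult[symmetric] mult.commute)
  moreover have "cg 1 (y ^ m) 1" using cg_power[OF y(2,1) O_one, of m] by simp
  ultimately show ?thesis using O_power[OF y(1)] by blast
qed

text \<open>For a suitable \<open>j\<close> both \<open>x\<close> and \<open>x^P\<close> are fixed
  by the \<open>P^j\<close>-th power map. They are congruent, hence equal by uniqueness of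
  Teichmueller representatives.\<close>

lemma root_of_unity:
  assumes x: "x \<in> \<O>" "x ^ e = 1" and e: "\<not> p dvd e"
  shows "x ^ P = x"
proof -
  obtain j where j: "j \<ge> 1" "e dvd P ^ j - 1" using dvd_power_minus_one[OF e] by blast
  interpret Pj: adic F \<O> \<pi> p "P ^ j" by (rule adic_power[OF j(1)])
  obtain m where m: "P ^ j - 1 = e * m" using j(2) by (elim dvdE)
  have "0 < P ^ j" using P_gt_1 by simp
  then have "P ^ j = Suc (e * m)" using m by linarith
  then have "x ^ (P ^ j) = x" using x(2) by (simp add: power_mult)
  moreover have "(x ^ P) ^ (P ^ j) = (x ^ (P ^ j)) ^ P"
    unfolding power_mult[symmetric] mult.commute[of P "P ^ j"] ..
  ultimately show ?thesis
    using Pj.teichmueller_unique[OF O_power[OF x(1), of P] x(1) _ _ cg_frob[OF x(1)]] by simp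
qed

definition mideal :: "'a set" where "mideal = {x \<in> \<O>. cg 1 x 0}"

sublocale res: local_dom \<O> mideal
proof
  show "inverse x \<in> \<O>" if "x \<in> \<O>" "x \<notin> mideal" for x
    using cg_0_or_unit[of x] that by (auto simp: \<U>_def mideal_def)
  show "x * y \<in> mideal" if "x \<in> mideal" "y \<in> \<O>" for x y
    using that cg_mult[of 1 x 0 y y] by (auto intro: O_mult simp: mideal_def)
  show "x + y \<in> mideal" if "x \<in> mideal" "y \<in> mideal" for x y
    using that cg_add[of 1 x 0 y 0] by (auto intro: O_add simp: mideal_def)
qed (use one_not_cg_0 in \<open>auto intro: O_intros simp: mideal_def\<close>)

lemma finite_residues: "finite (carrier res.RF)"
proof -
  have "carrier res.RF \<subseteq> res.cl ` {t. poly (Polynomial.monom 1 P - [:0, 1:]) t = 0}"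
  proof
    fix c assume "c \<in> carrier res.RF"
    then obtain x where x: "x \<in> \<O>" "c = res.cl x" unfolding res.carrier_k by blast
    obtain t where t: "t \<in> \<O>" "t ^ P = t" "cg 1 x t" using teichmueller[OF x(1)] .
    have "cg 1 (x - t) 0" using cg_diff[OF t(3) cg_refl[of 1 t]] by simp
    then have "c = res.cl t" using x t res.cl_eq[of x t] by (auto intro: O_diff simp: mideal_def)
    then show "c \<in> res.cl ` {t. poly (Polynomial.monom 1 P - [:0, 1:]) t = 0}"
      using t by (auto simp: poly_monom)
  qed
  moreover have "Polynomial.monom 1 P - [:0, 1:] \<noteq> (0 :: 'a poly)"
  proof
    assume "Polynomial.monom 1 P - [:0, 1:] = (0 :: 'a poly)"
    then have "Polynomial.coeff (Polynomial.monom 1 P - [:0, 1:] :: 'a poly) P = 0" by simp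
    then show False using P_gt_1 by (cases P) (auto simp: coeff_pCons split: nat.splits)
  qed
  ultimately show ?thesis using poly_roots_finite finite_subset by blast
qed

text \<open>The Teichmueller lift of a generator of the multiplicative group of the residue
  field.\<close>

lemma generator:
  obtains \<rho> where "\<rho> \<in> \<O>" "\<rho> ^ P = \<rho>" "\<rho> \<noteq> 0" "\<And>x. x \<in> \<O> \<Longrightarrow> cg 1 x 0 \<or> (\<exists>i. cg 1 x (\<rho> ^ i))"
    "\<And>t. t \<in> \<O> \<Longrightarrow> t ^ P = t \<Longrightarrow> t \<noteq> 0 \<Longrightarrow> \<exists>i. t = \<rho> ^ i"
proof -
  obtain g where g: "g \<in> \<O>" "\<not> cg 1 g 0" and gen: "\<And>x. x \<in> \<O> \<Longrightarrow> cg 1 x 0 \<or> (\<exists>i::nat. cg 1 (x - g ^ i) 0)"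
    using res.residue_generator[OF finite_residues] unfolding mideal_def by blast
  obtain \<rho> where \<rho>: "\<rho> \<in> \<O>" "\<rho> ^ P = \<rho>" "cg 1 g \<rho>" using teichmueller[OF g(1)] .
  have "\<rho> \<noteq> 0" using g(2) \<rho>(3) by auto
  have res: "cg 1 x 0 \<or> (\<exists>i. cg 1 x (\<rho> ^ i))" if x: "x \<in> \<O>" for x
  proof (cases "cg 1 x 0")
    case False
    then obtain i :: nat where "cg 1 (x - g ^ i) 0" using gen[OF x] by blast
    then have "cg 1 x (g ^ i)" using cg_add[of 1 "x - g ^ i" 0 "g ^ i" "g ^ i"] by simp
    also have "cg 1 (g ^ i) (\<rho> ^ i)" by (intro cg_power g \<rho>)
    finally show ?thesis by blast
  qed simp
  have "\<exists>i. t = \<rho> ^ i" if t: "t \<in> \<O>" "t ^ P = t" "t \<noteq> 0" for t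
  proof -
    have "\<not> cg 1 t 0" using teichmueller_unit[OF t] U_not_cg_0 by blast
    then obtain i where "cg 1 t (\<rho> ^ i)" using res[OF t(1)] by blast
    moreover have "(\<rho> ^ i) ^ P = \<rho> ^ i"
      using power_mult[of \<rho> i P] power_mult[of \<rho> P i] \<rho>(2) by (simp only: mult.commute[of i P])
    ultimately have "t = \<rho> ^ i"
      using teichmueller_unique[OF t(1) O_power[OF \<rho>(1)] t(2), of i] by simp
    then show ?thesis by blast
  qed
  then show thesis by (intro that[OF \<rho>(1,2) \<open>\<rho> \<noteq> 0\<close> res])
qed

end

subsection \<open>The valuation\<close>

context adic
begin

lemma decomposition_O:
  assumes "x \<in> \<O>" "x \<noteq> 0"
  shows "\<exists>k. \<exists>u\<in>\<U>. x = \<pi> ^ k * u"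
proof -
  have "\<exists>k. \<not> cg k x 0" using cg_separated[OF assms(1) O_zero] assms(2) by blast
  then obtain k where k: "\<not> cg (LEAST k. \<not> cg k x 0) x 0" by (metis LeastI)
  define m where "m = (LEAST k. \<not> cg k x 0)"
  have "m \<noteq> 0" using k cg_0[OF assms(1) O_zero] unfolding m_def by metis
  then obtain j where j: "m = Suc j" by (cases m) auto
  have "cg j x 0" using not_less_Least[of j "\<lambda>k. \<not> cg k x 0"] j unfolding m_def by auto
  then obtain u where u: "u \<in> \<O>" "x = \<pi> ^ j * u" by (auto simp: cg_def)
  have "\<not> cg 1 u 0"
  proof
    assume "cg 1 u 0"
    then have "cg (j + 1) (\<pi> ^ j * u) (\<pi> ^ j * 0)" by (rule cg_shift)
    then show False using k j u unfolding m_def by simp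
  qed
  then have "u \<in> \<U>" by (rule cg_0_or_unit[OF u(1)])
  then show ?thesis using u(2) by blast
qed

lemma decomposition:
  assumes "x \<in> F" "x \<noteq> 0"
  shows "\<exists>k::int. \<exists>u\<in>\<U>. x = \<pi> powi k * u"
proof -
  obtain n where n: "\<pi> ^ n * x \<in> \<O>" using frac[OF assms(1)] by blast
  then obtain k u where u: "u \<in> \<U>" "\<pi> ^ n * x = \<pi> ^ k * u"
    using decomposition_O[of "\<pi> ^ n * x"] assms(2) pi_nz by auto
  have "x = inverse (\<pi> ^ n) * (\<pi> ^ n * x)" using pi_nz by simp
  also have "\<dots> = \<pi> powi (int k - int n) * u"
    unfolding u(2) using pi_nz by (simp add: power_int_diff divide_inverse mult.commute)
  finally show ?thesis using u(1) by blast
qed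

lemma pi_power_unit: "\<pi> powi k \<in> \<U> \<Longrightarrow> k = 0"
proof (rule ccontr)
  assume k: "\<pi> powi k \<in> \<U>" "k \<noteq> 0"
  have "\<pi> ^ nat \<bar>k\<bar> \<in> \<U>"
    using k(1) U_inverse[OF k(1)] by (auto simp: power_int_def power_inverse split: if_splits)
  moreover obtain n where n: "nat \<bar>k\<bar> = Suc n" using k(2) by (cases "nat \<bar>k\<bar>") auto
  ultimately have "\<not> cg 1 (\<pi> * \<pi> ^ n) 0" using U_not_cg_0 by auto
  then show False using cg_pi_mult[OF O_power[OF pi_in]] by blast
qed

text \<open>The valuation normalised by \<open>ord \<pi> = 1\<close>. In a ramified extension with
  its own uniformiser it is therefore multiplied by the ramification index, unlike the
  rational-valued \<open>v\<close>.\<close>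

definition ord :: "'a \<Rightarrow> int"
  where "ord x = (THE k. \<exists>u\<in>\<U>. x = \<pi> powi k * u)"

lemma ord_eqI:
  assumes "u \<in> \<U>" "x = \<pi> powi k * u"
  shows "ord x = k"
  unfolding ord_def
proof (rule the_equality)
  show "\<exists>u\<in>\<U>. x = \<pi> powi k * u" using assms by blast
  fix j assume "\<exists>u\<in>\<U>. x = \<pi> powi j * u"
  then obtain w where w: "w \<in> \<U>" "x = \<pi> powi j * w" by blast
  have "\<pi> powi (j - k) = u * inverse w"
  proof -
    have "a / c = u * inverse w" if "c * u = a * w" "c \<noteq> 0" for a c :: 'a
      using that U_nz[OF w(1)] by (simp add: field_simps)
    then show ?thesis using assms(2) w(2) pi_nz by (simp add: power_int_diff)
  qed
  then have "\<pi> powi (j - k) \<in> \<U>" using U_mult[OF assms(1) U_inverse[OF w(1)]] by simp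
  then have "j - k = 0" by (rule pi_power_unit)
  then show "j = k" by simp
qed

lemma ord_decomp:
  assumes "x \<in> F" "x \<noteq> 0"
  obtains u where "u \<in> \<U>" "x = \<pi> powi ord x * u"
proof -
  obtain k u where ku: "u \<in> \<U>" "x = \<pi> powi k * u" using decomposition[OF assms] by blast
  then have "ord x = k" by (rule ord_eqI)
  then show thesis using that ku by simp
qed

lemma ord_mult: "x \<in> F \<Longrightarrow> y \<in> F \<Longrightarrow> x \<noteq> 0 \<Longrightarrow> y \<noteq> 0 \<Longrightarrow> ord (x * y) = ord x + ord y"
proof -
  assume x: "x \<in> F" "x \<noteq> 0" and y: "y \<in> F" "y \<noteq> 0"
  obtain u where u: "u \<in> \<U>" "x = \<pi> powi ord x * u" by (rule ord_decomp[OF x])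
  obtain w where w: "w \<in> \<U>" "y = \<pi> powi ord y * w" by (rule ord_decomp[OF y])
  have "x * y = (\<pi> powi ord x * u) * (\<pi> powi ord y * w)" using u(2) w(2) by simp
  also have "\<dots> = \<pi> powi (ord x + ord y) * (u * w)" using pi_nz by (simp add: power_int_add)
  finally show ?thesis by (rule ord_eqI[OF U_mult[OF u(1) w(1)]])
qed

lemma ord_U: "u \<in> \<U> \<Longrightarrow> ord u = 0"
  by (rule ord_eqI[of u]) auto

lemma ord_one: "ord 1 = 0"
  by (rule ord_U[OF U_one])

lemma ord_pi: "ord \<pi> = 1"
  by (rule ord_eqI[OF U_one]) simp

lemma ord_inverse: "x \<in> F \<Longrightarrow> x \<noteq> 0 \<Longrightarrow> ord (inverse x) = - ord x"
  using ord_mult[of x "inverse x"] by (simp add: inverse_closed ord_one)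

lemma ord_power: "x \<in> F \<Longrightarrow> x \<noteq> 0 \<Longrightarrow> ord (x ^ n) = int n * ord x"
  by (induction n) (auto simp: ord_one ord_mult power_closed algebra_simps)

lemma ord_prod: "(\<And>i. i \<in> I \<Longrightarrow> f i \<in> F \<and> f i \<noteq> 0) \<Longrightarrow> ord (prod f I) = (\<Sum>i\<in>I. ord (f i))"
  by (induction I rule: infinite_finite_induct) (auto simp: ord_one ord_mult prod_closed)

lemma ord_power_int: "x \<in> F \<Longrightarrow> x \<noteq> 0 \<Longrightarrow> ord (x powi n) = n * ord x"
  by (auto simp: power_int_def ord_power inverse_closed ord_inverse)

lemma ord_0_U: "x \<in> F \<Longrightarrow> x \<noteq> 0 \<Longrightarrow> ord x = 0 \<Longrightarrow> x \<in> \<U>"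
  using ord_decomp[of x] by auto

lemma ord_nonneg: "x \<in> F \<Longrightarrow> x \<noteq> 0 \<Longrightarrow> 0 \<le> ord x \<longleftrightarrow> x \<in> \<O>"
proof
  assume x: "x \<in> F" "x \<noteq> 0"
  obtain u where u: "u \<in> \<U>" "x = \<pi> powi ord x * u" by (rule ord_decomp[OF x])
  {
    assume "0 \<le> ord x"
    then have "\<pi> powi ord x = \<pi> ^ nat (ord x)" by (simp add: power_int_def)
    then have "\<pi> powi ord x * u \<in> \<O>" by (simp add: O_mult O_power pi_in U_O[OF u(1)])
    then show "x \<in> \<O>" using u(2) by simp
  next
    assume "x \<in> \<O>"
    then obtain k w where "w \<in> \<U>" "x = \<pi> ^ k * w" using decomposition_O x by blast
    then have "ord x = int k" by (intro ord_eqI[of w]) auto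
    then show "0 \<le> ord x" by simp
  }
qed

lemma ord_cg: "x \<in> \<O> \<Longrightarrow> x \<noteq> 0 \<Longrightarrow> cg k x 0 \<longleftrightarrow> int k \<le> ord x"
proof
  assume x: "x \<in> \<O>" "x \<noteq> 0"
  have xF: "x \<in> F" using x O_sub by auto
  {
    assume "cg k x 0"
    then obtain z where z: "z \<in> \<O>" "x = \<pi> ^ k * z" by (auto simp: cg_def)
    then have "ord x = int k + ord z" using x O_sub pi_in
      by (auto simp: ord_mult ord_power ord_pi ord_one power_closed subsetD)
    moreover have "0 \<le> ord z" using z x O_sub by (subst ord_nonneg) auto
    ultimately show "int k \<le> ord x" by simp
  next
    assume k: "int k \<le> ord x"
    have "x * inverse (\<pi> ^ k) \<in> \<O>"
      using x xF k pi_nz O_sub pi_in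
      by (subst ord_nonneg[symmetric]) (auto simp: ord_mult ord_inverse ord_power ord_pi power_closed inverse_closed mult_closed subsetD)
    then show "cg k x 0" using pi_nz unfolding cg_def by (intro bexI[of _ "x * inverse (\<pi> ^ k)"]) auto
  }
qed

lemma O_inter_units: "x \<in> F \<Longrightarrow> x \<notin> \<O> \<Longrightarrow> \<exists>z\<in>\<O>. inverse x = \<pi> * z"
proof -
  assume x: "x \<in> F" "x \<notin> \<O>"
  then have nz: "x \<noteq> 0" using O_zero by auto
  then have "0 < ord (inverse x)" using x ord_nonneg[OF x(1) nz] ord_inverse[OF x(1) nz] by simp
  then have "cg 1 (inverse x) 0" using x nz inverse_closed ord_nonneg[of "inverse x"]
    by (subst ord_cg) auto
  then show ?thesis by (auto simp: cg_def)
qed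

end

section \<open>Adjoining an algebraic element\<close>

definition adjoin :: "'a::comm_ring_1 set \<Rightarrow> 'a \<Rightarrow> 'a set"
  where "adjoin F x = {poly g x | g. g \<in> polys_over F}"

lemma adjoinI: "g \<in> polys_over F \<Longrightarrow> poly g x \<in> adjoin F x"
  by (auto simp: adjoin_def)

lemma polys_over_const: "0 \<in> F \<Longrightarrow> c \<in> F \<Longrightarrow> [:c:] \<in> polys_over F"
  by (auto simp: polys_over_def coeff_pCons split: nat.splits)

lemma adjoin_base: "0 \<in> F \<Longrightarrow> F \<subseteq> adjoin F x"
proof
  fix c assume "0 \<in> F" "c \<in> F"
  then show "c \<in> adjoin F x" using adjoinI[of "[:c:]" F x] polys_over_const[of F c] by auto
qed

lemma adjoin_gen: "0 \<in> F \<Longrightarrow> 1 \<in> F \<Longrightarrow> x \<in> adjoin F x"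
  using adjoinI[of "[:0, 1:]" F x] by (auto simp: polys_over_def coeff_pCons split: nat.splits)

context subfld
begin

lemma minimal_poly:
  assumes "p \<in> polys_over F" "p \<noteq> 0" "poly p x = 0"
  shows "\<exists>g\<in>polys_over F. Polynomial.lead_coeff g = 1 \<and> poly g x = 0 \<and>
    (\<forall>q\<in>polys_over F. poly q x = 0 \<longrightarrow> (\<exists>h\<in>polys_over F. q = g * h) \<and>
      (q \<noteq> 0 \<longrightarrow> Polynomial.degree g \<le> Polynomial.degree q))"
proof -
  define Q where "Q n = (\<exists>q\<in>polys_over F. q \<noteq> 0 \<and> poly q x = 0 \<and> Polynomial.degree q = n)" for n
  define n where "n = (LEAST n. Q n)"
  have "Q n" unfolding n_def using assms by (intro LeastI[of Q "Polynomial.degree p"]) (auto simp: Q_def)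
  then obtain f where f: "f \<in> polys_over F" "f \<noteq> 0" "poly f x = 0" "Polynomial.degree f = n" by (auto simp: Q_def)
  have min: "n \<le> Polynomial.degree q" if "q \<in> polys_over F" "q \<noteq> 0" "poly q x = 0" for q
    unfolding n_def by (rule Least_le) (use that in \<open>auto simp: Q_def\<close>)
  define g where "g = Polynomial.smult (inverse (Polynomial.lead_coeff f)) f"
  have lc: "Polynomial.lead_coeff f \<noteq> 0" "Polynomial.lead_coeff f \<in> F" using f by (auto simp: polys_over_def)
  have g: "g \<in> polys_over F" "Polynomial.lead_coeff g = 1" "poly g x = 0" "Polynomial.degree g = n" "g \<noteq> 0"
    unfolding g_def using f lc by (auto intro: polys_smult inverse_closed)
  have div: "\<exists>h\<in>polys_over F. q = g * h" if q: "q \<in> polys_over F" "poly q x = 0" for q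
  proof -
    obtain h r where hr: "h \<in> polys_over F" "r \<in> polys_over F" "q = g * h + r"
      "r = 0 \<or> Polynomial.degree r < Polynomial.degree g"
      using polys_division[OF g(1) g(5) q(1)] by blast
    have "poly r x = 0" using q(2) g(3) unfolding hr(3) by simp
    then have "r = 0" using min[OF hr(2)] hr(4) g(4) by (cases "r = 0") auto
    then show ?thesis using hr by auto
  qed
  have "Polynomial.degree g \<le> Polynomial.degree q" if "q \<in> polys_over F" "poly q x = 0" "q \<noteq> 0" for q
    using min[OF that(1,3,2)] g(4) by simp
  then show ?thesis using g(1-3) div by (intro bexI[of _ g]) simp_all
qed

text \<open>Inverses come from a Euclidean descent: dividing the minimal polynomial \<open>g\<close>
  by \<open>q\<close> expresses the inverse of \<open>q(x)\<close> through that of the remainder at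
  \<open>x\<close>, and the remainder has smaller degree.\<close>

lemma adjoin_subfld:
  assumes "p \<in> polys_over F" "p \<noteq> 0" "poly p x = 0"
  shows "subfld (adjoin F x)"
proof -
  obtain g where g: "g \<in> polys_over F" "Polynomial.lead_coeff g = 1" "poly g x = 0"
    and min: "\<And>q. q \<in> polys_over F \<Longrightarrow> poly q x = 0 \<Longrightarrow> q \<noteq> 0 \<Longrightarrow> Polynomial.degree g \<le> Polynomial.degree q"
    using minimal_poly[OF assms] by blast
  have g0: "g \<noteq> 0" using g(2) by auto
  have mult: "a * b \<in> adjoin F x" if ab: "a \<in> adjoin F x" "b \<in> adjoin F x" for a b
  proof -
    obtain q r where "q \<in> polys_over F" "a = poly q x" "r \<in> polys_over F" "b = poly r x"
      using ab by (auto simp: adjoin_def)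
    then show ?thesis using adjoinI[of "q * r" F x] polys_mult[of q r] by simp
  qed
  have uminus: "- a \<in> adjoin F x" if a: "a \<in> adjoin F x" for a
  proof -
    obtain q where "q \<in> polys_over F" "a = poly q x" using a by (auto simp: adjoin_def)
    then show ?thesis using adjoinI[of "0 - q" F x] polys_diff[OF polys_0, of q] by simp
  qed
  have inv: "inverse (poly q x) \<in> adjoin F x" if "q \<in> polys_over F" "q \<noteq> 0" "Polynomial.degree q < Polynomial.degree g" for q
    using that
  proof (induction "Polynomial.degree q" arbitrary: q rule: less_induct)
    case less
    show ?case
    proof (cases "Polynomial.degree q = 0")
      case True
      then have "q = [:Polynomial.coeff q 0:]" by (simp add: degree_0_id)
      then have "poly q x = Polynomial.coeff q 0" by (metis poly_const_conv)
      moreover have "inverse (Polynomial.coeff q 0) \<in> F" using less.prems by (auto simp: polys_over_def intro: inverse_closed)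
      ultimately show ?thesis using adjoin_base[of F x] by auto
    next
      case False
      obtain h r where hr: "h \<in> polys_over F" "r \<in> polys_over F" "g = q * h + r"
        "r = 0 \<or> Polynomial.degree r < Polynomial.degree q"
        using polys_division[OF less.prems(1,2) g(1)] by blast
      have qx: "poly q x \<noteq> 0" using min[OF less.prems(1)] less.prems by auto
      have "r \<noteq> 0"
      proof
        assume "r = 0"
        then have e: "g = q * h" using hr(3) by simp
        then have "poly h x = 0" using g(3) qx by simp
        moreover have "h \<noteq> 0" using e g0 by auto
        ultimately have "Polynomial.degree g \<le> Polynomial.degree h" using min[OF hr(1)] by blast
        moreover have "Polynomial.degree g = Polynomial.degree q + Polynomial.degree h"
          unfolding e using \<open>h \<noteq> 0\<close> less.prems by (intro degree_mult_eq) auto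
        ultimately show False using False by simp
      qed
      then have dr: "Polynomial.degree r < Polynomial.degree q" using hr(4) by simp
      have ir: "inverse (poly r x) \<in> adjoin F x"
        using less.hyps[OF dr hr(2) \<open>r \<noteq> 0\<close>] dr less.prems by simp
      have rx: "poly r x \<noteq> 0" using min[OF hr(2)] \<open>r \<noteq> 0\<close> dr less.prems by fastforce
      have "poly r x = - (poly q x * poly h x)"
        using g(3) unfolding hr(3) by (simp add: add_eq_0_iff)
      then have "inverse (poly q x) = - (poly h x * inverse (poly r x))"
        using rx qx by (simp add: field_simps)
      then show ?thesis using uminus[OF mult[OF adjoinI[OF hr(1)] ir]] by simp
    qed
  qed
  show ?thesis
  proof
    show "0 \<in> adjoin F x" "1 \<in> adjoin F x" using adjoinI[of 0 F x] adjoinI[of 1 F x] by auto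
    show "a + b \<in> adjoin F x" if ab: "a \<in> adjoin F x" "b \<in> adjoin F x" for a b
    proof -
      obtain q r where "q \<in> polys_over F" "a = poly q x" "r \<in> polys_over F" "b = poly r x"
        using ab by (auto simp: adjoin_def)
      then show ?thesis using adjoinI[of "q + r" F x] polys_add[of q r] by simp
    qed
    show "inverse a \<in> adjoin F x" if a: "a \<in> adjoin F x" for a
    proof (cases "a = 0")
      case False
      obtain q where q: "q \<in> polys_over F" "a = poly q x" using a by (auto simp: adjoin_def)
      obtain h r where hr: "h \<in> polys_over F" "r \<in> polys_over F" "q = g * h + r"
        "r = 0 \<or> Polynomial.degree r < Polynomial.degree g"
        using polys_division[OF g(1) g0 q(1)] by blast
      have "a = poly r x" using q(2) g(3) unfolding hr(3) by simp
      then show ?thesis using inv[of r] hr False by (cases "r = 0") auto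
    qed (use adjoinI[of 0 F x] in auto)
  qed (auto intro: mult uminus)
qed

end

lemma endo_eq_adjoin:
  assumes f: "fld_endo F f" and g: "fld_endo F' g" and K: "K \<subseteq> F" "K \<subseteq> F'" "x \<in> F" "x \<in> F'"
    and eq: "\<And>a. a \<in> K \<Longrightarrow> f a = g a" "f x = g x" and a: "a \<in> adjoin K x"
  shows "f a = g a"
proof -
  interpret f: fld_endo F f by fact
  interpret g: fld_endo F' g by fact
  obtain q where q: "q \<in> polys_over K" "a = poly q x" using a by (auto simp: adjoin_def)
  have qF: "q \<in> polys_over F" "q \<in> polys_over F'" using q(1) K by (auto simp: polys_over_def)
  have "map_poly f q = map_poly g q"
    using q(1) eq(1) by (intro poly_eqI) (auto simp: coeff_map_poly f.endo_zero g.endo_zero polys_over_def)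
  then show ?thesis unfolding q(2) f.poly_map_poly[OF qF(1) K(3), symmetric] g.poly_map_poly[OF qF(2) K(4), symmetric]
    by (simp add: eq(2))
qed

section \<open>Adjoining roots of unity\<close>

locale adic_ext = adic +
  fixes \<rho> :: 'a
  assumes rho_P: "\<rho> ^ P = \<rho>" and rho_nz: "\<rho> \<noteq> 0"
begin

definition M where "M = adjoin F \<rho>"
definition OM where "OM = adjoin \<O> \<rho>"
definition n where "n = (LEAST m. 0 < m \<and> \<rho> ^ m = 1)"

lemma n_pos: "0 < n" and rho_n: "\<rho> ^ n = 1" and n_least: "0 < m \<Longrightarrow> \<rho> ^ m = 1 \<Longrightarrow> n \<le> m"
proof -
  have "\<rho> ^ (P - 1) = 1" using rho_P rho_nz P_gt_1 by (cases P) auto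
  then have "0 < P - 1 \<and> \<rho> ^ (P - 1) = 1" using P_gt_1 by simp
  from LeastI[of "\<lambda>m. 0 < m \<and> \<rho> ^ m = 1", OF this] show "0 < n" "\<rho> ^ n = 1" by (auto simp: n_def)
  show "0 < m \<Longrightarrow> \<rho> ^ m = 1 \<Longrightarrow> n \<le> m" unfolding n_def by (rule Least_le) auto
qed

lemma rho_mod: "\<rho> ^ (i mod n) = \<rho> ^ i"
proof -
  have "\<rho> ^ i = \<rho> ^ (i mod n + n * (i div n))" by simp
  also have "\<dots> = \<rho> ^ (i mod n)" unfolding power_add power_mult by (simp add: rho_n)
  finally show ?thesis by simp
qed

lemma rho_inj: "inj_on (\<lambda>i. \<rho> ^ i) {..<n}"
proof (rule linorder_inj_onI')
  fix i j assume ij: "i \<in> {..<n}" "j \<in> {..<n}" "i < j"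
  show "\<rho> ^ i \<noteq> \<rho> ^ j"
  proof
    assume "\<rho> ^ i = \<rho> ^ j"
    moreover have "\<rho> ^ j = \<rho> ^ i * \<rho> ^ (j - i)" using ij by (simp add: power_add[symmetric])
    ultimately have "\<rho> ^ (j - i) = 1" using rho_nz by simp
    then show False using n_least[of "j - i"] ij by simp
  qed
qed

lemma roots_of_unity: "x ^ n = 1 \<Longrightarrow> \<exists>i<n. x = \<rho> ^ i"
proof -
  assume x: "x ^ n = 1"
  let ?f = "Polynomial.monom 1 n - 1 :: 'a poly"
  have df: "Polynomial.degree ?f = n" using n_pos
    unfolding diff_conv_add_uminus
    by (subst Polynomial.degree_add_eq_left) (auto simp: Polynomial.degree_monom_eq)
  then have f0: "?f \<noteq> 0" using n_pos by auto
  have sub: "(\<lambda>i. \<rho> ^ i) ` {..<n} \<subseteq> {x. poly ?f x = 0}"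
  proof safe
    fix i
    have "(\<rho> ^ i) ^ n = (\<rho> ^ n) ^ i" unfolding power_mult[symmetric] by (simp add: mult.commute)
    then show "poly ?f (\<rho> ^ i) = 0" by (simp add: poly_monom rho_n)
  qed
  have "card {x. poly ?f x = 0} \<le> n" using card_poly_roots_bound[OF f0] df by simp
  moreover have "card ((\<lambda>i. \<rho> ^ i) ` {..<n}) = n" using card_image[OF rho_inj] by simp
  ultimately have "(\<lambda>i. \<rho> ^ i) ` {..<n} = {x. poly ?f x = 0}"
    by (intro card_seteq[OF poly_roots_finite[OF f0] sub]) simp
  then show ?thesis using x by (auto simp: poly_monom)
qed

text \<open>Exponents of \<rho> matter only modulo its order \<open>n\<close>, so \<open>OM\<close>
  is spanned by finitely many powers. A spanning set is all that the completeness argument uses; the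
  coefficients may be ambiguous.\<close>

lemma OM_repr: "x \<in> OM \<Longrightarrow> \<exists>c. (\<forall>i. c i \<in> \<O>) \<and> x = (\<Sum>i<n. c i * \<rho> ^ i)"
proof -
  assume "x \<in> OM"
  then obtain g where g: "g \<in> polys_over \<O>" "x = poly g \<rho>" by (auto simp: OM_def adjoin_def)
  define c where "c i = (\<Sum>j\<in>{j. j \<le> Polynomial.degree g \<and> j mod n = i}. Polynomial.coeff g j)" for i
  have "x = (\<Sum>j\<le>Polynomial.degree g. Polynomial.coeff g j * \<rho> ^ (j mod n))"
    unfolding g(2) poly_altdef by (simp add: rho_mod)
  also have "\<dots> = (\<Sum>i<n. \<Sum>j\<in>{j \<in> {..Polynomial.degree g}. j mod n = i}. Polynomial.coeff g j * \<rho> ^ (j mod n))"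
    by (rule sum.group[symmetric]) (use n_pos in auto)
  also have "\<dots> = (\<Sum>i<n. c i * \<rho> ^ i)"
    unfolding c_def sum_distrib_right by (intro sum.cong) auto
  finally show ?thesis using g(1) by (intro exI[of _ c]) (auto simp: c_def polys_over_def intro: O_sum)
qed

lemma OM_lin: "(\<And>i. c i \<in> \<O>) \<Longrightarrow> (\<Sum>i<k. c i * \<rho> ^ i) \<in> OM"
proof -
  assume c: "\<And>i. c i \<in> \<O>"
  have "(\<Sum>i<k. Polynomial.monom (c i) i) \<in> polys_over \<O>"
    using c by (auto simp: polys_over_def coeff_sum intro!: O_sum O_zero)
  from adjoinI[OF this, of \<rho>] show ?thesis by (simp add: OM_def poly_sum poly_monom)
qed

lemma O_sub_OM: "\<O> \<subseteq> OM" unfolding OM_def by (rule adjoin_base[OF O_zero])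
lemma F_sub_M: "F \<subseteq> M" unfolding M_def by (rule adjoin_base) simp
lemma rho_OM: "\<rho> \<in> OM" unfolding OM_def by (rule adjoin_gen[OF O_zero O_one])

lemma OM_mult: "x \<in> OM \<Longrightarrow> y \<in> OM \<Longrightarrow> x * y \<in> OM"
  and OM_add: "x \<in> OM \<Longrightarrow> y \<in> OM \<Longrightarrow> x + y \<in> OM"
  and OM_uminus: "x \<in> OM \<Longrightarrow> - x \<in> OM"
proof -
  assume "x \<in> OM"
  then obtain g where g: "g \<in> polys_over \<O>" "x = poly g \<rho>" by (auto simp: OM_def adjoin_def)
  have "- g \<in> polys_over \<O>" using g(1) by (auto simp: polys_over_def intro: O_uminus)
  from adjoinI[OF this, of \<rho>] show "- x \<in> OM" by (simp add: g OM_def)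
  assume "y \<in> OM"
  then obtain h where h: "h \<in> polys_over \<O>" "y = poly h \<rho>" by (auto simp: OM_def adjoin_def)
  have "g + h \<in> polys_over \<O>" using g(1) h(1) by (auto simp: polys_over_def intro: O_add)
  from adjoinI[OF this, of \<rho>] show "x + y \<in> OM" by (simp add: g h OM_def)
  have "g * h \<in> polys_over \<O>" using g(1) h(1) by (auto simp: polys_over_def coeff_mult intro!: O_sum O_mult)
  from adjoinI[OF this, of \<rho>] show "x * y \<in> OM" by (simp add: g h OM_def)
qed

lemma M_subfld: "subfld M"
  unfolding M_def
proof (rule adjoin_subfld)
  show "Polynomial.monom 1 n - 1 \<in> polys_over F" by (intro polys_diff polys_monom) auto
  show "poly (Polynomial.monom 1 n - 1) \<rho> = 0" by (simp add: poly_monom rho_n)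
  show "Polynomial.monom 1 n - 1 \<noteq> (0 :: 'a poly)"
  proof
    assume "Polynomial.monom 1 n - 1 = (0 :: 'a poly)"
    then have "Polynomial.coeff (Polynomial.monom 1 n - 1 :: 'a poly) n = 0" by simp
    then show False using n_pos by simp
  qed
qed

text \<open>Nakayama's lemma for the span of \<open>1, \<rho>, \<rho>\<^sup>2, \<dots>\<close>.\<close>

lemma OM_proper: "y \<in> OM \<Longrightarrow> \<pi> * y \<noteq> 1"
proof
  assume y: "y \<in> OM" "\<pi> * y = 1"
  define S where "S k = {\<Sum>i<k. c i * \<rho> ^ i | c. \<forall>i. c i \<in> \<O>}" for k
  have "OM \<subseteq> S k" if "k \<le> n" for k
    using that
  proof (induction k rule: inc_induct)
    case base
    show ?case using OM_repr by (fastforce simp: S_def)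
  next
    case (step k)
    have "\<rho> ^ k \<in> OM" using OM_lin[of "\<lambda>i. if i = k then 1 else 0" "Suc k"] by (simp add: O_intros)
    then have "y * \<rho> ^ k \<in> S (Suc k)" using y(1) OM_mult step.IH by blast
    then obtain c where c: "\<And>i. c i \<in> \<O>" "y * \<rho> ^ k = (\<Sum>i<Suc k. c i * \<rho> ^ i)" by (auto simp: S_def)
    have "\<rho> ^ k = \<pi> * (y * \<rho> ^ k)" using y(2) by (simp add: mult.assoc[symmetric])
    also have "\<dots> = \<pi> * (\<Sum>i<k. c i * \<rho> ^ i) + \<pi> * c k * \<rho> ^ k" unfolding c(2) by (simp add: algebra_simps)
    \<comment> \<open>If \<pi> were invertible in \<open>OM\<close>, the last generator could be
      expressed by the previous ones, since \<open>1 - \<pi> * c k\<close> is a unit of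
      \<open>\<O>\<close>.\<close>
    finally have e: "(1 - \<pi> * c k) * \<rho> ^ k = \<pi> * (\<Sum>i<k. c i * \<rho> ^ i)" by (simp add: algebra_simps)
    define w where "w = inverse (1 + \<pi> * (- c k))"
    have w: "w \<in> \<O>" "w * (1 - \<pi> * c k) = 1"
      unfolding w_def using one_plus_unit[OF O_uminus[OF c(1)[of k]]] by auto
    have rk: "\<rho> ^ k = (\<Sum>i<k. (w * \<pi> * c i) * \<rho> ^ i)"
    proof -
      have "\<rho> ^ k = w * ((1 - \<pi> * c k) * \<rho> ^ k)" using w(2) by (simp add: mult.assoc[symmetric])
      then show ?thesis unfolding e by (simp add: sum_distrib_left mult.assoc)
    qed
    show ?case
    proof
      fix x assume "x \<in> OM"
      then obtain a where a: "\<And>i. a i \<in> \<O>" "x = (\<Sum>i<Suc k. a i * \<rho> ^ i)" using step.IH by (auto simp: S_def)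
      have "x = (\<Sum>i<k. a i * \<rho> ^ i) + a k * \<rho> ^ k" unfolding a(2) by simp
      also have "\<dots> = (\<Sum>i<k. (a i + a k * (w * \<pi> * c i)) * \<rho> ^ i)"
        by (subst rk) (simp add: sum_distrib_left sum.distrib algebra_simps)
      finally show "x \<in> S k" unfolding S_def using a(1) c(1) w(1)
        by (auto intro!: exI[of _ "\<lambda>i. a i + a k * (w * \<pi> * c i)"] O_add O_mult pi_in)
    qed
  qed
  from this[of 0] have "1 \<in> S 0" using O_sub_OM O_one by auto
  then show False by (auto simp: S_def)
qed

lemma OM_pi_ring: "pi_ring OM \<pi> p"
proof
  show "0 \<in> OM" "1 \<in> OM" "\<pi> \<in> OM" using O_sub_OM O_intros by auto
  show "\<exists>z\<in>OM. of_nat p = \<pi> * z" using p_in O_sub_OM by auto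
qed (auto intro: OM_mult OM_add OM_uminus p)

text \<open>Denominators and limits are treated coefficientwise. The Frobenius axiom passes to
  \<open>OM\<close> because coefficients and \<rho> are both fixed by it modulo \<pi>; properness is
  the Nakayama argument.\<close>

lemma M_adic: "adic M OM \<pi> p P"
proof -
  interpret Mf: subfld M by (rule M_subfld)
  interpret OM: pi_ring OM \<pi> p by (rule OM_pi_ring)
  have cg_OM: "OM.cg k x y" if "cg k x y" for k x y
    using O_sub_OM that by (auto simp: cg_def OM.cg_def)
  show "adic M OM \<pi> p P"
  proof
    show "OM \<subseteq> M" using O_sub by (auto simp: OM_def M_def adjoin_def polys_over_def)
    show "\<pi> \<noteq> 0" by (rule pi_nz)
    show "\<exists>k\<ge>1. P = p ^ k" by (rule P)
    show "\<pi> * x \<noteq> 1" if "x \<in> OM" for x by (rule OM_proper[OF that])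
    show "\<exists>k. \<pi> ^ k * x \<in> OM" if "x \<in> M" for x
    proof -
      obtain g where g: "g \<in> polys_over F" "x = poly g \<rho>" using \<open>x \<in> M\<close> by (auto simp: M_def adjoin_def)
      have "\<exists>k. \<forall>i<m. \<pi> ^ k * Polynomial.coeff g i \<in> \<O>" for m
      proof (induction m)
        case (Suc m)
        then obtain k where k: "\<And>i. i < m \<Longrightarrow> \<pi> ^ k * Polynomial.coeff g i \<in> \<O>" by blast
        obtain j where j: "\<pi> ^ j * Polynomial.coeff g m \<in> \<O>" using frac[of "Polynomial.coeff g m"] g(1) by (auto simp: polys_over_def)
        have "\<pi> ^ (j + k) * Polynomial.coeff g i \<in> \<O>" if "i < Suc m" for i
        proof (cases "i = m")
          case True
          then show ?thesis using O_mult[OF O_power[OF pi_in, of k] j] by (simp add: power_add ac_simps)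
        next
          case False
          then show ?thesis using O_mult[OF O_power[OF pi_in, of j] k[of i]] that by (simp add: power_add ac_simps)
        qed
        then show ?case by blast
      qed simp
      then obtain k where k: "\<And>i. i < Suc (Polynomial.degree g) \<Longrightarrow> \<pi> ^ k * Polynomial.coeff g i \<in> \<O>" by blast
      have "\<pi> ^ k * Polynomial.coeff g i \<in> \<O>" for i
        using k[of i] O_zero by (cases "i < Suc (Polynomial.degree g)") (auto simp: Polynomial.coeff_eq_0)
      then have "Polynomial.smult (\<pi> ^ k) g \<in> polys_over \<O>" by (simp add: polys_over_def)
      from adjoinI[OF this, of \<rho>] show ?thesis using g(2) by (auto simp: OM_def)
    qed
    show "\<exists>z\<in>OM. x ^ P - x = \<pi> * z" if "x \<in> OM" for x
    proof -
      obtain g where g: "g \<in> polys_over \<O>" "x = poly g \<rho>" using \<open>x \<in> OM\<close> by (auto simp: OM_def adjoin_def)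
      have g': "g \<in> polys_over OM" using g(1) O_sub_OM by (auto simp: polys_over_def)
      obtain k where k: "P = p ^ k" using P by blast
      have "OM.cg 1 (poly g \<rho> ^ (p ^ k)) (poly g (\<rho> ^ (p ^ k)))"
        using g(1) cg_frob k
        by (intro OM.freshman_poly[OF g' rho_OM g'] cg_OM) (auto simp: polys_over_def)
      then show ?thesis using rho_P by (simp add: k[symmetric] g(2) OM.cg_def)
    qed
    show "\<exists>y\<in>OM. \<forall>k. \<exists>z\<in>OM. y - s k = \<pi> ^ k * z"
      if s: "\<And>k. s k \<in> OM" "\<And>k. \<exists>z\<in>OM. s (Suc k) - s k = \<pi> ^ k * z" for s
    proof -
      have "\<exists>c. (\<forall>i. c i \<in> \<O>) \<and> s (Suc k) - s k = \<pi> ^ k * (\<Sum>i<n. c i * \<rho> ^ i)" for k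
      proof -
        obtain z where z: "z \<in> OM" "s (Suc k) - s k = \<pi> ^ k * z" using s(2)[of k] by blast
        obtain c where c: "\<forall>i. c i \<in> \<O>" "z = (\<Sum>i<n. c i * \<rho> ^ i)" using OM_repr[OF z(1)] by blast
        show ?thesis using c z(2) by (intro exI[of _ c]) simp
      qed
      then obtain c where c: "\<And>k i. c k i \<in> \<O>" "\<And>k. s (Suc k) - s k = \<pi> ^ k * (\<Sum>i<n. c k i * \<rho> ^ i)"
        by metis
      define t where "t i k = (\<Sum>j<k. \<pi> ^ j * c j i)" for i k
      have tO: "t i k \<in> \<O>" for i k unfolding t_def by (intro O_intros c)
      have "\<exists>y\<in>\<O>. \<forall>k. cg k y (t i k)" for i
      proof -
        have "cg k (t i (Suc k)) (t i k)" for k using c(1)[of k i] by (auto simp: t_def cg_def)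
        from limit[OF tO this] show ?thesis by blast
      qed
      then obtain y where y: "\<And>i. y i \<in> \<O>" "\<And>i k. cg k (y i) (t i k)" by metis
      then obtain z where z: "\<And>i k. z i k \<in> \<O>" "\<And>i k. y i - t i k = \<pi> ^ k * z i k"
        unfolding cg_def by metis
      have sk: "s k = s 0 + (\<Sum>i<n. t i k * \<rho> ^ i)" for k
      proof (induction k)
        case (Suc k)
        have "s (Suc k) = s k + \<pi> ^ k * (\<Sum>i<n. c k i * \<rho> ^ i)" using c(2)[of k] by (simp add: algebra_simps)
        then show ?case using Suc by (simp add: t_def sum_distrib_left sum.distrib algebra_simps)
      qed (simp add: t_def)
      show ?thesis
      proof (rule bexI[of _ "s 0 + (\<Sum>i<n. y i * \<rho> ^ i)"], rule allI)
        show "s 0 + (\<Sum>i<n. y i * \<rho> ^ i) \<in> OM" by (intro OM_add s OM_lin y)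
        fix k
        have "s 0 + (\<Sum>i<n. y i * \<rho> ^ i) - s k = (\<Sum>i<n. (y i - t i k) * \<rho> ^ i)"
          unfolding sk[of k] by (simp add: sum_subtractf algebra_simps)
        also have "\<dots> = \<pi> ^ k * (\<Sum>i<n. z i k * \<rho> ^ i)" unfolding z(2) by (simp add: sum_distrib_left mult.assoc)
        finally show "\<exists>z\<in>OM. s 0 + (\<Sum>i<n. y i * \<rho> ^ i) - s k = \<pi> ^ k * z" using OM_lin[of "\<lambda>i. z i k" n] z(1) by blast
      qed
    qed
  qed
qed

sublocale M: adic M OM \<pi> p P
  by (rule M_adic)

lemma cg_OM: "cg k x y \<Longrightarrow> M.cg k x y"
  using O_sub_OM by (auto simp: cg_def M.cg_def)

lemma OM_inter_F: "x \<in> OM \<Longrightarrow> x \<in> F \<Longrightarrow> x \<in> \<O>"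
proof (rule ccontr)
  assume x: "x \<in> OM" "x \<in> F" "x \<notin> \<O>"
  then obtain z where z: "z \<in> \<O>" "inverse x = \<pi> * z" using O_inter_units by blast
  have "x \<noteq> 0" using x O_zero by auto
  then have "\<pi> * (z * x) = 1" using z(2) left_inverse[of x] by (simp add: mult.assoc)
  then show False using OM_proper[OF OM_mult[of z x]] z(1) O_sub_OM x(1) by blast
qed

lemma U_OM: "u \<in> \<U> \<Longrightarrow> u \<in> M.\<U>"
  using O_sub_OM by (auto simp: \<U>_def M.\<U>_def)

lemma ord_M: "x \<in> F \<Longrightarrow> x \<noteq> 0 \<Longrightarrow> M.ord x = ord x"
proof -
  assume x: "x \<in> F" "x \<noteq> 0"
  obtain u where u: "u \<in> \<U>" "x = \<pi> powi ord x * u" by (rule ord_decomp[OF x])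
  show ?thesis by (rule M.ord_eqI[OF U_OM[OF u(1)] u(2)])
qed

text \<open>An automorphism of \<open>F\<close> acting on the residue field as a power of Frobenius extends to \<open>M\<close>,
  by the same power of Frobenius on \<open>\<rho>\<close>: this is a root of the conjugate of the minimal polynomial
  of \<open>\<rho>\<close>, because distinct \<open>n\<close>-th roots of unity are incongruent modulo \<open>\<pi>\<close>.\<close>

lemma extend_endo:
  assumes f: "fld_endo F f" and fO: "\<And>x. x \<in> \<O> \<Longrightarrow> f x \<in> \<O>"
    and fr: "\<And>x. x \<in> \<O> \<Longrightarrow> cg 1 (f x) (x ^ (p ^ j))"
  obtains h where "fld_endo M h" "\<And>x. x \<in> F \<Longrightarrow> h x = f x" "h \<rho> = \<rho> ^ (p ^ j)"
    "\<And>x. x \<in> OM \<Longrightarrow> h x \<in> OM" "\<And>x. x \<in> OM \<Longrightarrow> M.cg 1 (h x) (x ^ (p ^ j))"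
proof -
  interpret f: fld_endo F f by fact
  let ?c = "Polynomial.monom 1 n - 1 :: 'a poly"
  let ?r = "\<rho> ^ (p ^ j)"
  have c: "?c \<in> polys_over F" "poly ?c \<rho> = 0" "?c \<noteq> 0"
  proof -
    show "?c \<in> polys_over F" by (intro polys_diff polys_monom) auto
    show "poly ?c \<rho> = 0" by (simp add: poly_monom rho_n)
    show "?c \<noteq> 0"
    proof
      assume "?c = 0"
      then have "Polynomial.coeff ?c n = 0" by simp
      then show False using n_pos by simp
    qed
  qed
  obtain g where g: "g \<in> polys_over F" "Polynomial.lead_coeff g = 1" "poly g \<rho> = 0"
    and div: "\<And>q. q \<in> polys_over F \<Longrightarrow> poly q \<rho> = 0 \<Longrightarrow> \<exists>h\<in>polys_over F. q = g * h"
    using minimal_poly[OF c(1,3,2)] by blast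
  obtain h where h: "h \<in> polys_over F" "?c = g * h" using div[OF c(1,2)] by blast
  have split: "\<exists>A. q = (\<Prod>x\<in>#A. [:- x, 1:]) \<and> (\<forall>x\<in>#A. \<exists>i<n. x = \<rho> ^ i)"
    if q: "Polynomial.lead_coeff q = 1" "?c = q * q'" for q q'
  proof -
    have "q \<noteq> 0" using q(1) by auto
    then obtain A where A: "q = Polynomial.smult (Polynomial.lead_coeff q) (\<Prod>x\<in>#A. [:- x, 1:])"
      using alg_closed_imp_factorization by blast
    have "\<exists>i<n. x = \<rho> ^ i" if "x \<in># A" for x
    proof -
      have "poly (\<Prod>x\<in>#A. [:- x, 1:]) x = 0" using that by (auto simp: poly_prod_mset prod_mset_zero_iff)
      then have "poly q x = 0" by (subst A) simp
      then have "poly ?c x = 0" unfolding q(2) by simp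
      then show ?thesis by (intro roots_of_unity) (simp add: poly_monom)
    qed
    then show ?thesis using A q(1) by (intro exI[of _ A]) auto
  qed
  have roots_OM: "\<rho> ^ i \<in> OM" for i using M.O_power[OF rho_OM] .
  \<comment> \<open>The minimal polynomial is a product of factors \<open>X - \<rho>^i\<close>, so
    its coefficients lie in \<open>OM\<close> as well as in \<open>F\<close>, hence in
    \<open>\<O>\<close>.\<close>
  have gO: "g \<in> polys_over \<O>"
  proof -
    obtain A where A: "g = (\<Prod>x\<in>#A. [:- x, 1:])" "\<forall>x\<in>#A. \<exists>i<n. x = \<rho> ^ i" using split[OF g(2) h(2)] by blast
    have "(\<Prod>x\<in>#A. [:- x, 1:]) \<in> polys_over OM" using A(2)
    proof (induction A)
      case (add x A)
      have "[:- x, 1:] \<in> polys_over OM" using add.prems roots_OM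
        by (auto simp: polys_over_def coeff_pCons M.O_intros split: nat.splits)
      moreover have "(\<Prod>x\<in>#A. [:- x, 1:]) \<in> polys_over OM" using add by auto
      moreover have "q * r \<in> polys_over OM" if "q \<in> polys_over OM" "r \<in> polys_over OM" for q r
        using that by (auto simp: polys_over_def coeff_mult intro!: M.O_sum M.O_mult)
      ultimately show ?case by (simp only: image_mset_add_mset prod_mset.add_mset)
    qed (auto simp: polys_over_def M.O_intros)
    then show ?thesis using g(1) A(1) OM_inter_F by (auto simp: polys_over_def)
  qed
  define g' where "g' = map_poly f g"
  \<comment> \<open>Otherwise the value is a product of differences of distinct Teichmueller
    elements, that is, of units. But it is congruent to the \<open>p^j\<close>-th power of
    \<open>g(\<rho>) = 0\<close>.\<close>
  have g'0: "poly g' ?r = 0"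
  proof (rule ccontr)
    assume nz: "poly g' ?r \<noteq> 0"
    have mc: "map_poly f ?c = ?c"
      by (intro poly_eqI) (auto simp: coeff_map_poly f.endo_zero coeff_diff f.endo_diff f.endo_one f.endo_uminus coeff_monom)
    have lc: "Polynomial.lead_coeff g' = 1"
      unfolding g'_def f.degree_map_polys[OF g(1)] using g(2) by (simp add: coeff_map_poly f.endo_zero f.endo_one)
    have "?c = g' * map_poly f h" unfolding g'_def using f.map_poly_mult[OF g(1) h(1)] h(2) mc by simp
    from split[OF lc this] obtain A where A: "g' = (\<Prod>x\<in>#A. [:- x, 1:])" "\<forall>x\<in>#A. \<exists>i<n. x = \<rho> ^ i" by blast
    have tei: "(\<rho> ^ i) ^ P = \<rho> ^ i" for i
      using power_mult[of \<rho> i P] power_mult[of \<rho> P i] rho_P by (simp only: mult.commute[of i P])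
    have "poly (\<Prod>x\<in>#B. [:- x, 1:]) ?r \<in> M.\<U>" if "B \<subseteq># A" for B
      using that
    proof (induction B)
      case (add x B)
      then have xA: "x \<in># A" by (auto simp: insert_subset_eq_iff)
      have BA: "B \<subseteq># A" using add.prems by (rule subset_mset.order_trans[rotated]) simp
      obtain i where i: "x = \<rho> ^ i" using A(2) xA by blast
      have "?r \<noteq> x"
      proof
        assume "?r = x"
        then have "poly g' ?r = 0" unfolding A(1) using xA by (auto simp: poly_prod_mset prod_mset_zero_iff)
        then show False using nz by simp
      qed
      then have "\<not> M.cg 1 ?r x" using M.teichmueller_unique[OF roots_OM roots_OM tei tei, of "p ^ j" i] i by auto
      then have "\<not> M.cg 1 (?r - x) 0" using M.cg_add[of 1 "?r - x" 0 x x] by auto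
      then have "?r - x \<in> M.\<U>" using roots_OM i by (intro M.cg_0_or_unit M.O_diff) auto
      from M.U_mult[OF this add.IH[OF BA]] show ?case by (simp add: algebra_simps)
    qed (simp add: M.U_one)
    then have "poly g' ?r \<in> M.\<U>" using A(1) by auto
    then have "\<not> M.cg 1 (poly g' ?r) 0" by (rule M.U_not_cg_0)
    moreover have "M.cg 1 (poly g \<rho> ^ (p ^ j)) (poly g' ?r)"
    proof (rule M.freshman_poly)
      show "g \<in> polys_over OM" using gO O_sub_OM by (auto simp: polys_over_def)
      show "g' \<in> polys_over OM" using gO O_sub_OM fO by (auto simp: polys_over_def g'_def coeff_map_poly f.endo_zero)
      fix i
      have "Polynomial.coeff g i \<in> \<O>" using gO by (auto simp: polys_over_def)
      then show "M.cg 1 (Polynomial.coeff g i ^ p ^ j) (Polynomial.coeff g' i)"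
        using cg_OM[OF cg_sym[OF fr]] by (simp add: g'_def coeff_map_poly f.endo_zero)
    qed (rule rho_OM)
    then have "M.cg 1 0 (poly g' ?r)" using g(3) M.p_gt_1 by (simp add: power_0_left)
    then have "M.cg 1 (poly g' ?r) 0" by (rule M.cg_sym)
    ultimately show False by simp
  qed
  have wd: "poly (map_poly f q) ?r = poly (map_poly f q') ?r"
    if q: "q \<in> polys_over F" "q' \<in> polys_over F" "poly q \<rho> = poly q' \<rho>" for q q'
  proof -
    obtain h where h: "h \<in> polys_over F" "q - q' = g * h"
      using div[OF polys_diff[OF q(1,2)]] q(3) by auto
    have "q = q' + g * h" using h(2) by (simp add: algebra_simps)
    then have "map_poly f q = map_poly f q' + g' * map_poly f h"
      using q h(1) g(1) by (simp add: f.map_poly_add f.map_poly_mult polys_mult g'_def)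
    then show ?thesis using g'0 by simp
  qed
  define H where "H x = poly (map_poly f (SOME q. q \<in> polys_over F \<and> poly q \<rho> = x)) ?r" for x
  have H: "H (poly q \<rho>) = poly (map_poly f q) ?r" if "q \<in> polys_over F" for q
  proof -
    define q' where "q' = (SOME q'. q' \<in> polys_over F \<and> poly q' \<rho> = poly q \<rho>)"
    have *: "q' \<in> polys_over F \<and> poly q' \<rho> = poly q \<rho>" unfolding q'_def by (rule someI[of _ q]) (use that in simp)
    show ?thesis unfolding H_def q'_def[symmetric] by (rule wd[OF conjunct1[OF *] that conjunct2[OF *]])
  qed
  have M_repr: "\<exists>q\<in>polys_over F. x = poly q \<rho>" if "x \<in> M" for x using that by (auto simp: M_def adjoin_def)
  show thesis
  proof (rule that[of H])
    show "fld_endo M H"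
    proof (intro fld_endo.intro fld_endo_axioms.intro)
      show "subfld M" by (rule M_subfld)
      have rM: "?r \<in> M" using roots_OM M.O_sub by auto
      show "H x \<in> M" if x: "x \<in> M" for x
      proof -
        obtain q where q: "q \<in> polys_over F" "x = poly q \<rho>" using M_repr[OF x] by blast
        have "map_poly f q \<in> polys_over M" using f.map_polys[OF q(1)] F_sub_M by (auto simp: polys_over_def)
        then show ?thesis unfolding q(2) H[OF q(1)] using M.poly_closed rM by blast
      qed
      show "H (x + y) = H x + H y" "H (x * y) = H x * H y" if xy: "x \<in> M" "y \<in> M" for x y
      proof -
        obtain q q' where q: "q \<in> polys_over F" "x = poly q \<rho>" "q' \<in> polys_over F" "y = poly q' \<rho>"
          using M_repr[OF xy(1)] M_repr[OF xy(2)] by blast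
        show "H (x + y) = H x + H y" "H (x * y) = H x * H y"
          using H[OF polys_add[OF q(1,3)]] H[OF polys_mult[OF q(1,3)]] H[OF q(1)] H[OF q(3)] q
          by (simp_all add: f.map_poly_add f.map_poly_mult)
      qed
      show "H 1 = 1" using H[of 1] by (simp add: f.endo_one map_poly_1')
    qed
    show "H x = f x" if "x \<in> F" for x
      using H[of "[:x:]"] polys_over_const[of F x] that by (simp add: map_poly_pCons f.endo_zero)
    show "H \<rho> = ?r"
      using H[of "[:0, 1:]"] by (simp add: map_poly_pCons f.endo_zero f.endo_one polys_pCons)
    have HO: "H x \<in> OM \<and> M.cg 1 (H x) (x ^ (p ^ j))" if x: "x \<in> OM" for x
    proof -
      obtain q where q: "q \<in> polys_over \<O>" "x = poly q \<rho>" using x by (auto simp: OM_def adjoin_def)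
      have qF: "q \<in> polys_over F" using q(1) O_sub by (auto simp: polys_over_def)
      have qM: "q \<in> polys_over OM" "map_poly f q \<in> polys_over OM"
        using q(1) fO O_sub_OM by (auto simp: polys_over_def coeff_map_poly f.endo_zero)
      have "poly (map_poly f q) ?r \<in> OM" unfolding poly_altdef
        using qM by (auto simp: polys_over_def intro!: M.O_intros rho_OM)
      moreover have "M.cg 1 (poly q \<rho> ^ (p ^ j)) (poly (map_poly f q) ?r)"
      proof (rule M.freshman_poly[OF qM(1) rho_OM qM(2)])
        fix i
        have "Polynomial.coeff q i \<in> \<O>" using q(1) by (auto simp: polys_over_def)
        then show "M.cg 1 (Polynomial.coeff q i ^ p ^ j) (Polynomial.coeff (map_poly f q) i)"
          using cg_OM[OF cg_sym[OF fr]] by (simp add: coeff_map_poly f.endo_zero)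
      qed
      ultimately show ?thesis unfolding q(2) H[OF qF] using M.cg_sym by blast
    qed
    show "H x \<in> OM" "M.cg 1 (H x) (x ^ (p ^ j))" if "x \<in> OM" for x using HO[OF that] by auto
  qed
qed

end

section \<open>Valued fields and their finite extensions\<close>

locale valued = subfld F for F :: "'a::alg_closed_field set" +
  fixes v :: "'a \<Rightarrow> rat"
  assumes val: "valuation_on F v"
begin

lemma v_mult: "x \<in> F \<Longrightarrow> y \<in> F \<Longrightarrow> x \<noteq> 0 \<Longrightarrow> y \<noteq> 0 \<Longrightarrow> v (x * y) = v x + v y"
  using val by (auto simp: valuation_on_def)

lemma v_add: "x \<in> F \<Longrightarrow> y \<in> F \<Longrightarrow> x \<noteq> 0 \<Longrightarrow> y \<noteq> 0 \<Longrightarrow> x + y \<noteq> 0 \<Longrightarrow> min (v x) (v y) \<le> v (x + y)"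
  using val by (auto simp: valuation_on_def)

lemma v_one: "v 1 = 0"
  using v_mult[of 1 1] by simp

lemma v_uminus: "x \<in> F \<Longrightarrow> v (- x) = v x"
proof (cases "x = 0")
  case False
  assume x: "x \<in> F"
  have m1: "- 1 \<in> F" by (intro uminus_closed one_closed)
  have "v (-1) + v (-1) = 0" using v_mult[OF m1 m1] v_one by simp
  then have "v (-1) = 0" by simp
  then show ?thesis using v_mult[OF m1 x] False by simp
qed simp

lemma v_inverse: "x \<in> F \<Longrightarrow> x \<noteq> 0 \<Longrightarrow> v (inverse x) = - v x"
  using v_mult[of x "inverse x"] inverse_closed[of x] v_one by simp

lemma v_divide: "x \<in> F \<Longrightarrow> y \<in> F \<Longrightarrow> x \<noteq> 0 \<Longrightarrow> y \<noteq> 0 \<Longrightarrow> v (x / y) = v x - v y"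
  unfolding divide_inverse by (simp add: v_mult v_inverse inverse_closed)

lemma v_power: "x \<in> F \<Longrightarrow> x \<noteq> 0 \<Longrightarrow> v (x ^ n) = of_nat n * v x"
  by (induction n) (auto simp: v_one v_mult power_closed algebra_simps)

lemma v_power_int: "x \<in> F \<Longrightarrow> x \<noteq> 0 \<Longrightarrow> v (x powi n) = of_int n * v x"
  by (auto simp: power_int_def v_power v_inverse inverse_closed)

text \<open>These predicates treat \<open>0\<close> as having infinite value, whereas the number
  \<open>v 0\<close> is arbitrary.\<close>

definition ge :: "rat \<Rightarrow> 'a \<Rightarrow> bool" where "ge c x \<longleftrightarrow> x = 0 \<or> c \<le> v x"
definition gt :: "rat \<Rightarrow> 'a \<Rightarrow> bool" where "gt c x \<longleftrightarrow> x = 0 \<or> c < v x"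

lemma ge_add: "x \<in> F \<Longrightarrow> y \<in> F \<Longrightarrow> ge c x \<Longrightarrow> ge c y \<Longrightarrow> ge c (x + y)"
  using v_add[of x y] by (cases "x = 0"; cases "y = 0"; cases "x + y = 0") (auto simp: ge_def)

lemma gt_add: "x \<in> F \<Longrightarrow> y \<in> F \<Longrightarrow> gt c x \<Longrightarrow> gt c y \<Longrightarrow> gt c (x + y)"
  using v_add[of x y] by (cases "x = 0"; cases "y = 0"; cases "x + y = 0") (auto simp: gt_def)

lemma ge_uminus: "x \<in> F \<Longrightarrow> ge c (- x) \<longleftrightarrow> ge c x" and gt_uminus: "x \<in> F \<Longrightarrow> gt c (- x) \<longleftrightarrow> gt c x"
  by (auto simp: ge_def gt_def v_uminus)

lemma ge_diff: "x \<in> F \<Longrightarrow> y \<in> F \<Longrightarrow> ge c x \<Longrightarrow> ge c y \<Longrightarrow> ge c (x - y)"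
  using ge_add[of x "-y"] ge_uminus[of y] uminus_closed[of y] by simp

lemma gt_diff: "x \<in> F \<Longrightarrow> y \<in> F \<Longrightarrow> gt c x \<Longrightarrow> gt c y \<Longrightarrow> gt c (x - y)"
  using gt_add[of x "-y"] gt_uminus[of y] uminus_closed[of y] by simp

lemma ge_mult: "x \<in> F \<Longrightarrow> y \<in> F \<Longrightarrow> ge c x \<Longrightarrow> ge c' y \<Longrightarrow> ge (c + c') (x * y)"
  by (cases "x = 0 \<or> y = 0") (auto simp: ge_def v_mult)

lemma gt_ge_mult: "x \<in> F \<Longrightarrow> y \<in> F \<Longrightarrow> gt c x \<Longrightarrow> ge c' y \<Longrightarrow> gt (c + c') (x * y)"
  by (cases "x = 0 \<or> y = 0") (auto simp: ge_def gt_def v_mult)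

lemma gt_imp_ge: "gt c x \<Longrightarrow> ge c x" by (auto simp: ge_def gt_def)

definition \<O> :: "'a set" where "\<O> = valuation_ring F v"
definition mm :: "'a set" where "mm = maximal_ideal_of F v"

lemma O_iff: "x \<in> \<O> \<longleftrightarrow> x \<in> F \<and> ge 0 x" by (auto simp: \<O>_def valuation_ring_def ge_def)
lemma mm_iff: "x \<in> mm \<longleftrightarrow> x \<in> F \<and> gt 0 x" by (auto simp: mm_def maximal_ideal_of_def gt_def)

lemma local_dom: "local_dom \<O> mm"
proof
  show "x * y \<in> \<O>" if "x \<in> \<O>" "y \<in> \<O>" for x y using that ge_mult[of x y 0 0] by (auto simp: O_iff mult_closed)
  show "x * y \<in> mm" if "x \<in> mm" "y \<in> \<O>" for x y using that gt_ge_mult[of x y 0 0] by (auto simp: O_iff mm_iff mult_closed)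
  show "inverse x \<in> \<O>" if "x \<in> \<O>" "x \<notin> mm" for x
    using that by (auto simp: O_iff mm_iff ge_def gt_def inverse_closed v_inverse)
  show "1 \<notin> mm" by (auto simp: mm_iff gt_def v_one)
  show "1 \<in> \<O>" by (auto simp: O_iff ge_def v_one)
qed (auto simp: O_iff mm_iff ge_add gt_add ge_uminus gt_imp_ge add_closed uminus_closed, auto simp: gt_def)

lemma residue_field_eq: "residue_field F v = local_dom.RF \<O> mm"
  by (simp add: residue_field_def \<O>_def mm_def)

text \<open>Division with remainder in the value group: a remainder strictly between
  \<open>0\<close> and \<open>v \<pi>\<close> is excluded by the minimality of the uniformiser.
  Discreteness thus follows from its existence.\<close>

lemma uniformiser_multiple:
  assumes u: "uniformiser F v \<pi>" and x: "x \<in> F" "x \<noteq> 0"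
  shows "\<exists>k::int. v x = of_int k * v \<pi>"
proof -
  have pi: "\<pi> \<in> F" "\<pi> \<noteq> 0" "0 < v \<pi>" and min: "\<And>y. y \<in> F \<Longrightarrow> y \<noteq> 0 \<Longrightarrow> 0 < v y \<Longrightarrow> v \<pi> \<le> v y"
    using u by (auto simp: uniformiser_def)
  define k where "k = \<lfloor>v x / v \<pi>\<rfloor>"
  define y where "y = x / \<pi> powi k"
  have y: "y \<in> F" "y \<noteq> 0" unfolding y_def using x pi by (auto intro!: divide_closed power_int_closed)
  have vy: "v y = v x - of_int k * v \<pi>"
    unfolding y_def using x pi by (subst v_divide) (auto simp: v_power_int power_int_closed)
  have "of_int k \<le> v x / v \<pi>" "v x / v \<pi> < of_int k + 1" unfolding k_def by linarith+
  then have "0 \<le> v y" "v y < v \<pi>" using pi(3) unfolding vy by (simp_all add: field_simps)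
  then have "v y = 0" using min[OF y] by force
  then show ?thesis using vy by (intro exI[of _ k]) simp
qed

lemma ge_pi_power:
  assumes u: "uniformiser F v \<pi>" and x: "x \<in> F"
  shows "ge (of_nat k * v \<pi>) x \<longleftrightarrow> (\<exists>z\<in>\<O>. x = \<pi> ^ k * z)"
proof
  have pi: "\<pi> \<in> F" "\<pi> \<noteq> 0" "0 < v \<pi>" using u by (auto simp: uniformiser_def)
  {
    assume g: "ge (of_nat k * v \<pi>) x"
    have "x / \<pi> ^ k \<in> \<O>" using g x pi
      by (cases "x = 0") (auto simp: O_iff ge_def divide_closed power_closed v_divide v_power)
    then show "\<exists>z\<in>\<O>. x = \<pi> ^ k * z" using pi by (intro bexI[of _ "x / \<pi> ^ k"]) auto
  next
    assume "\<exists>z\<in>\<O>. x = \<pi> ^ k * z"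
    then obtain z where "z \<in> \<O>" "x = \<pi> ^ k * z" by blast
    then show "ge (of_nat k * v \<pi>) x" using pi
      by (cases "z = 0") (auto simp: O_iff ge_def v_mult v_power power_closed)
  }
qed

lemma mm_pi: "uniformiser F v \<pi> \<Longrightarrow> x \<in> mm \<longleftrightarrow> (\<exists>z\<in>\<O>. x = \<pi> * z)"
proof -
  assume u: "uniformiser F v \<pi>"
  have pi: "\<pi> \<in> F" "\<pi> \<noteq> 0" "0 < v \<pi>" using u by (auto simp: uniformiser_def)
  have "x \<in> mm \<longleftrightarrow> x \<in> F \<and> ge (of_nat 1 * v \<pi>) x"
    using u by (auto simp: mm_iff gt_def ge_def uniformiser_def)
  also have "\<dots> \<longleftrightarrow> (\<exists>z\<in>\<O>. x = \<pi> * z)"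
    using ge_pi_power[OF u, of x 1] pi by (auto simp: O_iff mult_closed)
  finally show ?thesis .
qed

lemma pi_ring:
  assumes u: "uniformiser F v \<pi>" and p: "Factorial_Ring.prime p" "of_nat p \<in> mm"
  shows "pi_ring \<O> \<pi> p"
proof -
  interpret local_dom \<O> mm by (rule local_dom)
  show ?thesis
  proof
    show "\<pi> \<in> \<O>" using u by (auto simp: uniformiser_def O_iff ge_def)
    show "\<exists>z\<in>\<O>. of_nat p = \<pi> * z" using mm_pi[OF u] p by simp
  qed (auto intro: O_zero O_one O_add O_uminus O_mult p)
qed

lemma adic:
  assumes u: "uniformiser F v \<pi>" and p: "Factorial_Ring.prime p" "of_nat p \<in> mm"
    and P: "\<exists>k\<ge>1. P = p ^ k" "\<And>x. x \<in> \<O> \<Longrightarrow> x ^ P - x \<in> mm"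
    and c: "complete_valued F v"
  shows "adic F \<O> \<pi> p P"
proof -
  interpret local_dom \<O> mm by (rule local_dom)
  interpret pi_ring \<O> \<pi> p by (rule pi_ring[OF u p])
  have pi: "\<pi> \<in> F" "\<pi> \<noteq> 0" "0 < v \<pi>" using u by (auto simp: uniformiser_def)
  show ?thesis
  proof
    show "\<O> \<subseteq> F" by (auto simp: O_iff)
    show "\<pi> \<noteq> 0" by (rule pi)
    show "\<exists>k. \<pi> ^ k * x \<in> \<O>" if x: "x \<in> F" for x
    proof (cases "x = 0")
      case False
      obtain k :: nat where k: "- v x / v \<pi> < of_nat k" using reals_Archimedean2 by blast
      then have "0 \<le> of_nat k * v \<pi> + v x" using pi by (simp add: field_simps)
      then show ?thesis using x pi False
        by (intro exI[of _ k]) (auto simp: O_iff ge_def v_mult v_power power_closed mult_closed)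
    qed (auto intro: O_zero)
    show "\<pi> * x \<noteq> 1" if "x \<in> \<O>" for x using mm_pi[OF u, of 1] one_notin that by metis
    show "\<exists>k\<ge>1. P = p ^ k" by (rule P)
    show "\<exists>z\<in>\<O>. x ^ P - x = \<pi> * z" if "x \<in> \<O>" for x using P(2)[OF that] mm_pi[OF u] by simp
    show "\<exists>y\<in>\<O>. \<forall>k. \<exists>z\<in>\<O>. y - s k = \<pi> ^ k * z"
      if s: "\<And>k. s k \<in> \<O>" "\<And>k. \<exists>z\<in>\<O>. s (Suc k) - s k = \<pi> ^ k * z" for s
    proof -
      have sF: "s k \<in> F" for k using s(1) by (auto simp: O_iff)
      have tele: "ge (of_nat k * v \<pi>) (s (k + j) - s k)" for j k
      proof (induction j)
        case (Suc j)
        have "ge (of_nat (k + j) * v \<pi>) (s (Suc (k + j)) - s (k + j))"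
          using ge_pi_power[OF u diff_closed[OF sF sF]] s(2) by blast
        moreover have "of_nat k * v \<pi> \<le> of_nat (k + j) * v \<pi>" using pi by (intro mult_right_mono) auto
        ultimately have "ge (of_nat k * v \<pi>) (s (Suc (k + j)) - s (k + j))"
          unfolding ge_def by linarith
        from ge_add[OF _ _ this Suc] show ?case by (simp add: diff_closed sF)
      qed (simp add: ge_def)
      have tele': "ge (of_nat k * v \<pi>) (s j - s i)" if "k \<le> i" "k \<le> j" for i j k
        using ge_diff[OF _ _ tele[of k "j - k"] tele[of k "i - k"]] that by (simp add: diff_closed sF)
      have "\<exists>l\<in>F. \<forall>N. \<exists>n0. \<forall>i\<ge>n0. s i = l \<or> N < v (s i - l)"
      proof -
        have "\<exists>n0. \<forall>i\<ge>n0. \<forall>j\<ge>n0. s i = s j \<or> N < v (s i - s j)" for N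
        proof -
          obtain k :: nat where k: "N / v \<pi> < of_nat k" using reals_Archimedean2 by blast
          then have "N < of_nat k * v \<pi>" using pi by (simp add: field_simps)
          then show ?thesis using tele'[of k] by (intro exI[of _ k]) (force simp: ge_def)
        qed
        then show ?thesis using c sF unfolding complete_valued_def by blast
      qed
      then obtain l where l: "l \<in> F" "\<And>N. \<exists>n0. \<forall>i\<ge>n0. s i = l \<or> N < v (s i - l)" by blast
      have close: "ge (of_nat k * v \<pi>) (l - s k)" for k
      proof -
        obtain n0 where n0: "\<And>i. i \<ge> n0 \<Longrightarrow> s i = l \<or> of_nat k * v \<pi> < v (s i - l)" using l(2) by blast
        define i where "i = max n0 k"
        have "ge (of_nat k * v \<pi>) (s i - l)" using n0[of i] by (auto simp: i_def ge_def)
        from ge_diff[OF _ _ tele'[of k k i] this] show ?thesis by (simp add: i_def diff_closed sF l)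
      qed
      have "ge 0 (l - s 0)" using close[of 0] by simp
      from ge_add[OF _ _ this, of "s 0"] have "l \<in> \<O>" using s(1)[of 0] by (auto simp: O_iff l diff_closed)
      moreover have "\<exists>z\<in>\<O>. l - s k = \<pi> ^ k * z" for k
        using ge_pi_power[OF u diff_closed[OF l(1) sF]] close by blast
      ultimately show ?thesis by blast
    qed
  qed
qed

lemma adic_ord:
  assumes u: "uniformiser F v \<pi>" and a: "adic F \<O> \<pi> p P" and x: "x \<in> F" "x \<noteq> 0"
  shows "v x = of_int (adic.ord \<O> \<pi> x) * v \<pi>"
proof -
  interpret adic F \<O> \<pi> p P by (rule a)
  have pi: "\<pi> \<in> F" "\<pi> \<noteq> 0" using u by (auto simp: uniformiser_def)
  obtain w where w: "w \<in> \<U>" "x = \<pi> powi ord x * w" by (rule ord_decomp[OF x])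
  have wF: "w \<in> F" "w \<noteq> 0" "inverse w \<in> \<O>" "w \<in> \<O>" using w by (auto simp: \<U>_def O_iff)
  have "v w = 0" using wF v_inverse[OF wF(1,2)] by (auto simp: O_iff ge_def)
  have "v x = v (\<pi> powi ord x) + v w"
    by (subst w(2), rule v_mult) (use pi wF in \<open>auto intro: power_int_closed\<close>)
  then show ?thesis using \<open>v w = 0\<close> pi by (simp add: v_power_int)
qed

end

text \<open>Elements of \<open>1 + \<pi>\<O>\<close> are highly divisible in the multiplicative group, hence so are
  their images.\<close>

lemma (in adic) ord_endo:
  assumes f: "fld_endo F f" and c: "c \<in> F" "c \<noteq> 0" "f c = c" "ord c \<noteq> 0"
    and x: "x \<in> F" "x \<noteq> 0"
  shows "ord (f x) = ord x"
proof -
  interpret f: fld_endo F f by fact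
  \<comment> \<open>Passing to \<open>P^2\<close> guarantees roots of an exponent at least 2;
    \<open>P - 1\<close> alone would be 1 for \<open>P = 2\<close>.\<close>
  interpret sq: adic F \<O> \<pi> p "P ^ 2" by (rule adic_power) simp
  define R where "R = P ^ 2 - 1"
  have "P * P \<ge> 2 * 2" using P_gt_1 by (intro mult_mono) auto
  then have R: "R \<ge> 2" unfolding R_def power2_eq_square by simp
  have one: "ord (f y) = 0" if y: "y \<in> \<O>" "cg 1 y 1" for y
  proof (rule ccontr)
    assume nz: "ord (f y) \<noteq> 0"
    \<comment> \<open>With \<open>R^k\<close>-th roots for this \<open>k\<close>, the order of
      \<open>f y\<close> would be a nonzero multiple of \<open>R^k\<close>, which exceeds its
      absolute value \<open>k\<close>.\<close>
    define k where "k = nat \<bar>ord (f y)\<bar>"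
    obtain z where z: "z \<in> \<O>" "cg 1 z 1" "z ^ (R ^ k) = y" using sq.one_unit_root_iter[OF y, of k] by (auto simp: R_def)
    have zU: "z \<in> \<U>" by (rule cg_1_unit[OF z(1,2) U_one])
    then have zF: "z \<in> F" "z \<noteq> 0" using U_O U_nz O_sub by auto
    have "ord (f y) = int (R ^ k) * ord (f z)"
      unfolding z(3)[symmetric] f.endo_power[OF zF(1)]
      using zF by (intro ord_power) (auto simp: f.endo_closed f.endo_eq_0_iff)
    then have "int (R ^ k) dvd \<bar>ord (f y)\<bar>" by simp
    then have "int (R ^ k) \<le> \<bar>ord (f y)\<bar>" using nz by (intro zdvd_imp_le) auto
    moreover have "int k = \<bar>ord (f y)\<bar>" by (simp add: k_def)
    ultimately have "int (R ^ k) \<le> int k" by simp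
    then have "R ^ k \<le> k" by (simp only: of_nat_le_iff)
    moreover have "k < 2 ^ k" by (rule less_exp)
    moreover have "2 ^ k \<le> R ^ k" using R by (rule power_mono) simp
    ultimately show False by simp
  qed
  have unit: "ord (f u) = 0" if u: "u \<in> \<U>" for u
  proof -
    have uF: "u \<in> F" "u \<noteq> 0" "u \<in> \<O>" using u U_O U_nz O_sub by auto
    have "cg 1 (u * u ^ (P - 1)) (u * 1)" using cg_frob[OF uF(3)] P_gt_1 by (cases P) auto
    then have "cg 1 (u ^ (P - 1)) 1" by (rule cg_cancel[OF u])
    then have "ord (f (u ^ (P - 1))) = 0" by (intro one O_power uF)
    moreover have "ord (f (u ^ (P - 1))) = int (P - 1) * ord (f u)"
      unfolding f.endo_power[OF uF(1)] using uF by (intro ord_power) (auto simp: f.endo_closed f.endo_eq_0_iff)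
    ultimately show ?thesis using P_gt_1 by simp
  qed
  \<comment> \<open>The combination of \<open>x\<close> and the fixed element \<open>c\<close> that
    has order 0; comparing orders of its image gives the claim for \<open>x\<close>.\<close>
  define u where "u = x powi ord c / c powi ord x"
  have uF: "u \<in> F" "u \<noteq> 0" unfolding u_def using x c by (auto intro!: divide_closed power_int_closed)
  have "ord u = 0" unfolding u_def divide_inverse using x c
    by (subst ord_mult) (auto simp: ord_power_int ord_inverse power_int_closed inverse_closed)
  then have "u \<in> \<U>" by (rule ord_0_U[OF uF])
  then have "ord (f u) = 0" by (rule unit)
  moreover have "f u = f x powi ord c / c powi ord x"
    unfolding u_def using x c by (simp add: f.endo_divide f.endo_power_int power_int_closed)
  moreover have "ord (f x powi ord c / c powi ord x) = ord c * ord (f x) - ord x * ord c"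
    unfolding divide_inverse using x c
    by (subst ord_mult) (auto simp: ord_power_int ord_inverse power_int_closed inverse_closed f.endo_closed f.endo_eq_0_iff)
  ultimately show ?thesis using c(4) by simp
qed

subsection \<open>Completeness and residues of finite extensions\<close>

locale fin_ext = valued F v for F :: "'a::alg_closed_field set" and v +
  fixes K :: "'a set" and D :: nat
  assumes ext: "extension_of_degree D K F" and complete_K: "complete_valued K v"
begin

lemma K_subfield: "subfield K \<Omega>" and K_sub: "K \<subseteq> F" and dim: "ring.dimension \<Omega> D K F"
  using ext by (auto simp: extension_of_degree_def)

lemma K_subfld: "subfld K" using subfield_ambient_iff[OF K_subfield] .

definition cauchy :: "(nat \<Rightarrow> 'a) \<Rightarrow> bool"
  where "cauchy s \<longleftrightarrow> (\<forall>N. \<exists>n0. \<forall>i\<ge>n0. \<forall>j\<ge>n0. gt N (s i - s j))"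
definition lim :: "(nat \<Rightarrow> 'a) \<Rightarrow> 'a \<Rightarrow> bool"
  where "lim s l \<longleftrightarrow> (\<forall>N. \<exists>n0. \<forall>i\<ge>n0. gt N (s i - l))"

lemma complete_valued_iff: "complete_valued E v \<longleftrightarrow> (\<forall>s. (\<forall>i. s i \<in> E) \<longrightarrow> cauchy s \<longrightarrow> (\<exists>l\<in>E. lim s l))"
  by (auto simp: complete_valued_def cauchy_def lim_def gt_def)

lemma lim_unique:
  assumes "\<And>i. s i \<in> F" "l \<in> F" "l' \<in> F" "lim s l" "lim s l'"
  shows "l = l'"
proof (rule ccontr)
  assume "l \<noteq> l'"
  obtain n0 where n0: "\<And>i. i \<ge> n0 \<Longrightarrow> gt (v (l - l')) (s i - l)" using assms(4) by (auto simp: lim_def)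
  obtain n1 where n1: "\<And>i. i \<ge> n1 \<Longrightarrow> gt (v (l - l')) (s i - l')" using assms(5) by (auto simp: lim_def)
  have "gt (v (l - l')) ((s (max n0 n1) - l') - (s (max n0 n1) - l))"
    by (intro gt_diff n0 n1 diff_closed assms) auto
  then show False using \<open>l \<noteq> l'\<close> by (auto simp: gt_def)
qed

text \<open>A subspace \<open>K a + S\<close> with \<open>S\<close> complete: if the coefficients of a Cauchy sequence
  were not Cauchy, then \<open>a\<close> would be a limit of elements of \<open>S\<close>.\<close>

lemma span_complete: "set Us \<subseteq> F \<Longrightarrow> complete_valued (ring.Span \<Omega> K Us) v \<and> ring.Span \<Omega> K Us \<subseteq> F"
proof (induction Us)
  case Nil
  interpret R: field "\<Omega> :: 'a ring" by (rule field_from_type_algebra)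
  show ?case by (auto simp: complete_valued_iff lim_def gt_def ambient_simps)
next
  case (Cons a Us)
  interpret R: field "\<Omega> :: 'a ring" by (rule field_from_type_algebra)
  interpret K: subfld K by (rule K_subfld)
  define S where "S = R.Span K Us"
  have S: "complete_valued S v" "S \<subseteq> F" using Cons by (auto simp: S_def)
  have aF: "a \<in> F" using Cons by simp
  have S_sub: "x - y \<in> S" if "x \<in> S" "y \<in> S" for x y
  proof -
    have neg: "\<ominus>\<^bsub>\<Omega>\<^esub> y = - y" by (rule R.minus_equality) (auto simp: ambient_simps)
    have "x \<oplus>\<^bsub>\<Omega>\<^esub> (\<ominus>\<^bsub>\<Omega>\<^esub> y) \<in> S"
      using that R.Span_subgroup_props[OF K_subfield, of Us] unfolding S_def by (auto simp: ambient_simps)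
    then show ?thesis by (simp add: ambient_simps neg)
  qed
  have S_mult: "c * x \<in> S" if "c \<in> K" "x \<in> S" for c x
    using R.Span_smult_closed[OF K_subfield, of Us c x] that unfolding S_def by (auto simp: ambient_simps)
  have mem: "x \<in> R.Span K (a # Us) \<longleftrightarrow> (\<exists>c\<in>K. \<exists>y\<in>S. x = c * a + y)" for x
    using R.line_extension_mem_iff[of x K a "R.Span K Us"] by (simp add: S_def ambient_simps)
  have S0: "0 \<in> S" using R.Span_subgroup_props(2)[OF K_subfield, of Us] unfolding S_def by (auto simp: ambient_simps)
  have sub: "R.Span K (a # Us) \<subseteq> F" using mem S(2) aF K_sub by (auto intro!: add_closed mult_closed)
  show ?case
  proof (cases "a \<in> S")
    case True
    have in_S: "c * a + y \<in> S" if "c \<in> K" "y \<in> S" for c y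
    proof -
      have "c * a - (0 - y) \<in> S" using that S_mult True S0 S_sub by blast
      then show ?thesis by simp
    qed
    have "R.Span K (a # Us) = S"
    proof (intro equalityI subsetI)
      fix x assume "x \<in> R.Span K (a # Us)"
      then obtain c y where "c \<in> K" "y \<in> S" "x = c * a + y" unfolding mem by blast
      then show "x \<in> S" using in_S by simp
    next
      fix x assume "x \<in> S"
      then show "x \<in> R.Span K (a # Us)" unfolding mem by (intro bexI[of _ 0] bexI[of _ x]) auto
    qed
    then show ?thesis using S by simp
  next
    case False
    have "\<exists>l\<in>R.Span K (a # Us). lim s l" if s: "\<And>i. s i \<in> R.Span K (a # Us)" "cauchy s" for s
    proof -
      have "\<exists>c y. c \<in> K \<and> y \<in> S \<and> s i = c * a + y" for i using s(1)[of i] mem by blast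
      then obtain c y where cy: "\<And>i. c i \<in> K" "\<And>i. y i \<in> S" "\<And>i. s i = c i * a + y i" by metis
      have F: "c i \<in> F" "y i \<in> F" "s i \<in> F" for i using cy(1,2)[of i] K_sub S(2) s(1)[of i] sub by auto
      have "cauchy c"
      proof (rule ccontr)
        assume "\<not> cauchy c"
        then obtain N where N: "\<And>n0. \<exists>i\<ge>n0. \<exists>j\<ge>n0. \<not> gt N (c i - c j)" by (auto simp: cauchy_def)
        then obtain I J where IJ: "\<And>n0. I n0 \<ge> n0" "\<And>n0. J n0 \<ge> n0" "\<And>n0. \<not> gt N (c (I n0) - c (J n0))" by metis
        \<comment> \<open>Along the chosen indices the differences of coefficients do not become
          small, so dividing by them preserves convergence to 0: the elements \<open>w k\<close> of
          \<open>S\<close> tend to \<open>- a\<close>.\<close>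
        define w where "w k = (y (I k) - y (J k)) / (c (I k) - c (J k))" for k
        have cnz: "c (I k) - c (J k) \<noteq> 0" "v (c (I k) - c (J k)) \<le> N" for k using IJ(3)[of k] by (auto simp: gt_def)
        have wS: "w k \<in> S" for k
          using S_mult[of "inverse (c (I k) - c (J k))" "y (I k) - y (J k)"] S_sub cy K.diff_closed K.inverse_closed
          by (simp add: w_def divide_inverse mult.commute)
        have e: "w k - (- a) = (s (I k) - s (J k)) / (c (I k) - c (J k))" for k
          using cnz(1)[of k] by (simp add: w_def cy(3) field_simps)
        have lw: "lim w (- a)" unfolding lim_def
        proof
          fix B
          obtain n0 where n0: "\<And>i j. i \<ge> n0 \<Longrightarrow> j \<ge> n0 \<Longrightarrow> gt (B + N) (s i - s j)" using s(2) by (force simp: cauchy_def)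
          have "gt B (w k - (- a))" if "k \<ge> n0" for k
          proof -
            have "gt (B + N) (s (I k) - s (J k))" using that IJ(1)[of k] IJ(2)[of k] by (intro n0) auto
            then show ?thesis unfolding e gt_def using cnz[of k]
              by (cases "s (I k) = s (J k)") (auto simp: v_divide diff_closed F)
          qed
          then show "\<exists>n0. \<forall>k\<ge>n0. gt B (w k - (- a))" by blast
        qed
        have wF: "w k \<in> F" for k using wS S(2) by auto
        have naF: "- a \<in> F" using aF by (rule uminus_closed)
        have "cauchy w" unfolding cauchy_def
        proof
          fix B
          obtain n0 where n0: "\<And>k. k \<ge> n0 \<Longrightarrow> gt B (w k - (- a))" using lw by (auto simp: lim_def)
          have "gt B (w i - w j)" if "i \<ge> n0" "j \<ge> n0" for i j
            using gt_diff[OF _ _ n0[OF that(1)] n0[OF that(2)]] wF aF by (simp add: add_closed)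
          then show "\<exists>n0. \<forall>i\<ge>n0. \<forall>j\<ge>n0. gt B (w i - w j)" by blast
        qed
        then obtain l where l: "l \<in> S" "lim w l" using S(1) wS unfolding complete_valued_iff by blast
        have "l = - a" using l S(2) lw wF naF by (intro lim_unique[of w]) auto
        then have "0 - l \<in> S" "0 - l = a" using S_sub[OF S0 l(1)] by auto
        then show False using False by simp
      qed
      then obtain c0 where c0: "c0 \<in> K" "lim c c0" using complete_K cy(1) unfolding complete_valued_iff by blast
      have c0F: "c0 \<in> F" using c0 K_sub by auto
      have gt_a: "gt (N + v a) (t * a)" if "t \<in> F" "gt N t" for t N
        using that aF by (cases "a = 0 \<or> t = 0") (auto simp: gt_def v_mult)
      have "cauchy y" unfolding cauchy_def
      proof
        fix N
        obtain n0 where n0: "\<And>i j. i \<ge> n0 \<Longrightarrow> j \<ge> n0 \<Longrightarrow> gt N (s i - s j)" using s(2) by (force simp: cauchy_def)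
        obtain n1 where n1: "\<And>i j. i \<ge> n1 \<Longrightarrow> j \<ge> n1 \<Longrightarrow> gt (N - v a) (c i - c j)" using \<open>cauchy c\<close> by (force simp: cauchy_def)
        have "gt N (y i - y j)" if ij: "i \<ge> max n0 n1" "j \<ge> max n0 n1" for i j
        proof -
          have "gt N ((c i - c j) * a)" using gt_a[OF _ n1, of i j] ij F diff_closed by simp
          moreover have "gt N (s i - s j)" using n0 ij by simp
          moreover have "y i - y j = (s i - s j) - (c i - c j) * a" by (simp add: cy(3) algebra_simps)
          ultimately show ?thesis using F aF by (metis gt_diff diff_closed mult_closed)
        qed
        then show "\<exists>n0. \<forall>i\<ge>n0. \<forall>j\<ge>n0. gt N (y i - y j)" by blast
      qed
      then obtain y0 where y0: "y0 \<in> S" "lim y y0" using S(1) cy(2) unfolding complete_valued_iff by blast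
      have y0F: "y0 \<in> F" using y0 S by auto
      have "lim s (c0 * a + y0)" unfolding lim_def
      proof
        fix N
        obtain n0 where n0: "\<And>i. i \<ge> n0 \<Longrightarrow> gt (N - v a) (c i - c0)" using c0(2) by (force simp: lim_def)
        obtain n1 where n1: "\<And>i. i \<ge> n1 \<Longrightarrow> gt N (y i - y0)" using y0(2) by (force simp: lim_def)
        have "gt N (s i - (c0 * a + y0))" if i: "i \<ge> max n0 n1" for i
        proof -
          have "gt N ((c i - c0) * a)" using gt_a[OF _ n0, of i] i F c0F diff_closed by simp
          moreover have "gt N (y i - y0)" using n1 i by simp
          moreover have "s i - (c0 * a + y0) = (c i - c0) * a + (y i - y0)" by (simp add: cy(3) algebra_simps)
          ultimately show ?thesis using F aF c0F y0F by (metis gt_add diff_closed mult_closed)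
        qed
        then show "\<exists>n0. \<forall>i\<ge>n0. gt N (s i - (c0 * a + y0))" by blast
      qed
      moreover have "c0 * a + y0 \<in> R.Span K (a # Us)" using mem c0 y0 by blast
      ultimately show ?thesis by blast
    qed
    then show ?thesis using sub unfolding complete_valued_iff by blast
  qed
qed

lemma complete_F: "complete_valued F v"
proof -
  interpret R: field "\<Omega> :: 'a ring" by (rule field_from_type_algebra)
  obtain Us where Us: "set Us \<subseteq> carrier \<Omega>" "R.Span K Us = F"
    using R.exists_base[OF K_subfield dim] by blast
  have "set Us \<subseteq> F" using R.Span_base_incl[OF K_subfield Us(1)] Us(2) by simp
  then show ?thesis using span_complete[of Us] Us(2) by simp
qed

lemma algebraic:
  assumes x: "x \<in> F"
  shows "\<exists>q\<in>polys_over K. q \<noteq> 0 \<and> Polynomial.degree q \<le> D \<and> poly q x = 0"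
proof -
  interpret R: field "\<Omega> :: 'a ring" by (rule field_from_type_algebra)
  interpret K: subfld K by (rule K_subfld)
  define Us where "Us = map (\<lambda>i. x ^ i) [0..<Suc D]"
  have UF: "set Us \<subseteq> F" unfolding Us_def using x by (auto intro: power_closed)
  have len: "length Us = Suc D" by (simp add: Us_def)
  have dep: "\<not> R.independent K Us"
    using R.independent_length_le_dimension[OF K_subfield dim _ UF] len by force
  have Uc: "set Us \<subseteq> carrier \<Omega>" by (simp add: ambient_simps)
  obtain Ks where Ks: "length Ks = length Us" "R.combine Ks Us = 0" "set Ks \<subseteq> K" "set Ks \<noteq> {0}"
    using R.dependent_imp_non_trivial_combine[OF K_subfield Uc dep] by (auto simp: ambient_simps)
  have comb: "R.combine As Bs = (\<Sum>i<length As. As ! i * Bs ! i)" if "length As = length Bs" for As Bs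
    using that
  proof (induction As Bs rule: list_induct2)
    case (Cons a As b Bs)
    then show ?case unfolding length_Cons sum.lessThan_Suc_shift by (simp add: ambient_simps)
  qed (simp add: ambient_simps)
  define q where "q = (\<Sum>i<Suc D. Polynomial.monom (Ks ! i) i)"
  have cq: "Polynomial.coeff q i = (if i < Suc D then Ks ! i else 0)" for i
    unfolding q_def coeff_sum by (auto simp: coeff_monom)
  have "Ks \<noteq> []" using Ks(1) len by auto
  then have "set Ks \<noteq> {}" by simp
  then obtain c where "c \<in> set Ks" "c \<noteq> 0" using Ks(4) subset_singleton_iff[of "set Ks" 0] by blast
  then obtain i where "i < Suc D" "Ks ! i \<noteq> 0" using Ks(1) len by (auto simp: in_set_conv_nth)
  then have "q \<noteq> 0" using cq[of i] by auto
  moreover have "q \<in> polys_over K" using Ks(1,3) len by (auto simp: polys_over_def cq intro: nth_mem subsetD)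
  moreover have "Polynomial.degree q \<le> D" by (intro degree_le) (auto simp: cq)
  moreover have "poly q x = 0"
    using Ks(2) comb[OF Ks(1)] Ks(1) len
    by (simp add: q_def poly_sum poly_monom Us_def del: sum.lessThan_Suc upt_Suc)
  ultimately show ?thesis by blast
qed

end

section \<open>Local fields\<close>

lemma residue_field_cong:
  assumes "\<And>x. x \<in> K \<Longrightarrow> x \<noteq> 0 \<Longrightarrow> w x = v x"
  shows "residue_field K w = residue_field K v"
proof -
  have "(x = 0 \<or> 0 \<le> w x) \<longleftrightarrow> (x = 0 \<or> 0 \<le> v x)" "(x = 0 \<or> 0 < w x) \<longleftrightarrow> (x = 0 \<or> 0 < v x)" if "x \<in> K" for x
    using assms[OF that] by (cases "x = 0"; simp)+
  then have "valuation_ring K w = valuation_ring K v" "maximal_ideal_of K w = maximal_ideal_of K v"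
    unfolding valuation_ring_def maximal_ideal_of_def by blast+
  then show ?thesis by (simp add: residue_field_def)
qed

text \<open>The unramified field in the Hasse invariant carries a valuation of its own that agrees
  with \<open>v\<close> on \<open>K\<close> only; this transports the local field structure to
  it.\<close>

lemma local_field_cong:
  assumes "local_field K v" "\<And>x. x \<in> K \<Longrightarrow> x \<noteq> 0 \<Longrightarrow> w x = v x"
  shows "local_field K w"
proof -
  have "subfield K \<Omega>" using assms(1) by (simp add: local_field_def)
  then interpret K: subfld K by (rule subfield_ambient_iff)
  have 1: "valuation_on K w \<longleftrightarrow> valuation_on K v"
    unfolding valuation_on_def using assms(2) by (auto simp: K.mult_closed K.add_closed)
  have 2: "value_group K w = value_group K v"
    unfolding value_group_def using assms(2) by (intro image_cong) auto
  have c: "s - l = 0 \<or> w (s - l) = v (s - l)" if "s \<in> K" "l \<in> K" for s l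
    using assms(2)[of "s - l"] that K.diff_closed by auto
  have 3: "complete_valued K w \<longleftrightarrow> complete_valued K v"
  proof -
    have e: "(s = l \<or> N < w (s - l)) \<longleftrightarrow> (s = l \<or> N < v (s - l))" if "s \<in> K" "l \<in> K" for s l N
      using c[OF that] by auto
    show ?thesis unfolding complete_valued_def
    proof (intro all_cong1)
      fix s :: "nat \<Rightarrow> 'a"
      show "((\<forall>i. s i \<in> K) \<and> (\<forall>N. \<exists>n0. \<forall>i\<ge>n0. \<forall>j\<ge>n0. s i = s j \<or> N < w (s i - s j)) \<longrightarrow>
          (\<exists>l\<in>K. \<forall>N. \<exists>n0. \<forall>i\<ge>n0. s i = l \<or> N < w (s i - l))) \<longleftrightarrow>
        ((\<forall>i. s i \<in> K) \<and> (\<forall>N. \<exists>n0. \<forall>i\<ge>n0. \<forall>j\<ge>n0. s i = s j \<or> N < v (s i - s j)) \<longrightarrow>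
          (\<exists>l\<in>K. \<forall>N. \<exists>n0. \<forall>i\<ge>n0. s i = l \<or> N < v (s i - l)))"
      proof (cases "\<forall>i. s i \<in> K")
        case True
        then show ?thesis by (simp add: e cong: bex_cong)
      qed blast
    qed
  qed
  have 4: "residue_field K w = residue_field K v" by (rule residue_field_cong[OF assms(2)])
  show ?thesis using assms(1) unfolding local_field_def 1 2 3 4 .
qed

locale lf = K: valued K v for K :: "'a::alg_closed_field set" and v +
  fixes \<pi> :: 'a and p t Q :: nat
  assumes lf: "local_field K v" and prime_p: "Factorial_Ring.prime p"
    and card_residue: "card (carrier (residue_field K v)) = p ^ t" and Q_def: "Q = p ^ t"
    and pi: "uniformiser K v \<pi>"
begin

lemma values_K: "value_group K v = \<int>" and complete_K: "complete_valued K v"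
  and finite_residue: "finite (carrier (residue_field K v))"
  using lf by (auto simp: local_field_def)

lemma v_pi: "v \<pi> = 1"
proof -
  have pi': "\<pi> \<in> K" "\<pi> \<noteq> 0" "0 < v \<pi>" using pi by (auto simp: uniformiser_def)
  have "1 \<in> value_group K v" unfolding values_K by simp
  then obtain x where x: "x \<in> K" "x \<noteq> 0" "v x = 1" unfolding value_group_def by force
  have "\<forall>y\<in>K - {0}. 0 < v y \<longrightarrow> v \<pi> \<le> v y" using pi by (simp add: uniformiser_def)
  from bspec[OF this, of x] have "v \<pi> \<le> 1" using x by simp
  moreover have "v \<pi> \<in> \<int>" using values_K pi' by (auto simp: value_group_def)
  then obtain k :: int where "v \<pi> = of_int k" by (elim Ints_cases)
  ultimately show ?thesis using pi' by simp
qed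

sublocale KD: local_dom K.\<O> K.mm
  by (rule K.local_dom)

lemma KD_RF: "KD.RF = residue_field K v"
  by (rule K.residue_field_eq[symmetric])

lemma t_pos: "1 \<le> t"
proof (rule ccontr)
  assume "\<not> 1 \<le> t"
  then have "card (carrier KD.RF) = 1" using card_residue KD_RF by simp
  moreover have "KD.cl 0 \<in> carrier KD.RF" "KD.cl 1 \<in> carrier KD.RF"
    unfolding KD.carrier_k by (auto intro: KD.O_zero KD.O_one)
  ultimately have "KD.cl 1 = KD.cl 0" by (auto simp: card_1_singleton_iff)
  then show False using KD.cl_eq[OF KD.O_one KD.O_zero] KD.one_notin by simp
qed

lemma p_in_mm: "of_nat p \<in> K.mm"
proof -
  have "of_nat (p ^ t) \<in> K.mm" using KD.residue_char card_residue finite_residue KD_RF by simp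
  then have *: "of_nat p ^ t \<in> K.mm" by simp
  show ?thesis
  proof (cases "(of_nat p :: 'a) = 0")
    case False
    have "of_nat p \<in> K" by (rule K.of_nat_closed)
    then show ?thesis using * False t_pos by (auto simp: K.mm_iff K.gt_def K.v_power zero_less_mult_iff)
  qed (simp add: KD.I_zero)
qed

lemma residue_Q: "x \<in> K.\<O> \<Longrightarrow> x ^ Q - x \<in> K.mm"
  using KD.residue_power card_residue finite_residue KD_RF by (simp add: Q_def)

sublocale KA: adic K K.\<O> \<pi> p Q
  by (rule K.adic[OF pi prime_p p_in_mm _ residue_Q complete_K]) (use t_pos Q_def in auto)

text \<open>A counting argument: the equation has at most \<open>Q\<close> roots in the ambient
  field, and \<open>K\<close> already contains one for each of its \<open>Q\<close> residue
  classes.\<close>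

lemma teichmueller_in_K:
  assumes "x ^ Q = x" shows "x \<in> K"
proof -
  let ?q = "Polynomial.monom 1 Q - [:0, 1:] :: 'a poly"
  have q0: "?q \<noteq> 0"
  proof
    assume "?q = 0"
    then have "Polynomial.coeff ?q Q = 0" by simp
    then show False using KA.P_gt_1 by (cases Q) (auto simp: coeff_pCons split: nat.splits)
  qed
  have dq: "Polynomial.degree ?q \<le> Q" using KA.P_gt_1
    by (intro Polynomial.degree_diff_le) (auto simp: degree_monom_le)
  let ?T = "{x. poly ?q x = 0}"
  have T: "x \<in> ?T \<longleftrightarrow> x ^ Q = x" for x by (simp add: poly_monom)
  have fin: "finite ?T" by (rule poly_roots_finite[OF q0])
  have "card ?T \<le> Q" using card_poly_roots_bound[OF q0] dq by simp
  moreover have "Q \<le> card (?T \<inter> K)"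
  proof -
    have "carrier KD.RF \<subseteq> KD.cl ` (?T \<inter> K)"
    proof
      fix c assume "c \<in> carrier KD.RF"
      then obtain x where x: "x \<in> K.\<O>" "c = KD.cl x" unfolding KD.carrier_k by blast
      obtain t where t: "t \<in> K.\<O>" "t ^ Q = t" "KA.cg 1 x t" using KA.teichmueller[OF x(1)] .
      have "x - t \<in> K.mm" using t(3) K.mm_pi[OF pi] by (auto simp: KA.cg_def)
      then have "c = KD.cl t" using KD.cl_eq x t by simp
      then show "c \<in> KD.cl ` (?T \<inter> K)" using t T K.O_iff by blast
    qed
    then have "card (carrier KD.RF) \<le> card (KD.cl ` (?T \<inter> K))" using fin by (intro card_mono) auto
    also have "\<dots> \<le> card (?T \<inter> K)" using fin by (intro card_image_le) auto
    finally show ?thesis using card_residue KD_RF Q_def by simp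
  qed
  ultimately have "?T \<inter> K = ?T" using fin by (intro card_seteq) auto
  then show ?thesis using assms T by blast
qed

end

locale lf_ext = lf K v \<pi> p t Q + fin_ext F v K D
  for K F :: "'a::alg_closed_field set" and v \<pi> p t Q D
begin

sublocale FD: local_dom \<O> mm
  by (rule local_dom)

lemma K_O: "K.\<O> \<subseteq> \<O>" and K_mm: "K.mm \<subseteq> mm"
  using K_sub by (auto simp: O_iff K.O_iff mm_iff K.mm_iff ge_def K.ge_def gt_def K.gt_def)

lemma p_mm: "of_nat p \<in> mm"
  using p_in_mm K_mm by auto

lemma mm_power: "x \<in> F \<Longrightarrow> x ^ n \<in> mm \<Longrightarrow> n \<noteq> 0 \<Longrightarrow> x \<in> mm"
  by (cases "x = 0") (auto simp: mm_iff gt_def v_power zero_less_mult_iff)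

lemma mm_diff: "x \<in> mm \<Longrightarrow> y \<in> mm \<Longrightarrow> x - y \<in> mm"
  using FD.I_add[of x "-y"] FD.I_uminus[of y] by simp

lemma mm_sum: "(\<And>i. i \<in> I \<Longrightarrow> f i \<in> mm) \<Longrightarrow> sum f I \<in> mm"
  by (induction I rule: infinite_finite_induct) (auto intro: FD.I_add FD.I_zero)

lemma O_sum: "(\<And>i. i \<in> I \<Longrightarrow> f i \<in> \<O>) \<Longrightarrow> sum f I \<in> \<O>"
  by (induction I rule: infinite_finite_induct) (auto intro: FD.O_add FD.O_zero)

lemma representatives: "\<exists>S\<subseteq>K.\<O>. finite S \<and> S \<noteq> {} \<and> (\<forall>c\<in>K.\<O>. \<exists>s\<in>S. c - s \<in> K.mm)"
proof -
  define g where "g C = (SOME x. x \<in> K.\<O> \<and> KD.cl x = C)" for C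
  have g: "g C \<in> K.\<O> \<and> KD.cl (g C) = C" if "C \<in> carrier KD.RF" for C
    unfolding g_def using that unfolding KD.carrier_k by (intro someI_ex[of "\<lambda>x. x \<in> K.\<O> \<and> KD.cl x = C"]) blast
  have cC: "KD.cl c \<in> carrier KD.RF" if "c \<in> K.\<O>" for c unfolding KD.carrier_k using that by blast
  show ?thesis
  proof (intro exI[of _ "g ` carrier KD.RF"] conjI ballI)
    show "g ` carrier KD.RF \<subseteq> K.\<O>" using g by blast
    show "finite (g ` carrier KD.RF)" using finite_residue KD_RF by simp
    show "g ` carrier KD.RF \<noteq> {}" using cC[OF KD.O_zero] by blast
    fix c assume c: "c \<in> K.\<O>"
    have "KD.cl c = KD.cl (g (KD.cl c))" using g[OF cC[OF c]] by simp
    then have "c - g (KD.cl c) \<in> K.mm" using KD.cl_eq c g[OF cC[OF c]] by blast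
    then show "\<exists>s\<in>g ` carrier KD.RF. c - s \<in> K.mm" using cC[OF c] by blast
  qed
qed

text \<open>An algebraic equation is divided by a coefficient of least valuation. Modulo
  \<open>mm\<close> only terms up to the highest unit coefficient remain; its index \<open>j\<close>
  is positive, as otherwise \<open>1\<close> would lie in \<open>mm\<close>.\<close>

lemma integral_relation:
  assumes x: "x \<in> \<O>"
  shows "\<exists>j a. 1 \<le> j \<and> j \<le> D \<and> (\<forall>i. a i \<in> K.\<O>) \<and> x ^ j - (\<Sum>i<j. a i * x ^ i) \<in> mm"
proof -
  have xF: "x \<in> F" using x by (simp add: O_iff)
  obtain q where q: "q \<in> polys_over K" "q \<noteq> 0" "Polynomial.degree q \<le> D" "poly q x = 0" using algebraic[OF xF] by blast
  define I where "I = {i. Polynomial.coeff q i \<noteq> 0}"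
  have I: "I \<subseteq> {..Polynomial.degree q}" "Polynomial.degree q \<in> I" unfolding I_def using q(2) by (auto intro: le_degree)
  then have finI: "finite I" using finite_subset by blast
  obtain i0 where i0: "i0 \<in> I" "\<And>i. i \<in> I \<Longrightarrow> v (Polynomial.coeff q i0) \<le> v (Polynomial.coeff q i)"
  proof -
    obtain m where m: "m \<in> (\<lambda>i. v (Polynomial.coeff q i)) ` I" "\<And>y. y \<in> (\<lambda>i. v (Polynomial.coeff q i)) ` I \<Longrightarrow> m \<le> y"
      using Min_in[of "(\<lambda>i. v (Polynomial.coeff q i)) ` I"] Min_le[of "(\<lambda>i. v (Polynomial.coeff q i)) ` I"] finI I(2) by blast
    then show thesis using that by blast
  qed
  define c where "c i = Polynomial.coeff q i / Polynomial.coeff q i0" for i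
  have qK: "Polynomial.coeff q i \<in> K" for i using q(1) by (auto simp: polys_over_def)
  have i0nz: "Polynomial.coeff q i0 \<noteq> 0" using i0(1) by (simp add: I_def)
  have cO: "c i \<in> K.\<O>" for i
    unfolding c_def using qK i0nz i0(2)[of i]
    by (cases "i \<in> I") (auto simp: K.O_iff K.ge_def I_def K.divide_closed K.v_divide)
  have c0: "c i0 = 1" unfolding c_def using i0nz by simp
  have csum: "(\<Sum>i\<le>D. c i * x ^ i) = 0"
  proof -
    have "(\<Sum>i\<le>D. Polynomial.coeff q i * x ^ i) = poly q x"
      unfolding poly_altdef using q(3) by (intro sum.mono_neutral_right) (auto simp: Polynomial.coeff_eq_0)
    then have "(\<Sum>i\<le>D. Polynomial.coeff q i * x ^ i) / Polynomial.coeff q i0 = 0" using q(4) by simp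
    then show ?thesis by (simp add: c_def sum_divide_distrib)
  qed
  have i0D: "i0 \<le> D" using i0(1) I(1) q(3) by auto
  define J where "J = {i. i \<le> D \<and> c i \<notin> K.mm}"
  define j where "j = Max J"
  have J: "finite J" "i0 \<in> J" unfolding J_def using i0D c0 KD.one_notin by auto
  have jJ: "j \<in> J" unfolding j_def using J by (intro Max_in) auto
  have jmax: "c i \<in> K.mm" if "j < i" "i \<le> D" for i
  proof (rule ccontr)
    assume "c i \<notin> K.mm"
    then have "i \<in> J" using that by (simp add: J_def)
    then have "i \<le> j" unfolding j_def using J by (intro Max_ge) auto
    then show False using that by simp
  qed
  define u where "u = inverse (c j)"
  have "c j \<noteq> 0" using jJ KD.I_zero unfolding J_def mem_Collect_eq by metis
  then have u: "u \<in> K.\<O>" "c j * u = 1"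
    using jJ KD.unit[OF cO, of j] by (auto simp: u_def J_def)
  have xpO: "x ^ i \<in> \<O>" for i by (rule FD.O_power[OF x])
  have split: "(\<Sum>i\<le>D. c i * x ^ i) = (\<Sum>i<j. c i * x ^ i) + c j * x ^ j + (\<Sum>i\<in>{j<..D}. c i * x ^ i)"
  proof -
    have "{..D} = {..<j} \<union> {j} \<union> {j<..D}" using jJ by (auto simp: J_def)
    moreover have "(\<Sum>i\<in>{..<j} \<union> {j} \<union> {j<..D}. c i * x ^ i) = (\<Sum>i\<in>{..<j} \<union> {j}. c i * x ^ i) + (\<Sum>i\<in>{j<..D}. c i * x ^ i)"
      by (rule sum.union_disjoint) auto
    ultimately show ?thesis by (simp add: sum.union_disjoint add.commute)
  qed
  have tail: "(\<Sum>i\<in>{j<..D}. c i * x ^ i) \<in> mm"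
    using jmax K_mm by (intro mm_sum FD.I_mult xpO) auto
  have e: "x ^ j - (\<Sum>i<j. (- (c i * u)) * x ^ i) = - ((\<Sum>i\<in>{j<..D}. c i * x ^ i) * u)"
  proof -
    have "(\<Sum>i<j. c i * x ^ i) + c j * x ^ j = - (\<Sum>i\<in>{j<..D}. c i * x ^ i)"
      using csum split by (simp add: eq_neg_iff_add_eq_0)
    then have "((\<Sum>i<j. c i * x ^ i) + c j * x ^ j) * u = - (\<Sum>i\<in>{j<..D}. c i * x ^ i) * u" by simp
    moreover have "((\<Sum>i<j. c i * x ^ i) + c j * x ^ j) * u = (\<Sum>i<j. c i * u * x ^ i) + (c j * u) * x ^ j"
      by (simp add: algebra_simps sum_distrib_left)
    ultimately show ?thesis using u(2) by (simp add: sum_negf algebra_simps)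
  qed
  have rel: "x ^ j - (\<Sum>i<j. (- (c i * u)) * x ^ i) \<in> mm"
    unfolding e using tail u(1) K_O by (intro FD.I_uminus FD.I_mult) auto
  have "j \<noteq> 0"
  proof
    assume "j = 0"
    then have "1 \<in> mm" using rel by simp
    then show False using FD.one_notin by simp
  qed
  moreover have "j \<le> D" using jJ by (simp add: J_def)
  moreover have "- (c i * u) \<in> K.\<O>" for i by (intro KD.O_uminus KD.O_mult cO u)
  ultimately show ?thesis using rel by (intro exI[of _ j] exI[of _ "\<lambda>i. - (c i * u)"]) simp
qed

lemma Q_pos: "0 < Q" using KA.P_gt_1 by simp

text \<open>The powers of \<open>x\<close> take finitely many, uniformly boundedly many, values modulo \<open>mm\<close>.\<close>

lemma residue_frobenius: "\<exists>f\<ge>1. \<forall>x\<in>\<O>. x ^ (Q ^ f) - x \<in> mm"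
proof -
  obtain S where S: "S \<subseteq> K.\<O>" "finite S" "S \<noteq> {}" "\<And>c. c \<in> K.\<O> \<Longrightarrow> \<exists>s\<in>S. c - s \<in> K.mm"
    using representatives by blast
  \<comment> \<open>Every power of \<open>x\<close> is congruent to a combination of at most
    \<open>D\<close> powers with coefficients in \<open>S\<close>; \<open>N\<close> bounds the
    number of such combinations independently of \<open>x\<close>.\<close>
  define N where "N = card S ^ D"
  have cS: "1 \<le> card S" using S by (simp add: Suc_leI card_gt_0_iff)
  have one: "\<exists>m. 1 \<le> m \<and> m \<le> N \<and> x ^ (Q ^ m) - x \<in> mm" if x: "x \<in> \<O>" for x
  proof -
    obtain j a where j: "1 \<le> j" "j \<le> D" and a: "\<And>i. a i \<in> K.\<O>" and rel: "x ^ j - (\<Sum>i<j. a i * x ^ i) \<in> mm"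
      using integral_relation[OF x] by blast
    have xpO: "x ^ i \<in> \<O>" for i by (rule FD.O_power[OF x])
    have comb: "\<exists>c. (\<forall>i. c i \<in> K.\<O>) \<and> x ^ k - (\<Sum>i<j. c i * x ^ i) \<in> mm" for k
    proof (induction k)
      case 0
      have "(\<Sum>i<j. (if i = 0 then 1 else 0) * x ^ i) = (\<Sum>i<j. if i = 0 then 1 else 0)" by (intro sum.cong) auto
      then have "x ^ 0 - (\<Sum>i<j. (if i = 0 then 1 else 0) * x ^ i) \<in> mm" using j(1) FD.I_zero by simp
      then show ?case by (intro exI[of _ "\<lambda>i. if i = 0 then 1 else 0"]) (auto intro: KD.O_one KD.O_zero)
    next
      case (Suc k)
      then obtain c where c: "\<And>i. c i \<in> K.\<O>" "x ^ k - (\<Sum>i<j. c i * x ^ i) \<in> mm" by blast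
      obtain j' where j': "j = Suc j'" using j(1) by (cases j) auto
      define c' where "c' i = (case i of 0 \<Rightarrow> 0 | Suc i' \<Rightarrow> c i') + c j' * a i" for i
      have c'O: "c' i \<in> K.\<O>" for i unfolding c'_def
        by (cases i) (auto intro!: KD.O_add KD.O_mult KD.O_zero c a)
      have "x ^ Suc k - (\<Sum>i<j. c' i * x ^ i) = (x ^ k - (\<Sum>i<j. c i * x ^ i)) * x + (x ^ j - (\<Sum>i<j. a i * x ^ i)) * c j'"
      proof -
        have "(\<Sum>i<j. c' i * x ^ i) = (\<Sum>i<j. (case i of 0 \<Rightarrow> 0 | Suc i' \<Rightarrow> c i') * x ^ i) + c j' * (\<Sum>i<j. a i * x ^ i)"
          by (simp add: c'_def sum_distrib_left sum.distrib algebra_simps)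
        moreover have "(\<Sum>i<j. (case i of 0 \<Rightarrow> 0 | Suc i' \<Rightarrow> c i') * x ^ i) = (\<Sum>i<j'. c i * x ^ i) * x"
          unfolding j' sum.lessThan_Suc_shift by (simp add: sum_distrib_left algebra_simps)
        moreover have "(\<Sum>i<j. c i * x ^ i) = (\<Sum>i<j'. c i * x ^ i) + c j' * x ^ j'" by (simp add: j')
        ultimately show ?thesis by (simp add: j' algebra_simps)
      qed
      also have "\<dots> \<in> mm" using c a rel x K_O by (intro FD.I_add FD.I_mult) auto
      finally show ?case using c'O by blast
    qed
    have "\<exists>s. s \<in> PiE {..<j} (\<lambda>_. S) \<and> x ^ k - (\<Sum>i<j. s i * x ^ i) \<in> mm" for k
    proof -
      obtain c where c: "\<And>i. c i \<in> K.\<O>" "x ^ k - (\<Sum>i<j. c i * x ^ i) \<in> mm" using comb by blast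
      have "\<exists>s. \<forall>i. s i \<in> S \<and> c i - s i \<in> K.mm" using S(4)[OF c(1)] by metis
      then obtain s where s: "\<And>i. s i \<in> S" "\<And>i. c i - s i \<in> K.mm" by blast
      have "(\<Sum>i<j. (c i - s i) * x ^ i) \<in> mm" using s(2) K_mm by (intro mm_sum FD.I_mult xpO) auto
      then have "(x ^ k - (\<Sum>i<j. c i * x ^ i)) + (\<Sum>i<j. (c i - s i) * x ^ i) \<in> mm" by (rule FD.I_add[OF c(2)])
      moreover have "(x ^ k - (\<Sum>i<j. c i * x ^ i)) + (\<Sum>i<j. (c i - s i) * x ^ i) = x ^ k - (\<Sum>i<j. restrict s {..<j} i * x ^ i)"
        by (simp add: sum_subtractf algebra_simps)
      ultimately show ?thesis using s(1) by (intro exI[of _ "restrict s {..<j}"]) auto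
    qed
    then obtain s where s: "\<And>k. s k \<in> PiE {..<j} (\<lambda>_. S)" "\<And>k. x ^ k - (\<Sum>i<j. s k i * x ^ i) \<in> mm" by metis
    have "card (PiE {..<j} (\<lambda>_. S)) = card S ^ j" by (simp add: card_PiE)
    also have "\<dots> \<le> N" unfolding N_def using j cS by (intro power_increasing) auto
    finally have "card (PiE {..<j} (\<lambda>_. S)) < card {..N}" by simp
    moreover have "(\<lambda>k. s (Q ^ k)) ` {..N} \<subseteq> PiE {..<j} (\<lambda>_. S)" using s(1) by auto
    moreover have "finite (PiE {..<j} (\<lambda>_. S))" using S(2) by (intro finite_PiE) auto
    ultimately have "\<not> inj_on (\<lambda>k. s (Q ^ k)) {..N}"
      using card_inj_on_le[of "\<lambda>k. s (Q ^ k)" "{..N}" "PiE {..<j} (\<lambda>_. S)"] by fastforce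
    then obtain i k where ik: "i < k" "k \<le> N" "s (Q ^ i) = s (Q ^ k)"
      unfolding inj_on_def by (metis atMost_iff linorder_neqE_nat)
    have cong: "x ^ (Q ^ k) - x ^ (Q ^ i) \<in> mm"
      using mm_diff[OF s(2)[of "Q ^ k"] s(2)[of "Q ^ i"]] ik(3) by simp
    \<comment> \<open>Congruences modulo \<open>p\<close> suffice to compare
      \<open>(y - x)^(Q^i)\<close> with \<open>y^(Q^i) - x^(Q^i)\<close>; this extracts the
      \<open>Q^i\<close>-th root from the congruence just found.\<close>
    interpret pr: pi_ring \<O> "of_nat p" p
      by unfold_locales (auto intro: FD.O_zero FD.O_one FD.O_add FD.O_uminus FD.O_mult FD.O_of_nat prime_p bexI[of _ 1])
    define y where "y = x ^ (Q ^ (k - i))"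
    have yO: "y \<in> \<O>" "y - x \<in> \<O>" unfolding y_def using xpO pr.O_diff x by auto
    have Qi: "Q ^ i = p ^ (t * i)" by (simp add: Q_def power_mult)
    have "pr.cg 1 ((y - x + x) ^ (Q ^ i)) ((y - x) ^ (Q ^ i) + x ^ (Q ^ i))"
      unfolding Qi by (intro pr.freshman yO x)
    then obtain z where z: "z \<in> \<O>" "y ^ (Q ^ i) - ((y - x) ^ (Q ^ i) + x ^ (Q ^ i)) = of_nat p * z" by (auto simp: pr.cg_def)
    have yk: "y ^ (Q ^ i) = x ^ (Q ^ k)" unfolding y_def using ik(1) by (simp add: power_mult[symmetric] power_add[symmetric])
    have "(y - x) ^ (Q ^ i) = (x ^ (Q ^ k) - x ^ (Q ^ i)) - of_nat p * z" using z(2) yk by (simp add: algebra_simps)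
    also have "\<dots> \<in> mm" by (intro mm_diff cong FD.I_mult p_mm z)
    finally have "y - x \<in> mm" using yO(2) Q_pos by (intro mm_power[of "y - x" "Q ^ i"]) (auto simp: O_iff)
    then show ?thesis using ik by (intro exI[of _ "k - i"]) (auto simp: y_def)
  qed
  have iter: "x ^ (Q ^ (m * n)) - x \<in> mm" if x: "x \<in> \<O>" "x ^ (Q ^ m) - x \<in> mm" for x m n
  proof (induction n)
    case (Suc n)
    interpret pr: pi_ring \<O> "of_nat p" p
      by unfold_locales (auto intro: FD.O_zero FD.O_one FD.O_add FD.O_uminus FD.O_mult FD.O_of_nat prime_p bexI[of _ 1])
    have dvd: "\<exists>w\<in>\<O>. a ^ r - b ^ r = (a - b) * w" if "a \<in> \<O>" "b \<in> \<O>" for a b r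
      using that by (intro bexI[of _ "\<Sum>i<r. b ^ (r - Suc i) * a ^ i"] power_diff_sumr2) (auto intro!: O_sum FD.O_mult FD.O_power)
    obtain w where w: "w \<in> \<O>" "(x ^ (Q ^ (m * n))) ^ (Q ^ m) - x ^ (Q ^ m) = (x ^ (Q ^ (m * n)) - x) * w"
      using dvd[of "x ^ (Q ^ (m * n))" x "Q ^ m"] x FD.O_power by blast
    have "x ^ (Q ^ (m * Suc n)) - x = ((x ^ (Q ^ (m * n))) ^ (Q ^ m) - x ^ (Q ^ m)) + (x ^ (Q ^ m) - x)"
      by (simp add: power_mult[symmetric] power_add[symmetric] add.commute)
    also have "\<dots> \<in> mm" unfolding w(2) by (intro FD.I_add FD.I_mult Suc w x)
    finally show ?case .
  qed (simp add: FD.I_zero)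
  show ?thesis
  \<comment> \<open>The period of each element is at most \<open>N\<close>, so the factorial is a
    common multiple of all of them.\<close>
  proof (intro exI[of _ "fact N"] conjI ballI)
    show "1 \<le> (fact N :: nat)" by (rule fact_ge_1)
    fix x assume x: "x \<in> \<O>"
    obtain m where m: "1 \<le> m" "m \<le> N" "x ^ (Q ^ m) - x \<in> mm" using one[OF x] by blast
    have "m dvd fact N" using m by (intro dvd_fact) auto
    then obtain n where n: "fact N = m * n" by (elim dvdE)
    show "x ^ (Q ^ fact N) - x \<in> mm" unfolding n by (rule iter[OF x m(3)])
  qed
qed

lemma adic_F:
  assumes "uniformiser F v \<pi>'" and f: "1 \<le> f" "\<And>x. x \<in> \<O> \<Longrightarrow> x ^ (Q ^ f) - x \<in> mm"
  shows "adic F \<O> \<pi>' p (Q ^ f)"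
proof (rule adic[OF assms(1) prime_p p_mm _ f(2) complete_F])
  show "\<exists>k\<ge>1. Q ^ f = p ^ k"
    using f(1) t_pos by (intro exI[of _ "t * f"]) (auto simp: Q_def power_mult)
qed

end

text \<open>Successive approximation: every element of \<open>A\<close> has a leading digit in the
  complete ring \<open>S\<close> and a remainder in \<open>A\<close> again, hence is the limit of
  its expansion. It is used for the integers of an unramified extension and for the elements fixed
  by Frobenius.\<close>

lemma (in adic) approximation:
  assumes S: "adic F' S \<pi> p P'" "S \<subseteq> \<O>" and A: "A \<subseteq> \<O>"
    and step: "\<And>x. x \<in> A \<Longrightarrow> \<exists>y\<in>S. \<exists>x'\<in>A. x = y + \<pi> * x'"
  shows "A \<subseteq> S"
proof
  interpret S: adic F' S \<pi> p P' by fact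
  fix x assume x: "x \<in> A"
  obtain Y X' where YX: "\<And>x. x \<in> A \<Longrightarrow> Y x \<in> S \<and> X' x \<in> A \<and> x = Y x + \<pi> * X' x"
    using step by metis
  define s where "s n = (X' ^^ n) x" for n
  have sA: "s n \<in> A" for n by (induction n) (use x YX in \<open>auto simp: s_def\<close>)
  define y where "y n = (\<Sum>i<n. \<pi> ^ i * Y (s i))" for n
  have yS: "y n \<in> S" for n unfolding y_def using YX sA by (intro S.O_sum S.O_mult S.O_power S.pi_in) auto
  have e: "x = y n + \<pi> ^ n * s n" for n
  proof (induction n)
    case 0
    show ?case by (simp add: y_def s_def)
  next
    case (Suc n)
    have "s n = Y (s n) + \<pi> * s (Suc n)" using YX[OF sA[of n]] by (simp add: s_def)
    then have "\<pi> ^ n * s n = \<pi> ^ n * Y (s n) + \<pi> ^ Suc n * s (Suc n)"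
      by (metis distrib_left mult.assoc power_Suc2)
    then show ?case using Suc by (simp add: y_def)
  qed
  have "S.cg k (y (Suc k)) (y k)" for k using YX sA by (auto simp: y_def S.cg_def)
  from S.limit[OF yS this] obtain l where l: "l \<in> S" "\<And>k. S.cg k l (y k)" by blast
  have "l = x"
  proof (rule cg_separated)
    fix k
    have "cg k l (y k)" using l(2)[of k] S(2) by (auto simp: S.cg_def cg_def)
    moreover have "cg k x (y k)" using e[of k] sA[of k] A by (auto simp: cg_def algebra_simps)
    ultimately show "cg k l x" using cg_sym cg_trans by blast
  qed (use l S A x in auto)
  then show "x \<in> S" using l by simp
qed

lemma combine_ambient:
  "ring.combine (\<Omega> :: 'a::alg_closed_field ring) As Bs = (\<Sum>i<min (length As) (length Bs). As ! i * Bs ! i)"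
proof -
  interpret R: field "\<Omega> :: 'a ring" by (rule field_from_type_algebra)
  show ?thesis
  proof (induction As Bs rule: R.combine.induct)
    case (1 k Ks u Us)
    then show ?case by (simp add: ambient_simps sum.lessThan_Suc_shift del: sum.lessThan_Suc)
  qed (auto simp: ambient_simps)
qed

text \<open>Identifies the order of the automorphism with the degree of the extension; a polynomial
  of degree below \<open>d\<close> cannot vanish at all \<open>d\<close> conjugates of
  \<gamma>.\<close>

lemma (in cyc) dimension:
  assumes K: "subfield K \<Omega>"
  shows "ring.dimension \<Omega> d K E"
proof -
  interpret R: field "\<Omega> :: 'a ring" by (rule field_from_type_algebra)
  define Us where "Us = map (\<lambda>i. \<gamma> ^ i) [0..<d]"
  have len: "length Us = d" by (simp add: Us_def)
  have Uc: "set Us \<subseteq> carrier \<Omega>" by (simp add: ambient_simps)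
  have comb: "R.combine Ks Us = (\<Sum>i<min (length Ks) d. Ks ! i * \<gamma> ^ i)" for Ks
    unfolding combine_ambient len by (intro sum.cong) (auto simp: Us_def)
  have "R.independent K Us"
  proof (rule R.trivial_combine_imp_independent[OF K Uc])
    fix Ks assume Ks: "set Ks \<subseteq> K" "R.combine Ks Us = \<zero>\<^bsub>\<Omega>\<^esub>"
    define n where "n = min (length Ks) d"
    define q where "q = (\<Sum>i<n. Polynomial.monom (Ks ! i) i)"
    have cq: "Polynomial.coeff q i = (if i < n then Ks ! i else 0)" for i
      unfolding q_def coeff_sum by (auto simp: coeff_monom)
    have qK: "q \<in> polys_over K" using Ks(1) by (auto simp: polys_over_def cq n_def intro: nth_mem subsetD)
    then have qE: "q \<in> polys_over E" using K_subset by (auto simp: polys_over_def)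
    have q0: "poly q \<gamma> = 0" using Ks(2) unfolding comb by (simp add: q_def poly_sum poly_monom n_def ambient_simps)
    have roots: "poly q ((\<sigma> ^^ j) \<gamma>) = 0" for j
    proof -
      interpret sj: fld_endo E "\<sigma> ^^ j" by (rule fld_endo_funpow)
      have "map_poly (\<sigma> ^^ j) q = q" using qK
        by (intro poly_eqI) (auto simp: coeff_map_poly sj.endo_zero polys_over_def funpow_fix_K)
      then show ?thesis using sj.poly_map_poly[OF qE \<gamma>_in] q0 by (simp add: sj.endo_zero)
    qed
    have "q = 0"
    proof (rule ccontr)
      assume "q \<noteq> 0"
      have "n > 0" using \<open>q \<noteq> 0\<close> by (cases n) (auto simp: q_def)
      have "Polynomial.degree q < d" 
        using \<open>n > 0\<close> d_pos by (intro degree_lessI) (auto simp: cq n_def)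
      then have "q = 0" using roots card_image[OF \<gamma>_distinct] d_pos
        by (intro poly_eqI_degree[of "(\<lambda>i. (\<sigma> ^^ i) \<gamma>) ` {..<d}"]) auto
      then show False using \<open>q \<noteq> 0\<close> by simp
    qed
    then have "Ks ! i = 0" if "i < n" for i using cq[of i] that by simp
    then show "set (take (length Us) Ks) \<subseteq> {\<zero>\<^bsub>\<Omega>\<^esub>}"
      by (auto simp: len n_def in_set_conv_nth ambient_simps)
  qed
  moreover have "R.Span K Us = E"
  proof (intro equalityI subsetI)
    fix x assume "x \<in> R.Span K Us"
    then obtain Ks where Ks: "set Ks \<subseteq> K" "x = R.combine Ks Us" using R.Span_eq_combine_set[OF K Uc] by blast
    moreover have "Ks ! i \<in> E" if "i < length Ks" for i using nth_mem[OF that] Ks(1) K_subset by blast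
    ultimately show "x \<in> E" unfolding Ks(2) comb
      by (auto intro!: sum_closed mult_closed power_closed \<gamma>_in)
  next
    fix x assume "x \<in> E"
    then obtain q where q: "q \<in> polys_over K" "Polynomial.degree q < d" "x = poly q \<gamma>"
      using generated[of x] by (metis funpow_0)
    define Ks where "Ks = map (Polynomial.coeff q) [0..<d]"
    have "x = (\<Sum>i<d. Polynomial.coeff q i * \<gamma> ^ i)"
      unfolding q(3) poly_altdef using q(2) by (intro sum.mono_neutral_left) (auto simp: Polynomial.coeff_eq_0)
    then have "x = R.combine Ks Us" unfolding comb by (simp add: Ks_def)
    moreover have "set Ks \<subseteq> K" using q(1) by (auto simp: Ks_def polys_over_def)
    ultimately show "x \<in> R.Span K Us" using R.Span_eq_combine_set[OF K Uc] by blast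
  qed
  ultimately show ?thesis using R.dimensionI[of K Us E] K len by metis
qed

section \<open>Unramified extensions\<close>

lemma galois_group_endo:
  assumes "\<sigma> \<in> carrier (galois_group L K)" "subfld L"
  shows "fld_endo L \<sigma>" "\<And>x. x \<in> K \<Longrightarrow> \<sigma> x = x" "\<sigma> \<in> extensional L"
proof -
  have \<sigma>: "\<sigma> \<in> ring_hom (ring_on L) (ring_on L)" "\<sigma> \<in> extensional L" "\<And>x. x \<in> K \<Longrightarrow> \<sigma> x = x"
    using assms(1) by (auto simp: galois_group_def ring_iso_def)
  interpret subfld L by fact
  show "fld_endo L \<sigma>"
    by unfold_locales
      (use \<sigma>(1) ring_hom_closed[OF \<sigma>(1)] ring_hom_add[OF \<sigma>(1)] ring_hom_mult[OF \<sigma>(1)] ring_hom_one[OF \<sigma>(1)]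
       in \<open>auto simp: ambient_simps\<close>)
qed (use assms(1) in \<open>auto simp: galois_group_def\<close>)

locale unr = lf_ext K W v \<pi> p t Q m for K W :: "'a::alg_closed_field set" and v \<pi> p t Q m +
  fixes \<phi>
  assumes e1: "ramification_index K W v = 1" and frob: "frobenius K W v \<phi>"
begin

lemma values_W: "x \<in> W \<Longrightarrow> x \<noteq> 0 \<Longrightarrow> v x \<in> \<int>"
proof -
  assume x: "x \<in> W" "x \<noteq> 0"
  define f where "f a = (\<lambda>b. a + b) ` value_group K v" for a
  have "card (f ` value_group W v) = 1" using e1 by (simp add: ramification_index_def f_def)
  then obtain C where C: "f ` value_group W v = {C}" by (auto simp: card_1_singleton_iff)
  have "v x \<in> value_group W v" "v 1 \<in> value_group W v" using x unfolding value_group_def by (auto intro: imageI)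
  then have "f (v x) = f 0" using C v_one by (metis imageI singletonD)
  moreover have "v x \<in> f (v x)" unfolding f_def values_K by (auto intro!: image_eqI[of _ _ 0])
  ultimately show ?thesis unfolding f_def values_K by auto
qed

lemma pi_W: "uniformiser W v \<pi>"
  unfolding uniformiser_def
proof (intro conjI ballI impI)
  show "\<pi> \<in> W - {0}" "0 < v \<pi>" using pi K_sub by (auto simp: uniformiser_def)
  fix x assume x: "x \<in> W - {0}" "0 < v x"
  then have "v x \<in> \<int>" using values_W by auto
  then obtain k :: int where "v x = of_int k" by (elim Ints_cases)
  then show "v \<pi> \<le> v x" using x(2) v_pi by simp
qed

lemma \<phi>_endo: "fld_endo W \<phi>" and \<phi>_K: "x \<in> K \<Longrightarrow> \<phi> x = x"
  using frob galois_group_endo[of \<phi> W K] subfld_axioms by (auto simp: frobenius_def)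

lemma \<phi>_cong: "x \<in> \<O> \<Longrightarrow> \<phi> x - x ^ Q \<in> mm"
  using frob card_residue by (simp add: frobenius_def Q_def \<O>_def mm_def)

lemma \<phi>_O: "x \<in> \<O> \<Longrightarrow> \<phi> x \<in> \<O>"
  using FD.O_add[of "\<phi> x - x ^ Q" "x ^ Q"] \<phi>_cong[of x] FD.I_sub FD.O_power[of x Q] by auto

text \<open>\<rho> is the lift of a generator of the residue field. As \<pi> remains a uniformiser,
  expansions with digits 0 and powers of \<rho> show that it generates \<open>W\<close>, and
  uniqueness of Teichmueller representatives determines \<phi> on it.\<close>

theorem unramified_structure:
  obtains \<rho> f where "1 \<le> f" "\<rho> ^ (Q ^ f) = \<rho>" "\<rho> \<noteq> 0" "W = adjoin K \<rho>" "\<rho> \<in> W" "\<phi> \<rho> = \<rho> ^ Q"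
    "\<And>c. c \<in> K \<Longrightarrow> c \<noteq> 0 \<Longrightarrow> cyc K W \<phi> m c \<rho>"
proof -
  interpret \<phi>: fld_endo W \<phi> by (rule \<phi>_endo)
  obtain f where f: "1 \<le> f" "\<And>x. x \<in> \<O> \<Longrightarrow> x ^ (Q ^ f) - x \<in> mm" using residue_frobenius by blast
  define P where "P = Q ^ f"
  interpret WA: adic W \<O> \<pi> p P unfolding P_def by (rule adic_F[OF pi_W f])
  interpret KP: adic K K.\<O> \<pi> p P unfolding P_def by (rule KA.adic_power[OF f(1)])
  obtain \<rho> where \<rho>: "\<rho> \<in> \<O>" "\<rho> ^ P = \<rho>" "\<rho> \<noteq> 0" "\<And>x. x \<in> \<O> \<Longrightarrow> WA.cg 1 x 0 \<or> (\<exists>i. WA.cg 1 x (\<rho> ^ i))"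
    using WA.generator by metis
  interpret X: adic_ext K K.\<O> \<pi> p P \<rho> by unfold_locales (use \<rho> in auto)
  have mm_cg: "x \<in> mm \<longleftrightarrow> WA.cg 1 x 0" for x using mm_pi[OF pi_W] by (auto simp: WA.cg_def)
  have XO: "X.OM \<subseteq> \<O>"
    using \<rho>(1) K_O by (auto simp: X.OM_def adjoin_def polys_over_def poly_altdef intro!: WA.O_sum WA.O_mult WA.O_power)
  have "\<O> \<subseteq> X.OM"
  proof (rule WA.approximation[OF X.M_adic XO order_refl])
    fix x assume x: "x \<in> \<O>"
    have rO: "\<rho> ^ i \<in> X.OM" for i using X.M.O_power[OF X.rho_OM] .
    obtain y where "y \<in> X.OM" "WA.cg 1 x y" using \<rho>(4)[OF x] rO X.M.O_zero by blast
    moreover from this obtain z where "z \<in> \<O>" "x - y = \<pi> * z" by (auto simp: WA.cg_def)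
    ultimately show "\<exists>y\<in>X.OM. \<exists>x'\<in>\<O>. x = y + \<pi> * x'"
      by (intro bexI[of _ y] bexI[of _ z]) (simp_all add: algebra_simps)
  qed
  have XW: "X.M = W"
  proof
    show "X.M \<subseteq> W" using \<rho>(1) K_sub WA.O_sub
      by (auto simp: X.M_def adjoin_def polys_over_def poly_altdef intro!: sum_closed mult_closed power_closed)
    show "W \<subseteq> X.M"
    proof
      fix x assume "x \<in> W"
      then obtain k where "\<pi> ^ k * x \<in> \<O>" using WA.frac by blast
      then have "\<pi> ^ k * x \<in> X.M" using \<open>\<O> \<subseteq> X.OM\<close> X.M.O_sub by blast
      then have "inverse (\<pi> ^ k) * (\<pi> ^ k * x) \<in> X.M"
        using X.M.pi_in X.M.O_sub by (intro X.M.mult_closed[of "inverse _"] X.M.inverse_closed X.M.power_closed) auto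
      moreover have "inverse (\<pi> ^ k) * (\<pi> ^ k * x) = x" using WA.pi_nz by (simp add: field_simps)
      ultimately show "x \<in> X.M" by simp
    qed
  qed
  have \<rho>W: "\<rho> \<in> W" using \<rho>(1) WA.O_sub by auto
  have pw: "(\<rho> ^ Q) ^ P = \<rho> ^ Q" using \<rho>(2) power_mult[of \<rho> Q P] power_mult[of \<rho> P Q] by (simp only: mult.commute[of Q P])
  have \<phi>\<rho>: "\<phi> \<rho> = \<rho> ^ Q"
  proof (rule WA.teichmueller_unique[OF \<phi>_O[OF \<rho>(1)] WA.O_power[OF \<rho>(1)] _ pw])
    show "\<phi> \<rho> ^ P = \<phi> \<rho>" using \<phi>.endo_power[OF \<rho>W, of P] \<rho>(2) by simp
    have "WA.cg 1 (\<phi> \<rho> - \<rho> ^ Q) 0" using \<phi>_cong[OF \<rho>(1)] mm_cg by simp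
    then show "WA.cg 1 (\<phi> \<rho>) (\<rho> ^ Q)" using WA.cg_add[of 1 "\<phi> \<rho> - \<rho> ^ Q" 0 "\<rho> ^ Q" "\<rho> ^ Q"] by simp
  qed
  \<comment> \<open>The residue of a fixed element is fixed by the \<open>Q\<close>-th power map, so
    its representative lies in \<open>K\<close>; the remainder after subtracting it and dividing by
    \<pi> is fixed again.\<close>
  have fixed: "x \<in> K" if x: "x \<in> W" "\<phi> x = x" for x
  proof -
    have "{x \<in> \<O>. \<phi> x = x} \<subseteq> K.\<O>"
    proof (rule WA.approximation[OF KP.adic_axioms K_O])
      fix x assume "x \<in> {x \<in> \<O>. \<phi> x = x}"
      then have x: "x \<in> \<O>" "\<phi> x = x" by auto
      obtain \<tau> where \<tau>: "\<tau> \<in> \<O>" "\<tau> ^ P = \<tau>" "WA.cg 1 x \<tau>" using WA.teichmueller[OF x(1)] .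
      have "WA.cg 1 (x - x ^ Q) 0" using \<phi>_cong[OF x(1)] mm_cg x(2) by simp
      then have "WA.cg 1 x (x ^ Q)" using WA.cg_add[of 1 "x - x ^ Q" 0 "x ^ Q" "x ^ Q"] by simp
      also have "WA.cg 1 (x ^ Q) (\<tau> ^ Q)" by (intro WA.cg_power \<tau> x)
      finally have "WA.cg 1 \<tau> (\<tau> ^ Q)" using WA.cg_trans[OF WA.cg_sym[OF \<tau>(3)]] by blast
      moreover have "(\<tau> ^ Q) ^ P = \<tau> ^ Q" using \<tau>(2) power_mult[of \<tau> Q P] power_mult[of \<tau> P Q] by (simp only: mult.commute[of Q P])
      ultimately have "\<tau> = \<tau> ^ Q" by (rule WA.teichmueller_unique[OF \<tau>(1) WA.O_power[OF \<tau>(1)] \<tau>(2), rotated])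
      then have \<tau>K: "\<tau> \<in> K" using teichmueller_in_K[OF sym] by blast
      obtain z where z: "z \<in> \<O>" "x - \<tau> = \<pi> * z" using \<tau>(3) by (auto simp: WA.cg_def)
      have piW: "\<pi> \<in> W" "\<phi> \<pi> = \<pi>" using pi K_sub \<phi>_K by (auto simp: uniformiser_def)
      have zW: "z \<in> W" using z WA.O_sub by auto
      have "\<phi> (x - \<tau>) = x - \<tau>" using x \<tau> \<phi>_K[OF \<tau>K] WA.O_sub by (subst \<phi>.endo_diff) auto
      then have "\<pi> * \<phi> z = \<pi> * z" unfolding z(2) using \<phi>.endo_mult[OF piW(1) zW] piW(2) by simp
      then have "\<phi> z = z" using WA.pi_nz by simp
      moreover have "\<tau> \<in> K.\<O>" using \<tau>(1) \<tau>K by (auto simp: O_iff K.O_iff ge_def K.ge_def)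
      moreover have "x = \<tau> + \<pi> * z" using z(2) by (simp add: algebra_simps)
      ultimately show "\<exists>y\<in>K.\<O>. \<exists>x'\<in>{x \<in> \<O>. \<phi> x = x}. x = y + \<pi> * x'" using z(1) by blast
    qed auto
    moreover obtain k where k: "\<pi> ^ k * x \<in> \<O>" using WA.frac[OF x(1)] by blast
    have piK: "\<pi> \<in> K" using pi by (simp add: uniformiser_def)
    have "\<phi> (\<pi> ^ k * x) = \<pi> ^ k * x"
      using x piK K_sub \<phi>_K[OF K.power_closed[OF piK]] by (subst \<phi>.endo_mult) (auto intro: power_closed)
    ultimately have "\<pi> ^ k * x \<in> K" using k K.O_iff by blast
    then have "inverse (\<pi> ^ k) * (\<pi> ^ k * x) \<in> K"
      using piK by (intro K.mult_closed[of "inverse _"] K.inverse_closed K.power_closed)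
    moreover have "inverse (\<pi> ^ k) * (\<pi> ^ k * x) = x" using WA.pi_nz by (simp add: field_simps)
    ultimately show ?thesis by simp
  qed
  have it: "(\<phi> ^^ j) \<rho> = \<rho> ^ (Q ^ j)" for j
    by (induction j) (auto simp: \<phi>.endo_power \<rho>W \<phi>\<rho> power_mult[symmetric] mult.commute)
  define n where "n = (LEAST j. 0 < j \<and> (\<phi> ^^ j) \<rho> = \<rho>)"
  have "0 < f \<and> (\<phi> ^^ f) \<rho> = \<rho>" using f(1) \<rho>(2) by (simp add: it P_def)
  from LeastI[of "\<lambda>j. 0 < j \<and> (\<phi> ^^ j) \<rho> = \<rho>", OF this] have n: "0 < n" "(\<phi> ^^ n) \<rho> = \<rho>" by (auto simp: n_def)
  have nl: "n \<le> j" if "0 < j" "(\<phi> ^^ j) \<rho> = \<rho>" for j unfolding n_def by (rule Least_le) (use that in simp)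
  have cy: "cyc K W \<phi> n c \<rho>" if c: "c \<in> K" "c \<noteq> 0" for c
  proof
    show "K \<subseteq> W" by (rule K_sub)
    show "(\<phi> ^^ n) x = x" if "x \<in> W" for x
    proof -
      interpret \<phi>n: fld_endo W "\<phi> ^^ n" by (rule \<phi>.fld_endo_funpow)
      have id: "fld_endo W (\<lambda>x. x)" by unfold_locales auto
      have fK: "(\<phi> ^^ n) a = a" if "a \<in> K" for a using that by (induction n) (auto simp: \<phi>_K)
      show ?thesis
        using endo_eq_adjoin[OF \<phi>n.fld_endo_axioms id K_sub K_sub \<rho>W \<rho>W fK n(2)] XW X.M_def that by blast
    qed
    show "inj_on (\<lambda>i. (\<phi> ^^ i) \<rho>) {..<n}"
    proof (rule linorder_inj_onI')
      fix i j assume ij: "i \<in> {..<n}" "j \<in> {..<n}" "i < j"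
      show "(\<phi> ^^ i) \<rho> \<noteq> (\<phi> ^^ j) \<rho>"
      proof
        assume a: "(\<phi> ^^ i) \<rho> = (\<phi> ^^ j) \<rho>"
        have "(\<phi> ^^ j) \<rho> = (\<phi> ^^ i) ((\<phi> ^^ (j - i)) \<rho>)" using ij by (simp flip: funpow_add[THEN fun_cong, simplified comp_apply])
        with a have "(\<phi> ^^ i) \<rho> = (\<phi> ^^ i) ((\<phi> ^^ (j - i)) \<rho>)" by simp
        then have "\<rho> = (\<phi> ^^ (j - i)) \<rho>"
          using fld_endo.endo_inj[OF \<phi>.fld_endo_funpow[of i]] \<rho>W \<phi>.funpow_closed by (auto dest: inj_onD)
        then show False using nl[of "j - i"] ij by simp
      qed
    qed
  qed (use fixed \<phi>_K c n \<rho>W in auto)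
  \<comment> \<open>So far \<open>n\<close> is only the order of \<phi> on \<rho>; the degree
    \<open>m\<close> enters through the dimension.\<close>
  have "n = m"
  proof -
    interpret R: field "\<Omega> :: 'a ring" by (rule field_from_type_algebra)
    have "R.dimension n K W" using cyc.dimension[OF cy K_subfield, of 1] by simp
    then show ?thesis using R.dimension_is_inj[OF K_subfield _ dim] by blast
  qed
  then show thesis using that[of f \<rho>] f(1) \<rho> \<rho>W \<phi>\<rho> cy XW X.M_def by (simp add: P_def)
qed

end

section \<open>Tamely ramified cyclic extensions\<close>

text \<open>The unit \<open>u\<close> in \<open>\<alpha> = \<pi>^e * u\<close> is a root of unity
  times a one-unit. The one-unit has an \<open>e\<close>-th root as \<open>p\<close> does not divide
  \<open>e\<close>; the root of unity remains and gives \<tau>.\<close>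

lemma (in adic) kummer:
  assumes \<alpha>: "\<alpha> \<in> F" "\<alpha> \<noteq> 0" "ord \<alpha> = int e" and e: "\<not> p dvd e"
  obtains s \<tau> where "s \<in> \<U>" "\<tau> \<in> \<O>" "\<tau> ^ P = \<tau>" "\<tau> \<noteq> 0" "(\<pi> * s) ^ e = \<alpha> * \<tau>"
proof -
  obtain u where u: "u \<in> \<U>" "\<alpha> = \<pi> powi ord \<alpha> * u" by (rule ord_decomp[OF \<alpha>(1,2)])
  then have \<alpha>u: "\<alpha> = \<pi> ^ e * u" using \<alpha>(3) by simp
  obtain t where t: "t \<in> \<O>" "t ^ P = t" "cg 1 u t" using teichmueller[OF U_O[OF u(1)]] .
  have "t \<noteq> 0" using t(3) U_not_cg_0[OF u(1)] by auto
  then have tU: "t \<in> \<U>" using t by (intro teichmueller_unit)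
  have ut: "u / t \<in> \<O>" unfolding divide_inverse using u tU by (intro U_O U_mult U_inverse)
  have "cg 1 (u / t) (t / t)" using u tU t(3) by (intro cg_divide cg_refl) (auto intro: U_O)
  then have "cg 1 (u / t) 1" using \<open>t \<noteq> 0\<close> by simp
  then obtain s where s: "s \<in> \<O>" "cg 1 s 1" "s ^ e = u / t" using one_unit_root_coprime[OF ut _ e] by blast
  have sU: "s \<in> \<U>" by (rule cg_1_unit[OF s(1,2) U_one])
  have eq: "(\<pi> * s) ^ e = \<alpha> * inverse t" unfolding power_mult_distrib s(3) \<alpha>u by (simp add: divide_inverse)
  show thesis
    by (rule that[OF sU _ _ _ eq]) (use tU t(2) \<open>t \<noteq> 0\<close> in \<open>auto intro: U_O U_inverse simp: power_inverse\<close>)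
qed

text \<open>The uniformiser \<open>lam\<close> is normalised by
  \<open>lam^e = \<pi> * \<tau>\<close>. The order \<open>d\<close> of \<sigma> and the ramification
  index \<open>e\<close> are independent data here; their relation is derived in
  \<open>d_eq\<close>. The exponent \<open>f\<close> only has to make \<open>Q^f\<close>-th powers
  trivial on residues.\<close>

locale tame = adic L \<O> lam p P + fld_endo L \<sigma>
  for L \<O> :: "'a::alg_closed_field set" and lam p P \<sigma> +
  fixes K OK :: "'a set" and \<pi> \<tau> :: 'a and Q f d e :: nat
  assumes KA: "adic K OK \<pi> p Q" and P_def: "P = Q ^ f" and f_pos: "1 \<le> f"
    and K_sub: "K \<subseteq> L" and OK: "OK = K \<inter> \<O>"
    and \<tau>: "\<tau> \<in> \<O>" "\<tau> ^ P = \<tau>" "\<tau> \<noteq> 0" and lam_e: "lam ^ e = \<pi> * \<tau>"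
    and e_pos: "1 \<le> e" and p_e: "\<not> p dvd e"
    and \<sigma>_K: "x \<in> K \<Longrightarrow> \<sigma> x = x" and \<sigma>_fixed: "x \<in> L \<Longrightarrow> \<sigma> x = x \<Longrightarrow> x \<in> K"
    and d_pos: "0 < d" and \<sigma>_d: "x \<in> L \<Longrightarrow> (\<sigma> ^^ d) x = x"
    and \<sigma>_min: "0 < j \<Longrightarrow> j < d \<Longrightarrow> \<exists>x\<in>L. (\<sigma> ^^ j) x \<noteq> x"
begin

sublocale KA: adic K OK \<pi> p Q by (rule KA)

lemma pi_L: "\<pi> \<in> L" "\<pi> \<in> \<O>" and lam_L: "lam \<in> L" and \<tau>_U: "\<tau> \<in> \<U>" and \<tau>_L: "\<tau> \<in> L"
  using KA.pi_in OK K_sub pi_in O_sub teichmueller_unit \<tau> by auto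

lemma ord_\<pi>: "ord \<pi> = int e"
proof -
  have "ord (lam ^ e) = ord \<pi> + ord \<tau>" unfolding lam_e using pi_L \<tau>_L \<tau> KA.pi_nz by (intro ord_mult) auto
  then show ?thesis using lam_L pi_nz by (simp add: ord_power ord_pi ord_U[OF \<tau>_U])
qed

lemma cg_ord: "x \<in> \<O> \<Longrightarrow> y \<in> \<O> \<Longrightarrow> cg k x y \<longleftrightarrow> x = y \<or> int k \<le> ord (x - y)"
proof -
  assume xy: "x \<in> \<O>" "y \<in> \<O>"
  have "cg k x y \<longleftrightarrow> cg k (x - y) 0" by (simp add: cg_def)
  then show ?thesis using xy ord_cg[of "x - y" k] O_diff[of x y] by (cases "x = y") auto
qed

lemma funpow_K: "x \<in> K \<Longrightarrow> (\<sigma> ^^ j) x = x"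
  by (induction j) (auto simp: \<sigma>_K)

lemma ord_funpow: "x \<in> L \<Longrightarrow> x \<noteq> 0 \<Longrightarrow> ord ((\<sigma> ^^ j) x) = ord x"
  using pi_L KA.pi_nz ord_\<pi> e_pos OK KA.pi_in by (intro ord_endo[OF fld_endo_funpow, of \<pi>]) (auto simp: funpow_K)

lemma funpow_eq_0: "x \<in> L \<Longrightarrow> (\<sigma> ^^ j) x = 0 \<longleftrightarrow> x = 0"
  by (rule fld_endo.endo_eq_0_iff[OF fld_endo_funpow])

lemma funpow_O: "x \<in> \<O> \<Longrightarrow> (\<sigma> ^^ j) x \<in> \<O>"
proof -
  assume x: "x \<in> \<O>"
  show ?thesis
  proof (cases "x = 0")
    case True
    then show ?thesis using funpow_eq_0[of 0 j] O_zero by simp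
  next
    case False
    have xL: "x \<in> L" using x O_sub by auto
    then show ?thesis
      using x ord_nonneg[OF xL False] ord_nonneg[of "(\<sigma> ^^ j) x"] ord_funpow[OF xL False] funpow_eq_0[OF xL] False
      by (simp add: funpow_closed)
  qed
qed

lemma funpow_cg: "x \<in> \<O> \<Longrightarrow> y \<in> \<O> \<Longrightarrow> cg k x y \<Longrightarrow> cg k ((\<sigma> ^^ j) x) ((\<sigma> ^^ j) y)"
proof -
  assume xy: "x \<in> \<O>" "y \<in> \<O>" "cg k x y"
  have L: "x \<in> L" "y \<in> L" using xy O_sub by auto
  have "(\<sigma> ^^ j) x - (\<sigma> ^^ j) y = (\<sigma> ^^ j) (x - y)"
    by (rule fld_endo.endo_diff[OF fld_endo_funpow L, symmetric])
  then show ?thesis using xy cg_ord[of x y k] L diff_closed[of x y]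
    by (cases "x = y") (auto simp: cg_ord funpow_O ord_funpow)
qed

lemma K_cg: "x \<in> OK \<Longrightarrow> y \<in> OK \<Longrightarrow> KA.cg 1 x y \<Longrightarrow> cg 1 x y"
proof -
  assume "KA.cg 1 x y"
  then obtain z where z: "z \<in> OK" "x - y = \<pi> * z" by (auto simp: KA.cg_def)
  have zO: "z \<in> \<O>" using z(1) OK by blast
  have "\<pi> = lam * (lam ^ (e - 1) * inverse \<tau>)"
    using lam_e e_pos \<tau> by (cases e) (auto simp: field_simps)
  then have "x - y = lam * ((lam ^ (e - 1) * inverse \<tau>) * z)" using z(2) by (simp add: mult.assoc)
  moreover have "(lam ^ (e - 1) * inverse \<tau>) * z \<in> \<O>"
    using U_O[OF U_inverse[OF \<tau>_U]] zO by (intro O_mult O_power pi_in)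
  ultimately show ?thesis by (auto simp: cg_def)
qed

lemma teich_power: "x ^ P = x \<Longrightarrow> (x ^ i) ^ P = x ^ i" for x :: 'a
  by (metis power_mult mult.commute)

lemma funpow_teich: "x \<in> L \<Longrightarrow> x ^ P = x \<Longrightarrow> ((\<sigma> ^^ j) x) ^ P = (\<sigma> ^^ j) x"
  by (metis fld_endo.endo_power[OF fld_endo_funpow])

definition \<rho> where "\<rho> = (SOME \<rho>. \<rho> \<in> \<O> \<and> \<rho> ^ P = \<rho> \<and> \<rho> \<noteq> 0 \<and> (\<forall>x\<in>\<O>. cg 1 x 0 \<or> (\<exists>i. cg 1 x (\<rho> ^ i))) \<and>
  (\<forall>t\<in>\<O>. t ^ P = t \<longrightarrow> t \<noteq> 0 \<longrightarrow> (\<exists>i. t = \<rho> ^ i)))"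

lemma \<rho>: "\<rho> \<in> \<O>" "\<rho> ^ P = \<rho>" "\<rho> \<noteq> 0"
  and \<rho>_cg: "x \<in> \<O> \<Longrightarrow> cg 1 x 0 \<or> (\<exists>i. cg 1 x (\<rho> ^ i))"
  and \<rho>_teich: "t \<in> \<O> \<Longrightarrow> t ^ P = t \<Longrightarrow> t \<noteq> 0 \<Longrightarrow> \<exists>i. t = \<rho> ^ i"
proof -
  let ?R = "\<lambda>\<rho>. \<rho> \<in> \<O> \<and> \<rho> ^ P = \<rho> \<and> \<rho> \<noteq> 0 \<and> (\<forall>x\<in>\<O>. cg 1 x 0 \<or> (\<exists>i. cg 1 x (\<rho> ^ i))) \<and>
    (\<forall>t\<in>\<O>. t ^ P = t \<longrightarrow> t \<noteq> 0 \<longrightarrow> (\<exists>i. t = \<rho> ^ i))"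
  obtain r where "?R r" by (rule generator) blast
  then have R: "?R \<rho>" unfolding \<rho>_def by (rule someI[of ?R])
  show "\<rho> \<in> \<O>" "\<rho> ^ P = \<rho>" "\<rho> \<noteq> 0" using R by auto
  show "cg 1 x 0 \<or> (\<exists>i. cg 1 x (\<rho> ^ i))" if "x \<in> \<O>" using R that by blast
  show "\<exists>i. t = \<rho> ^ i" if "t \<in> \<O>" "t ^ P = t" "t \<noteq> 0" using R that by blast
qed

lemma \<rho>_L: "\<rho> \<in> L" using \<rho>(1) O_sub by auto

text \<open>Elements of \<open>\<O>\<close> have expansions in \<open>lam\<close> with digits 0 and
  powers of \<rho>. The induction on the precision \<open>k\<close> proves all congruences at
  once.\<close>

lemma funpow_id:
  assumes "(\<sigma> ^^ j) \<rho> = \<rho>" "(\<sigma> ^^ j) lam = lam" and x: "x \<in> L"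
  shows "(\<sigma> ^^ j) x = x"
proof -
  interpret s: fld_endo L "\<sigma> ^^ j" by (rule fld_endo_funpow)
  have c: "cg k ((\<sigma> ^^ j) y) y" if "y \<in> \<O>" for k y using that
  proof (induction k arbitrary: y)
    case 0
    then show ?case by (intro cg_0 funpow_O)
  next
    case (Suc k)
    obtain w where w: "w = 0 \<or> (\<exists>i. w = \<rho> ^ i)" "cg 1 y w" using \<rho>_cg[OF Suc.prems] by blast
    have w': "w \<in> \<O>" "w \<in> L" "(\<sigma> ^^ j) w = w"
      using w(1) assms(1) \<rho>_L by (auto simp: s.endo_zero s.endo_power O_zero intro: O_power \<rho> power_closed)
    obtain z where z: "z \<in> \<O>" "y - w = lam * z" using w(2) by (auto simp: cg_def)
    have zL: "z \<in> L" using z O_sub by auto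
    have y: "y = w + lam * z" using z(2) by (simp add: algebra_simps)
    have "(\<sigma> ^^ j) y = w + lam * (\<sigma> ^^ j) z"
      unfolding y using w' zL lam_L assms(2) by (simp add: s.endo_add s.endo_mult mult_closed)
    moreover have "cg (Suc k) (lam * (\<sigma> ^^ j) z) (lam * z)" using cg_shift[OF Suc.IH[OF z(1)], of 1] by simp
    ultimately show ?case unfolding y by (auto intro: cg_add)
  qed
  have O: "(\<sigma> ^^ j) y = y" if "y \<in> \<O>" for y
    by (rule cg_separated[OF funpow_O[OF that] that c[OF that]])
  obtain k where k: "lam ^ k * x \<in> \<O>" using frac[OF x] by blast
  have "lam ^ k * (\<sigma> ^^ j) x = lam ^ k * x"
    using O[OF k] x lam_L assms(2) by (simp add: s.endo_mult s.endo_power power_closed)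
  then show ?thesis using pi_nz by simp
qed

text \<open>The order of \<sigma> on the residue field, read off from the representatives
  \<open>\<rho>^i\<close>; it is the residue degree of \<open>L\<close> over
  \<open>K\<close>.\<close>

definition f0 where "f0 = (LEAST j. 0 < j \<and> (\<sigma> ^^ j) \<rho> = \<rho>)"

lemma f0_pos: "0 < f0" and f0_\<rho>: "(\<sigma> ^^ f0) \<rho> = \<rho>"
  and f0_least: "0 < j \<Longrightarrow> (\<sigma> ^^ j) \<rho> = \<rho> \<Longrightarrow> f0 \<le> j"
proof -
  have "0 < d \<and> (\<sigma> ^^ d) \<rho> = \<rho>" using d_pos \<sigma>_d[OF \<rho>_L] by simp
  from LeastI[of "\<lambda>j. 0 < j \<and> (\<sigma> ^^ j) \<rho> = \<rho>", OF this] show "0 < f0" "(\<sigma> ^^ f0) \<rho> = \<rho>" by (auto simp: f0_def)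
  show "f0 \<le> j" if "0 < j" "(\<sigma> ^^ j) \<rho> = \<rho>" unfolding f0_def by (rule Least_le) (use that in simp)
qed

lemma f0_dvd_d: "f0 dvd d"
proof -
  have "(\<sigma> ^^ d) \<rho> = (\<sigma> ^^ (d mod f0)) ((\<sigma> ^^ (f0 * (d div f0))) \<rho>)"
    by (metis comp_apply funpow_add mod_mult_div_eq)
  then have "(\<sigma> ^^ (d mod f0)) \<rho> = \<rho>" using \<sigma>_d[OF \<rho>_L] funpow_multiple[OF f0_\<rho>] by simp
  then show ?thesis using f0_least[of "d mod f0"] mod_less_divisor[OF f0_pos, of d] by (auto simp: dvd_eq_mod_eq_0)
qed

text \<open>A generator of the inertia group, and with \<zeta> the value of the tame character on
  it.\<close>

definition \<iota> where "\<iota> = \<sigma> ^^ f0"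
definition \<zeta> where "\<zeta> = \<iota> lam / lam"

sublocale \<iota>: fld_endo L \<iota> unfolding \<iota>_def by (rule fld_endo_funpow)

lemma \<iota>_\<rho>: "\<iota> \<rho> = \<rho>" by (simp add: \<iota>_def f0_\<rho>)
lemma \<iota>_lam: "\<iota> lam = \<zeta> * lam" using pi_nz by (simp add: \<zeta>_def)
lemma \<zeta>_L: "\<zeta> \<in> L" unfolding \<zeta>_def by (intro divide_closed \<iota>.endo_closed lam_L)
lemma \<zeta>_nz: "\<zeta> \<noteq> 0" using \<iota>.endo_eq_0_iff[OF lam_L] pi_nz by (simp add: \<zeta>_def)

lemma \<iota>_teich: "t \<in> \<O> \<Longrightarrow> t ^ P = t \<Longrightarrow> \<iota> t = t"
  by (cases "t = 0") (use \<rho>_teich[of t] \<iota>_\<rho> \<rho>_L in \<open>auto simp: \<iota>.endo_zero \<iota>.endo_power\<close>)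

lemma \<zeta>_e: "\<zeta> ^ e = 1"
proof -
  have "\<iota> \<pi> = \<pi>" unfolding \<iota>_def using KA.pi_in OK by (intro funpow_K) simp
  then have "\<iota> (lam ^ e) = lam ^ e" unfolding lam_e
    using \<iota>_teich[OF \<tau>(1,2)] pi_L \<tau>_L by (simp add: \<iota>.endo_mult)
  then have "\<zeta> ^ e * lam ^ e = 1 * lam ^ e" using lam_L by (simp add: \<iota>.endo_power \<iota>_lam power_mult_distrib)
  then show ?thesis using pi_nz by (simp only: mult_right_cancel power_not_zero not_False_eq_True)
qed

lemma \<zeta>_O: "\<zeta> \<in> \<O>"
proof -
  have "int e * ord \<zeta> = 0" using ord_power[OF \<zeta>_L \<zeta>_nz, of e] by (simp add: \<zeta>_e ord_one)
  then show ?thesis using ord_nonneg[OF \<zeta>_L \<zeta>_nz] e_pos by simp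
qed

lemma \<zeta>_P: "\<zeta> ^ P = \<zeta>" by (rule root_of_unity[OF \<zeta>_O \<zeta>_e p_e])

lemma \<iota>_funpow_lam: "(\<iota> ^^ k) lam = \<zeta> ^ k * lam"
  by (induction k) (use \<iota>_teich[OF \<zeta>_O \<zeta>_P] \<zeta>_L lam_L in \<open>auto simp: \<iota>.endo_mult \<iota>.endo_power \<iota>_lam power_closed\<close>)

lemma \<iota>_funpow: "\<iota> ^^ k = \<sigma> ^^ (f0 * k)"
  by (simp add: \<iota>_def funpow_mult)

lemma \<iota>_funpow_\<rho>: "(\<iota> ^^ k) \<rho> = \<rho>"
  by (induction k) (auto simp: \<iota>_\<rho>)

lemma \<iota>_e: "x \<in> L \<Longrightarrow> (\<iota> ^^ e) x = x"
  using funpow_id[of "f0 * e" x] \<iota>_funpow[of e] \<iota>_funpow_lam[of e] \<iota>_funpow_\<rho>[of e] \<zeta>_e by simp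

lemma \<zeta>_primitive: "0 < k \<Longrightarrow> f0 * k < d \<Longrightarrow> \<zeta> ^ k \<noteq> 1"
proof
  assume k: "0 < k" "f0 * k < d" "\<zeta> ^ k = 1"
  then have "(\<sigma> ^^ (f0 * k)) x = x" if "x \<in> L" for x
    using funpow_id[of "f0 * k" x] \<iota>_funpow[of k] \<iota>_funpow_lam[of k] \<iota>_funpow_\<rho>[of k] that by simp
  then show False using \<sigma>_min[of "f0 * k"] k f0_pos by auto
qed

definition T where "T = {x \<in> L. \<iota> x = x}"

lemma \<iota>_\<sigma>: "\<iota> (\<sigma> x) = \<sigma> (\<iota> x)"
  by (simp add: \<iota>_def funpow_swap1)

lemma cyc_T: "cyc K T \<sigma> f0 1 \<rho>"
proof
  show "inj_on (\<lambda>i. (\<sigma> ^^ i) \<rho>) {..<f0}"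
  proof (rule linorder_inj_onI')
    fix i j assume ij: "i \<in> {..<f0}" "j \<in> {..<f0}" "i < j"
    show "(\<sigma> ^^ i) \<rho> \<noteq> (\<sigma> ^^ j) \<rho>"
    proof
      assume a: "(\<sigma> ^^ i) \<rho> = (\<sigma> ^^ j) \<rho>"
      have "(\<sigma> ^^ j) \<rho> = (\<sigma> ^^ i) ((\<sigma> ^^ (j - i)) \<rho>)" using ij by (simp flip: funpow_add[THEN fun_cong, simplified comp_apply])
      with a have "(\<sigma> ^^ i) \<rho> = (\<sigma> ^^ i) ((\<sigma> ^^ (j - i)) \<rho>)" by simp
      then have "\<rho> = (\<sigma> ^^ (j - i)) \<rho>"
        using fld_endo.endo_inj[OF fld_endo_funpow[of i]] \<rho>_L funpow_closed by (auto dest: inj_onD)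
      then show False using f0_least[of "j - i"] ij by simp
    qed
  qed
  show "K \<subseteq> T" using K_sub funpow_K by (auto simp: T_def \<iota>_def)
  show "(\<sigma> ^^ f0) x = x" if "x \<in> T" for x using that by (simp add: T_def \<iota>_def)
qed (auto simp: T_def \<iota>.endo_zero \<iota>.endo_one \<iota>.endo_add \<iota>.endo_mult \<iota>.endo_uminus \<iota>.endo_inverse add_closed mult_closed
    uminus_closed inverse_closed \<iota>_\<sigma> endo_closed endo_add endo_mult endo_one \<sigma>_K \<sigma>_fixed f0_pos \<rho>_L \<iota>_\<rho>)

interpretation T: cyc K T \<sigma> f0 1 \<rho> by (rule cyc_T)

lemma KP: "adic K OK \<pi> p P" unfolding P_def by (rule KA.adic_power[OF f_pos])

text \<open>One inequality holds because \<iota> is faithful on \<open>lam\<close>, where it acts by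
  an \<open>e\<close>-th root of unity. For the other, the norm of \<open>lam\<close> to the inertia
  field has order \<open>E\<close>, but orders of elements of \<open>K(\<rho>)\<close> are multiples
  of \<open>e\<close>, since \<pi> is a uniformiser there.\<close>

lemma d_eq: "d = f0 * e"
proof -
  obtain E where E: "d = f0 * E" using f0_dvd_d by (elim dvdE)
  have E0: "0 < E" using E d_pos by (cases E) auto
  have "E \<le> e"
  proof (rule ccontr)
    assume "\<not> E \<le> e"
    then have "f0 * e < d" using E f0_pos by simp
    then show False using \<zeta>_primitive[of e] e_pos \<zeta>_e by simp
  qed
  define \<nu> where "\<nu> = (\<Prod>j<E. (\<iota> ^^ j) lam)"
  have \<nu>L: "\<nu> \<in> L" "\<nu> \<noteq> 0" unfolding \<nu>_def using lam_L pi_nz \<zeta>_nz \<zeta>_L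
    by (auto intro!: prod_closed mult_closed power_closed simp: \<iota>_funpow_lam)
  have "(\<iota> ^^ E) lam = lam" using \<sigma>_d[OF lam_L] E by (simp add: \<iota>_funpow)
  then have "\<nu> \<in> T" using \<iota>.prod_funpow_shift[OF lam_L, of E] \<nu>L by (simp add: T_def \<nu>_def)
  then obtain q where q: "q \<in> polys_over K" "\<nu> = poly q \<rho>" using T.generated[of \<nu>] by (metis funpow_0)
  interpret KP: adic K OK \<pi> p P by (rule KP)
  interpret X: adic_ext K OK \<pi> p P \<rho> by unfold_locales (use \<rho> in auto)
  have "\<nu> \<in> X.M" unfolding X.M_def q(2) using q(1) by (rule adjoinI)
  then obtain u where u: "u \<in> X.M.\<U>" "\<nu> = \<pi> powi X.M.ord \<nu> * u" using X.M.ord_decomp \<nu>L(2) by metis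
  have OKO: "OK \<subseteq> \<O>" using OK by blast
  then have XO: "X.OM \<subseteq> \<O>"
    using \<rho>(1) by (auto simp: X.OM_def adjoin_def polys_over_def poly_altdef intro!: O_sum O_mult O_power)
  have uU: "u \<in> \<U>" using u(1) XO by (auto simp: \<U>_def X.M.\<U>_def)
  have "ord \<nu> = X.M.ord \<nu> * int e"
    using u(2) pi_L KA.pi_nz uU U_nz[OF uU] U_O[OF uU] O_sub ord_U[OF uU]
    by (metis (no_types, lifting) ord_mult ord_power_int power_int_closed ord_\<pi> add.right_neutral power_int_eq_0_iff subsetD)
  moreover have "ord \<nu> = int E"
    unfolding \<nu>_def using lam_L pi_nz \<zeta>_nz \<iota>.funpow_closed
    by (subst ord_prod) (auto simp: \<iota>_funpow ord_funpow ord_pi funpow_eq_0)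
  ultimately have "int e dvd int E" by simp
  then have "e \<le> E" using E0 by (intro dvd_imp_le) auto
  then show ?thesis using \<open>E \<le> e\<close> E by simp
qed

lemma \<zeta>_order: "0 < k \<Longrightarrow> k < e \<Longrightarrow> \<zeta> ^ k \<noteq> 1"
  using \<zeta>_primitive[of k] d_eq f0_pos by simp

text \<open>The minimal polynomial of \<rho> over \<open>K\<close> has coefficients fixed by
  Frobenius modulo \<open>lam\<close>. So \<open>\<rho>^Q\<close> is a root modulo
  \<open>lam\<close>, hence congruent and therefore equal to a conjugate of \<rho>.\<close>

lemma frobenius_lift: "\<exists>i0. (\<sigma> ^^ i0) \<rho> = \<rho> ^ Q"
proof -
  define g where "g = (\<Prod>j<f0. [:- (\<sigma> ^^ j) \<rho>, 1:])"
  have rO: "(\<sigma> ^^ j) \<rho> \<in> \<O>" for j by (intro funpow_O \<rho>)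
  have gK: "g \<in> polys_over K" unfolding g_def by (rule T.min_poly)
  have gO: "g \<in> polys_over \<O>" unfolding g_def
  proof -
    have *: "prod (\<lambda>j. [:- (\<sigma> ^^ j) \<rho>, 1:]) I \<in> polys_over \<O>" for I
    proof (induction I rule: infinite_finite_induct)
      case (insert j I)
      have "[:- (\<sigma> ^^ j) \<rho>, 1:] * h \<in> polys_over \<O>" if h: "h \<in> polys_over \<O>" for h
        using h rO[of j] by (auto simp: polys_over_def coeff_pCons split: nat.splits intro!: O_intros)
      then show ?case using insert by simp
    qed (auto simp: polys_over_def O_zero O_one coeff_1)
    show "(\<Prod>j<f0. [:- (\<sigma> ^^ j) \<rho>, 1:]) \<in> polys_over \<O>" by (rule *)
  qed
  obtain k where k: "Q = p ^ k" using KA.P by blast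
  have gg: "cg 1 (Polynomial.coeff g i ^ (p ^ k)) (Polynomial.coeff g i)" for i
  proof -
    have "Polynomial.coeff g i \<in> OK" using gK gO OK by (auto simp: polys_over_def)
    then show ?thesis using K_cg[OF KA.O_power _ KA.cg_frob] k by simp
  qed
  have "cg 1 (poly g \<rho> ^ Q) (poly g (\<rho> ^ Q))" unfolding k by (rule freshman_poly[OF gO \<rho>(1) gO gg])
  moreover have "poly g \<rho> = 0" unfolding g_def poly_prod using f0_pos
    by (intro prod_zero bexI[of _ 0]) auto
  moreover have "0 < Q" using KA.P_gt_1 by simp
  ultimately have "cg 1 (poly g (\<rho> ^ Q)) 0" by (intro cg_sym[of 1 0]) (simp add: power_0_left)
  then have "cg 1 (\<Prod>j<f0. \<rho> ^ Q - (\<sigma> ^^ j) \<rho>) 0" by (simp add: g_def poly_prod)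
  then obtain j where j: "cg 1 (\<rho> ^ Q - (\<sigma> ^^ j) \<rho>) 0"
    using cg_1_prime_prod[of "{..<f0}" "\<lambda>j. \<rho> ^ Q - (\<sigma> ^^ j) \<rho>"] rO \<rho> O_diff O_power by blast
  then have "cg 1 (\<rho> ^ Q) ((\<sigma> ^^ j) \<rho>)" by (simp add: cg_def)
  then have "\<rho> ^ Q = (\<sigma> ^^ j) \<rho>"
    by (rule teichmueller_unique[OF O_power[OF \<rho>(1)] rO teich_power[OF \<rho>(2)] funpow_teich[OF \<rho>_L \<rho>(2)]])
  then show ?thesis by (intro exI[of _ j]) simp
qed

definition i0 where "i0 = (SOME i. (\<sigma> ^^ i) \<rho> = \<rho> ^ Q)"
definition \<Phi> where "\<Phi> = \<sigma> ^^ i0"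

sublocale \<Phi>: fld_endo L \<Phi> unfolding \<Phi>_def by (rule fld_endo_funpow)

lemma \<Phi>_\<rho>: "\<Phi> \<rho> = \<rho> ^ Q"
  unfolding \<Phi>_def i0_def using frobenius_lift by (rule someI_ex)

lemma \<iota>_cg: "x \<in> \<O> \<Longrightarrow> cg 1 (\<iota> x) x" and \<Phi>_cg: "x \<in> \<O> \<Longrightarrow> cg 1 (\<Phi> x) (x ^ Q)"
proof -
  assume x: "x \<in> \<O>"
  obtain w where w: "w = 0 \<or> (\<exists>i. w = \<rho> ^ i)" "cg 1 x w" using \<rho>_cg[OF x] by blast
  have wO: "w \<in> \<O>" using w(1) \<rho> by (auto intro: O_zero O_power)
  have Q0: "0 < Q" using KA.P_gt_1 by simp
  have w2: "\<iota> w = w" "\<Phi> w = w ^ Q" using w(1) \<rho>_L Q0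
    by (auto simp: \<iota>.endo_zero \<Phi>.endo_zero \<iota>.endo_power \<Phi>.endo_power \<iota>_\<rho> \<Phi>_\<rho> power_mult[symmetric] mult.commute)
  have "cg 1 (\<iota> x) w" using funpow_cg[OF x wO w(2), of f0] w2 by (simp add: \<iota>_def)
  then show "cg 1 (\<iota> x) x" using cg_trans[OF _ cg_sym[OF w(2)]] by blast
  have "cg 1 (\<Phi> x) (w ^ Q)" using funpow_cg[OF x wO w(2), of i0] w2 by (simp add: \<Phi>_def)
  then show "cg 1 (\<Phi> x) (x ^ Q)" using cg_trans cg_sym[OF cg_power[OF w(2) x wO]] by blast
qed

definition \<omega> where "\<omega> = \<Phi> lam / lam"

lemma \<Phi>_lam: "\<Phi> lam = \<omega> * lam" using pi_nz by (simp add: \<omega>_def)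
lemma \<omega>_L: "\<omega> \<in> L" unfolding \<omega>_def by (intro divide_closed \<Phi>.endo_closed lam_L)
lemma \<omega>_nz: "\<omega> \<noteq> 0" using \<Phi>.endo_eq_0_iff[OF lam_L] pi_nz by (simp add: \<omega>_def)

lemma \<omega>_U: "\<omega> \<in> \<U>"
proof -
  have "ord (\<Phi> lam) = ord \<omega> + ord lam" unfolding \<Phi>_lam by (intro ord_mult \<omega>_L lam_L \<omega>_nz pi_nz)
  then have "ord \<omega> = 0" using ord_funpow[OF lam_L pi_nz, of i0] by (simp add: \<Phi>_def)
  then show ?thesis by (rule ord_0_U[OF \<omega>_L \<omega>_nz])
qed

lemma \<iota>_\<Phi>: "\<iota> (\<Phi> x) = \<Phi> (\<iota> x)"
  unfolding \<iota>_def \<Phi>_def by (metis add.commute comp_apply funpow_add)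

lemma \<Phi>_\<zeta>: "\<Phi> \<zeta> = \<zeta> ^ Q"
proof -
  obtain i where "\<zeta> = \<rho> ^ i" using \<rho>_teich[OF \<zeta>_O \<zeta>_P \<zeta>_nz] by blast
  then show ?thesis using \<rho>_L \<Phi>_\<rho> by (simp add: \<Phi>.endo_power power_mult[symmetric] mult.commute)
qed

text \<open>Commutativity of the Galois group enters here: evaluating
  \<open>\<iota> \<Phi> = \<Phi> \<iota>\<close> at \<open>lam\<close> gives
  \<open>\<iota> \<omega> * \<zeta> = \<omega> * \<zeta>^Q\<close>, and inertia does not change the
  residue of \<omega>.\<close>

lemma \<zeta>_Q: "\<zeta> ^ Q = \<zeta>"
proof (rule teichmueller_unique)
  show "\<zeta> ^ Q \<in> \<O>" "\<zeta> \<in> \<O>" "(\<zeta> ^ Q) ^ P = \<zeta> ^ Q" "\<zeta> ^ P = \<zeta>" by (intro O_power \<zeta>_O teich_power \<zeta>_P)+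
  have "\<iota> (\<Phi> lam) = \<iota> \<omega> * (\<zeta> * lam)" unfolding \<Phi>_lam using \<omega>_L lam_L by (simp add: \<iota>.endo_mult \<iota>_lam)
  moreover have "\<Phi> (\<iota> lam) = \<zeta> ^ Q * (\<omega> * lam)" unfolding \<iota>_lam using \<zeta>_L lam_L by (simp add: \<Phi>.endo_mult \<Phi>_lam \<Phi>_\<zeta>)
  ultimately have eq: "\<iota> \<omega> * \<zeta> = \<omega> * \<zeta> ^ Q" using \<iota>_\<Phi>[of lam] pi_nz by (simp add: field_simps)
  have "cg 1 (\<iota> \<omega> * \<zeta>) (\<omega> * \<zeta>)" using U_O[OF \<omega>_U] \<iota>_cg \<zeta>_O funpow_O[of \<omega> f0] by (intro cg_mult cg_refl) (auto simp: \<iota>_def)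
  then show "cg 1 (\<zeta> ^ Q) \<zeta>" using cg_cancel[OF \<omega>_U] eq by simp
qed

lemma e_dvd_Q: "e dvd Q - 1"
proof -
  have "\<zeta> ^ (Q - 1) * \<zeta> = 1 * \<zeta>" using \<zeta>_Q KA.P_gt_1 by (cases Q) (auto simp: mult.commute)
  then have "\<zeta> ^ (Q - 1) = 1" using \<zeta>_nz by (simp only: mult_right_cancel not_False_eq_True)
  moreover have "\<zeta> ^ (Q - 1) = \<zeta> ^ ((Q - 1) mod e) * (\<zeta> ^ e) ^ ((Q - 1) div e)"
    by (metis mod_mult_div_eq power_add power_mult)
  ultimately have "\<zeta> ^ ((Q - 1) mod e) = 1" using \<zeta>_e by simp
  then have "(Q - 1) mod e = 0" using \<zeta>_order[of "(Q - 1) mod e"] e_pos mod_less_divisor[of e "Q - 1"] by auto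
  then show ?thesis by (simp add: dvd_eq_mod_eq_0)
qed

text \<open>\<open>\<rho> + lam\<close> is a primitive element: an automorphism fixing it fixes the
  residue of \<rho>, hence \<rho> by the uniqueness of representatives, and then
  \<open>lam\<close>.\<close>

lemma cyc_L:
  assumes "b \<in> K" "b \<noteq> 0"
  shows "cyc K L \<sigma> d b (\<rho> + lam)"
proof
  show "inj_on (\<lambda>i. (\<sigma> ^^ i) (\<rho> + lam)) {..<d}"
  proof (rule linorder_inj_onI')
    fix i j assume ij: "i \<in> {..<d}" "j \<in> {..<d}" "i < j"
    show "(\<sigma> ^^ i) (\<rho> + lam) \<noteq> (\<sigma> ^^ j) (\<rho> + lam)"
    proof
      assume a: "(\<sigma> ^^ i) (\<rho> + lam) = (\<sigma> ^^ j) (\<rho> + lam)"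
      interpret si: fld_endo L "\<sigma> ^^ i" by (rule fld_endo_funpow)
      define \<psi> where "\<psi> = \<sigma> ^^ (j - i)"
      interpret \<psi>: fld_endo L \<psi> unfolding \<psi>_def by (rule fld_endo_funpow)
      have "(\<sigma> ^^ j) (\<rho> + lam) = (\<sigma> ^^ i) (\<psi> (\<rho> + lam))"
        unfolding \<psi>_def using ij by (simp flip: funpow_add[THEN fun_cong, simplified comp_apply])
      then have "\<rho> + lam = \<psi> (\<rho> + lam)" using a inj_onD[OF si.endo_inj] \<psi>.endo_closed add_closed[OF \<rho>_L lam_L] by simp
      then have eq: "\<rho> + lam = \<psi> \<rho> + \<psi> lam" using \<psi>.endo_add[OF \<rho>_L lam_L] by simp
      have "cg 1 lam 0" using cg_pi_mult[OF O_one] by simp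
      then have l: "cg 1 (\<psi> lam) lam" using funpow_cg[OF pi_in O_zero, of 1 "j - i"] \<psi>.endo_zero cg_sym cg_trans unfolding \<psi>_def by metis
      have "cg 1 (\<psi> \<rho> + \<psi> lam - \<psi> lam) (\<rho> + lam - lam)" by (rule cg_diff[OF _ l]) (simp add: eq)
      then have "cg 1 (\<psi> \<rho>) \<rho>" by simp
      then have r: "\<psi> \<rho> = \<rho>" unfolding \<psi>_def
        by (rule teichmueller_unique[OF funpow_O[OF \<rho>(1)] \<rho>(1) funpow_teich[OF \<rho>_L \<rho>(2)] \<rho>(2)])
      then have "\<psi> lam = lam" using eq by simp
      then have "(\<sigma> ^^ (j - i)) x = x" if "x \<in> L" for x using funpow_id[of "j - i" x] r that unfolding \<psi>_def by blast
      then show False using \<sigma>_min[of "j - i"] ij by (auto simp: less_imp_diff_less)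
    qed
  qed
qed (use K_sub \<sigma>_K \<sigma>_fixed d_pos \<sigma>_d assms \<rho>_L lam_L in \<open>auto intro: add_closed\<close>)

end

lemma fld_endo_comp: "fld_endo F f \<Longrightarrow> fld_endo F g \<Longrightarrow> fld_endo F (\<lambda>x. f (g x))"
proof -
  assume "fld_endo F f" "fld_endo F g"
  then interpret f: fld_endo F f + g: fld_endo F g .
  show ?thesis by unfold_locales
    (auto simp: f.endo_closed g.endo_closed f.endo_add g.endo_add f.endo_mult g.endo_mult f.endo_one g.endo_one)
qed

lemma fld_endo_id: "subfld F \<Longrightarrow> fld_endo F (\<lambda>x. x)"
  by (simp add: fld_endo_def fld_endo_axioms_def)

lemma power_geometric: "0 < Q \<Longrightarrow> Q ^ l = 1 + (Q - 1) * (\<Sum>i<l. Q ^ i)" for Q :: nat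
proof (induction l)
  case (Suc l)
  then obtain q where "Q = Suc q" by (cases Q) auto
  then show ?case using Suc by (simp add: algebra_simps)
qed simp

section \<open>Residues of automorphisms applied to the uniformiser\<close>

context tame
begin

definition \<epsilon> where "\<epsilon> = (\<Prod>k<e. \<zeta> ^ k)"

text \<open>The exponents add up to \<open>e (e - 1) / 2\<close>; for even \<open>e\<close> the
  primitive root satisfies \<open>\<zeta>^(e/2) = -1\<close>.\<close>

lemma \<epsilon>_eq: "\<epsilon> = (- 1) ^ (e - 1)"
proof -
  have s: "\<epsilon> = \<zeta> ^ (e * (e - 1) div 2)"
    unfolding \<epsilon>_def by (simp flip: power_sum add: lessThan_atLeast0 Sum_Ico_nat)
  show ?thesis
  proof (cases "even e")
    case True
    then obtain j where j: "e = 2 * j" by (elim evenE)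
    have "(\<zeta> ^ j) ^ 2 = 1" using \<zeta>_e by (simp add: j power_mult[symmetric] mult.commute)
    moreover have "\<zeta> ^ j \<noteq> 1" using \<zeta>_order[of j] j e_pos by simp
    ultimately have "\<zeta> ^ j = - 1" by (simp add: power2_eq_1_iff)
    moreover have "e * (e - 1) div 2 = j * (e - 1)" using j by simp
    ultimately show ?thesis by (simp add: s power_mult)
  next
    case False
    then obtain i where "e = 2 * i + 1" by (elim oddE)
    then obtain j where j: "e - 1 = 2 * j" by simp
    then have "e * (e - 1) div 2 = e * j" by simp
    then show ?thesis unfolding s j by (simp add: power_mult \<zeta>_e)
  qed
qed

lemma \<epsilon>_nz: "\<epsilon> \<noteq> 0" and \<epsilon>_inverse: "inverse \<epsilon> = \<epsilon>"
proof -
  have 1: "\<epsilon> * \<epsilon> = 1" unfolding \<epsilon>_eq by (simp add: power_mult_distrib[symmetric])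
  then show "\<epsilon> \<noteq> 0" by auto
  then show "inverse \<epsilon> = \<epsilon>" using 1 by (simp add: inverse_unique)
qed

lemma \<zeta>_U: "\<zeta> \<in> \<U>"
  using \<zeta>_O \<zeta>_P \<zeta>_nz by (rule teichmueller_unit)

lemma \<epsilon>_U: "\<epsilon> \<in> \<U>"
proof -
  have "prod f I \<in> \<U>" if "\<And>i. f i \<in> \<U>" for f :: "nat \<Rightarrow> 'a" and I
    by (induction I rule: infinite_finite_induct) (auto intro: U_mult U_one that)
  then show ?thesis unfolding \<epsilon>_def using U_power[OF \<zeta>_U] by blast
qed

definition g where "g = (Q - 1) div e"

lemma eg: "e * g = Q - 1"
  using e_dvd_Q by (simp add: g_def)

text \<open>Applying \<Phi> to \<open>lam^e = \<pi> * \<tau>\<close> yields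
  \<open>\<omega>^e = \<tau>^(Q - 1)\<close>. The sign \<epsilon> can be inserted since
  \<open>\<epsilon>^(Q - 1) = 1\<close>.\<close>

lemma \<omega>_Q: "\<omega> ^ (Q - 1) = (\<epsilon> * \<tau>) ^ (g * (Q - 1))"
proof -
  obtain i where i: "\<tau> = \<rho> ^ i" using \<rho>_teich \<tau> by blast
  have \<tau>\<Phi>: "\<Phi> \<tau> = \<tau> ^ Q" using \<rho>_L \<Phi>_\<rho> by (simp add: i \<Phi>.endo_power power_mult[symmetric] mult.commute)
  have \<pi>\<Phi>: "\<Phi> \<pi> = \<pi>" unfolding \<Phi>_def using KA.pi_in OK by (intro funpow_K) simp
  have "\<omega> ^ e * lam ^ e = \<Phi> (lam ^ e)" using lam_L by (simp add: \<Phi>.endo_power \<Phi>_lam power_mult_distrib)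
  also have "\<dots> = \<pi> * \<tau> ^ Q" unfolding lam_e using pi_L \<tau>_L by (simp add: \<Phi>.endo_mult \<tau>\<Phi> \<pi>\<Phi>)
  also have "\<dots> = \<tau> ^ (Q - 1) * lam ^ e" unfolding lam_e using KA.P_gt_1 by (cases Q) auto
  finally have we: "\<omega> ^ e = \<tau> ^ (Q - 1)" using pi_nz by simp
  have "\<zeta> ^ (Q - 1) = 1" unfolding eg[symmetric] using \<zeta>_e by (simp add: power_mult)
  then have "(\<zeta> ^ k) ^ (Q - 1) = 1" for k
    unfolding power_mult[symmetric] mult.commute[of k "Q - 1"] unfolding power_mult by simp
  then have "\<epsilon> ^ (Q - 1) = 1" unfolding \<epsilon>_def prod_power_distrib by simp
  then have e1: "\<epsilon> ^ (g * (Q - 1)) = 1" by (simp add: mult.commute[of g] power_mult)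
  have "\<omega> ^ (Q - 1) = \<tau> ^ (g * (Q - 1))"
    unfolding eg[symmetric] power_mult we by (simp add: eg power_mult[symmetric] mult.commute)
  then show ?thesis unfolding power_mult_distrib e1 by simp
qed

text \<open>Mediates between \<open>\<omega>^l\<close>, which the comparison of algebras provides,
  and \<open>\<omega>^(1 + Q + ... + Q^(l-1))\<close>, by which \<open>\<Phi>^l\<close> multiplies
  \<open>lam\<close> up to congruence. The exponents differ by a multiple of \<open>Q - 1\<close>,
  where \<open>\<omega>_Q\<close> applies.\<close>

lemma \<omega>_geometric: "\<omega> ^ (\<Sum>i<l. Q ^ i) * (\<epsilon> * \<tau>) ^ (g * l) = \<omega> ^ l * (\<epsilon> * \<tau>) ^ (g * (\<Sum>i<l. Q ^ i))"
proof -
  have "\<exists>y. (\<Sum>i<l. Q ^ i) = l + (Q - 1) * y"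
  proof (induction l)
    case (Suc l)
    then obtain y where "(\<Sum>i<l. Q ^ i) = l + (Q - 1) * y" by blast
    moreover have "Q ^ l = 1 + (Q - 1) * (\<Sum>i<l. Q ^ i)"
      using KA.P_gt_1 by (intro power_geometric) simp
    ultimately show ?case by (intro exI[of _ "y + (\<Sum>i<l. Q ^ i)"]) (simp add: algebra_simps)
  qed simp
  then obtain y where y: "(\<Sum>i<l. Q ^ i) = l + (Q - 1) * y" by blast
  have "\<omega> ^ ((Q - 1) * y) = (\<epsilon> * \<tau>) ^ (g * ((Q - 1) * y))"
    unfolding power_mult[of \<omega>] \<omega>_Q unfolding power_mult[symmetric] mult.assoc ..
  then show ?thesis unfolding y power_add distrib_left by (simp only: mult_ac)
qed

lemma \<Phi>_funpow_cg: "x \<in> \<O> \<Longrightarrow> cg 1 ((\<Phi> ^^ l) x) (x ^ (Q ^ l))"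
proof (induction l)
  case (Suc l)
  have *: "(\<Phi> ^^ l) x \<in> \<O>" using funpow_O[OF Suc.prems, of "i0 * l"] by (simp add: \<Phi>_def funpow_mult)
  have "cg 1 (\<Phi> ((\<Phi> ^^ l) x)) (((\<Phi> ^^ l) x) ^ Q)" by (rule \<Phi>_cg[OF *])
  also have "cg 1 (((\<Phi> ^^ l) x) ^ Q) ((x ^ (Q ^ l)) ^ Q)"
    by (intro cg_power Suc * O_power)
  finally show ?case by (simp add: power_mult[symmetric] mult.commute)
qed simp

lemma \<iota>_funpow_cg: "x \<in> \<O> \<Longrightarrow> cg 1 ((\<iota> ^^ a) x) x"
proof (induction a)
  case (Suc a)
  have *: "(\<iota> ^^ a) x \<in> \<O>" using funpow_O[OF Suc.prems, of "f0 * a"] by (simp add: \<iota>_funpow)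
  show ?case using cg_trans[OF \<iota>_cg[OF *]] Suc by simp
qed simp

lemma \<Phi>_funpow_lam: "\<exists>w\<in>\<U>. (\<Phi> ^^ l) lam = w * lam \<and> cg 1 w (\<omega> ^ (\<Sum>i<l. Q ^ i))"
proof (induction l)
  case 0
  show ?case by (intro bexI[of _ 1]) (auto intro: U_one)
next
  case (Suc l)
  then obtain w where w: "w \<in> \<U>" "(\<Phi> ^^ l) lam = w * lam" "cg 1 w (\<omega> ^ (\<Sum>i<l. Q ^ i))" by blast
  have wO: "w \<in> \<O>" "w \<in> L" using U_O[OF w(1)] O_sub by auto
  have *: "cg 1 (\<Phi> w) (w ^ Q)" by (rule \<Phi>_cg[OF wO(1)])
  have \<Phi>O: "\<Phi> w \<in> \<O>" unfolding \<Phi>_def by (rule funpow_O[OF wO(1)])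
  have wU: "\<Phi> w \<in> \<U>" by (rule cg_1_unit[OF \<Phi>O * U_power[OF w(1)]])
  have "cg 1 (\<Phi> w) ((\<omega> ^ (\<Sum>i<l. Q ^ i)) ^ Q)"
    using U_O[OF \<omega>_U] by (intro cg_trans[OF *] cg_power w wO O_power)
  then have "cg 1 (\<Phi> w * \<omega>) ((\<omega> ^ (\<Sum>i<l. Q ^ i)) ^ Q * \<omega>)"
    using U_O[OF \<omega>_U] by (intro cg_mult \<Phi>O cg_refl)
  also have "(\<omega> ^ (\<Sum>i<l. Q ^ i)) ^ Q * \<omega> = \<omega> ^ (\<Sum>i<Suc l. Q ^ i)"
    unfolding sum.lessThan_Suc_shift by (simp add: power_mult[symmetric] sum_distrib_right mult.commute[of Q])
  finally have "cg 1 (\<Phi> w * \<omega>) (\<omega> ^ (\<Sum>i<Suc l. Q ^ i))" .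
  moreover have "(\<Phi> ^^ Suc l) lam = (\<Phi> w * \<omega>) * lam"
    using w(2) wO lam_L by (simp add: \<Phi>.endo_mult \<Phi>_lam mult.assoc)
  ultimately show ?case using U_mult[OF wU \<omega>_U] by blast
qed

text \<open>The automorphism raises the unit part of \<open>\<beta>\<close> to the power \<open>Q\<^sup>l\<close> modulo \<open>lam\<close>, and multiplies
  \<open>lam\<close> by a unit whose residue is determined by that of \<open>\<zeta>\<^sup>a \<omega>\<^sup>l\<close>.\<close>

lemma evaluation:
  assumes u: "u \<in> \<U>" and a: "cg 1 (\<zeta> ^ a * \<omega> ^ l) (((\<epsilon> * \<tau>) ^ l / u) ^ g)" and \<beta>: "\<beta> \<in> L" "\<beta> \<noteq> 0"
  shows "cg 1 ((\<iota> ^^ a) ((\<Phi> ^^ l) \<beta>) / \<beta>)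
    (\<beta> ^ (Q ^ l - 1) / ((\<epsilon> * \<pi>) powi (int (g * (\<Sum>i<l. Q ^ i)) * ord \<beta>) * u powi (int g * ord \<beta>)))"
proof -
  define S where "S = (\<Sum>i<l. Q ^ i)"
  define k where "k = ord \<beta>"
  interpret \<Phi>l: fld_endo L "\<Phi> ^^ l" by (rule \<Phi>.fld_endo_funpow)
  interpret \<iota>a: fld_endo L "\<iota> ^^ a" by (rule \<iota>.fld_endo_funpow)
  obtain \<beta>\<^sub>0 where b0: "\<beta>\<^sub>0 \<in> \<U>" "\<beta> = lam powi k * \<beta>\<^sub>0" unfolding k_def by (rule ord_decomp[OF \<beta>])
  have b0': "\<beta>\<^sub>0 \<in> \<O>" "\<beta>\<^sub>0 \<in> L" "\<beta>\<^sub>0 \<noteq> 0" using U_O[OF b0(1)] O_sub U_nz[OF b0(1)] by auto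
  obtain w where w: "w \<in> \<U>" "(\<Phi> ^^ l) lam = w * lam" "cg 1 w (\<omega> ^ S)" using \<Phi>_funpow_lam[of l] unfolding S_def by blast
  have wO: "w \<in> \<O>" "w \<in> L" using U_O[OF w(1)] O_sub by auto
  define \<eta> where "\<eta> = (\<iota> ^^ a) w * \<zeta> ^ a"
  have \<iota>w: "cg 1 ((\<iota> ^^ a) w) w" by (rule \<iota>_funpow_cg[OF wO(1)])
  have \<iota>wO: "(\<iota> ^^ a) w \<in> \<O>" unfolding \<iota>_funpow by (rule funpow_O[OF wO(1)])
  have \<iota>wU: "(\<iota> ^^ a) w \<in> \<U>" by (rule cg_1_unit[OF \<iota>wO \<iota>w w(1)])
  have \<eta>U: "\<eta> \<in> \<U>" unfolding \<eta>_def by (intro U_mult \<iota>wU U_power \<zeta>_U)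
  have \<eta>: "(\<iota> ^^ a) ((\<Phi> ^^ l) lam) = \<eta> * lam"
    unfolding w(2) \<eta>_def using wO lam_L by (simp add: \<iota>a.endo_mult \<iota>_funpow_lam mult.assoc)
  \<comment> \<open>The predicted residue of the factor \<eta> by which the whole automorphism
    multiplies \<open>lam\<close>.\<close>
  define \<kappa> where "\<kappa> = (\<epsilon> * \<tau>) ^ (g * S) / u ^ g"
  have \<kappa>U: "\<kappa> \<in> \<U>" unfolding \<kappa>_def divide_inverse by (intro U_mult U_power U_inverse \<epsilon>_U \<tau>_U u)
  have etU: "\<epsilon> * \<tau> \<in> \<U>" by (intro U_mult \<epsilon>_U \<tau>_U)
  have \<eta>\<kappa>: "cg 1 \<eta> \<kappa>"
  proof (rule cg_cancel[OF U_power[OF etU, of "g * l"]])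
    have "cg 1 \<eta> (\<omega> ^ S * \<zeta> ^ a)" unfolding \<eta>_def
      using \<iota>wO \<zeta>_O by (intro cg_mult cg_trans[OF \<iota>w w(3)] cg_refl O_power)
    then have "cg 1 ((\<epsilon> * \<tau>) ^ (g * l) * \<eta>) ((\<epsilon> * \<tau>) ^ (g * l) * (\<omega> ^ S * \<zeta> ^ a))"
      using U_O[OF etU] by (intro cg_scale O_power)
    also have "(\<epsilon> * \<tau>) ^ (g * l) * (\<omega> ^ S * \<zeta> ^ a) = (\<epsilon> * \<tau>) ^ (g * S) * (\<zeta> ^ a * \<omega> ^ l)"
      using \<omega>_geometric[of l] unfolding S_def by (simp add: mult_ac)
    also have "cg 1 \<dots> ((\<epsilon> * \<tau>) ^ (g * S) * (((\<epsilon> * \<tau>) ^ l / u) ^ g))"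
      using U_O[OF etU] by (intro cg_scale O_power a)
    also have "(\<epsilon> * \<tau>) ^ (g * S) * (((\<epsilon> * \<tau>) ^ l / u) ^ g) = (\<epsilon> * \<tau>) ^ (g * l) * \<kappa>"
      unfolding \<kappa>_def by (simp add: power_divide power_mult[symmetric] mult.commute)
    finally show "cg 1 ((\<epsilon> * \<tau>) ^ (g * l) * \<eta>) ((\<epsilon> * \<tau>) ^ (g * l) * \<kappa>)" .
  qed
  define b where "b = (\<iota> ^^ a) ((\<Phi> ^^ l) \<beta>\<^sub>0)"
  have \<Phi>O: "(\<Phi> ^^ l) \<beta>\<^sub>0 \<in> \<O>" using funpow_O[OF b0'(1), of "i0 * l"] by (simp add: \<Phi>_def funpow_mult)
  have bO: "b \<in> \<O>" unfolding b_def \<iota>_funpow by (rule funpow_O[OF \<Phi>O])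
  have bc: "cg 1 b (\<beta>\<^sub>0 ^ (Q ^ l))"
    unfolding b_def by (rule cg_trans[OF \<iota>_funpow_cg[OF \<Phi>O] \<Phi>_funpow_cg[OF b0'(1)]])
  have "cg 1 (b / \<beta>\<^sub>0) (\<beta>\<^sub>0 ^ (Q ^ l) / \<beta>\<^sub>0)" by (rule cg_divide[OF bc cg_refl bO b0(1) b0(1)])
  moreover have Ql: "Q ^ l = Suc (Q ^ l - 1)" using KA.P_gt_1 by simp
  moreover have "\<beta>\<^sub>0 ^ (Q ^ l) / \<beta>\<^sub>0 = \<beta>\<^sub>0 ^ (Q ^ l - 1)" by (subst Ql) (use b0'(3) in simp)
  ultimately have bd: "cg 1 (b / \<beta>\<^sub>0) (\<beta>\<^sub>0 ^ (Q ^ l - 1))" by simp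
  have bdO: "b / \<beta>\<^sub>0 \<in> \<O>" unfolding divide_inverse by (intro O_mult bO U_O[OF U_inverse[OF b0(1)]])
  have \<Phi>\<beta>: "(\<Phi> ^^ l) \<beta> = (\<Phi> ^^ l) lam powi k * (\<Phi> ^^ l) \<beta>\<^sub>0"
    unfolding b0(2) using lam_L b0' by (simp add: \<Phi>l.endo_mult \<Phi>l.endo_power_int power_int_closed)
  have "(\<iota> ^^ a) ((\<Phi> ^^ l) \<beta>) = (\<eta> * lam) powi k * b"
    unfolding \<Phi>\<beta> b_def \<eta>[symmetric] using lam_L b0' \<Phi>.funpow_closed
    by (simp add: \<iota>a.endo_mult \<iota>a.endo_power_int power_int_closed)
  then have lhs: "(\<iota> ^^ a) ((\<Phi> ^^ l) \<beta>) / \<beta> = \<eta> powi k * (b / \<beta>\<^sub>0)"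
    unfolding b0(2) using pi_nz by (simp add: power_int_mult_distrib)
  have "cg 1 (\<eta> powi k * (b / \<beta>\<^sub>0)) (\<kappa> powi k * (\<beta>\<^sub>0 ^ (Q ^ l - 1)))"
    by (intro cg_mult cg_power_int \<eta>\<kappa> \<eta>U \<kappa>U bd O_power b0' U_O[OF U_power_int])
  moreover have "\<kappa> powi k * (\<beta>\<^sub>0 ^ (Q ^ l - 1)) =
    \<beta> ^ (Q ^ l - 1) / ((\<epsilon> * \<pi>) powi (int (g * S) * k) * u powi (int g * k))"
  proof -
    \<comment> \<open>With this factorisation the power of \<open>lam\<close> in
      \<open>\<beta>^(Q^l - 1)\<close> becomes a power of \<open>\<pi> * \<tau>\<close>; the part
      from \<tau> is that of \<kappa>, while the part from \<pi> is cancelled by the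
      denominator.\<close>
    have "Q ^ l - 1 = e * (g * S)" unfolding S_def mult.assoc[symmetric] eg using power_geometric[of Q l] KA.P_gt_1 by simp
    moreover have "(lam powi k) ^ n = (lam ^ n) powi k" for n
      unfolding power_int_of_nat[symmetric] power_int_mult[symmetric] mult.commute[of k] ..
    ultimately have "(lam powi k) ^ (Q ^ l - 1) = ((lam ^ e) ^ (g * S)) powi k" by (simp only: power_mult[of lam e "g * S"])
    also have "\<dots> = (\<pi> ^ (g * S)) powi k * (\<tau> ^ (g * S)) powi k"
      unfolding lam_e by (simp add: power_mult_distrib power_int_mult_distrib)
    finally have 1: "\<beta> ^ (Q ^ l - 1) = (\<pi> ^ (g * S)) powi k * (\<tau> ^ (g * S)) powi k * \<beta>\<^sub>0 ^ (Q ^ l - 1)"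
      unfolding b0(2) power_mult_distrib by simp
    have 2: "(\<epsilon> * \<pi>) powi (int (g * S) * k) = (\<epsilon> ^ (g * S)) powi k * (\<pi> ^ (g * S)) powi k"
      unfolding power_int_mult power_int_of_nat by (simp add: power_mult_distrib power_int_mult_distrib)
    have 3: "u powi (int g * k) = (u ^ g) powi k" unfolding power_int_mult power_int_of_nat ..
    \<comment> \<open>As \<epsilon> is a sign, it may stand in the numerator, as in \<kappa>, or in
      the denominator, as in the claim.\<close>
    have "inverse (\<epsilon> ^ (g * S)) = \<epsilon> ^ (g * S)" by (simp add: power_inverse[symmetric] \<epsilon>_inverse)
    then have 5: "inverse ((\<epsilon> ^ (g * S)) powi k) = (\<epsilon> ^ (g * S)) powi k"
      by (simp flip: power_int_inverse)
    have 4: "\<kappa> powi k = (\<epsilon> ^ (g * S)) powi k * (\<tau> ^ (g * S)) powi k / (u ^ g) powi k"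
      unfolding \<kappa>_def by (simp add: power_mult_distrib power_int_mult_distrib power_int_divide_distrib)
    have nz: "(\<pi> ^ (g * S)) powi k \<noteq> 0" using KA.pi_nz by simp
    have "(\<pi> ^ (g * S)) powi k * (\<tau> ^ (g * S)) powi k * \<beta>\<^sub>0 ^ (Q ^ l - 1) /
      ((\<epsilon> ^ (g * S)) powi k * (\<pi> ^ (g * S)) powi k * (u ^ g) powi k) =
      inverse ((\<epsilon> ^ (g * S)) powi k) * (\<tau> ^ (g * S)) powi k / (u ^ g) powi k * \<beta>\<^sub>0 ^ (Q ^ l - 1)"
      using nz by (simp add: divide_inverse mult_ac)
    then show ?thesis unfolding 1 2 3 4 5 by simp
  qed
  ultimately show ?thesis unfolding lhs S_def k_def by simp
qed

end

context tame
begin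

lemma U_K: "w \<in> KA.\<U> \<Longrightarrow> w \<in> \<U>"
proof -
  have "OK \<subseteq> \<O>" using OK by blast
  then show "w \<in> KA.\<U> \<Longrightarrow> w \<in> \<U>" by (auto simp: KA.\<U>_def \<U>_def)
qed

lemma ord_K: "x \<in> K \<Longrightarrow> x \<noteq> 0 \<Longrightarrow> ord x = int e * KA.ord x"
proof -
  assume x: "x \<in> K" "x \<noteq> 0"
  obtain w where w: "w \<in> KA.\<U>" "x = \<pi> powi KA.ord x * w" by (rule KA.ord_decomp[OF x])
  have wU: "w \<in> \<U>" by (rule U_K[OF w(1)])
  have "ord (\<pi> powi KA.ord x * w) = KA.ord x * int e + 0"
    using pi_L KA.pi_nz U_nz[OF wU] U_O[OF wU] O_sub
    by (subst ord_mult) (auto simp: ord_power_int power_int_closed ord_\<pi> ord_U[OF wU])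
  then show ?thesis using w(2) by simp
qed

lemma \<zeta>_power_int: "\<zeta> powi a = \<zeta> ^ nat (a mod int e)"
proof -
  have "\<zeta> powi a = \<zeta> powi (int e * (a div int e) + a mod int e)" by simp
  also have "\<dots> = (\<zeta> ^ e) powi (a div int e) * \<zeta> powi (a mod int e)"
    by (subst power_int_add) (use \<zeta>_nz in \<open>auto simp: power_int_mult\<close>)
  also have "\<dots> = \<zeta> ^ nat (a mod int e)" using e_pos by (simp add: \<zeta>_e power_int_def)
  finally show ?thesis .
qed

text \<open>Over \<open>M = L W\<close>, extend \<open>\<iota>\<close> by the identity of \<open>W\<close> and \<open>\<Phi>\<close> by the Frobenius of \<open>W\<close>. Valuations of
  the comparison scalars determine \<open>n\<close>, and residues determine the action of \<open>\<sigma>\<^sup>n\<close>.\<close>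

theorem reciprocity:
  assumes W: "1 \<le> fW" "\<rho>W ^ (Q ^ fW) = \<rho>W" "\<rho>W \<noteq> 0" "W = adjoin K \<rho>W" "\<rho>W \<in> W"
    and \<phi>: "fld_endo W \<phi>" "\<And>x. x \<in> K \<Longrightarrow> \<phi> x = x" "\<phi> \<rho>W = \<rho>W ^ Q"
    and u: "u \<in> KA.\<U>" and c: "c \<in> K" "c \<noteq> 0" "KA.ord c = r"
    and iso: "csa_iso K L \<sigma> d (u * \<pi> ^ l) \<gamma> r0 W \<phi> m c \<omega>' s0 h"
  shows "\<exists>(n::nat) q. int d * r = int m * (int d * q + int n) \<and> (\<forall>\<beta>\<in>L - {0}. cg 1 ((\<sigma> ^^ n) \<beta> / \<beta>)
    (\<beta> ^ (Q ^ l - 1) / ((\<epsilon> * \<pi>) powi (int (g * (\<Sum>i<l. Q ^ i)) * ord \<beta>) * u powi (int g * ord \<beta>))))"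
proof -
  interpret I: csa_iso K L \<sigma> d "u * \<pi> ^ l" \<gamma> r0 W \<phi> m c \<omega>' s0 h by (rule iso)
  interpret \<phi>: fld_endo W \<phi> by (rule \<phi>)
  have m: "0 < m" by (rule I.B.d_pos)
  have KW: "K \<subseteq> W" by (rule I.B.K_subset)
  have uU: "u \<in> \<U>" by (rule U_K[OF u])
  have uL: "u \<in> L" "u \<noteq> 0" using U_O[OF uU] O_sub U_nz[OF uU] by auto
  have iter: "x ^ (q ^ n) = x" if "x ^ q = x" for x :: 'a and q n
    by (induction n) (use that in \<open>auto simp: power_mult\<close>)
  \<comment> \<open>A common exponent for which the residues of \<open>L\<close> and the root of
    unity \<rho>W are both fixed.\<close>
  have "P ^ fW = (Q ^ fW) ^ f" by (simp add: P_def power_mult[symmetric] mult.commute)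
  then have \<rho>WP: "\<rho>W ^ (P ^ fW) = \<rho>W" using iter[OF W(2), of f] by simp
  interpret LP: adic L \<O> lam p "P ^ fW" by (rule adic_power[OF W(1)])
  interpret X: adic_ext L \<O> lam p "P ^ fW" \<rho>W by unfold_locales (use \<rho>WP W(3) in auto)
  obtain kQ where kQ: "Q = p ^ kQ" using KA.P by blast
  obtain \<Phi>' where \<Phi>': "fld_endo X.M \<Phi>'" "\<And>x. x \<in> L \<Longrightarrow> \<Phi>' x = \<Phi> x" "\<Phi>' \<rho>W = \<rho>W ^ Q"
    "\<And>x. x \<in> X.OM \<Longrightarrow> \<Phi>' x \<in> X.OM" "\<And>x. x \<in> X.OM \<Longrightarrow> X.M.cg 1 (\<Phi>' x) (x ^ Q)"
  proof -
    have 1: "\<Phi> x \<in> \<O>" if "x \<in> \<O>" for x unfolding \<Phi>_def using that by (rule funpow_O)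
    show thesis using X.extend_endo[OF \<Phi>.fld_endo_axioms 1, of kQ] \<Phi>_cg that unfolding kQ by blast
  qed
  obtain \<iota>' where \<iota>': "fld_endo X.M \<iota>'" "\<And>x. x \<in> L \<Longrightarrow> \<iota>' x = \<iota> x" "\<iota>' \<rho>W = \<rho>W"
    "\<And>x. x \<in> X.OM \<Longrightarrow> \<iota>' x \<in> X.OM" "\<And>x. x \<in> X.OM \<Longrightarrow> X.M.cg 1 (\<iota>' x) x"
  proof -
    have 1: "\<iota> x \<in> \<O>" if "x \<in> \<O>" for x unfolding \<iota>_def using that by (rule funpow_O)
    have 2: "cg 1 (\<iota> x) (x ^ (p ^ 0))" if "x \<in> \<O>" for x using \<iota>_cg[OF that] by simp
    from X.extend_endo[OF \<iota>.fld_endo_axioms 1 2] obtain h where h: "fld_endo X.M h" "\<And>x. x \<in> L \<Longrightarrow> h x = \<iota> x"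
      "h \<rho>W = \<rho>W ^ (p ^ 0)" "\<And>x. x \<in> X.OM \<Longrightarrow> h x \<in> X.OM" "\<And>x. x \<in> X.OM \<Longrightarrow> X.M.cg 1 (h x) (x ^ (p ^ 0))" by blast
    show thesis by (rule that[of h]) (use h in simp_all)
  qed
  interpret \<Phi>': fld_endo X.M \<Phi>' by (rule \<Phi>')
  interpret \<iota>': fld_endo X.M \<iota>' by (rule \<iota>')
  have idM: "fld_endo X.M (\<lambda>x. x)" by (rule fld_endo_id[OF X.M_subfld])
  have LM: "L \<subseteq> X.M" by (rule X.F_sub_M)
  have \<rho>M: "\<rho>W \<in> X.M" using X.rho_OM X.M.O_sub by auto
  have KM: "K \<subseteq> X.M" using K_sub LM by blast
  have WM: "W \<subseteq> X.M" unfolding W(4) X.M_def adjoin_def using K_sub by (fastforce simp: polys_over_def)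
  have eqM: "f1 x = f2 x" if "fld_endo X.M f1" "fld_endo X.M f2" "\<And>y. y \<in> L \<Longrightarrow> f1 y = f2 y" "f1 \<rho>W = f2 \<rho>W" "x \<in> X.M" for f1 f2 x
    using endo_eq_adjoin[OF that(1,2) LM LM \<rho>M \<rho>M that(3,4)] that(5) unfolding X.M_def by blast
  have \<iota>K: "\<iota>' x = x" and \<Phi>K: "\<Phi>' x = x" if "x \<in> K" for x
    using that K_sub \<iota>'(2) \<Phi>'(2) by (auto simp: \<iota>_def \<Phi>_def funpow_K)
  have \<iota>W: "\<iota>' w = w" if "w \<in> W" for w
    by (rule endo_eq_adjoin[OF \<iota>'(1) idM KM KM \<rho>M \<rho>M \<iota>K \<iota>'(3)]) (use that W(4) in auto)
  have \<Phi>W: "\<Phi>' w = \<phi> w" if "w \<in> W" for w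
    by (rule endo_eq_adjoin[OF \<Phi>'(1) \<phi>(1) KM KW \<rho>M W(5)]) (use that W(4) \<Phi>K \<phi> \<Phi>'(3) in auto)
  have comm: "\<iota>' (\<Phi>' x) = \<Phi>' (\<iota>' x)" if "x \<in> X.M" for x
  proof (rule eqM[OF fld_endo_comp[OF \<iota>'(1) \<Phi>'(1)] fld_endo_comp[OF \<Phi>'(1) \<iota>'(1)] _ _ that])
    show "\<iota>' (\<Phi>' y) = \<Phi>' (\<iota>' y)" if "y \<in> L" for y
      using that by (simp add: \<iota>'(2) \<Phi>'(2) \<iota>.endo_closed \<Phi>.endo_closed \<iota>_\<Phi>)
    show "\<iota>' (\<Phi>' \<rho>W) = \<Phi>' (\<iota>' \<rho>W)" using \<rho>M by (simp add: \<iota>'(3) \<Phi>'(3) \<iota>'.endo_power)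
  qed
  have \<iota>'L: "(\<iota>' ^^ k) x = (\<iota> ^^ k) x" and \<Phi>'L: "(\<Phi>' ^^ k) x = (\<Phi> ^^ k) x" if "x \<in> L" for x k
    by (induction k) (auto simp: \<iota>'(2) \<Phi>'(2) \<iota>.funpow_closed \<Phi>.funpow_closed that)
  have \<iota>'\<rho>: "(\<iota>' ^^ k) \<rho>W = \<rho>W" for k by (induction k) (auto simp: \<iota>'(3))
  have \<Phi>'\<rho>: "(\<Phi>' ^^ k) \<rho>W = \<rho>W ^ (Q ^ k)" for k
    by (induction k) (auto simp: \<Phi>'.endo_power \<Phi>'(3) \<rho>M power_mult)
  \<comment> \<open>The factor \<open>d\<close> makes \<open>\<Phi>'^N\<close> trivial on
    \<open>L\<close>, the factor \<open>fW\<close> makes it fix \<rho>W, and divisibility by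
    \<open>m\<close> and by \<open>d\<close> makes both generators' powers scalar.\<close>
  define N where "N = m * (d * fW)"
  define kA where "kA = m * fW * i0"
  have \<iota>'e: "(\<iota>' ^^ e) x = x" if "x \<in> X.M" for x
    by (rule eqM[OF \<iota>'.fld_endo_funpow idM _ \<iota>'\<rho> that]) (simp add: \<iota>'L \<iota>_e)
  have \<Phi>'N: "(\<Phi>' ^^ N) x = x" if "x \<in> X.M" for x
  proof (rule eqM[OF \<Phi>'.fld_endo_funpow idM _ _ that])
    show "(\<Phi>' ^^ N) y = y" if y: "y \<in> L" for y
    proof -
      have "(\<Phi>' ^^ N) y = (\<sigma> ^^ (d * kA)) y"
        unfolding \<Phi>'L[OF y] unfolding \<Phi>_def funpow_mult by (simp add: N_def kA_def ac_simps)
      then show ?thesis using funpow_multiple[OF \<sigma>_d[OF y]] by simp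
    qed
    have "Q ^ N = (Q ^ fW) ^ (m * d)" by (simp add: N_def power_mult[symmetric] ac_simps)
    then show "(\<Phi>' ^^ N) \<rho>W = \<rho>W" unfolding \<Phi>'\<rho> using iter[OF W(2)] by simp
  qed
  have "\<exists>\<alpha>\<in>X.M - {0}. \<exists>\<beta>\<in>X.M - {0}. (\<Prod>k<e. (\<iota>' ^^ k) \<alpha>) * (u * \<pi> ^ l) = 1 \<and>
    (\<Prod>k<N. (\<Phi>' ^^ k) \<beta>) * (u * \<pi> ^ l) ^ kA = c ^ (d * fW) \<and> \<iota>' \<beta> * \<alpha> = \<Phi>' \<alpha> * \<beta>"
  proof (rule I.comparison[OF WM LM \<iota>'(1) \<iota>W _ \<Phi>'(1) \<Phi>W _ comm \<iota>'e _ \<Phi>'N])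
    show "\<iota>' x = (\<sigma> ^^ f0) x" "\<Phi>' x = (\<sigma> ^^ i0) x" if "x \<in> L" for x
      using that \<iota>'(2) \<Phi>'(2) by (auto simp: \<iota>_def \<Phi>_def)
    show "e * f0 = d" "N = m * (d * fW)" "N * i0 = d * kA" "0 < N"
      using d_eq m d_pos W(1) by (auto simp: N_def kA_def)
  qed
  then obtain \<alpha> \<beta> where \<alpha>: "\<alpha> \<in> X.M" "\<alpha> \<noteq> 0" and \<beta>: "\<beta> \<in> X.M" "\<beta> \<noteq> 0"
    and eq1: "(\<Prod>k<e. (\<iota>' ^^ k) \<alpha>) * (u * \<pi> ^ l) = 1"
    and eq2: "(\<Prod>k<N. (\<Phi>' ^^ k) \<beta>) * (u * \<pi> ^ l) ^ kA = c ^ (d * fW)"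
    and eq3: "\<iota>' \<beta> * \<alpha> = \<Phi>' \<alpha> * \<beta>" by blast
  define b where "b = u * \<pi> ^ l"
  have bL: "b \<in> L" "b \<noteq> 0" unfolding b_def using uL pi_L KA.pi_nz by (auto intro: mult_closed power_closed)
  have bM: "b \<in> X.M" "c \<in> X.M" using bL LM c KM by auto
  have ordL: "X.M.ord x = ord x" if "x \<in> L" "x \<noteq> 0" for x using that by (rule X.ord_M)
  have ord_b: "X.M.ord b = int (e * l)"
    unfolding ordL[OF bL] unfolding b_def using uL pi_L KA.pi_nz
    by (simp add: ord_mult power_closed ord_power ord_\<pi> ord_U[OF uU])
  have ord_c: "X.M.ord c = int e * r" using ordL ord_K c K_sub by auto
  have ord_pi': "X.M.ord \<pi> = int e" using ordL pi_L KA.pi_nz ord_\<pi> by simp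
  have ord_endo': "X.M.ord ((F ^^ k) x) = X.M.ord x" "(F ^^ k) x \<in> X.M" "(F ^^ k) x \<noteq> 0"
    if F: "fld_endo X.M F" "F \<pi> = \<pi>" and x: "x \<in> X.M" "x \<noteq> 0" for F k x
  proof -
    have "(F ^^ k) \<pi> = \<pi>" by (induction k) (auto simp: F)
    then show "X.M.ord ((F ^^ k) x) = X.M.ord x"
      using ord_pi' e_pos LM pi_L KA.pi_nz by (intro X.M.ord_endo[OF fld_endo.fld_endo_funpow[OF F(1)], of \<pi>] x) auto
    show "(F ^^ k) x \<in> X.M" "(F ^^ k) x \<noteq> 0"
      using fld_endo.funpow_closed[OF F(1) x(1)] fld_endo.endo_eq_0_iff[OF fld_endo.fld_endo_funpow[OF F(1)] x(1)] x(2) by auto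
  qed
  have piK: "\<pi> \<in> K" using KA.pi_in OK by simp
  have ord_prod': "X.M.ord (\<Prod>k<j. (F ^^ k) x) = int j * X.M.ord x" "(\<Prod>k<j. (F ^^ k) x) \<in> X.M" "(\<Prod>k<j. (F ^^ k) x) \<noteq> 0"
    if F: "fld_endo X.M F" "F \<pi> = \<pi>" and x: "x \<in> X.M" "x \<noteq> 0" for F x j
  proof -
    show "X.M.ord (\<Prod>k<j. (F ^^ k) x) = int j * X.M.ord x"
      using ord_endo'[OF F x] by (subst X.M.ord_prod) auto
    show "(\<Prod>k<j. (F ^^ k) x) \<in> X.M" by (intro X.M.prod_closed ord_endo'(2)[OF F x])
    show "(\<Prod>k<j. (F ^^ k) x) \<noteq> 0" using ord_endo'(3)[OF F x] by simp
  qed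
  define a where "a = X.M.ord \<beta>"
  have ord_\<alpha>: "X.M.ord \<alpha> = - int l"
  proof -
    note pr = ord_prod'[OF \<iota>'(1) \<iota>K[OF piK] \<alpha>, of e]
    have "X.M.ord ((\<Prod>k<e. (\<iota>' ^^ k) \<alpha>) * b) = 0" using eq1 X.M.ord_one by (simp add: b_def)
    then have "int e * X.M.ord \<alpha> + int (e * l) = 0"
      using X.M.ord_mult[OF pr(2) bM(1) pr(3) bL(2)] pr(1) ord_b by simp
    then have "int e * (X.M.ord \<alpha> + int l) = 0" by (simp add: algebra_simps)
    then show ?thesis using e_pos by simp
  qed
  \<comment> \<open>The second norm equation loses the common factor \<open>fW * e\<close>; what
    remains is the Hasse invariant \<open>r / m\<close> as a fraction with denominator
    \<open>d\<close>.\<close>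
  have valuations: "int d * r = int m * (int f0 * a + int (i0 * l))"
  proof -
    note pr = ord_prod'[OF \<Phi>'(1) \<Phi>K[OF piK] \<beta>, of N]
    have "X.M.ord ((\<Prod>k<N. (\<Phi>' ^^ k) \<beta>) * b ^ kA) = int N * a + int kA * int (e * l)"
      using X.M.ord_mult[OF pr(2) X.M.power_closed[OF bM(1)] pr(3)] bL(2) bM X.M.ord_power pr(1) ord_b by (simp add: a_def)
    moreover have "X.M.ord (c ^ (d * fW)) = int (d * fW) * (int e * r)" using X.M.ord_power bM c ord_c by simp
    ultimately have "int N * a + int kA * int (e * l) = int (d * fW) * (int e * r)" using eq2 by (simp add: b_def)
    then have "int (fW * e) * (int m * (int f0 * a + int (i0 * l))) = int (fW * e) * (int d * r)"
      by (simp add: N_def kA_def d_eq algebra_simps)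
    then show ?thesis using W(1) e_pos by (simp only: mult_cancel_left) auto
  qed
  obtain s where s: "s \<in> X.M.\<U>" "\<alpha> = lam powi (- int l) * s" using X.M.ord_decomp[OF \<alpha>] unfolding ord_\<alpha> by blast
  obtain t where t: "t \<in> X.M.\<U>" "\<beta> = lam powi a * t" using X.M.ord_decomp[OF \<beta>] unfolding a_def by blast
  have \<alpha>s: "\<alpha> = s / lam ^ l" using s(2) by (simp add: power_int_minus divide_inverse mult.commute)
  have st: "s \<in> X.OM" "t \<in> X.OM" "s \<in> X.M" "t \<in> X.M" "s \<noteq> 0" "t \<noteq> 0"
    using X.M.U_O[OF s(1)] X.M.U_O[OF t(1)] X.M.U_nz[OF s(1)] X.M.U_nz[OF t(1)] X.M.O_sub by auto
  have lamM: "lam \<in> X.M" using lam_L LM by auto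
  have \<iota>'s: "X.M.cg 1 ((\<iota>' ^^ k) s) s \<and> (\<iota>' ^^ k) s \<in> X.OM" for k
  proof (induction k)
    case (Suc k)
    then show ?case using X.M.cg_trans[OF \<iota>'(5)] \<iota>'(4) by simp
  qed (use st in simp)
  define S where "S = (\<Prod>k<e. (\<iota>' ^^ k) s)"
  \<comment> \<open>Inertia acts trivially on residues, so the norm of \<open>s\<close> is congruent
    to \<open>s^e\<close>.\<close>
  have Sc: "X.M.cg 1 S (\<Prod>k<e. s)" unfolding S_def by (intro X.M.cg_prod) (use \<iota>'s st in auto)
  have "S * b = (\<epsilon> * \<tau>) ^ l * \<pi> ^ l"
  proof -
    have "(\<iota>' ^^ k) \<alpha> = (\<iota>' ^^ k) s / (\<zeta> ^ k * lam) ^ l" for k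
    proof -
      interpret ik: fld_endo X.M "\<iota>' ^^ k" by (rule \<iota>'.fld_endo_funpow)
      show ?thesis unfolding \<alpha>s using st lamM \<iota>'L[OF lam_L, of k]
        by (simp add: ik.endo_divide ik.endo_power X.M.power_closed \<iota>_funpow_lam)
    qed
    then have "(\<Prod>k<e. (\<iota>' ^^ k) \<alpha>) = S / ((\<Prod>k<e. \<zeta> ^ k) * lam ^ e) ^ l"
      by (simp add: S_def prod_dividef prod_power_distrib[symmetric] prod.distrib)
    also have "\<dots> = S / ((\<epsilon> * \<tau>) ^ l * \<pi> ^ l)" unfolding \<epsilon>_def[symmetric] lam_e by (simp add: power_mult_distrib mult_ac)
    finally have "S / ((\<epsilon> * \<tau>) ^ l * \<pi> ^ l) * b = 1" using eq1 by (simp add: b_def)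
    then show ?thesis using \<epsilon>_nz \<tau>(3) KA.pi_nz by (simp add: divide_simps split: if_splits)
  qed
  then have S: "S = (\<epsilon> * \<tau>) ^ l / u" unfolding b_def using KA.pi_nz uL by (simp add: divide_simps)
  have eq3': "\<zeta> powi a * \<omega> ^ l * (\<iota>' t * s) = \<Phi>' s * t"
  proof -
    have "\<iota>' \<beta> = (\<zeta> * lam) powi a * \<iota>' t"
      unfolding t(2) using st lamM \<iota>'(2)[OF lam_L] by (simp add: \<iota>'.endo_mult \<iota>'.endo_power_int X.M.power_int_closed \<iota>_lam)
    moreover have "\<Phi>' \<alpha> = \<Phi>' s / (\<omega> * lam) ^ l"
      unfolding \<alpha>s using st lamM \<Phi>'(2)[OF lam_L] by (simp add: \<Phi>'.endo_divide \<Phi>'.endo_power X.M.power_closed \<Phi>_lam)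
    ultimately have "(\<zeta> * lam) powi a * \<iota>' t * (s / lam ^ l) = \<Phi>' s / (\<omega> * lam) ^ l * (lam powi a * t)"
      using eq3 unfolding \<alpha>s t(2) by simp
    then have "(\<zeta> powi a * \<iota>' t * s) * (lam powi a / lam ^ l) = (\<Phi>' s * t / \<omega> ^ l) * (lam powi a / lam ^ l)"
      by (simp add: power_int_mult_distrib power_mult_distrib mult_ac divide_inverse)
    moreover have "lam powi a / lam ^ l \<noteq> 0" using pi_nz by simp
    ultimately have "\<zeta> powi a * \<iota>' t * s = \<Phi>' s * t / \<omega> ^ l" using mult_right_cancel by blast
    then show ?thesis using \<omega>_nz by (simp add: field_simps)
  qed
  \<comment> \<open>The order of \<beta> may be negative; modulo \<open>e\<close> it becomes the
    exponent of an iterate of \<iota>.\<close>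
  define a' where "a' = nat (a mod int e)"
  define z where "z = \<zeta> ^ a' * \<omega> ^ l"
  have zO: "z \<in> \<O>" unfolding z_def by (intro O_mult O_power \<zeta>_O U_O[OF \<omega>_U])
  have zOM: "z \<in> X.OM" using zO X.O_sub_OM by auto
  define R where "R = ((\<epsilon> * \<tau>) ^ l / u) ^ g"
  have RO: "R \<in> \<O>" unfolding R_def divide_inverse
    by (intro O_power O_mult U_O[OF U_inverse[OF uU]] U_O[OF \<tau>_U] U_O[OF \<epsilon>_U])
  have "X.M.cg 1 z R"
  proof -
    have SO: "S \<in> X.OM" unfolding S_def by (intro X.M.O_prod) (use \<iota>'s in auto)
    have sQ: "s ^ Q = s * (s ^ e) ^ g" using eg KA.P_gt_1 by (cases Q) (auto simp: power_mult[symmetric])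
    have "X.M.cg 1 (z * (t * s)) (z * (\<iota>' t * s))"
      by (intro X.M.cg_mult[OF X.M.cg_refl] X.M.cg_mult[OF _ X.M.cg_refl] X.M.cg_sym[OF \<iota>'(5)] X.M.O_mult zOM st \<iota>'(4))
    also have "z * (\<iota>' t * s) = \<Phi>' s * t" using eq3' unfolding z_def a'_def \<zeta>_power_int[symmetric] .
    also have "X.M.cg 1 (\<Phi>' s * t) (s ^ Q * t)" by (intro X.M.cg_mult \<Phi>'(4,5) st X.M.cg_refl)
    also have "s ^ Q * t = (t * s) * (s ^ e) ^ g" unfolding sQ by simp
    finally have "X.M.cg 1 ((t * s) * z) ((t * s) * (s ^ e) ^ g)" by (simp only: mult.commute[of z])
    then have "X.M.cg 1 z ((s ^ e) ^ g)" by (rule X.M.cg_cancel[OF X.M.U_mult[OF t(1) s(1)]])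
    also have "X.M.cg 1 ((s ^ e) ^ g) (S ^ g)"
      using Sc SO st by (intro X.M.cg_power X.M.O_power) (auto intro: X.M.cg_sym)
    finally show ?thesis unfolding R_def S .
  qed
  then obtain y where y: "y \<in> X.OM" "z - R = lam * y" by (auto simp: X.M.cg_def)
  have "y = (z - R) / lam" using y(2) pi_nz by simp
  \<comment> \<open>The congruence was proved over \<open>M\<close>, but both sides lie in
    \<open>L\<close>; the quotient is then integral over \<open>M\<close> and in \<open>L\<close>,
    so it belongs to \<open>\<O>\<close>.\<close>
  then have "y \<in> L" using zO RO O_sub lam_L by (auto intro!: divide_closed diff_closed)
  then have "y \<in> \<O>" by (rule X.OM_inter_F[OF y(1)])
  then have key: "cg 1 (\<zeta> ^ a' * \<omega> ^ l) (((\<epsilon> * \<tau>) ^ l / u) ^ g)"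
    using y(2) unfolding z_def R_def by (auto simp: cg_def)
  define n where "n = f0 * a' + i0 * l"
  have \<sigma>n: "(\<sigma> ^^ n) \<beta> = (\<iota> ^^ a') ((\<Phi> ^^ l) \<beta>)" for \<beta>
    unfolding n_def \<iota>_funpow \<Phi>_def funpow_mult funpow_add by (simp add: mult.commute)
  \<comment> \<open>The integer by which \<open>r / m\<close> exceeds \<open>n / d\<close>; it comes
    from reducing \<open>a\<close> modulo \<open>e\<close>.\<close>
  define q where "q = a div int e"
  have aq: "a = int e * q + int a'" using e_pos by (simp add: a'_def q_def)
  have "int f0 * (int e * q + int a') + int (i0 * l) = int d * q + int n"
    by (simp add: n_def d_eq algebra_simps)
  then have "int d * r = int m * (int d * q + int n)" using valuations unfolding aq by simp
  moreover have "\<forall>\<beta>\<in>L - {0}. cg 1 ((\<sigma> ^^ n) \<beta> / \<beta>)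
    (\<beta> ^ (Q ^ l - 1) / ((\<epsilon> * \<pi>) powi (int (g * (\<Sum>i<l. Q ^ i)) * ord \<beta>) * u powi (int g * ord \<beta>)))"
    unfolding \<sigma>n using evaluation[OF uU key] by blast
  ultimately show ?thesis by blast
qed

end

section \<open>Brauer equivalence and ramification\<close>

lemma brauer_equivalent_csa_iso:
  assumes A: "cyc K E \<sigma> d b \<gamma>" and B: "cyc K W \<phi> m c \<omega>"
    and br: "brauer_equivalent K (cyclic_algebra E \<sigma> d b) (cyclic_algebra W \<phi> m c)"
  shows "\<exists>r s h. csa_iso K E \<sigma> d b \<gamma> r W \<phi> m c \<omega> s h"
proof -
  obtain r s h where r: "r \<ge> 1" and s: "s \<ge> 1"
    and h: "h \<in> ring_iso (matrix_algebra r (cyclic_algebra E \<sigma> d b)) (matrix_algebra s (cyclic_algebra W \<phi> m c))"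
    and sm: "\<And>a x. a \<in> K \<Longrightarrow> x \<in> carrier (matrix_algebra r (cyclic_algebra E \<sigma> d b)) \<Longrightarrow>
      h (a \<odot>\<^bsub>matrix_algebra r (cyclic_algebra E \<sigma> d b)\<^esub> x) = a \<odot>\<^bsub>matrix_algebra s (cyclic_algebra W \<phi> m c)\<^esub> h x"
    using br unfolding brauer_equivalent_def algebra_isomorphic_def by blast
  interpret A: csa K E \<sigma> d b \<gamma> r using A r by (simp add: csa_def csa_axioms_def)
  interpret B: csa K W \<phi> m c \<omega> s using B s by (simp add: csa_def csa_axioms_def)
  have add: "h (N + N') = h N + h N'" if "N \<in> carrier A.RM" "N' \<in> carrier A.RM" for N N'
    using ring_iso_memE(3)[OF h that] unfolding A.add_RM B.add_RM .
  have bij: "bij_betw h (carrier A.RM) (carrier B.RM)" by (rule ring_iso_memE(5)[OF h])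
  have z: "0 \<in> carrier A.RM" by (simp add: A.carrier_RM)
  have h0: "h 0 = 0" using add[OF z z] by (simp only: add_0_left add_cancel_right_right)
  have "csa_iso K E \<sigma> d b \<gamma> r W \<phi> m c \<omega> s h"
  proof
    show "h N \<in> carrier B.RM" if "N \<in> carrier A.RM" for N by (rule ring_iso_memE(1)[OF h that])
    show "h (N \<otimes>\<^bsub>A.RM\<^esub> N') = h N \<otimes>\<^bsub>B.RM\<^esub> h N'" if "N \<in> carrier A.RM" "N' \<in> carrier A.RM" for N N'
      by (rule ring_iso_memE(2)[OF h that])
    show "h (a \<odot>\<^bsub>A.RM\<^esub> N) = a \<odot>\<^bsub>B.RM\<^esub> h N" if "a \<in> K" "N \<in> carrier A.RM" for a N by (rule sm[OF that])
    show "N = 0" if "N \<in> carrier A.RM" "h N = 0" for N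
      by (rule inj_onD[OF bij_betw_imp_inj_on[OF bij] _ that(1) z]) (simp only: that(2) h0)
    show "h ` carrier A.RM = carrier B.RM" using bij by (simp add: bij_betw_def)
    show "inj_on h (carrier A.RM)" using bij by (simp add: bij_betw_def)
  qed (rule add)
  then show ?thesis by blast
qed

lemma Ints_coset_eq: "(\<lambda>n. a + n) ` \<int> = (\<lambda>n. b + n) ` \<int> \<longleftrightarrow> a - b \<in> \<int>" for a b :: "'a::ring_1"
proof
  assume "(\<lambda>n. a + n) ` \<int> = (\<lambda>n. b + n) ` \<int>"
  moreover have "a \<in> (\<lambda>n. a + n) ` \<int>" by (rule image_eqI[of _ _ 0]) auto
  ultimately show "a - b \<in> \<int>" by auto
next
  have "(\<lambda>n. a + n) ` \<int> \<subseteq> (\<lambda>n. b + n) ` \<int>" if "a - b \<in> \<int>" for a b :: 'a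
  proof (rule image_subsetI)
    fix n :: 'a assume "n \<in> \<int>"
    then show "a + n \<in> (\<lambda>n. b + n) ` \<int>" 
      using that by (intro image_eqI[of _ _ "(a - b) + n"] Ints_add) simp_all
  qed
  moreover assume "a - b \<in> \<int>"
  moreover from this have "b - a \<in> \<int>" by (metis Ints_minus minus_diff_eq)
  ultimately show "(\<lambda>n. a + n) ` \<int> = (\<lambda>n. b + n) ` \<int>" by (intro equalityI)
qed

text \<open>Since \<open>v \<pi> = 1\<close> is an integral multiple \<open>E\<close> of
  \<open>v lam\<close>, the value group consists of the multiples of \<open>1/E\<close>, with the
  cosets of \<open>i/E\<close> for \<open>i < E\<close> modulo the integers.\<close>

lemma ramification_index_uniformiser:
  assumes V: "valued L v" and K: "value_group K v = \<int>" and \<pi>: "\<pi> \<in> L" "\<pi> \<noteq> 0" "v \<pi> = 1" and lam: "uniformiser L v lam"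
  shows "1 \<le> ramification_index K L v" "v lam = 1 / of_nat (ramification_index K L v)"
proof -
  interpret valued L v by (rule V)
  have l: "lam \<in> L" "lam \<noteq> 0" "0 < v lam" using lam by (auto simp: uniformiser_def)
  obtain k where k: "1 = of_int k * v lam" using uniformiser_multiple[OF lam \<pi>(1,2)] \<pi>(3) by auto
  have "0 < k" using k l(3) by (metis of_int_0_less_iff zero_less_mult_pos2 zero_less_one)
  then obtain E where E: "k = int E" "0 < E" by (metis pos_int_cases)
  have vl: "v lam = 1 / of_nat E" using k E by (simp add: field_simps)
  define C where "C a = (\<lambda>b. a + b) ` (\<int> :: rat set)" for a
  have C: "C a = C b \<longleftrightarrow> a - b \<in> \<int>" for a b unfolding C_def by (rule Ints_coset_eq)
  have vg: "value_group L v = range (\<lambda>k::int. of_int k / of_nat E)"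
  proof (intro equalityI subsetI)
    fix x assume "x \<in> value_group L v"
    then obtain y where "y \<in> L" "y \<noteq> 0" "x = v y" by (auto simp: value_group_def)
    then show "x \<in> range (\<lambda>k::int. of_int k / of_nat E)" using uniformiser_multiple[OF lam, of y] vl by auto
  next
    fix x assume "x \<in> range (\<lambda>k::int. of_int k / (of_nat E :: rat))"
    then obtain j :: int where "x = of_int j / of_nat E" by blast
    then have "x = v (lam powi j)" using l vl by (simp add: v_power_int)
    then show "x \<in> value_group L v" unfolding value_group_def using l by (auto intro!: imageI power_int_closed)
  qed
  have "C ` value_group L v = (\<lambda>k. C (of_nat k / of_nat E)) ` {..<E}"
  proof (intro equalityI subsetI)
    fix Z assume "Z \<in> C ` value_group L v"
    then obtain j :: int where j: "Z = C (of_int j / of_nat E)" unfolding vg by blast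
    define i where "i = nat (j mod int E)"
    define y where "y = j div int E"
    have jy: "j = int E * y + int i" using E by (simp add: i_def y_def)
    have "(of_int j / of_nat E - of_nat i / of_nat E :: rat) = of_int y" unfolding jy using E by (simp add: add_divide_distrib)
    then have "Z = C (of_nat i / of_nat E)" unfolding j C by (simp only: Ints_of_int)
    moreover have "i < E" using E by (simp add: i_def nat_less_iff)
    ultimately show "Z \<in> (\<lambda>k. C (of_nat k / of_nat E)) ` {..<E}" by blast
  next
    fix Z assume "Z \<in> (\<lambda>k. C (of_nat k / of_nat E)) ` {..<E}"
    then obtain i where "Z = C (of_nat i / of_nat E)" by blast
    moreover have "of_nat i / of_nat E \<in> value_group L v" unfolding vg by (auto intro: range_eqI[of _ _ "int i"])
    ultimately show "Z \<in> C ` value_group L v" by blast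
  qed
  moreover have "inj_on (\<lambda>k. C (of_nat k / of_nat E)) {..<E}"
  proof (rule inj_onI)
    fix i j assume ij: "i \<in> {..<E}" "j \<in> {..<E}" "C (of_nat i / of_nat E) = C (of_nat j / of_nat E)"
    then obtain z :: int where "(of_nat i / of_nat E - of_nat j / of_nat E :: rat) = of_int z" unfolding C by (auto elim: Ints_cases)
    then have "(of_int (int i - int j) :: rat) = of_int (int E * z)" using E by (simp add: field_simps)
    then have "int i - int j = int E * z" by (simp only: of_int_eq_iff)
    moreover have "\<bar>int i - int j\<bar> < int E" using ij by auto
    ultimately have "int E * \<bar>z\<bar> < int E * 1" by (simp add: abs_mult)
    then have "\<bar>z\<bar> < 1" using mult_less_cancel_left_pos[of "int E" "\<bar>z\<bar>" 1] E by simp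
    then have "z = 0" by simp
    then show "i = j" using \<open>int i - int j = int E * z\<close> by simp
  qed
  ultimately have "ramification_index K L v = E"
    unfolding ramification_index_def K C_def[symmetric, abs_def] by (simp add: card_image)
  then show "1 \<le> ramification_index K L v" "v lam = 1 / of_nat (ramification_index K L v)" using E vl by auto
qed

section \<open>Galois groups and characters\<close>

lemma QZ_class_eq: "QZ_class a = QZ_class b \<longleftrightarrow> a - b \<in> \<int>"
proof -
  have "QZ_class a = (\<lambda>n. a + n) ` \<int>" for a
    unfolding QZ_class_def r_coset_def rat_add_group_def by (auto simp: add.commute)
  then show ?thesis by (simp only: Ints_coset_eq)
qed

lemma QZ_class_carrier: "QZ_class a \<in> carrier QZ"
  by (auto simp: QZ_def FactGroup_def RCOSETS_def QZ_class_def rat_add_group_def)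

lemma QZ_one: "\<one>\<^bsub>QZ\<^esub> = QZ_class 0"
  by (auto simp: QZ_def FactGroup_def QZ_class_def r_coset_def rat_add_group_def)

lemma QZ_mult: "QZ_class a \<otimes>\<^bsub>QZ\<^esub> QZ_class b = QZ_class (a + b)"
proof -
  have "comm_group rat_add_group"
    by (rule comm_groupI) (auto simp: rat_add_group_def intro: exI[of _ "- _"])
  then interpret comm_group rat_add_group .
  have inv: "inv\<^bsub>rat_add_group\<^esub> x = - x" for x
    by (rule inv_equality) (auto simp: rat_add_group_def)
  have "subgroup \<int> rat_add_group"
    by unfold_locales (auto simp: inv, auto simp: rat_add_group_def)
  then interpret normal "\<int>" rat_add_group by (rule subgroup_imp_normal)
  show ?thesis unfolding QZ_def QZ_class_def FactGroup_def
    using rcos_sum[of a b] by (simp add: rat_add_group_def)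
qed

lemma fld_endo_cong: "fld_endo F f \<Longrightarrow> (\<And>x. x \<in> F \<Longrightarrow> f' x = f x) \<Longrightarrow> fld_endo F f'"
  by (simp add: fld_endo_def fld_endo_axioms_def subfld_def)

lemma galois_group_iff:
  assumes "subfld L"
  shows "s \<in> carrier (galois_group L K) \<longleftrightarrow> fld_endo L s \<and> s ` L = L \<and> s \<in> extensional L \<and> (\<forall>x\<in>K. s x = x)"
proof
  assume s: "s \<in> carrier (galois_group L K)"
  have "bij_betw s L L" using s by (auto simp: galois_group_def dest: ring_iso_memE(5))
  then show "fld_endo L s \<and> s ` L = L \<and> s \<in> extensional L \<and> (\<forall>x\<in>K. s x = x)"
    using galois_group_endo[OF s assms] by (auto simp: bij_betw_def)
next
  assume s: "fld_endo L s \<and> s ` L = L \<and> s \<in> extensional L \<and> (\<forall>x\<in>K. s x = x)"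
  then interpret s: fld_endo L s by blast
  have "s \<in> ring_iso (ring_on L) (ring_on L)"
    using s s.endo_inj
    by (intro ring_iso_memI) (auto simp: ambient_simps s.endo_closed s.endo_add s.endo_mult s.endo_one bij_betw_def)
  then show "s \<in> carrier (galois_group L K)" using s by (simp add: galois_group_def)
qed

lemma galois_group_is_group:
  assumes L: "subfld L" and K: "K \<subseteq> L"
  shows "group (galois_group L K)"
proof -
  interpret subfld L by (rule L)
  note iff = galois_group_iff[OF L]
  have mult: "s \<otimes>\<^bsub>galois_group L K\<^esub> s' = compose L s s'" and one: "\<one>\<^bsub>galois_group L K\<^esub> = (\<lambda>x\<in>L. x)" for s s'
    by (simp_all add: galois_group_def)
  show ?thesis
  proof (rule groupI)
    show "\<one>\<^bsub>galois_group L K\<^esub> \<in> carrier (galois_group L K)"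
      unfolding one iff using K fld_endo_cong[OF fld_endo_id[OF L], of "\<lambda>x\<in>L. x"] by auto
    show "s \<otimes>\<^bsub>galois_group L K\<^esub> s' \<in> carrier (galois_group L K)"
      if s: "s \<in> carrier (galois_group L K)" "s' \<in> carrier (galois_group L K)" for s s'
    proof -
      have es: "fld_endo L s" "fld_endo L s'" using s iff by blast+
      have "fld_endo L (compose L s s')"
        by (rule fld_endo_cong[OF fld_endo_comp[OF es]]) (simp add: compose_def)
      moreover have "compose L s s' ` L = s ` s' ` L" unfolding image_image by (intro image_cong) (auto simp: compose_def)
      then have "compose L s s' ` L = L" using s unfolding iff by simp
      ultimately show ?thesis using s K unfolding mult iff by (auto simp: compose_def)
    qed
    show "x \<otimes>\<^bsub>galois_group L K\<^esub> y \<otimes>\<^bsub>galois_group L K\<^esub> z = x \<otimes>\<^bsub>galois_group L K\<^esub> (y \<otimes>\<^bsub>galois_group L K\<^esub> z)"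
      if "x \<in> carrier (galois_group L K)" "y \<in> carrier (galois_group L K)" "z \<in> carrier (galois_group L K)" for x y z
      using that unfolding mult iff by (auto simp: compose_def fun_eq_iff)
    show "\<one>\<^bsub>galois_group L K\<^esub> \<otimes>\<^bsub>galois_group L K\<^esub> s = s" if "s \<in> carrier (galois_group L K)" for s
      using that unfolding mult one iff by (auto simp: compose_def fun_eq_iff extensional_def)
    show "\<exists>s'\<in>carrier (galois_group L K). s' \<otimes>\<^bsub>galois_group L K\<^esub> s = \<one>\<^bsub>galois_group L K\<^esub>"
      if s: "s \<in> carrier (galois_group L K)" for s
    proof
      interpret s: fld_endo L s using s iff by blast
      have sL: "s ` L = L" using s iff by blast
      define s' where "s' = (\<lambda>x\<in>L. inv_into L s x)"
      have s's: "s' (s x) = x" if "x \<in> L" for x using that s.endo_inj s.endo_closed by (simp add: s'_def)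
      have eq: "s' y = x" if "x \<in> L" "y = s x" for x y using s's that by simp
      have ex: "\<exists>x\<in>L. y = s x" if "y \<in> L" for y using that sL by blast
      have "fld_endo L s'"
      proof
        show "s' y \<in> L" if "y \<in> L" for y using ex[OF that] eq by auto
        show "s' (y + y') = s' y + s' y'" "s' (y * y') = s' y * s' y'" if y: "y \<in> L" "y' \<in> L" for y y'
        proof -
          obtain x x' where x: "x \<in> L" "y = s x" "x' \<in> L" "y' = s x'" using ex[OF y(1)] ex[OF y(2)] by blast
          have "s' (y + y') = x + x'" using x by (intro eq) (auto simp: s.endo_add add_closed)
          then show "s' (y + y') = s' y + s' y'" using eq x by simp
          have "s' (y * y') = x * x'" using x by (intro eq) (auto simp: s.endo_mult mult_closed)
          then show "s' (y * y') = s' y * s' y'" using eq x by simp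
        qed
        show "s' 1 = 1" using eq[of 1 1] s.endo_one by simp
      qed
      moreover have "s' ` L = L"
      proof
        show "s' ` L \<subseteq> L" using ex eq by fastforce
        show "L \<subseteq> s' ` L"
        proof
          fix x assume "x \<in> L"
          then show "x \<in> s' ` L" using s's s.endo_closed by (intro image_eqI[of _ _ "s x"]) auto
        qed
      qed
      moreover have "s' x = x" if "x \<in> K" for x using eq[of x x] that K s unfolding iff by auto
      ultimately show "s' \<in> carrier (galois_group L K)" unfolding iff by (simp add: s'_def)
      show "s' \<otimes>\<^bsub>galois_group L K\<^esub> s = \<one>\<^bsub>galois_group L K\<^esub>"
        unfolding mult one using s's by (auto simp: compose_def fun_eq_iff)
    qed
  qed
qed

text \<open>The orbit stays among at most \<open>D\<close> roots and \<open>f\<close> is injective,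
  so there is a period of at most \<open>D\<close>. The factorial makes the exponent independent of
  \<open>x\<close>.\<close>

lemma (in fld_endo) finite_order:
  assumes K: "K \<subseteq> F" "\<And>x. x \<in> K \<Longrightarrow> f x = x"
    and x: "x \<in> F" and q: "q \<in> polys_over K" "q \<noteq> 0" "Polynomial.degree q \<le> D" "poly q x = 0"
  shows "(f ^^ fact D) x = x"
proof -
  have qF: "q \<in> polys_over F" using q(1) K(1) by (auto simp: polys_over_def)
  define R where "R = {y. poly q y = 0}"
  have R: "finite R" "card R \<le> D" unfolding R_def
    using poly_roots_finite[OF q(2)] card_poly_roots_bound[OF q(2)] q(3) by auto
  have orbit: "(f ^^ j) x \<in> R" for j
  proof -
    interpret fj: fld_endo F "f ^^ j" by (rule fld_endo_funpow)
    have fK: "(f ^^ j) a = a" if "a \<in> K" for a using that K(2) by (induction j) auto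
    have "map_poly (f ^^ j) q = q" using q(1)
      by (intro poly_eqI) (auto simp: coeff_map_poly fj.endo_zero polys_over_def fK)
    then show ?thesis using fj.poly_map_poly[OF qF x] q(4) by (simp add: R_def fj.endo_zero)
  qed
  have "\<not> inj_on (\<lambda>j. (f ^^ j) x) {..D}"
  proof
    assume "inj_on (\<lambda>j. (f ^^ j) x) {..D}"
    then have "card {..D} \<le> card R" using orbit R(1) by (intro card_inj_on_le) auto
    then show False using R(2) by simp
  qed
  then obtain i j where ij: "i < j" "j \<le> D" "(f ^^ i) x = (f ^^ j) x"
    unfolding inj_on_def by (metis atMost_iff linorder_neqE_nat)
  have "(f ^^ j) x = (f ^^ i) ((f ^^ (j - i)) x)"
    using ij by (simp flip: funpow_add[THEN fun_cong, simplified comp_apply])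
  then have "(f ^^ (j - i)) x = x"
    using inj_onD[OF fld_endo.endo_inj[OF fld_endo_funpow[of i]], of x "(f ^^ (j - i)) x"] ij x funpow_closed by simp
  moreover have "j - i dvd fact D" using ij by (intro dvd_fact) auto
  then obtain k where "fact D = (j - i) * k" by (elim dvdE)
  ultimately show ?thesis by (simp add: funpow_multiple)
qed

lemma of_nat_div_diff_Ints:
  assumes "0 < d"
  shows "(of_nat i / of_nat d - of_nat j / of_nat d :: rat) \<in> \<int> \<longleftrightarrow> i mod d = j mod d"
proof -
  have "(of_nat i / of_nat d - of_nat j / of_nat d :: rat) \<in> \<int> \<longleftrightarrow> (\<exists>z. int i - int j = int d * z)"
  proof
    assume "(of_nat i / of_nat d - of_nat j / of_nat d :: rat) \<in> \<int>"
    then obtain z where "(of_nat i / of_nat d - of_nat j / of_nat d :: rat) = of_int z" by (elim Ints_cases)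
    then have "(of_int (int i - int j) :: rat) = of_int (int d * z)" using assms by (simp add: field_simps)
    then have "int i - int j = int d * z" by (simp only: of_int_eq_iff)
    then show "\<exists>z. int i - int j = int d * z" by blast
  next
    assume "\<exists>z. int i - int j = int d * z"
    then obtain z where "int i - int j = int d * z" by blast
    then have "(of_int (int i - int j) :: rat) = of_int (int d * z)" by (simp only:)
    then have z: "(of_nat i - of_nat j :: rat) = of_nat d * of_int z" by simp
    have "(of_nat i / of_nat d - of_nat j / of_nat d :: rat) = of_int z"
      unfolding diff_divide_distrib[symmetric] z using assms by simp
    then show "(of_nat i / of_nat d - of_nat j / of_nat d :: rat) \<in> \<int>" by (simp only: Ints_of_int)
  qed
  also have "\<dots> \<longleftrightarrow> int i mod int d = int j mod int d" unfolding mod_eq_dvd_iff dvd_def ..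
  finally show ?thesis by (simp only: of_nat_mod[symmetric] of_nat_eq_iff)
qed

locale galois_cyclic = subfld L for L :: "'a::alg_closed_field set" +
  fixes K :: "'a set" and \<sigma> :: "'a \<Rightarrow> 'a" and d :: nat
  assumes K_sub: "K \<subseteq> L" and \<sigma>_G: "\<sigma> \<in> carrier (galois_group L K)"
    and d_pos: "0 < d" and \<sigma>_d: "x \<in> L \<Longrightarrow> (\<sigma> ^^ d) x = x"
    and \<sigma>_min: "0 < j \<Longrightarrow> j < d \<Longrightarrow> \<exists>x\<in>L. (\<sigma> ^^ j) x \<noteq> x"
    and carrier_G: "carrier (galois_group L K) = range (\<lambda>j. restrict (\<sigma> ^^ j) L)"
begin

sublocale fld_endo L \<sigma>
  by (rule galois_group_endo[OF \<sigma>_G subfld_axioms])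

lemma funpow_mod: "x \<in> L \<Longrightarrow> (\<sigma> ^^ (n mod d)) x = (\<sigma> ^^ n) x"
proof -
  assume x: "x \<in> L"
  have "(\<sigma> ^^ n) x = (\<sigma> ^^ (n mod d + d * (n div d))) x" by simp
  also have "\<dots> = (\<sigma> ^^ (n mod d)) x" unfolding funpow_add using funpow_multiple[OF \<sigma>_d[OF x]] by simp
  finally show ?thesis by simp
qed

lemma restrict_eq: "restrict (\<sigma> ^^ i) L = restrict (\<sigma> ^^ j) L \<longleftrightarrow> i mod d = j mod d"
proof
  assume "i mod d = j mod d"
  then show "restrict (\<sigma> ^^ i) L = restrict (\<sigma> ^^ j) L" using funpow_mod by (intro restrict_ext) metis
next
  assume "restrict (\<sigma> ^^ i) L = restrict (\<sigma> ^^ j) L"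
  then have eq: "(\<sigma> ^^ (i mod d)) x = (\<sigma> ^^ (j mod d)) x" if "x \<in> L" for x
    using that funpow_mod by (metis restrict_apply')
  have main: "\<not> a < b" if ab: "b < d" "\<And>x. x \<in> L \<Longrightarrow> (\<sigma> ^^ a) x = (\<sigma> ^^ b) x" for a b
  proof
    assume l: "a < b"
    have "(\<sigma> ^^ (b - a)) x = x" if x: "x \<in> L" for x
    proof -
      have "(\<sigma> ^^ b) x = (\<sigma> ^^ a) ((\<sigma> ^^ (b - a)) x)"
        using l by (simp flip: funpow_add[THEN fun_cong, simplified comp_apply])
      then show ?thesis
        using inj_onD[OF fld_endo.endo_inj[OF fld_endo_funpow[of a]], of x "(\<sigma> ^^ (b - a)) x"] ab(2)[OF x] x funpow_closed by simp
    qed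
    moreover have "0 < b - a" "b - a < d" using l ab(1) by auto
    ultimately show False using \<sigma>_min[of "b - a"] by blast
  qed
  have "\<not> i mod d < j mod d" by (rule main) (use eq d_pos in auto)
  moreover have "\<not> j mod d < i mod d" by (rule main) (use eq d_pos in auto)
  ultimately show "i mod d = j mod d" by simp
qed

text \<open>The faithful character with value \<open>1/d\<close> at the generator. The exponent
  selected by \<open>SOME\<close> is determined only modulo \<open>d\<close>, which does not affect
  its class.\<close>

definition \<chi> :: "('a \<Rightarrow> 'a) \<Rightarrow> rat set"
  where "\<chi> s = QZ_class (of_nat (SOME j. s = restrict (\<sigma> ^^ j) L) / of_nat d)"

lemma chi: "\<chi> (restrict (\<sigma> ^^ j) L) = QZ_class (of_nat j / of_nat d)"
proof -
  define i where "i = (SOME i. restrict (\<sigma> ^^ j) L = restrict (\<sigma> ^^ i) L)"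
  have "restrict (\<sigma> ^^ j) L = restrict (\<sigma> ^^ i) L" unfolding i_def by (rule someI[of _ j]) (rule refl)
  then have "i mod d = j mod d" using restrict_eq by metis
  then show ?thesis unfolding \<chi>_def i_def[symmetric] QZ_class_eq of_nat_div_diff_Ints[OF d_pos] .
qed

lemma chi_eq: "\<chi> (restrict (\<sigma> ^^ i) L) = \<chi> (restrict (\<sigma> ^^ j) L) \<longleftrightarrow> i mod d = j mod d"
  unfolding chi QZ_class_eq by (rule of_nat_div_diff_Ints[OF d_pos])

lemma chi_hom: "\<chi> \<in> hom (galois_group L K) QZ"
proof (rule homI)
  show "\<chi> s \<in> carrier QZ" for s unfolding \<chi>_def by (rule QZ_class_carrier)
  fix s s' assume "s \<in> carrier (galois_group L K)" "s' \<in> carrier (galois_group L K)"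
  then obtain i j where ij: "s = restrict (\<sigma> ^^ i) L" "s' = restrict (\<sigma> ^^ j) L" unfolding carrier_G by blast
  have "s \<otimes>\<^bsub>galois_group L K\<^esub> s' = compose L s s'" by (simp add: galois_group_def)
  also have "\<dots> = restrict (\<sigma> ^^ (i + j)) L"
    unfolding ij by (auto simp: compose_def fun_eq_iff funpow_add funpow_closed)
  finally show "\<chi> (s \<otimes>\<^bsub>galois_group L K\<^esub> s') = \<chi> s \<otimes>\<^bsub>QZ\<^esub> \<chi> s'"
    unfolding ij chi QZ_mult by (simp add: chi add_divide_distrib)
qed

text \<open>Faithfulness makes the kernel trivial, so that its fixed field is \<open>L\<close>, and
  leaves \<sigma> as the only automorphism with value \<open>1/d\<close>.\<close>

lemma character_algebra_chi: "character_algebra K L \<chi> b = cyclic_algebra L \<sigma> d b"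
proof -
  have "\<chi> ` carrier (galois_group L K) = (\<lambda>j. \<chi> (restrict (\<sigma> ^^ j) L)) ` {..<d}"
  proof (intro equalityI subsetI)
    fix c assume "c \<in> \<chi> ` carrier (galois_group L K)"
    then obtain j where "c = \<chi> (restrict (\<sigma> ^^ j) L)" unfolding carrier_G by blast
    also have "\<dots> = \<chi> (restrict (\<sigma> ^^ (j mod d)) L)" unfolding chi_eq by simp
    finally show "c \<in> (\<lambda>j. \<chi> (restrict (\<sigma> ^^ j) L)) ` {..<d}" using d_pos by auto
  qed (auto simp: carrier_G)
  moreover have "inj_on (\<lambda>j. \<chi> (restrict (\<sigma> ^^ j) L)) {..<d}" by (rule inj_onI) (auto simp: chi_eq)
  ultimately have card: "card (\<chi> ` carrier (galois_group L K)) = d" by (simp add: card_image)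
  have "kernel (galois_group L K) QZ \<chi> \<subseteq> {restrict (\<sigma> ^^ 0) L}"
  proof
    fix s assume "s \<in> kernel (galois_group L K) QZ \<chi>"
    then obtain j where j: "s = restrict (\<sigma> ^^ j) L" "\<chi> s = QZ_class 0" by (auto simp: kernel_def carrier_G QZ_one)
    then have "\<chi> (restrict (\<sigma> ^^ j) L) = \<chi> (restrict (\<sigma> ^^ 0) L)" by (simp add: chi del: funpow.simps)
    then show "s \<in> {restrict (\<sigma> ^^ 0) L}" unfolding j(1) chi_eq restrict_eq[symmetric] by simp
  qed
  then have fixed: "fixed_field L (kernel (galois_group L K) QZ \<chi>) = L" by (auto simp: fixed_field_def)
  have ext: "\<sigma> \<in> extensional L" using galois_group_endo[OF \<sigma>_G subfld_axioms] by blast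
  have \<sigma>1: "\<sigma> = restrict (\<sigma> ^^ 1) L" using extensional_restrict[OF ext] by simp
  have "(SOME s. s \<in> carrier (galois_group L K) \<and> \<chi> s = QZ_class (1 / of_nat d)) = \<sigma>"
  proof (rule some_equality)
    have "\<chi> \<sigma> = QZ_class (1 / of_nat d)" using chi[of 1] unfolding \<sigma>1[symmetric] by simp
    then show "\<sigma> \<in> carrier (galois_group L K) \<and> \<chi> \<sigma> = QZ_class (1 / of_nat d)" using \<sigma>_G by blast
    fix s assume s: "s \<in> carrier (galois_group L K) \<and> \<chi> s = QZ_class (1 / of_nat d)"
    then obtain j where j: "s = restrict (\<sigma> ^^ j) L" unfolding carrier_G by blast
    have "\<chi> (restrict (\<sigma> ^^ j) L) = \<chi> (restrict (\<sigma> ^^ 1) L)" using s unfolding j chi by simp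
    then have "restrict (\<sigma> ^^ j) L = restrict (\<sigma> ^^ 1) L" by (simp only: chi_eq restrict_eq)
    then show "s = \<sigma>" unfolding j by (rule trans[OF _ \<sigma>1[symmetric]])
  qed
  then show ?thesis unfolding character_algebra_def Let_def card fixed by (simp add: extensional_restrict[OF ext])
qed

end

text \<open>The uniform degree bound gives the group generator finite order \<open>d\<close>;
  integral powers then reduce to iterates of a function.\<close>

lemma galois_cyclic_exists:
  assumes L: "subfld L" and K: "K \<subseteq> L" and cyc: "cyclic_group (galois_group L K)"
    and alg: "\<And>x. x \<in> L \<Longrightarrow> \<exists>q\<in>polys_over K. q \<noteq> 0 \<and> Polynomial.degree q \<le> D \<and> poly q x = 0"
  shows "\<exists>\<sigma> d. galois_cyclic L K \<sigma> d"
proof -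
  interpret group "galois_group L K" by (rule galois_group_is_group[OF L K])
  obtain \<sigma> where \<sigma>: "\<sigma> \<in> carrier (galois_group L K)"
    and gen: "carrier (galois_group L K) = range (\<lambda>n::int. \<sigma> [^]\<^bsub>galois_group L K\<^esub> n)"
    using cyc unfolding cyclic_group by blast
  interpret s: fld_endo L \<sigma> by (rule galois_group_endo(1)[OF \<sigma> L])
  have \<sigma>K: "\<sigma> x = x" if "x \<in> K" for x using galois_group_endo(2)[OF \<sigma> L that] .
  have pow: "\<sigma> [^]\<^bsub>galois_group L K\<^esub> (n::nat) = restrict (\<sigma> ^^ n) L" for n
  proof (induction n)
    case 0
    show ?case by (auto simp: galois_group_def fun_eq_iff)
  next
    case (Suc n)
    have "\<sigma> [^]\<^bsub>galois_group L K\<^esub> Suc n = compose L (restrict (\<sigma> ^^ n) L) \<sigma>"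
      unfolding nat_pow_Suc Suc by (simp add: galois_group_def)
    also have "\<dots> = restrict (\<sigma> ^^ Suc n) L"
      by (auto simp: compose_def fun_eq_iff s.endo_closed funpow_swap1)
    finally show ?case .
  qed
  define d where "d = (LEAST j. 0 < j \<and> (\<forall>x\<in>L. (\<sigma> ^^ j) x = x))"
  have "0 < (fact D :: nat) \<and> (\<forall>x\<in>L. (\<sigma> ^^ fact D) x = x)"
    using s.finite_order[OF K \<sigma>K] alg by (metis fact_gt_zero)
  from LeastI[of "\<lambda>j. 0 < j \<and> (\<forall>x\<in>L. (\<sigma> ^^ j) x = x)", OF this]
  have d: "0 < d" "\<And>x. x \<in> L \<Longrightarrow> (\<sigma> ^^ d) x = x" by (auto simp: d_def)
  have dl: "\<exists>x\<in>L. (\<sigma> ^^ j) x \<noteq> x" if "0 < j" "j < d" for j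
    using not_less_Least[of j "\<lambda>j. 0 < j \<and> (\<forall>x\<in>L. (\<sigma> ^^ j) x = x)"] that unfolding d_def by blast
  have one: "\<sigma> [^]\<^bsub>galois_group L K\<^esub> (int d) = \<one>\<^bsub>galois_group L K\<^esub>"
    unfolding int_pow_int pow using d(2) by (auto simp: galois_group_def fun_eq_iff)
  have "carrier (galois_group L K) \<subseteq> range (\<lambda>j. restrict (\<sigma> ^^ j) L)"
  proof
    fix s assume "s \<in> carrier (galois_group L K)"
    then obtain k :: int where k: "s = \<sigma> [^]\<^bsub>galois_group L K\<^esub> k" unfolding gen by blast
    define a where "a = k div int d"
    define j where "j = nat (k mod int d)"
    have kj: "k = int d * a + int j" using d(1) by (simp add: a_def j_def)
    have "s = (\<sigma> [^]\<^bsub>galois_group L K\<^esub> (int d)) [^]\<^bsub>galois_group L K\<^esub> a \<otimes>\<^bsub>galois_group L K\<^esub> \<sigma> [^]\<^bsub>galois_group L K\<^esub> (int j)"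
      unfolding k kj int_pow_mult[OF \<sigma>] int_pow_pow[OF \<sigma>] ..
    also have "\<dots> = restrict (\<sigma> ^^ j) L" unfolding one unfolding int_pow_one int_pow_int
      using l_one[OF nat_pow_closed[OF \<sigma>, of j]] unfolding pow .
    finally show "s \<in> range (\<lambda>j. restrict (\<sigma> ^^ j) L)" by blast
  qed
  moreover have "range (\<lambda>j. restrict (\<sigma> ^^ j) L) \<subseteq> carrier (galois_group L K)"
    using \<sigma> by (auto simp flip: pow)
  ultimately have "carrier (galois_group L K) = range (\<lambda>j. restrict (\<sigma> ^^ j) L)" by (rule equalityI)
  then have "galois_cyclic L K \<sigma> d"
    using L K \<sigma> d dl by (intro galois_cyclic.intro galois_cyclic_axioms.intro)
  then show ?thesis by blast
qed

text \<open>The exponents are rational as written, since \<open>v \<beta>\<close> has denominator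
  \<open>e\<close>. They are integers because \<open>e\<close> divides \<open>p^t - 1\<close>; the
  existential integers \<open>a\<close> and \<open>b\<close> express this together with the
  congruence.\<close>

theorem theorem5p1:
  fixes K L :: "'a::alg_closed_field set"
    and v :: "'a \<Rightarrow> rat"
    and \<pi>\<^sub>K \<pi>\<^sub>L :: 'a
    and \<theta> :: "'a \<Rightarrow> 'a \<Rightarrow> 'a"
    and p t q n e :: nat
  assumes "local_field K v"
    and "Factorial_Ring.prime p" and "card (carrier (residue_field K v)) = p ^ t"
    and "Factorial_Ring.prime q" and "q \<noteq> p"
    and "cyclic_extension (q ^ n) K L"
    and "valuation_on L v"
    and "e = ramification_index K L v"
    and "tamely_ramified p K L v"
    and "uniformiser K v \<pi>\<^sub>K" and "uniformiser L v \<pi>\<^sub>L"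
    and "local_reciprocity_map K L v \<theta>"
  shows "\<forall>i::nat. \<forall>u\<in>Units (ring_on (valuation_ring K v)). \<forall>\<beta>\<in>L - {0}.
    \<exists>a b::int.
      of_int a = of_nat (p ^ (t * i) - 1) * v \<beta> \<and>
      of_int b = of_nat (p ^ t - 1) * v \<beta> \<and>
      cong_mod L v \<pi>\<^sub>L
        (\<theta> (u * \<pi>\<^sub>K ^ i) \<beta> / \<beta>)
        (\<beta> ^ (p ^ (t * i) - 1) / (((-1) ^ (e - 1) * \<pi>\<^sub>K) powi a * u powi b))"
proof -
  have ext: "extension_of_degree (q ^ n) K L" and fixed: "fixed_field L (carrier (galois_group L K)) = K"
    and cyclic: "cyclic_group (galois_group L K)"
    using assms(6) by (auto simp: cyclic_extension_def)
  have sK: "subfld K" and sL: "subfld L" and KL: "K \<subseteq> L"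
    using ext subfield_ambient_iff by (auto simp: extension_of_degree_def)
  have pK: "\<pi>\<^sub>K \<in> K" "\<pi>\<^sub>K \<noteq> 0" using assms(10) by (auto simp: uniformiser_def)
  define Q where "Q = p ^ t"
  interpret lf_ext K L v \<pi>\<^sub>K p t Q "q ^ n"
    by unfold_locales
      (use assms ext sK sL in \<open>auto simp: Q_def local_field_def subfld_def\<close>)
  have vK: "valued K v" by (rule K.valued_axioms)
  have piL: "\<pi>\<^sub>K \<in> L" using pK KL by blast
  have e1: "1 \<le> e" and ve: "v \<pi>\<^sub>L = 1 / of_nat e"
    using ramification_index_uniformiser[OF valued_axioms values_K piL pK(2) v_pi assms(11)] unfolding assms(8) by auto
  have pe: "\<not> p dvd e" using assms(8,9) by (simp add: tamely_ramified_def)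
  obtain f where f: "1 \<le> f" "\<And>x. x \<in> \<O> \<Longrightarrow> x ^ (Q ^ f) - x \<in> mm" using residue_frobenius by blast
  interpret LA: adic L \<O> \<pi>\<^sub>L p "Q ^ f" by (rule adic_F[OF assms(11) f])
  have "(1 :: rat) = of_int (LA.ord \<pi>\<^sub>K) * (1 / of_nat e)"
    using adic_ord[OF assms(11) LA.adic_axioms piL pK(2)] v_pi ve by simp
  then have "(of_int (LA.ord \<pi>\<^sub>K) :: rat) = of_int (int e)" using e1 by (simp add: field_simps)
  then have ord: "LA.ord \<pi>\<^sub>K = int e" by (simp only: of_int_eq_iff)
  \<comment> \<open>The given uniformiser of \<open>L\<close> is replaced by one that is a Kummer
    generator up to a root of unity; the congruence is indifferent to this as both generate the same
    ideal.\<close>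
  obtain s \<tau> where s: "s \<in> LA.\<U>" and \<tau>: "\<tau> \<in> \<O>" "\<tau> ^ (Q ^ f) = \<tau>" "\<tau> \<noteq> 0" "(\<pi>\<^sub>L * s) ^ e = \<pi>\<^sub>K * \<tau>"
    using LA.kummer[OF piL pK(2) ord pe] by blast
  define lam where "lam = \<pi>\<^sub>L * s"
  have pL: "\<pi>\<^sub>L \<in> L" "\<pi>\<^sub>L \<noteq> 0" using assms(11) by (auto simp: uniformiser_def)
  have sL': "s \<in> L" "s \<noteq> 0" using LA.U_O[OF s] LA.U_nz[OF s] O_iff by auto
  have "v s = 0" using adic_ord[OF assms(11) LA.adic_axioms sL'] LA.ord_U[OF s] by simp
  then have vlam: "v lam = 1 / of_nat e" unfolding lam_def using v_mult[OF pL(1) sL'(1) pL(2) sL'(2)] ve by simp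
  have ulam: "uniformiser L v lam" using assms(11) vlam ve pL sL'
    by (auto simp: uniformiser_def lam_def mult_closed)
  obtain \<sigma> d where gc: "galois_cyclic L K \<sigma> d" using galois_cyclic_exists[OF sL KL cyclic algebraic] by blast
  interpret G: galois_cyclic L K \<sigma> d by (rule gc)
  interpret LL: adic L \<O> lam p "Q ^ f" by (rule adic_F[OF ulam f])
  have \<sigma>K: "\<sigma> x = x" if "x \<in> K" for x using galois_group_endo(2)[OF G.\<sigma>_G sL that] .
  interpret T: tame L \<O> lam p "Q ^ f" \<sigma> K K.\<O> \<pi>\<^sub>K \<tau> Q f d e
  proof
    show "1 \<le> f" by (rule f)
    show "K.\<O> = K \<inter> \<O>" using KL by (auto simp: K.O_iff O_iff K.ge_def ge_def)
    show "x \<in> K" if x: "x \<in> L" "\<sigma> x = x" for x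
    proof -
      have "(\<sigma> ^^ j) x = x" for j by (induction j) (auto simp: x)
      then have "x \<in> fixed_field L (carrier (galois_group L K))" using x by (auto simp: fixed_field_def G.carrier_G)
      then show ?thesis unfolding fixed .
    qed
  qed (use KL \<tau> e1 pe \<sigma>K G.d_pos G.\<sigma>_d G.\<sigma>_min in \<open>auto simp: lam_def\<close>)
  show ?thesis
  proof (intro allI ballI)
    fix i u \<beta>
    assume u: "u \<in> Units (ring_on (valuation_ring K v))" and \<beta>: "\<beta> \<in> L - {0}"
    have uU: "u \<in> KA.\<U>"
    proof -
      obtain y where y: "u \<in> K.\<O>" "y \<in> K.\<O>" "u * y = 1"
        using u by (auto simp: Units_def K.\<O>_def ambient_simps)
      then have "inverse u = y" by (simp add: inverse_unique)
      then show ?thesis using y by (auto simp: KA.\<U>_def)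
    qed
    have uK: "u \<in> K" "u \<noteq> 0" using KA.U_O[OF uU] KA.U_nz[OF uU] K.O_iff by auto
    define b where "b = u * \<pi>\<^sub>K ^ i"
    have b: "b \<in> K" "b \<noteq> 0" unfolding b_def using uK pK by (auto intro: K.mult_closed K.power_closed)
    have rec: "has_hasse_invariant K v (cyclic_algebra L \<sigma> d b) (G.\<chi> (\<theta> b))"
      using assms(12) G.chi_hom b unfolding local_reciprocity_map_def G.character_algebra_chi[symmetric] by blast
    have "\<theta> b \<in> carrier (galois_group L K)"
    proof -
      have "\<theta> \<in> hom (mult_of (ring_on K)) (galois_group L K)"
        using assms(12) by (auto simp: local_reciprocity_map_def epi_def)
      moreover have "b \<in> carrier (mult_of (ring_on K))" using b by (simp add: ambient_simps)
      ultimately show ?thesis by (rule hom_in_carrier)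
    qed
    then obtain j where j: "\<theta> b = restrict (\<sigma> ^^ j) L" unfolding G.carrier_G by blast
    obtain m r W w \<phi> \<pi>' where W: "unramified_extension m K W w" "\<And>x. x \<in> K - {0} \<Longrightarrow> w x = v x"
      "frobenius K W w \<phi>" and \<pi>': "uniformiser K v \<pi>'"
      and br: "brauer_equivalent K (cyclic_algebra L \<sigma> d b) (cyclic_algebra W \<phi> m (\<pi>' powi r))"
      and chi: "G.\<chi> (\<theta> b) = QZ_class (of_int r / of_nat m)"
      using rec unfolding has_hasse_invariant_def by blast
    have wv: "w x = v x" if "x \<in> K" "x \<noteq> 0" for x using W(2) that by blast
    have lfw: "local_field K w" by (rule local_field_cong[OF assms(1) wv])
    have uw: "uniformiser K w \<pi>\<^sub>K" using assms(10) wv unfolding uniformiser_def by auto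
    have sW: "subfld W" "extension_of_degree m K W"
      using W(1) subfield_ambient_iff by (auto simp: unramified_extension_def extension_of_degree_def)
    interpret U: unr K W w \<pi>\<^sub>K p t Q m \<phi>
      by unfold_locales
        (use W lfw uw sW sK assms(2,3) residue_field_cong[of K w v, OF wv] in
          \<open>auto simp: Q_def local_field_def subfld_def unramified_extension_def\<close>)
    obtain \<rho>W fW where \<rho>W: "1 \<le> fW" "\<rho>W ^ (Q ^ fW) = \<rho>W" "\<rho>W \<noteq> 0" "W = adjoin K \<rho>W" "\<rho>W \<in> W" "\<phi> \<rho>W = \<rho>W ^ Q"
      and cycW: "\<And>c. c \<in> K \<Longrightarrow> c \<noteq> 0 \<Longrightarrow> cyc K W \<phi> m c \<rho>W"
      by (rule U.unramified_structure) (rule that; assumption?; simp)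
    have p': "\<pi>' \<in> K" "\<pi>' \<noteq> 0" using \<pi>' by (auto simp: uniformiser_def)
    \<comment> \<open>The Hasse invariant comes with some uniformiser \<pi>' of \<open>K\<close>,
      possibly other than \<open>\<pi>\<^sub>K\<close>; the comparison only sees its order.\<close>
    have ord\<pi>': "KA.ord \<pi>' = 1"
    proof -
      interpret l': lf K v \<pi>' p t Q by unfold_locales (use assms \<pi>' in \<open>auto simp: Q_def\<close>)
      have "(1 :: rat) = of_int (KA.ord \<pi>')"
        using K.adic_ord[OF assms(10) KA.adic_axioms p'] v_pi l'.v_pi by simp
      then show ?thesis by (metis of_int_1 of_int_eq_iff)
    qed
    define c where "c = \<pi>' powi r"
    have c: "c \<in> K" "c \<noteq> 0" "KA.ord c = r" unfolding c_def using p' ord\<pi>'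
      by (auto simp: K.power_int_closed KA.ord_power_int)
    obtain r0 s0 h where iso: "csa_iso K L \<sigma> d b (T.\<rho> + lam) r0 W \<phi> m c \<rho>W s0 h"
      using brauer_equivalent_csa_iso[OF T.cyc_L[OF b] cycW[OF c(1,2)] br[folded c_def]] by blast
    obtain N z where Nz: "int d * r = int m * (int d * z + int N)" and
      main: "\<And>\<beta>. \<beta> \<in> L - {0} \<Longrightarrow> LL.cg 1 ((\<sigma> ^^ N) \<beta> / \<beta>) (\<beta> ^ (Q ^ i - 1) /
        ((T.\<epsilon> * \<pi>\<^sub>K) powi (int (T.g * (\<Sum>l<i. Q ^ l)) * LL.ord \<beta>) * u powi (int T.g * LL.ord \<beta>)))"
      using T.reciprocity[OF \<rho>W(1-5) U.\<phi>_endo U.\<phi>_K \<rho>W(6) uU c iso[unfolded b_def]] by blast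
    have m0: "0 < m" by (rule cyc.d_pos[OF cycW[OF c(1,2)]])
    \<comment> \<open>The invariant \<open>r / m\<close> and the value of the faithful character at
      \<open>\<sigma>^N\<close> have the same class, so that \<open>\<theta> b\<close> must be
      \<open>\<sigma>^N\<close>.\<close>
    have "(of_int r / of_nat m :: rat) - of_nat N / of_nat d = of_int z"
    proof -
      have "(of_int (int d * r) :: rat) = of_int (int m * (int d * z + int N))" unfolding Nz ..
      then show ?thesis using m0 G.d_pos by (simp add: field_simps)
    qed
    then have "G.\<chi> (\<theta> b) = G.\<chi> (restrict (\<sigma> ^^ N) L)" unfolding chi G.chi QZ_class_eq by (simp only: Ints_of_int)
    then have "\<theta> b = restrict (\<sigma> ^^ N) L" unfolding j G.chi_eq G.restrict_eq .
    then have \<theta>\<beta>: "\<theta> b \<beta> = (\<sigma> ^^ N) \<beta>" using \<beta> by simp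
    define A where "A = int (T.g * (\<Sum>l<i. Q ^ l)) * LL.ord \<beta>"
    define B where "B = int T.g * LL.ord \<beta>"
    have v\<beta>: "v \<beta> = of_int (LL.ord \<beta>) * (1 / of_nat e)"
      using adic_ord[OF ulam LL.adic_axioms, of \<beta>] \<beta> vlam by simp
    have Q0: "0 < Q" using KA.P_gt_1 by simp
    have "Q ^ i - 1 = e * (T.g * (\<Sum>l<i. Q ^ l))" unfolding mult.assoc[symmetric] T.eg using power_geometric[OF Q0, of i] by simp
    then have 1: "of_int A = of_nat (Q ^ i - 1) * v \<beta>" unfolding A_def v\<beta> using e1 by simp
    have 2: "of_int B = of_nat (Q - 1) * v \<beta>" unfolding B_def v\<beta> T.eg[symmetric] using e1 by simp
    have "LL.cg 1 (\<theta> b \<beta> / \<beta>) (\<beta> ^ (Q ^ i - 1) / (((-1) ^ (e - 1) * \<pi>\<^sub>K) powi A * u powi B))"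
      using main[OF \<beta>] unfolding \<theta>\<beta> A_def B_def T.\<epsilon>_eq .
    then have "\<theta> b \<beta> / \<beta> - \<beta> ^ (Q ^ i - 1) / (((-1) ^ (e - 1) * \<pi>\<^sub>K) powi A * u powi B) \<in> mm"
      using mm_pi[OF ulam] by (auto simp: LL.cg_def)
    then have "cong_mod L v \<pi>\<^sub>L (\<theta> b \<beta> / \<beta>) (\<beta> ^ (Q ^ i - 1) / (((-1) ^ (e - 1) * \<pi>\<^sub>K) powi A * u powi B))"
      unfolding cong_mod_def mm_pi[OF assms(11)] \<O>_def by blast
    then show "\<exists>a b::int.
      of_int a = of_nat (p ^ (t * i) - 1) * v \<beta> \<and>
      of_int b = of_nat (p ^ t - 1) * v \<beta> \<and>
      cong_mod L v \<pi>\<^sub>L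
        (\<theta> (u * \<pi>\<^sub>K ^ i) \<beta> / \<beta>)
        (\<beta> ^ (p ^ (t * i) - 1) / (((-1) ^ (e - 1) * \<pi>\<^sub>K) powi a * u powi b))"
      using 1 2 unfolding b_def power_mult Q_def by blast
  qed
qed

end
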